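(* For every $\lambda>0$, every $\varepsilon>0$ and every integer $d\ge 2$ there exists an infinite family $\{X_k\}_{k\ge 1}$ of $d$-dimensional Cayley complexes, where $X_k$ is a Cayley complex over $\mathbb{F}_2^{n_k}$ (so $X_k(0)=\mathbb{F}_2^{n_k}$), such that every $X_k$ is a $\lambda$-local spectral expander and the degree of $X_k$ is at most $2^{(n_k)^{\varepsilon}}$.
   Context: A pure $d$-dimensional simplicial complex $X$ is a collection of sets of size $d+1$ (top faces) together with all their subsets; $X(i)$ denotes the faces of size $i+1$, and $X(-1)=\{\emptyset\}$. $X$ carries a probability distribution on $X(d)$ with full support, which induces distributions on each $X(i)$ (choose a top face, then a uniformly random $(i+1)$-subset of it). The link of a face $s$ is $X_s=\{t\setminus s: t\in X, t\supseteq s\}$, with the distribution on its top faces obtained by conditioning on containing $s$. For a weighted graph $G$, $\lambda(G)$ denotes the second largest absolute value of an eigenvalue of its random walk operator; $G$ is a (two-sided) $\lambda$-spectral expander if $\lambda(G)\le\lambda$. A $d$-dimensional complex $X$ is a $\lambda$-local spectral expander if for every face $s\in X$ (including $s=\emptyset$) the link $X_s$ is connected (its underlying graph is connected), and for every $s\in X(d-2)$ the underlying weighted graph of $X_s$ satisfies $\lambda(X_s)\le\lambda$. A Cayley graph $\mathrm{Cay}(\mathbb{F}_2^n,S)$ for $S\subseteq\mathbb{F}_2^n$ has vertices $\mathbb{F}_2^n$ and edges $\{x,x+s\}$, $x\in\mathbb{F}_2^n$, $s\in S$ (labelled by $s$). A Cayley complex over $\mathbb{F}_2^n$ is a simplicial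 complex whose vertices and edges form a Cayley graph $\mathrm{Cay}(\mathbb{F}_2^n,S)$ and in which all edges with the same label have the same weight; its degree is $|S|$.
   Formalization: Connectedness of links is required only for faces of dimension at most d−2 (including the empty face); for larger faces the link has no edges, and demanding it literally would force X to be a single simplex, so no infinite family could exist. *)

theory Defs
  imports
    "HOL-Probability.Probability_Mass_Function"
    "HOL-Library.Z2"
    "Jordan_Normal_Form.Char_Poly"
begin

record 'a weighted_complex =
  faces :: "'a set set"
  top_distr :: "'a set pmf"

text \<open>The index is an integer so that \<open>level X (-1)\<close> is the empty face.\<close>

definition level :: "'a weighted_complex \<Rightarrow> int \<Rightarrow> 'a set set" where
  "level X i = {s \<in> faces X. int (card s) = i + 1}"

definition pure_complex :: "nat \<Rightarrow> 'a weighted_complex \<Rightarrow> bool" where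
  "pure_complex d X \<longleftrightarrow>
     finite (faces X) \<and>
     faces X = (\<Union>t\<in>level X (int d). Pow t) \<and>
     set_pmf (top_distr X) = level X (int d)"

definition induced_distr :: "'a weighted_complex \<Rightarrow> int \<Rightarrow> 'a set pmf" where
  "induced_distr X i =
     bind_pmf (top_distr X) (\<lambda>t. pmf_of_set {s. s \<subseteq> t \<and> int (card s) = i + 1})"

definition link :: "'a weighted_complex \<Rightarrow> 'a set \<Rightarrow> 'a weighted_complex" where
  "link X s =
     \<lparr>faces = {t - s | t. t \<in> faces X \<and> s \<subseteq> t},
      top_distr = map_pmf (\<lambda>t. t - s) (cond_pmf (top_distr X) {t. s \<subseteq> t})\<rparr>"

definition vertices :: "'a weighted_complex \<Rightarrow> 'a set" where
  "vertices X = {v. {v} \<in> level X 0}"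

definition connected_graph :: "'a weighted_complex \<Rightarrow> bool" where
  "connected_graph X \<longleftrightarrow>
     (\<forall>u\<in>vertices X. \<forall>v\<in>vertices X. (u, v) \<in> {(x, y). {x, y} \<in> level X 1}\<^sup>*)"

text \<open>For \<open>u = v\<close> the weight is 0, since \<open>{u, v}\<close> is then not a two-element set.\<close>

definition edge_weight :: "'a weighted_complex \<Rightarrow> 'a \<Rightarrow> 'a \<Rightarrow> real" where
  "edge_weight X u v = pmf (induced_distr X 1) {u, v}"

definition walk_prob :: "'a weighted_complex \<Rightarrow> 'a \<Rightarrow> 'a \<Rightarrow> real" where
  "walk_prob X u v = edge_weight X u v / (\<Sum>w\<in>vertices X. edge_weight X u w)"

text \<open>The matrix depends on the chosen enumeration of the vertices, but its characteristic
  polynomial does not. The random walk is reversible, so all eigenvalues are real and the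
  real roots of the characteristic polynomial are the full spectrum with multiplicity.\<close>

definition walk_matrix :: "'a weighted_complex \<Rightarrow> real Matrix.mat" where
  "walk_matrix X =
     (let vs = (SOME vs. distinct vs \<and> set vs = vertices X)
      in Matrix.mat (length vs) (length vs) (\<lambda>(i, j). walk_prob X (vs ! i) (vs ! j)))"

definition walk_spectrum :: "'a weighted_complex \<Rightarrow> real multiset" where
  "walk_spectrum X = proots (char_poly (walk_matrix X))"

text \<open>Multiplicities count: a disconnected or a bipartite graph has value 1.\<close>

definition second_abs_eigenvalue :: "'a weighted_complex \<Rightarrow> real" where
  "second_abs_eigenvalue X =
     rev (sorted_list_of_multiset (image_mset abs (walk_spectrum X))) ! 1"

text \<open>Connectedness is required of the links of dimension at least 1, that is, of faces of
  dimension at most \<open>d - 2\<close>: the links of larger faces have no edges at all.\<close>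

definition local_spectral_expander :: "nat \<Rightarrow> real \<Rightarrow> 'a weighted_complex \<Rightarrow> bool" where
  "local_spectral_expander d lam X \<longleftrightarrow>
     (\<forall>i \<le> int d - 2. \<forall>s\<in>level X i. connected_graph (link X s)) \<and>
     (\<forall>s\<in>level X (int d - 2). second_abs_eigenvalue (link X s) \<le> lam)"

text \<open>\<open>\<bbbF>\<^sub>2\<^sup>n\<close> is \<open>carrier_vec n\<close> over the two-element field \<open>bit\<close>. The equation for
  \<open>level X 1\<close> forces \<open>0 \<notin> S\<close>, because edges are two-element sets.\<close>

definition cayley_complex ::
    "nat \<Rightarrow> bit Matrix.vec set \<Rightarrow> bit Matrix.vec weighted_complex \<Rightarrow> bool" where
  "cayley_complex n S X \<longleftrightarrow>
     S \<subseteq> carrier_vec n \<and>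
     level X 0 = {{x} | x. x \<in> carrier_vec n} \<and>
     level X 1 = {{x, x + s} | x s. x \<in> carrier_vec n \<and> s \<in> S} \<and>
     (\<forall>s\<in>S. \<forall>x\<in>carrier_vec n. \<forall>y\<in>carrier_vec n.
        edge_weight X x (x + s) = edge_weight X y (y + s))"

end

theory Submission
  imports Defs "HOL-Number_Theory.Cong"
begin

text \<open>
  A \<^emph>\<open>frame system\<close> is a weight on \<open>D\<close>-tuples of independent vectors of \<open>\<bbbF>\<^sub>2\<^sup>n\<close> that is invariant under
  change of basis and for which, once some of the vectors are fixed, any two further ones have small
  maximal correlation. The simplices \<open>x, x + v\<^sub>0, \<dots>, x + v\<^sub>d\<^sub>-\<^sub>1\<close>, with \<open>x\<close> uniform and \<open>v\<close> drawn from a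
  frame system with \<open>D = d\<close>, form a Cayley complex; invariance makes the order of the vertices irrelevant,
  and the correlation of two vectors bounds the second eigenvalue of the links.

  The system of all independent tuples has \<open>2\<^sup>O\<^sup>(\<^sup>n\<^sup>)\<close> frames. From a frame system in dimension \<open>n\<close> with
  \<open>D = 2\<^sup>d r\<close> vectors one gets a system with \<open>d\<close> vectors in dimension \<open>n\<^sup>2\<close> and only squared support:
  take two independent frames \<open>v, \<xi>\<close> and the matrices \<open>v\<^sup>T P\<^sub>k \<xi>\<close>, where \<open>P\<^sub>k\<close> projects to the indices
  whose \<open>k\<close>-th binary digit is 1. Fixing the first \<open>m\<close> matrices leaves the group of those \<open>g \<in> GL\<^sub>D\<close>
  that commute with \<open>P\<^sub>0, \<dots>, P\<^sub>m\<^sub>-\<^sub>1\<close>, acting by \<open>(v, \<xi>) \<mapsto> (g v, g\<^sup>-\<^sup>T \<xi>)\<close>, and the two next matrices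
  are invariant under two subgroups of it. A Heisenberg type subgroup, together with matrices whose
  pairwise differences are invertible (powers of a companion matrix of the cyclotomic polynomial of a
  large prime), shows that functions invariant under these two subgroups are almost uncorrelated.
  After \<open>t\<close> iterations the dimension is \<open>N = n\<^sup>p\<close> with \<open>p = 2\<^sup>t\<close>, while the logarithm of the number of
  generators is still \<open>O(n) = O(N\<^sup>1\<^sup>/\<^sup>p)\<close>.
\<close>

section \<open>The ring of row- and column-finite matrices over the two-element field\<close>

text \<open>Invariance alone does not finish the correlation estimate. Rows whose index has all m
  fixed digits equal to 0 occur in none of the fixed matrices, so the group of the fibre need not
  act transitively and an invariant function need not be constant. On these rows the bound for the
  old frame system is used instead; hence the induction carries a correlation bound, the new bound
  has two terms, and the old \<delta> must be small against 1/D^2. The factor r in D = 2^d r gives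
  room for matrices that preserve every digit: r = p - 1 is the degree of the cyclotomic polynomial
  of the prime p, and its companion matrix yields p powers with invertible differences. Each
  averaging costs an error of order p^(-1/2), made small by choosing p before D. Binary digits fit
  characteristic 2: a linear change of the d new vectors is a linear change of digits, hence a
  permutation of the old indices. Correlation bounds say nothing about the link of the empty face,
  where the vertex after x is x plus a generator; its connectedness comes from the generation clause
  of frame systems.\<close>

declare add_bit_eq_xor [simp del] mult_bit_eq_and [simp del]
  bit_not_zero_iff [simp del] bit_not_one_iff [simp del]

lemma bit_add_self [simp]: "(x :: bit) + x = 0"
  by (cases x) (simp_all flip: mult_2)

lemma bit_1_iff: "(x :: bit) = 1 \<longleftrightarrow> x \<noteq> 0"
  by (cases x) simp_all

text \<open>One type for matrices of all sizes makes multiplication total and gives a ring with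
  transposition; a matrix of a given size is padded with zeros. Finite rows make the sums in a
  product finite, and finite columns keep the class closed under transposition.\<close>

typedef bmat =
  "{A :: nat \<Rightarrow> nat \<Rightarrow> bit. (\<forall>i. finite {j. A i j \<noteq> 0}) \<and> (\<forall>j. finite {i. A i j \<noteq> 0})}"
  morphisms ent Abs_bmat
  by (rule exI[of _ "\<lambda>_ _. 0"]) auto

lemma finite_row [simp]: "finite {j. ent A i j \<noteq> 0}"
  and finite_col [simp]: "finite {i. ent A i j \<noteq> 0}"
  using ent[of A] by auto

lemma ent_Abs:
  assumes "\<And>i. finite {j. f i j \<noteq> 0}" "\<And>j. finite {i. f i j \<noteq> 0}"
  shows "ent (Abs_bmat f) = f"
  using assms by (intro Abs_bmat_inverse) auto

lemma bmat_eqI: "(\<And>i j. ent A i j = ent B i j) \<Longrightarrow> A = B"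
  by (metis ent_inject ext)

instantiation bmat :: ring_1
begin

definition "0 = Abs_bmat (\<lambda>_ _. 0)"
definition "1 = Abs_bmat (\<lambda>i j. if i = j then 1 else 0)"
definition "A + B = Abs_bmat (\<lambda>i j. ent A i j + ent B i j)"
definition "A - B = Abs_bmat (\<lambda>i j. ent A i j - ent B i j)"
definition "- A = Abs_bmat (\<lambda>i j. - ent A i j)"
definition "A * B = Abs_bmat (\<lambda>i k. \<Sum>j\<in>{j. ent A i j \<noteq> 0}. ent A i j * ent B j k)"

lemma ent_0: "ent 0 i j = 0"
  unfolding zero_bmat_def by (subst ent_Abs) auto

lemma ent_1: "ent 1 i j = (if i = j then 1 else 0)"
  unfolding one_bmat_def by (subst ent_Abs) auto

lemma ent_add: "ent (A + B) i j = ent A i j + ent B i j"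
proof -
  have "finite {j. ent A i j + ent B i j \<noteq> 0}" for i
    by (rule finite_subset[of _ "{j. ent A i j \<noteq> 0} \<union> {j. ent B i j \<noteq> 0}"]) auto
  moreover have "finite {i. ent A i j + ent B i j \<noteq> 0}" for j
    by (rule finite_subset[of _ "{i. ent A i j \<noteq> 0} \<union> {i. ent B i j \<noteq> 0}"]) auto
  ultimately show ?thesis unfolding plus_bmat_def by (subst ent_Abs) auto
qed

lemma ent_diff: "ent (A - B) i j = ent A i j - ent B i j"
proof -
  have "A - B = A + B" unfolding minus_bmat_def plus_bmat_def by simp
  then show ?thesis by (simp add: ent_add)
qed

lemma ent_uminus: "ent (- A) i j = - ent A i j"
  unfolding uminus_bmat_def by (subst ent_Abs) auto

lemma ent_mult_raw: "ent (A * B) i k = (\<Sum>j\<in>{j. ent A i j \<noteq> 0}. ent A i j * ent B j k)"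
proof -
  let ?f = "\<lambda>i k. \<Sum>j\<in>{j. ent A i j \<noteq> 0}. ent A i j * ent B j k"
  have "finite {k. ?f i k \<noteq> 0}" for i
  proof (rule finite_subset)
    show "{k. ?f i k \<noteq> 0} \<subseteq> (\<Union>j\<in>{j. ent A i j \<noteq> 0}. {k. ent B j k \<noteq> 0})"
    proof
      fix k assume "k \<in> {k. ?f i k \<noteq> 0}"
      then obtain j where "ent A i j \<noteq> 0" "ent A i j * ent B j k \<noteq> 0"
        using sum.not_neutral_contains_not_neutral by (smt (verit) mem_Collect_eq)
      then show "k \<in> (\<Union>j\<in>{j. ent A i j \<noteq> 0}. {k. ent B j k \<noteq> 0})" by auto
    qed
  qed auto
  moreover have "finite {i. ?f i k \<noteq> 0}" for k
  proof (rule finite_subset)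
    show "{i. ?f i k \<noteq> 0} \<subseteq> (\<Union>j\<in>{j. ent B j k \<noteq> 0}. {i. ent A i j \<noteq> 0})"
    proof
      fix i assume "i \<in> {i. ?f i k \<noteq> 0}"
      then obtain j where "ent A i j \<noteq> 0" "ent A i j * ent B j k \<noteq> 0"
        using sum.not_neutral_contains_not_neutral by (smt (verit) mem_Collect_eq)
      then show "i \<in> (\<Union>j\<in>{j. ent B j k \<noteq> 0}. {i. ent A i j \<noteq> 0})" by auto
    qed
  qed auto
  ultimately show ?thesis unfolding times_bmat_def by (subst ent_Abs) auto
qed

text \<open>The summation set may be any finite set containing the common support, so that later
  sums run over a convenient range such as \<open>{..<n}\<close> instead of the support of a
  row.\<close>

lemma ent_mult:
  assumes "finite S" and "\<And>j. ent A i j \<noteq> 0 \<Longrightarrow> ent B j k \<noteq> 0 \<Longrightarrow> j \<in> S"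
  shows "ent (A * B) i k = (\<Sum>j\<in>S. ent A i j * ent B j k)"
  unfolding ent_mult_raw
proof (rule sum.mono_neutral_cong)
  show "ent A i j * ent B j k = 0" if "j \<in> {j. ent A i j \<noteq> 0} - S" for j
    using that assms(2)[of j] by auto
qed (use assms(1) in auto)

instance
proof
  fix A B C :: bmat
  show "A * B * C = A * (B * C)"
  proof (rule bmat_eqI)
    fix i l
    let ?S = "{j. ent A i j \<noteq> 0}" and ?T = "\<Union>j\<in>{j. ent A i j \<noteq> 0}. {k. ent B j k \<noteq> 0}"
    have AB: "ent (A * B) i k = (\<Sum>j\<in>?S. ent A i j * ent B j k)" for k
      by (rule ent_mult_raw)
    have "ent (A * B * C) i l = (\<Sum>k\<in>?T. ent (A * B) i k * ent C k l)"
    proof (rule ent_mult)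
      fix k assume "ent (A * B) i k \<noteq> 0"
      then obtain j where "ent A i j \<noteq> 0" "ent A i j * ent B j k \<noteq> 0"
        unfolding AB using sum.not_neutral_contains_not_neutral by (smt (verit) mem_Collect_eq)
      then show "k \<in> ?T" by auto
    qed auto
    also have "\<dots> = (\<Sum>k\<in>?T. \<Sum>j\<in>?S. ent A i j * (ent B j k * ent C k l))"
      by (simp add: AB sum_distrib_right mult.assoc)
    also have "\<dots> = (\<Sum>j\<in>?S. ent A i j * (\<Sum>k\<in>?T. ent B j k * ent C k l))"
      by (subst sum.swap) (simp add: sum_distrib_left)
    also have "\<dots> = (\<Sum>j\<in>?S. ent A i j * ent (B * C) j l)"
      by (intro sum.cong refl arg_cong2[where f = "(*)"] ent_mult[symmetric]) auto
    finally show "ent (A * B * C) i l = ent (A * (B * C)) i l"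
      by (simp add: ent_mult_raw)
  qed
  show "(A + B) * C = A * C + B * C"
  proof (rule bmat_eqI)
    fix i k
    let ?S = "{j. ent C j k \<noteq> 0}"
    have "ent (D * C) i k = (\<Sum>j\<in>?S. ent D i j * ent C j k)" for D
      by (rule ent_mult) auto
    then show "ent ((A + B) * C) i k = ent (A * C + B * C) i k"
      by (simp add: ent_add ring_distribs sum.distrib)
  qed
  show "A * (B + C) = A * B + A * C"
    by (rule bmat_eqI) (simp add: ent_add ent_mult_raw ring_distribs sum.distrib)
  show "1 * A = A"
  proof (rule bmat_eqI)
    fix i k
    have "ent (1 * A) i k = (\<Sum>j\<in>{i}. ent 1 i j * ent A j k)"
      by (rule ent_mult) (auto simp: ent_1 split: if_splits)
    then show "ent (1 * A) i k = ent A i k" by (simp add: ent_1)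
  qed
  show "A * 1 = A"
  proof (rule bmat_eqI)
    fix i k
    have "ent (A * 1) i k = (\<Sum>j\<in>{k}. ent A i j * ent 1 j k)"
      by (rule ent_mult) (auto simp: ent_1 split: if_splits)
    then show "ent (A * 1) i k = ent A i k" by (simp add: ent_1)
  qed
  show "(0::bmat) \<noteq> 1"
    by (metis ent_0 ent_1 zero_neq_one)
qed (rule bmat_eqI, simp add: ent_0 ent_1 ent_add ent_diff ent_uminus add_ac)+

end

lemmas ent_simps = ent_0 ent_1 ent_add ent_diff ent_uminus

lemma bmat_add_self [simp]: "(A :: bmat) + A = 0"
  by (rule bmat_eqI) (simp add: ent_simps)

lemma bmat_add_self_left [simp]: "(A :: bmat) + (A + B) = B"
  by (simp flip: add.assoc)

lemma bmat_minus [simp]: "- (A :: bmat) = A"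
  by (rule bmat_eqI) (simp add: ent_simps)

lemma bmat_diff [simp]: "(A :: bmat) - B = A + B"
  by (rule bmat_eqI) (simp add: ent_simps)

lemma bmat_add_eq_0_iff [simp]: "(A :: bmat) + B = 0 \<longleftrightarrow> A = B"
  using eq_neg_iff_add_eq_0[of A B] by simp

lemma ent_sum: "ent (sum f S) i j = (\<Sum>s\<in>S. ent (f s) i j)"
  by (induction S rule: infinite_finite_induct) (auto simp: ent_simps)

definition tr :: "bmat \<Rightarrow> bmat" where
  "tr A = Abs_bmat (\<lambda>i j. ent A j i)"

lemma ent_tr [simp]: "ent (tr A) i j = ent A j i"
  unfolding tr_def by (subst ent_Abs) auto

lemma tr_tr [simp]: "tr (tr A) = A"
  by (rule bmat_eqI) simp

lemma tr_add [simp]: "tr (A + B) = tr A + tr B"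
  by (rule bmat_eqI) (simp add: ent_simps)

lemma tr_0 [simp]: "tr 0 = 0" and tr_1 [simp]: "tr 1 = 1"
  by (rule bmat_eqI, simp add: ent_simps)+

lemma tr_mult [simp]: "tr (A * B) = tr B * tr A"
proof (rule bmat_eqI)
  fix i k
  have "ent (A * B) k i = (\<Sum>j\<in>{j. ent A k j \<noteq> 0}. ent A k j * ent B j i)"
    by (rule ent_mult_raw)
  also have "\<dots> = (\<Sum>j\<in>{j. ent A k j \<noteq> 0}. ent (tr B) i j * ent (tr A) j k)"
    by (simp add: mult.commute)
  also have "\<dots> = ent (tr B * tr A) i k"
    by (rule ent_mult[symmetric]) auto
  finally show "ent (tr (A * B)) i k = ent (tr B * tr A) i k" by simp
qed

definition dg :: "nat set \<Rightarrow> bmat" where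
  "dg S = Abs_bmat (\<lambda>i j. if i = j \<and> i \<in> S then 1 else 0)"

lemma ent_dg: "ent (dg S) i j = (if i = j \<and> i \<in> S then 1 else 0)"
  unfolding dg_def by (subst ent_Abs) auto

lemma ent_dg_mult [simp]: "ent (dg S * A) i j = (if i \<in> S then ent A i j else 0)"
  by (subst ent_mult[of "{i}"]) (auto simp: ent_dg split: if_splits)

lemma ent_mult_dg [simp]: "ent (A * dg S) i j = (if j \<in> S then ent A i j else 0)"
  by (subst ent_mult[of "{j}"]) (auto simp: ent_dg split: if_splits)

lemma dg_mult_dg [simp]: "dg S * dg T = dg (S \<inter> T)"
  by (rule bmat_eqI) (auto simp: ent_dg)

lemma dg_mult_dg_left [simp]: "dg S * (dg T * A) = dg (S \<inter> T) * A"
  by (simp flip: mult.assoc)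

lemma tr_dg [simp]: "tr (dg S) = dg S"
  by (rule bmat_eqI) (auto simp: ent_dg)

lemma dg_UNIV [simp]: "dg UNIV = 1" and dg_empty [simp]: "dg {} = 0"
  by (rule bmat_eqI, simp add: ent_dg ent_simps)+

lemma dg_Un_disjoint: "S \<inter> T = {} \<Longrightarrow> dg (S \<union> T) = dg S + dg T"
  by (rule bmat_eqI) (auto simp: ent_dg ent_simps)

lemma dg_Compl: "dg (- S) = 1 + dg S"
  by (rule bmat_eqI) (auto simp: ent_dg ent_simps)

lemma dg_mult_eq_iff: "dg S * A = dg S * B \<longleftrightarrow> (\<forall>i\<in>S. \<forall>j. ent A i j = ent B i j)"
proof
  assume "dg S * A = dg S * B"
  then have "ent (dg S * A) i j = ent (dg S * B) i j" for i j by simp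
  then show "\<forall>i\<in>S. \<forall>j. ent A i j = ent B i j" by (metis ent_dg_mult)
qed (auto intro!: bmat_eqI)

lemma dg_mult_fix: "dg S * A = A \<longleftrightarrow> (\<forall>i j. ent A i j \<noteq> 0 \<longrightarrow> i \<in> S)"
proof
  assume "dg S * A = A"
  then show "\<forall>i j. ent A i j \<noteq> 0 \<longrightarrow> i \<in> S" by (metis ent_dg_mult)
qed (intro bmat_eqI, simp, metis)

lemma mult_dg_fix: "A * dg S = A \<longleftrightarrow> (\<forall>i j. ent A i j \<noteq> 0 \<longrightarrow> j \<in> S)"
proof
  assume "A * dg S = A"
  then show "\<forall>i j. ent A i j \<noteq> 0 \<longrightarrow> j \<in> S" by (metis ent_mult_dg)
qed (intro bmat_eqI, simp, metis)

text \<open>The matrix units E_ab. Multiplying by one from the left copies a single row to a chosen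
  place; this is how individual rows are extracted and compared.\<close>

definition mun :: "nat \<Rightarrow> nat \<Rightarrow> bmat" where
  "mun a b = Abs_bmat (\<lambda>i j. if i = a \<and> j = b then 1 else 0)"

lemma ent_mun: "ent (mun a b) i j = (if i = a \<and> j = b then 1 else 0)"
  unfolding mun_def by (subst ent_Abs) auto

lemma ent_mun_mult [simp]: "ent (mun a b * A) i j = (if i = a then ent A b j else 0)"
  by (subst ent_mult[of "{b}"]) (auto simp: ent_mun split: if_splits)

lemma ent_mult_mun [simp]: "ent (A * mun a b) i j = (if j = b then ent A i a else 0)"
  by (subst ent_mult[of "{a}"]) (auto simp: ent_mun split: if_splits)

lemma tr_mun [simp]: "tr (mun a b) = mun b a"
  by (rule bmat_eqI) (auto simp: ent_mun)

lemma mun_mult_mun [simp]: "mun a b * mun c d = (if b = c then mun a d else 0)"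
  by (rule bmat_eqI) (auto simp: ent_mun ent_simps)

lemma dg_mult_mun [simp]: "dg S * mun a b = (if a \<in> S then mun a b else 0)"
  and mun_mult_dg [simp]: "mun a b * dg S = (if b \<in> S then mun a b else 0)"
  by (rule bmat_eqI, simp only: ent_dg_mult ent_mult_dg, simp add: ent_mun ent_simps)+

lemma mun_diag: "mun a a = dg {a}"
  by (rule bmat_eqI) (auto simp: ent_mun ent_dg)

lemma bmat_eq_0_iff: "A = 0 \<longleftrightarrow> (\<forall>i j. ent A i j = 0)"
  by (metis bmat_eqI ent_0)

lemma bmat_nonzero_entry:
  assumes "A \<noteq> 0" obtains i j where "ent A i j = 1"
  using assms bmat_eqI[of A 0] by (metis bit_1_iff ent_0)

lemma mun_sandwich: "ent A b c = 1 \<Longrightarrow> mun a b * A * mun c d = mun a d"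
  by (rule bmat_eqI) (auto simp: ent_mun)

definition id_mat :: "nat \<Rightarrow> bmat" where
  "id_mat n = dg {..<n}"

text \<open>The \<open>a\<close> by \<open>b\<close> matrices, as a Peirce corner of the big ring,
  so that membership is an equation between products.\<close>

definition corner :: "nat \<Rightarrow> nat \<Rightarrow> bmat set" where
  "corner a b = {A. id_mat a * A = A \<and> A * id_mat b = A}"

lemma corner_iff: "A \<in> corner a b \<longleftrightarrow> (\<forall>i j. ent A i j \<noteq> 0 \<longrightarrow> i < a \<and> j < b)"
  unfolding corner_def id_mat_def by (auto simp: dg_mult_fix mult_dg_fix)

lemma finite_corner [simp]: "finite (corner a b)"
proof -
  have inj: "inj_on (\<lambda>A. {(i, j). ent A i j \<noteq> 0}) UNIV"
  proof (rule inj_onI, rule bmat_eqI)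
    fix A B i j assume "{(i, j). ent A i j \<noteq> 0} = {(i, j). ent B i j \<noteq> 0}"
    then have "ent A i j \<noteq> 0 \<longleftrightarrow> ent B i j \<noteq> 0" by blast
    then show "ent A i j = ent B i j" by (metis bit_1_iff)
  qed
  have "(\<lambda>A. {(i, j). ent A i j \<noteq> 0}) ` corner a b \<subseteq> Pow ({..<a} \<times> {..<b})"
    by (auto simp: corner_iff)
  then have "finite ((\<lambda>A. {(i, j). ent A i j \<noteq> 0}) ` corner a b)"
    by (rule finite_subset) auto
  then show ?thesis using inj finite_imageD inj_on_subset by blast
qed

lemma card_corner: "card (corner a b) = 2 ^ (a * b)"
proof -
  have "bij_betw (\<lambda>A. {(i, j). ent A i j \<noteq> 0}) (corner a b) (Pow ({..<a} \<times> {..<b}))"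
  proof (rule bij_betw_imageI)
    show "inj_on (\<lambda>A. {(i, j). ent A i j \<noteq> 0}) (corner a b)"
    proof (rule inj_onI, rule bmat_eqI)
      fix A B i j assume "{(i, j). ent A i j \<noteq> 0} = {(i, j). ent B i j \<noteq> 0}"
      then have "ent A i j \<noteq> 0 \<longleftrightarrow> ent B i j \<noteq> 0" by blast
      then show "ent A i j = ent B i j" by (metis bit_1_iff)
    qed
    show "(\<lambda>A. {(i, j). ent A i j \<noteq> 0}) ` corner a b = Pow ({..<a} \<times> {..<b})"
    proof
      show "Pow ({..<a} \<times> {..<b}) \<subseteq> (\<lambda>A. {(i, j). ent A i j \<noteq> 0}) ` corner a b"
      proof
        fix Z assume Z: "Z \<in> Pow ({..<a} \<times> {..<b})"
        let ?f = "\<lambda>i j. if (i, j) \<in> Z then (1::bit) else 0"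
        have e: "ent (Abs_bmat ?f) = ?f"
        proof (rule ent_Abs)
          show "finite {j. ?f i j \<noteq> 0}" for i
            by (rule finite_subset[of _ "{..<b}"]) (use Z in auto)
          show "finite {i. ?f i j \<noteq> 0}" for j
            by (rule finite_subset[of _ "{..<a}"]) (use Z in auto)
        qed
        show "Z \<in> (\<lambda>A. {(i, j). ent A i j \<noteq> 0}) ` corner a b"
          by (rule image_eqI[of _ _ "Abs_bmat ?f"]) (use Z in \<open>auto simp: e corner_iff split: if_splits\<close>)
      qed
    qed (auto simp: corner_iff)
  qed
  then have "card (corner a b) = card (Pow ({..<a} \<times> {..<b}))" by (rule bij_betw_same_card)
  then show ?thesis by (simp add: card_Pow card_cartesian_product)
qed

text \<open>Convention: multiplication from the left puts row \<open>\<pi> i\<close> in place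
  \<open>i\<close>, so products compose in reverse order.\<close>

definition pmat :: "(nat \<Rightarrow> nat) \<Rightarrow> bmat" where
  "pmat \<pi> = Abs_bmat (\<lambda>i j. if j = \<pi> i then 1 else 0)"

lemma ent_pmat:
  assumes "bij \<pi>" shows "ent (pmat \<pi>) i j = (if j = \<pi> i then 1 else 0)"
proof -
  have "finite {i. j = \<pi> i}" for j
    using assms by (intro finite_subset[of "{i. j = \<pi> i}" "{inv_into UNIV \<pi> j}"]) (auto simp: bij_is_inj)
  then show ?thesis unfolding pmat_def by (subst ent_Abs) auto
qed

lemma ent_pmat_mult: "bij \<pi> \<Longrightarrow> ent (pmat \<pi> * A) i j = ent A (\<pi> i) j"
  by (subst ent_mult[of "{\<pi> i}"]) (auto simp: ent_pmat split: if_splits)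

lemma tr_pmat: assumes "bij \<pi>" shows "tr (pmat \<pi>) = pmat (inv_into UNIV \<pi>)"
  using assms by (intro bmat_eqI) (auto simp: ent_pmat bij_imp_bij_inv bij_is_inj bij_is_surj surj_f_inv_f)

lemma pmat_comp: "bij \<pi> \<Longrightarrow> bij \<sigma> \<Longrightarrow> pmat \<pi> * pmat \<sigma> = pmat (\<sigma> \<circ> \<pi>)"
  by (intro bmat_eqI) (simp add: ent_pmat_mult ent_pmat bij_comp)

lemma pmat_id [simp]: "pmat (\<lambda>i. i) = 1"
proof (rule bmat_eqI)
  fix i j
  have "bij (\<lambda>i::nat. i)" using bij_id by (simp add: id_def)
  from ent_pmat[OF this] show "ent (pmat (\<lambda>i. i)) i j = ent 1 i j" by (simp add: ent_1)
qed

lemma pmat_inv: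
  assumes "bij \<pi>" shows "pmat \<pi> * tr (pmat \<pi>) = 1" "tr (pmat \<pi>) * pmat \<pi> = 1"
  using assms by (simp_all add: tr_pmat pmat_comp bij_imp_bij_inv bij_is_inj bij_is_surj
      comp_def surj_f_inv_f)

lemma pmat_dg:
  assumes "bij \<pi>" shows "pmat \<pi> * dg S = dg (\<pi> -` S) * pmat \<pi>"
  by (rule bmat_eqI) (auto simp: ent_pmat[OF assms])

section \<open>Weighted inner products and maximal correlation\<close>

definition wip :: "'o set \<Rightarrow> ('o \<Rightarrow> real) \<Rightarrow> ('o \<Rightarrow> real) \<Rightarrow> ('o \<Rightarrow> real) \<Rightarrow> real" where
  "wip W m F G = (\<Sum>w\<in>W. m w * F w * G w)"

definition wnm :: "'o set \<Rightarrow> ('o \<Rightarrow> real) \<Rightarrow> ('o \<Rightarrow> real) \<Rightarrow> real" where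
  "wnm W m F = sqrt (wip W m F F)"

text \<open>An upper bound for the maximal (Hirschfeld-Gebelein-Renyi) correlation of
  \<open>X\<close> and \<open>Y\<close>. The weight is not normalised, so conditioning is just
  restriction to a subset.\<close>

definition mc :: "'o set \<Rightarrow> ('o \<Rightarrow> real) \<Rightarrow> ('o \<Rightarrow> 'x) \<Rightarrow> ('o \<Rightarrow> 'y) \<Rightarrow> real \<Rightarrow> bool" where
  "mc W m X Y \<delta> \<longleftrightarrow> (\<forall>f g. (\<Sum>w\<in>W. m w * f (X w)) = 0 \<longrightarrow> (\<Sum>w\<in>W. m w * g (Y w)) = 0 \<longrightarrow>
     \<bar>wip W m (\<lambda>w. f (X w)) (\<lambda>w. g (Y w))\<bar> \<le>
       \<delta> * wnm W m (\<lambda>w. f (X w)) * wnm W m (\<lambda>w. g (Y w)))"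

definition wt :: "'o set \<Rightarrow> ('o \<Rightarrow> real) \<Rightarrow> bool" where
  "wt W m \<longleftrightarrow> finite W \<and> (\<forall>w\<in>W. 0 \<le> m w)"

lemma wt_subset: "wt W m \<Longrightarrow> V \<subseteq> W \<Longrightarrow> wt V m"
  unfolding wt_def using finite_subset by auto

lemma wt_fibre: "wt W m \<Longrightarrow> wt {w\<in>W. P w} m"
  by (rule wt_subset) auto

lemma wtD: "wt W m \<Longrightarrow> finite W" "wt W m \<Longrightarrow> w \<in> W \<Longrightarrow> 0 \<le> m w"
  unfolding wt_def by auto

lemma sqrt_scale:
  fixes a d x y :: real
  assumes "0 \<le> M" "a \<le> d * x * y" shows "M * a \<le> d * (sqrt M * x) * (sqrt M * y)"
proof -
  have "d * (sqrt M * x) * (sqrt M * y) = (sqrt M * sqrt M) * (d * x * y)" by (simp only: mult_ac)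
  moreover have "M * a \<le> (sqrt M * sqrt M) * (d * x * y)"
    using assms mult_left_mono[OF assms(2,1)] by simp
  ultimately show ?thesis by (simp only:)
qed

lemma wip_self_nonneg: "wt W m \<Longrightarrow> 0 \<le> wip W m F F"
  unfolding wip_def wt_def by (intro sum_nonneg) (simp add: mult.assoc)

lemma wnm_nonneg: "wt W m \<Longrightarrow> 0 \<le> wnm W m F"
  unfolding wnm_def using wip_self_nonneg[of W m F] by simp

lemma wnm_sq: "wt W m \<Longrightarrow> (wnm W m F)\<^sup>2 = wip W m F F"
  unfolding wnm_def using wip_self_nonneg[of W m F] by simp

lemma wip_cong:
  "(\<And>w. w \<in> W \<Longrightarrow> m w = m' w) \<Longrightarrow> (\<And>w. w \<in> W \<Longrightarrow> F w = F' w) \<Longrightarrow>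
   (\<And>w. w \<in> W \<Longrightarrow> G w = G' w) \<Longrightarrow> wip W m F G = wip W m' F' G'"
  unfolding wip_def by (intro sum.cong) auto

lemma wnm_cong:
  "(\<And>w. w \<in> W \<Longrightarrow> m w = m' w) \<Longrightarrow> (\<And>w. w \<in> W \<Longrightarrow> F w = F' w) \<Longrightarrow> wnm W m F = wnm W m' F'"
  unfolding wnm_def by (intro arg_cong[where f = sqrt] wip_cong) auto

lemma wip_sym: "wip W m F G = wip W m G F"
  unfolding wip_def by (simp add: mult_ac)

lemma wip_add_left: "wip W m (\<lambda>w. F w + F' w) G = wip W m F G + wip W m F' G"
  and wip_diff_left: "wip W m (\<lambda>w. F w - F' w) G = wip W m F G - wip W m F' G"
  and wip_scale_left: "wip W m (\<lambda>w. c * F w) G = c * wip W m F G"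
  and wip_add_right: "wip W m F (\<lambda>w. G w + G' w) = wip W m F G + wip W m F G'"
  and wip_diff_right: "wip W m F (\<lambda>w. G w - G' w) = wip W m F G - wip W m F G'"
  and wip_scale_right: "wip W m F (\<lambda>w. c * G w) = c * wip W m F G"
  unfolding wip_def
  by (simp_all add: algebra_simps sum.distrib sum_subtractf sum_distrib_left)

lemma wip_sum_left: "wip W m (\<lambda>w. \<Sum>i\<in>I. F i w) G = (\<Sum>i\<in>I. wip W m (F i) G)"
  unfolding wip_def by (simp add: sum_distrib_left sum_distrib_right) (rule sum.swap)

lemma wip_sum_right: "wip W m F (\<lambda>w. \<Sum>i\<in>I. G i w) = (\<Sum>i\<in>I. wip W m F (G i))"
  using wip_sum_left[of W m G I F] by (simp add: wip_sym)

lemma wip_cauchy_schwarz: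
  assumes "wt W m"
  shows "\<bar>wip W m F G\<bar> \<le> wnm W m F * wnm W m G"
proof -
  have "(wip W m F G)\<^sup>2 = (\<Sum>w\<in>W. (sqrt (m w) * F w) * (sqrt (m w) * G w))\<^sup>2"
    unfolding wip_def
  proof (intro arg_cong[where f = "\<lambda>x. x\<^sup>2"] sum.cong refl)
    fix w assume "w \<in> W"
    then have "m w = sqrt (m w) * sqrt (m w)" using assms by (simp add: wtD)
    then have "m w * F w * G w = (sqrt (m w) * sqrt (m w)) * (F w * G w)" by (simp only: mult.assoc)
    then show "m w * F w * G w = sqrt (m w) * F w * (sqrt (m w) * G w)" by (simp only: mult_ac)
  qed
  also have "\<dots> \<le> (\<Sum>w\<in>W. (sqrt (m w) * F w)\<^sup>2) * (\<Sum>w\<in>W. (sqrt (m w) * G w)\<^sup>2)"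
    by (rule Cauchy_Schwarz_ineq_sum)
  also have "\<dots> = (wnm W m F * wnm W m G)\<^sup>2"
  proof -
    have "(\<Sum>w\<in>W. (sqrt (m w) * H w)\<^sup>2) = wip W m H H" for H
      unfolding wip_def using assms
      by (intro sum.cong refl) (simp add: power_mult_distrib wtD power2_eq_square)
    then show ?thesis using assms by (simp add: power_mult_distrib wnm_sq)
  qed
  finally show ?thesis
    using assms by (metis abs_le_square_iff abs_of_nonneg mult_nonneg_nonneg wnm_nonneg)
qed

lemma wnm_triangle:
  assumes "wt W m"
  shows "wnm W m (\<lambda>w. F w + G w) \<le> wnm W m F + wnm W m G"
proof (rule power2_le_imp_le)
  have "(wnm W m (\<lambda>w. F w + G w))\<^sup>2 = wip W m F F + 2 * wip W m F G + wip W m G G"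
    using assms by (simp add: wnm_sq wip_add_left wip_add_right wip_sym[of W m G F])
  also have "\<dots> \<le> wip W m F F + 2 * (wnm W m F * wnm W m G) + wip W m G G"
    using wip_cauchy_schwarz[OF assms, of F G] by linarith
  also have "\<dots> = (wnm W m F + wnm W m G)\<^sup>2"
    using assms by (simp add: power2_sum wnm_sq algebra_simps)
  finally show "(wnm W m (\<lambda>w. F w + G w))\<^sup>2 \<le> (wnm W m F + wnm W m G)\<^sup>2" .
qed (use assms in \<open>simp add: wnm_nonneg\<close>)

lemma wnm_scale:
  "wnm W m (\<lambda>w. c * F w) = \<bar>c\<bar> * wnm W m F"
  unfolding wnm_def by (simp add: wip_scale_left wip_scale_right real_sqrt_mult flip: mult.assoc)

lemma wnm_sum:
  assumes "wt W m" "finite I"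
  shows "wnm W m (\<lambda>w. \<Sum>i\<in>I. F i w) \<le> (\<Sum>i\<in>I. wnm W m (F i))"
  using assms(2)
proof (induction I rule: finite_induct)
  case empty
  then show ?case by (simp add: wnm_def wip_def)
next
  case (insert i I)
  then show ?case
    using wnm_triangle[OF assms(1), of "F i" "\<lambda>w. \<Sum>i\<in>I. F i w"] by simp
qed

text \<open>Conditional expectation of \<open>F\<close> given \<open>Z\<close>. On a fibre of total
  weight 0 the division yields the default 0, which is harmless because all weights there
  vanish.\<close>

definition cmean :: "'o set \<Rightarrow> ('o \<Rightarrow> real) \<Rightarrow> ('o \<Rightarrow> 'z) \<Rightarrow> ('o \<Rightarrow> real) \<Rightarrow> 'o \<Rightarrow> real" where
  "cmean W m Z F w = (\<Sum>v\<in>{v\<in>W. Z v = Z w}. m v * F v) / (\<Sum>v\<in>{v\<in>W. Z v = Z w}. m v)"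

lemma cmean_fibre_mean:
  assumes "wt W m"
  shows "(\<Sum>w\<in>{w\<in>W. Z w = z}. m w * (F w - cmean W m Z F w)) = 0"
proof -
  let ?S = "{w\<in>W. Z w = z}" and ?M = "\<Sum>w\<in>{w\<in>W. Z w = z}. m w"
  have "(\<Sum>w\<in>?S. m w * (F w - cmean W m Z F w))
      = (\<Sum>w\<in>?S. m w * (F w - (\<Sum>v\<in>?S. m v * F v) / ?M))"
    by (intro sum.cong) (auto simp: cmean_def)
  also have "\<dots> = (\<Sum>v\<in>?S. m v * F v) - ?M * ((\<Sum>v\<in>?S. m v * F v) / ?M)"
    by (simp only: right_diff_distrib sum_subtractf sum_distrib_right)
  also have "\<dots> = 0"
  proof (cases "?M = 0")
    case True
    then have "\<forall>w\<in>?S. m w = 0" using assms by (subst (asm) sum_nonneg_eq_0_iff) (auto simp: wt_def)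
    then show ?thesis using True by simp
  qed simp
  finally show ?thesis .
qed

lemma sum_fibres: "finite W \<Longrightarrow> (\<Sum>w\<in>W. h w) = (\<Sum>z\<in>Z ` W. \<Sum>w\<in>{w\<in>W. Z w = z}. h w)"
  by (rule sum.image_gen)

lemma wip_fibres: "finite W \<Longrightarrow> wip W m F G = (\<Sum>z\<in>Z ` W. wip {w\<in>W. Z w = z} m F G)"
  unfolding wip_def by (rule sum_fibres)

text \<open>Law of total covariance: on each fibre the conditional means are constant and the
  residuals have weighted sum 0, so both mixed terms vanish.\<close>

lemma wip_cmean_decomp:
  assumes "wt W m"
  shows "wip W m F G = wip W m (cmean W m Z F) (cmean W m Z G) +
    wip W m (\<lambda>w. F w - cmean W m Z F w) (\<lambda>w. G w - cmean W m Z G w)"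
    (is "_ = wip W m ?f ?g + wip W m ?F ?G")
proof -
  have "wip {w\<in>W. Z w = z} m F G =
      wip {w\<in>W. Z w = z} m ?f ?g + wip {w\<in>W. Z w = z} m ?F ?G" if "z \<in> Z ` W" for z
  proof -
    let ?S = "{w\<in>W. Z w = z}"
    from that obtain u where u: "u \<in> W" "Z u = z" by blast
    have c: "?f w = ?f u" "?g w = ?g u" if "w \<in> ?S" for w
      using that u by (auto simp: cmean_def)
    have "wip ?S m F G = (\<Sum>w\<in>?S. m w * ?f w * ?g w + m w * ?F w * ?G w
        + ?g u * (m w * ?F w) + ?f u * (m w * ?G w))"
      unfolding wip_def by (intro sum.cong refl) (auto simp: c algebra_simps)
    also have "\<dots> = wip ?S m ?f ?g + wip ?S m ?F ?G"
      unfolding sum.distrib sum_distrib_left[symmetric]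
        cmean_fibre_mean[OF assms, where Z = Z and z = z and F = F]
        cmean_fibre_mean[OF assms, where Z = Z and z = z and F = G]
      by (simp only: wip_def mult_zero_right add_0_right)
    finally show ?thesis .
  qed
  then show ?thesis
    by (subst (1 2 3) wip_fibres[OF wtD(1)[OF assms], of m _ _ Z]) (simp add: sum.distrib)
qed

lemma wnm_cmean_le:
  assumes "wt W m"
  shows "wnm W m (cmean W m Z F) \<le> wnm W m F"
    and "wnm W m (\<lambda>w. F w - cmean W m Z F w) \<le> wnm W m F"
  using wip_cmean_decomp[OF assms, where F = F and G = F and Z = Z] 
    wip_self_nonneg[OF assms, of "cmean W m Z F"] wip_self_nonneg[OF assms, of "\<lambda>w. F w - cmean W m Z F w"]
  by (auto simp: wnm_def)

text \<open>The decomposition of \<open>wip_cmean_decomp\<close>, applied to \<open>F\<close> and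
  the conditional mean of \<open>G\<close>: conditional means are idempotent, so the residual term
  is 0.\<close>

lemma sum_mult_cmean:
  assumes "wt W m"
  shows "wip W m F (cmean W m Z G) = wip W m (cmean W m Z F) (cmean W m Z G)"
proof -
  have "cmean W m Z (cmean W m Z G) w = cmean W m Z G w" if "w \<in> W" for w
  proof -
    let ?S = "{v\<in>W. Z v = Z w}"
    have "cmean W m Z (cmean W m Z G) w = (\<Sum>v\<in>?S. m v * cmean W m Z G w) / (\<Sum>v\<in>?S. m v)"
      by (simp add: cmean_def)
    also have "\<dots> = (\<Sum>v\<in>?S. m v) * cmean W m Z G w / (\<Sum>v\<in>?S. m v)"
      by (simp only: sum_distrib_right)
    also have "\<dots> = cmean W m Z G w"
      by (cases "(\<Sum>v\<in>?S. m v) = 0") (simp_all add: cmean_def)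
    finally show ?thesis .
  qed
  note idem = this
  have "wip W m F (cmean W m Z G) = wip W m (cmean W m Z F) (cmean W m Z (cmean W m Z G)) +
     wip W m (\<lambda>w. F w - cmean W m Z F w) (\<lambda>w. cmean W m Z G w - cmean W m Z (cmean W m Z G) w)"
    by (rule wip_cmean_decomp[OF assms])
  also have "wip W m (cmean W m Z F) (cmean W m Z (cmean W m Z G)) =
      wip W m (cmean W m Z F) (cmean W m Z G)"
    by (rule wip_cong) (simp_all add: idem)
  also have "wip W m (\<lambda>w. F w - cmean W m Z F w) (\<lambda>w. cmean W m Z G w - cmean W m Z (cmean W m Z G) w) = 0"
    unfolding wip_def by (simp add: idem)
  finally show ?thesis by simp
qed

lemma sum_cmean:
  assumes "wt W m"
  shows "(\<Sum>w\<in>W. m w * cmean W m Z F w) = (\<Sum>w\<in>W. m w * F w)"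
proof -
  have "(\<Sum>w\<in>W. m w * (F w - cmean W m Z F w)) = 0"
    by (subst sum_fibres[OF wtD(1)[OF assms], of _ Z]) (simp add: cmean_fibre_mean[OF assms])
  then show ?thesis by (simp add: right_diff_distrib sum_subtractf)
qed

text \<open>By the law of total covariance.\<close>

lemma covariance_bound:
  assumes m: "wt W m" and "0 \<le> \<delta>1" "0 \<le> \<delta>2"
    and mean: "\<bar>wip W m (cmean W m Z F) (cmean W m Z G)\<bar> \<le> \<delta>1 * wnm W m F * wnm W m G"
    and fibre: "\<And>z. z \<in> Z ` W \<Longrightarrow>
       \<bar>wip {w\<in>W. Z w = z} m (\<lambda>w. F w - cmean W m Z F w) (\<lambda>w. G w - cmean W m Z G w)\<bar> \<le>
        \<delta>2 * wnm {w\<in>W. Z w = z} m (\<lambda>w. F w - cmean W m Z F w)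
          * wnm {w\<in>W. Z w = z} m (\<lambda>w. G w - cmean W m Z G w)"
  shows "\<bar>wip W m F G\<bar> \<le> (\<delta>1 + \<delta>2) * wnm W m F * wnm W m G"
proof -
  let ?F = "\<lambda>w. F w - cmean W m Z F w" and ?G = "\<lambda>w. G w - cmean W m Z G w"
  let ?S = "\<lambda>z. {w\<in>W. Z w = z}"
  have "\<bar>wip W m ?F ?G\<bar> \<le> (\<Sum>z\<in>Z ` W. \<bar>wip (?S z) m ?F ?G\<bar>)"
    by (subst wip_fibres[OF wtD(1)[OF m], of _ _ _ Z]) (rule sum_abs)
  also have "\<dots> \<le> (\<Sum>z\<in>Z ` W. \<delta>2 * (wnm (?S z) m ?F * wnm (?S z) m ?G))"
    using fibre by (intro sum_mono) (simp add: mult.assoc)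
  also have "\<dots> = \<delta>2 * (\<Sum>z\<in>Z ` W. wnm (?S z) m ?F * wnm (?S z) m ?G)"
    by (simp add: sum_distrib_left)
  \<comment> \<open>A Cauchy-Schwarz inequality over the fibres recombines the fibrewise norms into
    the norms on all of \<open>W\<close>.\<close>
  also have "\<dots> \<le> \<delta>2 * (wnm W m ?F * wnm W m ?G)"
  proof (rule mult_left_mono)
    have "(\<Sum>z\<in>Z ` W. wnm (?S z) m ?F * wnm (?S z) m ?G)\<^sup>2 \<le>
       (\<Sum>z\<in>Z ` W. (wnm (?S z) m ?F)\<^sup>2) * (\<Sum>z\<in>Z ` W. (wnm (?S z) m ?G)\<^sup>2)"
      by (rule Cauchy_Schwarz_ineq_sum)
    also have "\<dots> = (wnm W m ?F * wnm W m ?G)\<^sup>2"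
    proof -
      have "(wnm (?S z) m h)\<^sup>2 = wip (?S z) m h h" for z h using wt_fibre[OF m] by (rule wnm_sq)
      then show ?thesis
        unfolding power_mult_distrib
        using wnm_sq[OF m, of ?F] wnm_sq[OF m, of ?G]
          wip_fibres[OF wtD(1)[OF m], of m ?F ?F Z] wip_fibres[OF wtD(1)[OF m], of m ?G ?G Z] by simp
    qed
    finally show "(\<Sum>z\<in>Z ` W. wnm (?S z) m ?F * wnm (?S z) m ?G) \<le> wnm W m ?F * wnm W m ?G"
      by (rule power2_le_imp_le) (use m in \<open>simp add: wnm_nonneg\<close>)
  qed (use assms in auto)
  also have "\<dots> \<le> \<delta>2 * (wnm W m F * wnm W m G)"
    using assms(3) m by (intro mult_left_mono mult_mono wnm_cmean_le[OF m]) (auto simp: wnm_nonneg)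
  finally have "\<bar>wip W m ?F ?G\<bar> \<le> \<delta>2 * (wnm W m F * wnm W m G)" .
  moreover have "\<bar>wip W m F G\<bar> \<le> \<bar>wip W m (cmean W m Z F) (cmean W m Z G)\<bar> + \<bar>wip W m ?F ?G\<bar>"
    by (subst wip_cmean_decomp[OF m, where Z = Z]) auto
  ultimately show ?thesis using mean by (simp add: algebra_simps)
qed


lemma mcD:
  assumes "mc W m X Y \<delta>" "(\<Sum>w\<in>W. m w * f (X w)) = 0" "(\<Sum>w\<in>W. m w * g (Y w)) = 0"
  shows "\<bar>wip W m (\<lambda>w. f (X w)) (\<lambda>w. g (Y w))\<bar> \<le>
       \<delta> * wnm W m (\<lambda>w. f (X w)) * wnm W m (\<lambda>w. g (Y w))"
  using assms unfolding mc_def by blast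

lemma mc_sym:
  assumes "mc W m X Y \<delta>" shows "mc W m Y X \<delta>"
  unfolding mc_def
proof (intro allI impI)
  fix f g assume "(\<Sum>w\<in>W. m w * f (Y w)) = 0" "(\<Sum>w\<in>W. m w * g (X w)) = 0"
  from mcD[OF assms this(2,1)]
  show "\<bar>wip W m (\<lambda>w. f (Y w)) (\<lambda>w. g (X w))\<bar> \<le> \<delta> * wnm W m (\<lambda>w. f (Y w)) * wnm W m (\<lambda>w. g (X w))"
    by (simp add: wip_sym mult_ac)
qed

lemma mc_cong:
  assumes "\<And>w. w \<in> W \<Longrightarrow> m w = m' w" "\<And>w. w \<in> W \<Longrightarrow> X w = X' w" "\<And>w. w \<in> W \<Longrightarrow> Y w = Y' w"
  shows "mc W m X Y \<delta> \<longleftrightarrow> mc W m' X' Y' \<delta>"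
  unfolding mc_def wip_def wnm_def using assms by (simp cong: sum.cong)

lemma mc_comp:
  assumes "mc W m X Y \<delta>" "\<And>w. w \<in> W \<Longrightarrow> X' w = \<phi> (X w)" "\<And>w. w \<in> W \<Longrightarrow> Y' w = \<psi> (Y w)"
  shows "mc W m X' Y' \<delta>"
proof -
  have "mc W m (\<lambda>w. \<phi> (X w)) (\<lambda>w. \<psi> (Y w)) \<delta>"
    unfolding mc_def
  proof (intro allI impI)
    fix f g assume "(\<Sum>w\<in>W. m w * f (\<phi> (X w))) = 0" "(\<Sum>w\<in>W. m w * g (\<psi> (Y w))) = 0"
    then show "\<bar>wip W m (\<lambda>w. f (\<phi> (X w))) (\<lambda>w. g (\<psi> (Y w)))\<bar> \<le>
       \<delta> * wnm W m (\<lambda>w. f (\<phi> (X w))) * wnm W m (\<lambda>w. g (\<psi> (Y w)))"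
      using mcD[OF assms(1), of "\<lambda>x. f (\<phi> x)" "\<lambda>y. g (\<psi> y)"] by simp
  qed
  then show ?thesis using mc_cong[of W m m X' "\<lambda>w. \<phi> (X w)" Y' "\<lambda>w. \<psi> (Y w)"] assms by simp
qed

lemma mc_mono:
  assumes "mc W m X Y \<delta>" "\<delta> \<le> \<delta>'" "wt W m"
  shows "mc W m X Y \<delta>'"
  unfolding mc_def
proof (intro allI impI)
  fix f g assume *: "(\<Sum>w\<in>W. m w * f (X w)) = 0" "(\<Sum>w\<in>W. m w * g (Y w)) = 0"
  have "\<delta> * wnm W m (\<lambda>w. f (X w)) * wnm W m (\<lambda>w. g (Y w)) \<le>
      \<delta>' * wnm W m (\<lambda>w. f (X w)) * wnm W m (\<lambda>w. g (Y w))"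
    using assms(2,3) by (intro mult_right_mono) (auto simp: wnm_nonneg)
  then show "\<bar>wip W m (\<lambda>w. f (X w)) (\<lambda>w. g (Y w))\<bar> \<le>
       \<delta>' * wnm W m (\<lambda>w. f (X w)) * wnm W m (\<lambda>w. g (Y w))"
    using mcD[OF assms(1) *] by linarith
qed

text \<open>The chain rule for correlation. The conditional mean of a function of
  \<open>(Y1, Y2)\<close> given \<open>Y1\<close> is a function of \<open>Y1\<close>, which
  \<open>mc1\<close> controls; on a fibre of \<open>Y1\<close> the residuals are centred functions
  of \<open>X\<close> and \<open>Y2\<close>, which \<open>mc2\<close> controls.\<close>

lemma mc_chain:
  assumes m: "wt W m" and "0 \<le> \<delta>1" "0 \<le> \<delta>2"
    and mc1: "mc W m X Y1 \<delta>1" and mc2: "\<And>y. mc {w\<in>W. Y1 w = y} m X Y2 \<delta>2"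
  shows "mc W m X (\<lambda>w. (Y1 w, Y2 w)) (\<delta>1 + \<delta>2)"
  unfolding mc_def
proof (intro allI impI)
  fix f :: "_ \<Rightarrow> real" and g :: "_ \<Rightarrow> real" assume f: "(\<Sum>w\<in>W. m w * f (X w)) = 0" and g: "(\<Sum>w\<in>W. m w * g (Y1 w, Y2 w)) = 0"
  let ?F = "\<lambda>w. f (X w)" and ?G = "\<lambda>w. g (Y1 w, Y2 w)"
  let ?c = "\<lambda>y. (\<Sum>v\<in>{v\<in>W. Y1 v = y}. m v * ?G v) / (\<Sum>v\<in>{v\<in>W. Y1 v = y}. m v)"
  have c: "cmean W m Y1 ?G = (\<lambda>w. ?c (Y1 w))" by (rule ext) (rule cmean_def)
  show "\<bar>wip W m ?F ?G\<bar> \<le> (\<delta>1 + \<delta>2) * wnm W m ?F * wnm W m ?G"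
  proof (rule covariance_bound[OF m assms(2,3)])
    have "wip W m (cmean W m Y1 ?F) (cmean W m Y1 ?G) = wip W m ?F (cmean W m Y1 ?G)"
      by (rule sum_mult_cmean[OF m, symmetric])
    then have "\<bar>wip W m (cmean W m Y1 ?F) (cmean W m Y1 ?G)\<bar> = \<bar>wip W m ?F (\<lambda>w. ?c (Y1 w))\<bar>"
      by (simp only: c)
    also have "\<dots> \<le> \<delta>1 * wnm W m ?F * wnm W m (\<lambda>w. ?c (Y1 w))"
      using sum_cmean[OF m, of Y1 ?G] g by (intro mcD[OF mc1 f]) (simp only: c)
    also have "\<dots> \<le> \<delta>1 * wnm W m ?F * wnm W m ?G"
      using wnm_cmean_le(1)[OF m, of Y1 ?G] assms(2) m
      by (intro mult_left_mono mult_nonneg_nonneg wnm_nonneg) (simp_all only: c)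
    finally show "\<bar>wip W m (cmean W m Y1 ?F) (cmean W m Y1 ?G)\<bar> \<le> \<delta>1 * wnm W m ?F * wnm W m ?G" .
  next
    fix y assume "y \<in> Y1 ` W"
    let ?S = "{w\<in>W. Y1 w = y}"
    let ?d = "(\<Sum>v\<in>{v\<in>W. Y1 v = y}. m v * ?F v) / (\<Sum>v\<in>{v\<in>W. Y1 v = y}. m v)"
    have *: "?F w - cmean W m Y1 ?F w = (\<lambda>x. f x - ?d) (X w)"
         "?G w - cmean W m Y1 ?G w = (\<lambda>z. g (y, z) - ?c y) (Y2 w)" if "w \<in> ?S" for w
      using that by (auto simp: cmean_def)
    have 1: "(\<Sum>w\<in>?S. m w * (\<lambda>x. f x - ?d) (X w)) = 0"
      unfolding cmean_fibre_mean[OF m, where Z = Y1 and F = ?F and z = y, symmetric]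
      by (intro sum.cong refl arg_cong2[where f = "(*)"] *(1)[symmetric]) auto
    have 2: "(\<Sum>w\<in>?S. m w * (\<lambda>z. g (y, z) - ?c y) (Y2 w)) = 0"
      unfolding cmean_fibre_mean[OF m, where Z = Y1 and F = ?G and z = y, symmetric]
      by (intro sum.cong refl arg_cong2[where f = "(*)"] *(2)[symmetric]) auto
    show "\<bar>wip ?S m (\<lambda>w. ?F w - cmean W m Y1 ?F w) (\<lambda>w. ?G w - cmean W m Y1 ?G w)\<bar> \<le>
        \<delta>2 * wnm ?S m (\<lambda>w. ?F w - cmean W m Y1 ?F w) * wnm ?S m (\<lambda>w. ?G w - cmean W m Y1 ?G w)"
      using mcD[OF mc2 1 2] wip_cong[OF refl *, where m = m and W = ?S]
        wnm_cong[OF refl *(1), where m = m and W = ?S] wnm_cong[OF refl *(2), where m = m and W = ?S]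
      by simp
  qed
qed

text \<open>Conditioning on the second coordinate: averaging over \<open>A\<close> leaves functions
  of \<open>X2\<close> and \<open>Y2\<close>, covered by \<open>mc2\<close>, while on a slice
  \<open>A \<times> {y}\<close> the residuals depend on \<open>X1\<close> and \<open>Y1\<close> only
  and are covered by \<open>mc1\<close>.\<close>

lemma mc_prod:
  assumes wtA: "wt A a" and wtB: "wt B b" and "0 \<le> \<delta>1" "0 \<le> \<delta>2"
    and mc1: "mc A a X1 Y1 \<delta>1" and mc2: "mc B b X2 Y2 \<delta>2"
  shows "mc (A \<times> B) (\<lambda>w. a (fst w) * b (snd w)) (\<lambda>w. (X1 (fst w), X2 (snd w)))
     (\<lambda>w. (Y1 (fst w), Y2 (snd w))) (\<delta>2 + \<delta>1)"
  unfolding mc_def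
proof (intro allI impI)
  let ?W = "A \<times> B" and ?m = "\<lambda>w. a (fst w) * b (snd w)"
  fix f :: "_ \<Rightarrow> real" and g :: "_ \<Rightarrow> real"
  let ?F = "\<lambda>w. f (X1 (fst w), X2 (snd w))" and ?G = "\<lambda>w. g (Y1 (fst w), Y2 (snd w))"
  assume f: "(\<Sum>w\<in>?W. ?m w * ?F w) = 0" and g: "(\<Sum>w\<in>?W. ?m w * ?G w) = 0"
  have m: "wt ?W ?m" using wtA wtB by (auto simp: wt_def)
  have b: "0 \<le> b y" if "y \<in> B" for y using wtB that by (simp add: wtD)
  define M where "M = sum a A"
  have M0: "0 \<le> M" using wtA by (simp add: M_def sum_nonneg wtD)
  have fib: "{w\<in>?W. snd w = y} = A \<times> {y}" if "y \<in> B" for y using that by auto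
  have S: "(\<Sum>w\<in>A\<times>{y}. h w) = (\<Sum>x\<in>A. h (x, y))" for h :: "_ \<Rightarrow> real" and y
    by (rule sum.reindex_bij_witness[of _ "\<lambda>x. (x, y)" fst]) auto
  have SW: "(\<Sum>w\<in>?W. h w) = (\<Sum>y\<in>B. \<Sum>x\<in>A. h (x, y))" for h :: "_ \<Rightarrow> real"
    by (subst sum.swap) (simp add: sum.cartesian_product)
  have MM: "(\<Sum>x\<in>A. a x * c * u * v) = M * (c * u * v)" for c u v
    by (simp add: M_def sum_distrib_right mult.assoc)
  define fb where "fb x2 = (\<Sum>x\<in>A. a x * f (X1 x, x2)) / M" for x2
  define gb where "gb x2 = (\<Sum>x\<in>A. a x * g (Y1 x, x2)) / M" for x2
  have cm: "cmean ?W ?m snd h w = (if b (snd w) = 0 then 0 else (\<Sum>x\<in>A. a x * h (x, snd w)) / M)"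
    if "w \<in> ?W" for h w
  proof -
    have "snd w \<in> B" using that by auto
    then have "cmean ?W ?m snd h w = (\<Sum>x\<in>A. a x * b (snd w) * h (x, snd w)) / (\<Sum>x\<in>A. a x * b (snd w))"
      unfolding cmean_def by (simp add: fib S)
    also have "\<dots> = (b (snd w) * (\<Sum>x\<in>A. a x * h (x, snd w))) / (b (snd w) * M)"
      by (simp add: M_def sum_distrib_left sum_distrib_right mult_ac)
    finally show ?thesis by simp
  qed
  show "\<bar>wip ?W ?m ?F ?G\<bar> \<le> (\<delta>2 + \<delta>1) * wnm ?W ?m ?F * wnm ?W ?m ?G"
  proof (rule covariance_bound[OF m assms(4,3), where Z = snd])
    have e: "wip ?W ?m (cmean ?W ?m snd (\<lambda>w. h1 (w))) (cmean ?W ?m snd h2)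
       = M * wip B b (\<lambda>y. (\<Sum>x\<in>A. a x * h1 (x, y)) / M) (\<lambda>y. (\<Sum>x\<in>A. a x * h2 (x, y)) / M)" for h1 h2
    proof -
      have "wip ?W ?m (cmean ?W ?m snd h1) (cmean ?W ?m snd h2) =
         (\<Sum>w\<in>?W. ?m w * ((\<Sum>x\<in>A. a x * h1 (x, snd w)) / M) * ((\<Sum>x\<in>A. a x * h2 (x, snd w)) / M))"
        unfolding wip_def by (intro sum.cong refl) (auto simp: cm)
      also have "\<dots> = (\<Sum>y\<in>B. M * (b y * ((\<Sum>x\<in>A. a x * h1 (x, y)) / M) * ((\<Sum>x\<in>A. a x * h2 (x, y)) / M)))"
        unfolding SW by (intro sum.cong refl) (simp only: fst_conv snd_conv MM)
      finally show ?thesis by (simp add: wip_def sum_distrib_left)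
    qed
    have mean: "(\<Sum>y\<in>B. b y * ((\<Sum>x\<in>A. a x * h (x, y)) / M)) = 0" if "(\<Sum>w\<in>?W. ?m w * h w) = 0" for h
    proof -
      have "(\<Sum>w\<in>?W. ?m w * h w) = (\<Sum>y\<in>B. b y * (\<Sum>x\<in>A. a x * h (x, y)))"
        unfolding SW by (simp add: sum_distrib_left mult_ac)
      then show ?thesis using that by (simp add: sum_divide_distrib[symmetric])
    qed
    have "\<bar>wip B b (\<lambda>y. fb (X2 y)) (\<lambda>y. gb (Y2 y))\<bar> \<le>
        \<delta>2 * wnm B b (\<lambda>y. fb (X2 y)) * wnm B b (\<lambda>y. gb (Y2 y))"
      using mean[OF f] mean[OF g] by (intro mcD[OF mc2]) (auto simp: fb_def gb_def)
    then have "M * \<bar>wip B b (\<lambda>y. fb (X2 y)) (\<lambda>y. gb (Y2 y))\<bar> \<le>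
        \<delta>2 * (sqrt M * wnm B b (\<lambda>y. fb (X2 y))) * (sqrt M * wnm B b (\<lambda>y. gb (Y2 y)))"
      by (rule sqrt_scale[OF M0])
    also have "sqrt M * wnm B b (\<lambda>y. fb (X2 y)) = wnm ?W ?m (cmean ?W ?m snd ?F)"
      unfolding wnm_def e by (simp add: real_sqrt_mult fb_def)
    also have "sqrt M * wnm B b (\<lambda>y. gb (Y2 y)) = wnm ?W ?m (cmean ?W ?m snd ?G)"
      unfolding wnm_def e by (simp add: real_sqrt_mult gb_def)
    also have "\<delta>2 * wnm ?W ?m (cmean ?W ?m snd ?F) * wnm ?W ?m (cmean ?W ?m snd ?G) \<le>
       \<delta>2 * wnm ?W ?m ?F * wnm ?W ?m ?G"
      unfolding mult.assoc using assms(4) m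
      by (intro mult_left_mono mult_mono wnm_cmean_le(1)[OF m]) (auto intro!: wnm_nonneg)
    finally show "\<bar>wip ?W ?m (cmean ?W ?m snd ?F) (cmean ?W ?m snd ?G)\<bar> \<le> \<delta>2 * wnm ?W ?m ?F * wnm ?W ?m ?G"
      unfolding e using M0 by (simp add: abs_mult fb_def gb_def)
  next
    fix y assume "y \<in> snd ` ?W"
    then have y: "y \<in> B" by (auto split: if_splits)
    let ?S = "{w\<in>?W. snd w = y}"
    let ?F' = "\<lambda>w. ?F w - cmean ?W ?m snd ?F w" and ?G' = "\<lambda>w. ?G w - cmean ?W ?m snd ?G w"
    have Sy: "?S = A \<times> {y}" by (rule fib[OF y])
    \<comment> \<open>Slices with \<open>b y = 0\<close> are treated apart, since there the
      conditional means are the default 0 and not the averages \<open>fb\<close> and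
      \<open>gb\<close>.\<close>
    show "\<bar>wip ?S ?m ?F' ?G'\<bar> \<le> \<delta>1 * wnm ?S ?m ?F' * wnm ?S ?m ?G'"
    proof (cases "b y = 0")
      case True
      then have "wip ?S ?m h1 h2 = 0" for h1 h2 unfolding wip_def Sy S by simp
      then show ?thesis by (simp add: wnm_def)
    next
      case False
      define f1 where "f1 x1 = f (x1, X2 y) - fb (X2 y)" for x1
      define g1 where "g1 y1 = g (y1, Y2 y) - gb (Y2 y)" for y1
      have FG: "?F' w = f1 (X1 (fst w))" "?G' w = g1 (Y1 (fst w))" if "w \<in> ?S" for w
        using that False by (auto simp: cm f1_def g1_def fb_def gb_def)
      have W: "wip ?S ?m (\<lambda>w. h1 (fst w)) (\<lambda>w. h2 (fst w)) = b y * wip A a h1 h2" for h1 h2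
        unfolding wip_def Sy S by (simp add: sum_distrib_left mult_ac)
      have N: "wnm ?S ?m (\<lambda>w. h1 (fst w)) = sqrt (b y) * wnm A a h1" for h1
        unfolding wnm_def W by (simp add: real_sqrt_mult)
      have z: "(\<Sum>x\<in>A. a x * (h x - (\<Sum>x\<in>A. a x * h x) / M)) = 0" for h
        using cmean_fibre_mean[OF wtA, where Z = "\<lambda>_. ()" and z = "()" and F = h] by (simp add: cmean_def M_def)
      have "\<bar>wip A a (\<lambda>x. f1 (X1 x)) (\<lambda>x. g1 (Y1 x))\<bar> \<le>
          \<delta>1 * wnm A a (\<lambda>x. f1 (X1 x)) * wnm A a (\<lambda>x. g1 (Y1 x))"
        using z[of "\<lambda>x. f (X1 x, X2 y)"] z[of "\<lambda>x. g (Y1 x, Y2 y)"]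
        by (intro mcD[OF mc1]) (auto simp: f1_def g1_def fb_def gb_def)
      then have "b y * \<bar>wip A a (\<lambda>x. f1 (X1 x)) (\<lambda>x. g1 (Y1 x))\<bar> \<le>
          \<delta>1 * (sqrt (b y) * wnm A a (\<lambda>x. f1 (X1 x))) * (sqrt (b y) * wnm A a (\<lambda>x. g1 (Y1 x)))"
        by (rule sqrt_scale[OF b[OF y]])
      moreover have "wip ?S ?m ?F' ?G' = b y * wip A a (\<lambda>x. f1 (X1 x)) (\<lambda>x. g1 (Y1 x))"
        unfolding W[symmetric] by (rule wip_cong) (use FG in auto)
      moreover have "wnm ?S ?m ?F' = sqrt (b y) * wnm A a (\<lambda>x. f1 (X1 x))"
        unfolding N[symmetric] by (rule wnm_cong) (use FG in auto)
      moreover have "wnm ?S ?m ?G' = sqrt (b y) * wnm A a (\<lambda>x. g1 (Y1 x))"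
        unfolding N[symmetric] by (rule wnm_cong) (use FG in auto)
      ultimately show ?thesis using b[OF y] by (simp add: abs_mult)
    qed
  qed
qed

lemma mc_const: "mc W m X (\<lambda>_. c) 0"
  by (simp add: mc_def wip_def flip: sum_distrib_right)

lemma mc_empty: "mc {} m X Y e"
  by (simp add: mc_def wip_def wnm_def)

section \<open>Averaging over finite groups of measure-preserving maps\<close>

text \<open>The group is a subset \<open>U\<close> of a monoid in which every element has an
  inverse; this lets groups of invertible matrices sit inside the ring \<open>bmat\<close>.\<close>

locale group_action =
  fixes W :: "'o set" and m :: "'o \<Rightarrow> real" and act :: "'g :: monoid_mult \<Rightarrow> 'o \<Rightarrow> 'o"
    and U :: "'g set"
  assumes wt_W: "wt W m"
    and finite_U: "finite U" and one_U: "1 \<in> U"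
    and mult_U: "\<And>g h. g \<in> U \<Longrightarrow> h \<in> U \<Longrightarrow> g * h \<in> U"
    and inv_U: "\<And>g. g \<in> U \<Longrightarrow> \<exists>h\<in>U. g * h = 1 \<and> h * g = 1"
    and act_W: "\<And>g w. g \<in> U \<Longrightarrow> w \<in> W \<Longrightarrow> act g w \<in> W"
    and act_mult: "\<And>g h w. g \<in> U \<Longrightarrow> h \<in> U \<Longrightarrow> w \<in> W \<Longrightarrow> act (g * h) w = act g (act h w)"
    and act_one: "\<And>w. w \<in> W \<Longrightarrow> act 1 w = w"
    and m_act: "\<And>g w. g \<in> U \<Longrightarrow> w \<in> W \<Longrightarrow> m (act g w) = m w"
begin

abbreviation "ip \<equiv> wip W m"
abbreviation "nm \<equiv> wnm W m"

definition sg :: "'g set \<Rightarrow> bool" where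
  "sg N \<longleftrightarrow> N \<subseteq> U \<and> 1 \<in> N \<and> (\<forall>g\<in>N. \<forall>h\<in>N. g * h \<in> N) \<and> (\<forall>g\<in>N. \<exists>h\<in>N. g * h = 1 \<and> h * g = 1)"

definition av :: "'g set \<Rightarrow> ('o \<Rightarrow> real) \<Rightarrow> 'o \<Rightarrow> real" where
  "av N F w = (\<Sum>g\<in>N. F (act g w)) / real (card N)"

definition fixed :: "'g set \<Rightarrow> ('o \<Rightarrow> real) \<Rightarrow> bool" where
  "fixed N F \<longleftrightarrow> (\<forall>g\<in>N. \<forall>w\<in>W. F (act g w) = F w)"

lemma nm_nonneg: "0 \<le> nm F"
  using wt_W by (rule wnm_nonneg)

lemma nm_sq: "(nm F)\<^sup>2 = ip F F"
  using wt_W by (rule wnm_sq)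

lemma cauchy_schwarz: "\<bar>ip F G\<bar> \<le> nm F * nm G"
  using wt_W by (rule wip_cauchy_schwarz)

lemma sg_U: "sg U"
  unfolding sg_def using one_U mult_U inv_U by auto

lemma sgD:
  assumes "sg N"
  shows "N \<subseteq> U" "1 \<in> N" "g \<in> N \<Longrightarrow> h \<in> N \<Longrightarrow> g * h \<in> N" "finite N" "0 < card N" "g \<in> N \<Longrightarrow> g \<in> U"
proof -
  show "finite N" using assms finite_U finite_subset sg_def by blast
  then show "0 < card N" using assms by (auto simp: sg_def card_gt_0_iff)
qed (use assms in \<open>auto simp: sg_def\<close>)

lemma bij_act:
  assumes "g \<in> U" shows "bij_betw (act g) W W"
proof -
  obtain h where h: "h \<in> U" "g * h = 1" "h * g = 1" using inv_U assms by blast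
  show ?thesis
    by (rule bij_betw_byWitness[where f' = "act h"])
      (use h assms in \<open>auto simp: act_W act_one simp flip: act_mult\<close>)
qed

lemma sum_act:
  assumes "g \<in> U" shows "(\<Sum>w\<in>W. m w * F (act g w)) = (\<Sum>w\<in>W. m w * F w)"
proof -
  have "(\<Sum>w\<in>W. m w * F w) = (\<Sum>w\<in>W. m (act g w) * F (act g w))"
    by (rule sum.reindex_bij_betw[OF bij_act[OF assms], symmetric])
  then show ?thesis using assms by (simp add: m_act)
qed

lemma ip_act:
  assumes "g \<in> U" shows "ip (\<lambda>w. F (act g w)) (\<lambda>w. G (act g w)) = ip F G"
  using sum_act[OF assms, of "\<lambda>w. F w * G w"] unfolding wip_def by (simp add: mult.assoc)

lemma nm_act: "g \<in> U \<Longrightarrow> nm (\<lambda>w. F (act g w)) = nm F"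
  unfolding wnm_def by (simp add: ip_act)

lemma fixed_av:
  assumes "sg N" shows "fixed N (av N F)"
  unfolding fixed_def
proof (intro ballI)
  fix h w assume h: "h \<in> N" and w: "w \<in> W"
  obtain k where k: "k \<in> N" "h * k = 1" "k * h = 1" using assms h unfolding sg_def by blast
  have bij: "bij_betw (\<lambda>g. g * h) N N"
    by (rule bij_betw_byWitness[where f' = "\<lambda>g. g * k"])
      (use assms h k in \<open>auto simp: sgD mult.assoc\<close>)
  have "(\<Sum>g\<in>N. F (act g (act h w))) = (\<Sum>g\<in>N. F (act (g * h) w))"
    using assms h w by (intro sum.cong refl) (simp add: act_mult sgD)
  also have "\<dots> = (\<Sum>g\<in>N. F (act g w))"
    by (rule sum.reindex_bij_betw[OF bij])
  finally show "av N F (act h w) = av N F w" by (simp add: av_def)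
qed

lemma av_fixed: "sg N \<Longrightarrow> fixed N F \<Longrightarrow> w \<in> W \<Longrightarrow> av N F w = F w"
  using sgD(2,5)[of N] by (auto simp: av_def fixed_def)

lemma fixed_subset: "fixed N F \<Longrightarrow> N' \<subseteq> N \<Longrightarrow> fixed N' F"
  unfolding fixed_def by auto

lemma fixed_diff: "fixed N F \<Longrightarrow> fixed N G \<Longrightarrow> fixed N (\<lambda>w. F w - G w)"
  unfolding fixed_def by simp

text \<open>The action preserves the weight, so \<open>av N\<close> is the orthogonal projection
  onto the functions fixed by \<open>N\<close>.\<close>

lemma ip_av_fixed:
  assumes "sg N" "fixed N F" shows "ip F (av N G) = ip F G"
proof -
  have "ip F (\<lambda>w. G (act g w)) = ip F G" if "g \<in> N" for g
  proof -
    have "ip F (\<lambda>w. G (act g w)) = ip (\<lambda>w. F (act g w)) (\<lambda>w. G (act g w))"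
      by (rule wip_cong) (use assms that in \<open>auto simp: fixed_def\<close>)
    then show ?thesis using assms that by (simp add: ip_act sgD)
  qed
  then have "(\<Sum>g\<in>N. ip F (\<lambda>w. G (act g w))) = real (card N) * ip F G" by simp
  moreover have "ip F (av N G) = (\<Sum>g\<in>N. ip F (\<lambda>w. G (act g w))) / real (card N)"
    unfolding av_def by (subst wip_sum_right[symmetric])
      (simp add: wip_scale_right[of W m F "1 / real (card N)", simplified])
  ultimately show ?thesis using sgD(5)[OF assms(1)] by simp
qed

lemma ip_av:
  assumes "sg N" shows "ip (av N F) G = ip F (av N G)"
  using ip_av_fixed[OF assms fixed_av[OF assms], of F G] ip_av_fixed[OF assms fixed_av[OF assms], of G F]
  by (simp add: wip_sym)

lemma nm_av:
  assumes "sg N" shows "nm (av N F) \<le> nm F"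
proof -
  have "(nm (av N F))\<^sup>2 = ip (av N F) F"
    using ip_av_fixed[OF assms fixed_av[OF assms]] by (simp add: nm_sq)
  also have "\<dots> \<le> nm (av N F) * nm F"
    using cauchy_schwarz[of "av N F" F] by linarith
  finally show ?thesis
    using nm_nonneg[of "av N F"] nm_nonneg[of F]
    by (cases "nm (av N F) = 0") (auto simp: power2_eq_square)
qed

lemma nm_diff_av:
  assumes "sg N" shows "nm (\<lambda>w. F w - av N F w) \<le> nm F"
proof -
  have "ip F (av N F) = ip (av N F) (av N F)"
    using ip_av_fixed[OF assms fixed_av[OF assms], of F F] by (simp add: wip_sym)
  then have "ip (\<lambda>w. F w - av N F w) (\<lambda>w. F w - av N F w) = ip F F - ip (av N F) (av N F)"
    by (simp add: wip_diff_left wip_diff_right wip_sym[of W m "av N F" F])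
  also have "\<dots> \<le> ip F F" using wip_self_nonneg[OF wt_W, of "av N F"] by simp
  finally show ?thesis unfolding wnm_def by simp
qed

text \<open>The third hypothesis says that \<open>N\<close> normalises \<open>N'\<close>: an element
  of \<open>N'\<close> moved past \<open>g\<close> stays in \<open>N'\<close> and is then absorbed
  by \<open>G\<close>.\<close>

lemma fixed_av_normal:
  assumes "sg N" "N' \<subseteq> U" "\<And>g n. g \<in> N \<Longrightarrow> n \<in> N' \<Longrightarrow> \<exists>n'\<in>N'. g * n = n' * g" "fixed N' G"
  shows "fixed N' (av N G)"
  unfolding fixed_def
proof (intro ballI)
  fix n w assume n: "n \<in> N'" and w: "w \<in> W"
  have "G (act g (act n w)) = G (act g w)" if g: "g \<in> N" for g
  proof -
    obtain n' where n': "n' \<in> N'" "g * n = n' * g" using assms(3) g n by blast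
    have U: "g \<in> U" "n \<in> U" "n' \<in> U" using assms n n' g by (auto simp: sgD)
    have "act g (act n w) = act n' (act g w)"
      using n' U w by (simp flip: act_mult)
    then show ?thesis using assms(4) n' U w by (simp add: fixed_def act_W)
  qed
  then show "av N G (act n w) = av N G w" by (simp add: av_def)
qed

text \<open>The norm of an orthogonal projection of \<open>X\<close> is the largest inner product of
  \<open>X\<close> with a unit vector of the subspace; testing with \<open>av N X\<close> itself
  suffices.\<close>

lemma nm_av_le_of_dual:
  assumes "sg N" "0 \<le> e" "\<And>F. fixed N F \<Longrightarrow> \<bar>ip F X\<bar> \<le> e * nm F"
  shows "nm (av N X) \<le> e"
proof -
  have "(nm (av N X))\<^sup>2 = ip (av N X) X"
    using ip_av_fixed[OF assms(1) fixed_av[OF assms(1)]] by (simp add: nm_sq)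
  also have "\<dots> \<le> e * nm (av N X)"
    using assms(3)[OF fixed_av[OF assms(1)], of X] by linarith
  finally show ?thesis
    using nm_nonneg[of "av N X"] assms(2)
    by (cases "nm (av N X) = 0") (auto simp: power2_eq_square)
qed

lemma nm_av_diff_le:
  assumes "sg N" "\<And>h. h \<in> N \<Longrightarrow> nm (\<lambda>w. F (act h w) - F w) \<le> e"
  shows "nm (\<lambda>w. av N F w - F w) \<le> e"
proof -
  have c: "0 < real (card N)" and fin: "finite N" using sgD[OF assms(1)] by auto
  have "av N F w - F w = (1 / real (card N)) * (\<Sum>h\<in>N. F (act h w) - F w)" for w
    using c by (simp add: av_def sum_subtractf field_simps)
  then have "nm (\<lambda>w. av N F w - F w) = (1 / real (card N)) * nm (\<lambda>w. \<Sum>h\<in>N. F (act h w) - F w)"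
    by (simp only: wnm_scale) simp
  also have "\<dots> \<le> (1 / real (card N)) * (\<Sum>h\<in>N. nm (\<lambda>w. F (act h w) - F w))"
    using wnm_sum[OF wt_W fin, of "\<lambda>h w. F (act h w) - F w"] c
    by (intro mult_left_mono) auto
  also have "\<dots> \<le> (1 / real (card N)) * (\<Sum>h\<in>N. e)"
    using c assms(2) by (intro mult_left_mono sum_mono) auto
  finally show ?thesis using c by simp
qed

text \<open>A function fixed by many maps sees only the average of \<open>G\<close> over these maps, which is
  short when the translates of \<open>G\<close> are almost orthogonal.\<close>

lemma almost_orthogonal_translates:
  assumes n: "\<And>i. i < M \<Longrightarrow> n i \<in> U" and F: "\<And>i w. i < M \<Longrightarrow> w \<in> W \<Longrightarrow> F (act (n i) w) = F w"
    and orth: "\<And>i j. i < M \<Longrightarrow> j < M \<Longrightarrow> i \<noteq> j \<Longrightarrow>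
       \<bar>ip (\<lambda>w. G (act (n i) w)) (\<lambda>w. G (act (n j) w))\<bar> \<le> \<eta> * (nm G)\<^sup>2"
    and M: "0 < M" and \<eta>: "0 \<le> \<eta>"
  shows "\<bar>ip F G\<bar> \<le> sqrt (1 / real M + \<eta>) * nm F * nm G"
proof -
  let ?T = "\<lambda>i w. G (act (n i) w)"
  let ?A = "\<lambda>w. \<Sum>i<M. ?T i w"
  have "ip F (?T i) = ip F G" if "i < M" for i
  proof -
    have "ip F (?T i) = ip (\<lambda>w. F (act (n i) w)) (?T i)"
      by (rule wip_cong) (use F that in auto)
    then show ?thesis using n that by (simp add: ip_act)
  qed
  then have 1: "ip F ?A = real M * ip F G" by (simp add: wip_sum_right)
  have "(nm ?A)\<^sup>2 = (\<Sum>i<M. \<Sum>j<M. ip (?T i) (?T j))"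
    by (simp add: nm_sq wip_sum_left wip_sum_right)
  also have "\<dots> \<le> (\<Sum>i<M. \<Sum>j<M. (if i = j then (nm G)\<^sup>2 else 0) + \<eta> * (nm G)\<^sup>2)"
  proof (intro sum_mono)
    fix i j assume "i \<in> {..<M}" "j \<in> {..<M}"
    then show "ip (?T i) (?T j) \<le> (if i = j then (nm G)\<^sup>2 else 0) + \<eta> * (nm G)\<^sup>2"
      using orth[of i j] n[of i] \<eta> by (auto simp: ip_act nm_sq wip_self_nonneg[OF wt_W])
  qed
  also have "\<dots> = real M * (nm G)\<^sup>2 + real M * (real M * (\<eta> * (nm G)\<^sup>2))"
    by (simp add: sum.distrib algebra_simps)
  also have "\<dots> = (real M * (sqrt (1 / real M + \<eta>) * nm G))\<^sup>2"
    using M \<eta> by (simp add: power_mult_distrib power2_eq_square field_simps)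
  finally have "nm ?A \<le> real M * (sqrt (1 / real M + \<eta>) * nm G)"
    using M \<eta> nm_nonneg by (auto elim!: power2_le_imp_le)
  then have "\<bar>ip F ?A\<bar> \<le> nm F * (real M * (sqrt (1 / real M + \<eta>) * nm G))"
    using cauchy_schwarz[of F ?A] nm_nonneg[of F] mult_left_mono order_trans by blast
  then have "real M * \<bar>ip F G\<bar> \<le> real M * (sqrt (1 / real M + \<eta>) * nm F * nm G)"
    unfolding 1 by (simp add: abs_mult mult_ac)
  then show ?thesis using M by simp
qed

lemma nm_triangle: "nm (\<lambda>w. F w + G w) \<le> nm F + nm G"
  using wt_W by (rule wnm_triangle)

text \<open>Displacement is subadditive along products because \<open>act h\<close> is an isometry.
  Together with a factorisation of bounded length it passes from generators to a whole
  group.\<close>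

lemma nm_act_mult_diff:
  assumes "g \<in> U" "h \<in> U" "nm (\<lambda>w. F (act g w) - F w) \<le> a" "nm (\<lambda>w. F (act h w) - F w) \<le> b"
  shows "nm (\<lambda>w. F (act (g * h) w) - F w) \<le> a + b"
proof -
  have "nm (\<lambda>w. F (act (g * h) w) - F w) =
      nm (\<lambda>w. (F (act g (act h w)) - F (act h w)) + (F (act h w) - F w))"
    by (rule wnm_cong) (use assms in \<open>auto simp: act_mult\<close>)
  also have "\<dots> \<le> nm (\<lambda>w. F (act g (act h w)) - F (act h w)) + nm (\<lambda>w. F (act h w) - F w)"
    by (rule nm_triangle)
  also have "nm (\<lambda>w. F (act g (act h w)) - F (act h w)) = nm (\<lambda>w. F (act g w) - F w)"
    using nm_act[OF assms(2), of "\<lambda>w. F (act g w) - F w"] by simp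
  finally show ?thesis using assms by linarith
qed

lemma nm_act_diff_near_fixed:
  assumes "g \<in> U" "\<And>w. w \<in> W \<Longrightarrow> A (act g w) = A w" "nm (\<lambda>w. F w - A w) \<le> e"
  shows "nm (\<lambda>w. F (act g w) - F w) \<le> 2 * e"
proof -
  have "nm (\<lambda>w. F (act g w) - F w) = nm (\<lambda>w. (F (act g w) - A (act g w)) + (-1) * (F w - A w))"
    by (rule wnm_cong) (use assms in auto)
  also have "\<dots> \<le> nm (\<lambda>w. F (act g w) - A (act g w)) + nm (\<lambda>w. (-1) * (F w - A w))"
    by (rule nm_triangle)
  also have "\<dots> = 2 * nm (\<lambda>w. F w - A w)"
    using nm_act[OF assms(1), of "\<lambda>w. F w - A w"] wnm_scale[of W m "-1" "\<lambda>w. F w - A w"] by simp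
  finally show ?thesis using assms by linarith
qed

end

section \<open>General linear groups inside the matrix ring\<close>

definition is_inv :: "bmat \<Rightarrow> bmat \<Rightarrow> bool" where
  "is_inv g h \<longleftrightarrow> g * h = 1 \<and> h * g = 1"

definition uinv :: "bmat \<Rightarrow> bmat" where
  "uinv g = (THE h. is_inv g h)"

text \<open>Block matrices diag(g', 1): the two equations force the rows and columns from
  \<open>n\<close> on to be those of the identity. All these groups share the same unit and
  multiplication.\<close>

definition gl :: "nat \<Rightarrow> bmat set" where
  "gl n = {g. (\<exists>h. is_inv g h) \<and> g * dg {n..} = dg {n..} \<and> dg {n..} * g = dg {n..}}"

lemma mult_eq_assoc: "(a :: bmat) * b = c \<Longrightarrow> a * (b * x) = c * x"
  by (simp flip: mult.assoc)

lemma is_inv_unique: "is_inv g h \<Longrightarrow> is_inv g h' \<Longrightarrow> h = h'"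
  unfolding is_inv_def by (metis mult.assoc mult_1_left mult_1_right)

lemma uinv_eq: "is_inv g h \<Longrightarrow> uinv g = h"
  unfolding uinv_def using is_inv_unique by (intro the_equality) auto

lemma is_inv_mult: "is_inv g g' \<Longrightarrow> is_inv h h' \<Longrightarrow> is_inv (g * h) (h' * g')"
  unfolding is_inv_def by (metis mult.assoc mult_1_left mult_1_right)

lemma is_inv_sym: "is_inv g h \<Longrightarrow> is_inv h g"
  unfolding is_inv_def by auto

lemma is_inv_tr: "is_inv g h \<Longrightarrow> is_inv (tr g) (tr h)"
  unfolding is_inv_def by (simp flip: tr_mult)

lemma is_inv_1 [simp]: "is_inv 1 1"
  by (simp add: is_inv_def)

lemma is_inv_commute: "is_inv g h \<Longrightarrow> g * a = a * g \<Longrightarrow> h * a = a * h"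
  unfolding is_inv_def by (metis mult.assoc mult_1_left mult_1_right)

lemma id_mat_Compl: "id_mat n + dg {n..} = 1"
  unfolding id_mat_def by (rule bmat_eqI) (auto simp: ent_dg ent_simps)

lemma gl_is_inv: "g \<in> gl n \<Longrightarrow> is_inv g (uinv g)"
  unfolding gl_def using uinv_eq by auto

lemma gl_1 [simp]: "1 \<in> gl n"
  unfolding gl_def by (auto simp: is_inv_def)

lemma gl_mult: "g \<in> gl n \<Longrightarrow> h \<in> gl n \<Longrightarrow> g * h \<in> gl n"
  unfolding gl_def using is_inv_mult by (fastforce simp: mult.assoc simp flip: mult.assoc[of _ g h])

lemma gl_is_inv_mem:
  assumes "g \<in> gl n" "is_inv g h" shows "h \<in> gl n"
proof -
  have "h * dg {n..} = (h * g) * dg {n..}" "dg {n..} * h = dg {n..} * (g * h)"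
    using assms(1) by (simp_all add: gl_def mult.assoc mult_eq_assoc)
  then show ?thesis
    using assms(2) is_inv_sym[OF assms(2)] unfolding gl_def by (auto simp: is_inv_def)
qed

lemma gl_uinv: "g \<in> gl n \<Longrightarrow> uinv g \<in> gl n"
  using gl_is_inv gl_is_inv_mem by blast

lemma gl_tr:
  assumes "g \<in> gl n" shows "tr g \<in> gl n"
proof -
  have "tr g * dg {n..} = tr (dg {n..} * g)" "dg {n..} * tr g = tr (g * dg {n..})" by simp_all
  then have "tr g * dg {n..} = dg {n..}" "dg {n..} * tr g = dg {n..}"
    using assms by (simp_all add: gl_def del: tr_mult)
  moreover have "\<exists>h. is_inv (tr g) h" using gl_is_inv[OF assms] is_inv_tr by blast
  ultimately show ?thesis by (simp add: gl_def)
qed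

lemma uinv_mult: "g \<in> gl n \<Longrightarrow> h \<in> gl n \<Longrightarrow> uinv (g * h) = uinv h * uinv g"
  by (intro uinv_eq is_inv_mult gl_is_inv)

lemma gl_id_mat:
  assumes "g \<in> gl n" shows "g * id_mat n = id_mat n * g"
proof -
  have 1: "id_mat n = 1 + dg {n..}" using id_mat_Compl[of n] by (metis bmat_add_self_left add.commute)
  then show ?thesis using assms by (simp add: gl_def distrib_left distrib_right)
qed

lemma gl_decomp:
  assumes "g \<in> gl n" shows "g = id_mat n * g * id_mat n + dg {n..}"
proof -
  have "id_mat n * g * id_mat n = g * id_mat n"
    by (simp add: gl_id_mat[OF assms, symmetric] mult.assoc) (simp add: id_mat_def)
  moreover have "g = g * (id_mat n + dg {n..})" by (simp add: id_mat_Compl)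
  ultimately show ?thesis using assms by (simp add: gl_def distrib_left)
qed

lemma finite_gl [simp]: "finite (gl n)"
proof (rule finite_subset)
  show "gl n \<subseteq> (\<lambda>A. A + dg {n..}) ` corner n n"
  proof
    fix g assume "g \<in> gl n"
    from gl_decomp[OF this] show "g \<in> (\<lambda>A. A + dg {n..}) ` corner n n"
      by (rule image_eqI) (simp add: corner_def id_mat_def mult.assoc)
  qed
qed simp

lemma gl_pmat:
  assumes "bij \<pi>" "\<And>i. n \<le> i \<Longrightarrow> \<pi> i = i" shows "pmat \<pi> \<in> gl n"
proof -
  have "\<exists>h. is_inv (pmat \<pi>) h" using pmat_inv[OF assms(1)] by (auto simp: is_inv_def)
  moreover have lt: "\<pi> i < n \<longleftrightarrow> i < n" for i
    using assms by (metis bij_pointE linorder_not_le)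
  have eq: "\<pi> i = i" if "n \<le> \<pi> i" for i using lt[of i] assms(2)[of i] that by simp
  have "ent (pmat \<pi> * dg {n..}) i j = ent (dg {n..}) i j" for i j
    using eq[of i] assms(2)[of i] by (auto simp: ent_pmat[OF assms(1)] ent_dg)
  then have "pmat \<pi> * dg {n..} = dg {n..}" by (rule bmat_eqI)
  moreover have "ent (dg {n..} * pmat \<pi>) i j = ent (dg {n..}) i j" for i j
    using eq[of i] assms(2)[of i] by (auto simp: ent_pmat[OF assms(1)] ent_dg)
  then have "dg {n..} * pmat \<pi> = dg {n..}" by (rule bmat_eqI)
  ultimately show ?thesis by (simp add: gl_def)
qed

lemma mult_orth: "X * dg y = X \<Longrightarrow> dg x * Y = Y \<Longrightarrow> y \<inter> x = {} \<Longrightarrow> X * Y = 0"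
  by (metis dg_empty dg_mult_dg mult.assoc mult_zero_left mult_zero_right)

section \<open>The fibres of the tensor construction\<close>

text \<open>The indices whose binary digit \<open>l\<close> is 1, so that \<open>dg (bset l)\<close>
  is the projection P_l.\<close>

definition bset :: "nat \<Rightarrow> nat set" where
  "bset l = {i. bit i l}"

text \<open>The setting in which the first \<open>m\<close> matrices have the prescribed values
  \<open>cst\<close> and the matrices for the digits \<open>m\<close> and \<open>Suc m\<close> are
  compared. Of the auxiliary matrices only the relations used are kept: every \<open>tau i\<close>
  preserves the digits up to \<open>Suc m\<close>, differences of two of them are invertible, and
  the involution \<open>s\<close> flips digit \<open>Suc m\<close> and preserves the lower
  ones.\<close>

locale tensor_link =
  fixes D m M :: nat and mu :: "bmat \<Rightarrow> real" and cst :: "nat \<Rightarrow> bmat" and tau :: "nat \<Rightarrow> bmat" and s :: bmat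
  assumes finite_supp: "finite {v. mu v \<noteq> 0}" and mu_nonneg: "0 \<le> mu v"
    and supp_row: "mu v \<noteq> 0 \<Longrightarrow> id_mat D * v = v"
    and supp_rinv: "mu v \<noteq> 0 \<Longrightarrow> \<exists>\<theta>. v * \<theta> = id_mat D"
    and mu_gl: "g \<in> gl D \<Longrightarrow> mu (g * v) = mu v"
    and M_pos: "0 < M"
    and tau_D: "i < M \<Longrightarrow> tau i * id_mat D = id_mat D * tau i"
    and tau_bset: "i < M \<Longrightarrow> l \<le> Suc m \<Longrightarrow> tau i * dg (bset l) = dg (bset l) * tau i"
    and tau_s: "i < M \<Longrightarrow> tau i * s = s * tau i"
    and tau_tau: "i < M \<Longrightarrow> j < M \<Longrightarrow> tau i * tau j = tau j * tau i"
    and tau_inv: "i < M \<Longrightarrow> j < M \<Longrightarrow> i \<noteq> j \<Longrightarrow> \<exists>h. is_inv (tau i + tau j) h"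
    and s_s: "s * s = 1" and tr_s: "tr s = s"
    and s_D: "s * id_mat D = id_mat D * s"
    and s_bset: "l \<le> m \<Longrightarrow> s * dg (bset l) = dg (bset l) * s"
    and s_flip: "s * dg (bset (Suc m)) = dg (- bset (Suc m)) * s"
begin

text \<open>Matrices that are block diagonal with respect to the cells, a cell being a set of
  indices with equal digits below \<open>m\<close>.\<close>

definition comm :: "bmat set" where
  "comm = {X. \<forall>l<m. X * dg (bset l) = dg (bset l) * X}"

definition hset :: "bmat set" where
  "hset = gl D \<inter> comm"

text \<open>The block with rows in \<open>x\<close> and columns in \<open>y\<close>. If
  \<open>x\<close> and \<open>y\<close> are disjoint, products inside the block vanish, so adding 1
  turns it into an elementary abelian group of unipotent matrices.\<close>

definition rset :: "nat set \<Rightarrow> nat set \<Rightarrow> bmat set" where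
  "rset x y = {X \<in> comm. dg x * X = X \<and> X * dg y = X}"

definition nset :: "nat set \<Rightarrow> nat set \<Rightarrow> bmat set" where
  "nset x y = (\<lambda>X. 1 + X) ` rset x y"

definition dom :: "(bmat \<times> bmat) set" where
  "dom = {(v, \<xi>). mu v \<noteq> 0 \<and> mu \<xi> \<noteq> 0 \<and> (\<forall>l<m. tr v * dg (bset l) * \<xi> = cst l)}"

definition wgt :: "bmat \<times> bmat \<Rightarrow> real" where
  "wgt w = mu (fst w) * mu (snd w)"

text \<open>The second component carries the contragredient action. Hence tr v P \<xi> is invariant
  under every \<open>g\<close> that commutes with a diagonal projection P.\<close>

definition act :: "bmat \<Rightarrow> bmat \<times> bmat \<Rightarrow> bmat \<times> bmat" where
  "act g w = (g * fst w, tr (uinv g) * snd w)"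

lemma comm_closed:
  "1 \<in> comm" "0 \<in> comm" "X \<in> comm \<Longrightarrow> Y \<in> comm \<Longrightarrow> X + Y \<in> comm"
  "X \<in> comm \<Longrightarrow> Y \<in> comm \<Longrightarrow> X * Y \<in> comm" "dg S \<in> comm" "X \<in> comm \<Longrightarrow> tr X \<in> comm"
proof -
  show "X * Y \<in> comm" if "X \<in> comm" "Y \<in> comm"
    using that unfolding comm_def by (auto simp: mult.assoc) (metis mult.assoc)
  show "tr X \<in> comm" if "X \<in> comm"
    unfolding comm_def
  proof (intro CollectI allI impI)
    fix l assume l: "l < m"
    have "tr X * dg (bset l) = tr (dg (bset l) * X)" by simp
    also have "\<dots> = tr (X * dg (bset l))" using that l by (simp add: comm_def del: tr_mult)
    finally show "tr X * dg (bset l) = dg (bset l) * tr X" by simp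
  qed
qed (auto simp: comm_def distrib_left distrib_right Int_commute)

lemma comm_is_inv: "X \<in> comm \<Longrightarrow> is_inv X Y \<Longrightarrow> Y \<in> comm"
  unfolding comm_def using is_inv_commute by blast

lemma comm_tau_s: "i < M \<Longrightarrow> tau i \<in> comm" "s \<in> comm"
  unfolding comm_def using tau_bset s_bset by auto

lemma hset_uinv: "g \<in> hset \<Longrightarrow> is_inv g (uinv g)" "g \<in> hset \<Longrightarrow> uinv g \<in> hset"
  unfolding hset_def using gl_is_inv gl_uinv comm_is_inv by blast+

lemma hset_closed: "1 \<in> hset" "g \<in> hset \<Longrightarrow> h \<in> hset \<Longrightarrow> g * h \<in> hset" "g \<in> hset \<Longrightarrow> tr g \<in> hset"
  "finite hset"
  unfolding hset_def using comm_closed gl_mult gl_tr by auto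

lemma mem_dom: "(v, \<xi>) \<in> dom \<longleftrightarrow> mu v \<noteq> 0 \<and> mu \<xi> \<noteq> 0 \<and> (\<forall>l<m. tr v * dg (bset l) * \<xi> = cst l)"
  by (simp add: dom_def)

lemma act_dom:
  assumes "g \<in> hset" "w \<in> dom" shows "act g w \<in> dom"
proof -
  obtain v \<xi> where w: "w = (v, \<xi>)" by (cases w)
  have "tr (g * v) * dg (bset l) * (tr (uinv g) * \<xi>) = cst l" if "l < m" for l
  proof -
    have "tr g * dg (bset l) = dg (bset l) * tr g"
      using hset_closed(3)[OF assms(1)] that by (auto simp: hset_def comm_def)
    from this[THEN mult_eq_assoc]
    have "tr (g * v) * dg (bset l) * (tr (uinv g) * \<xi>) = tr v * dg (bset l) * (tr g * tr (uinv g)) * \<xi>"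
      by (simp add: mult.assoc)
    also have "tr g * tr (uinv g) = 1"
      using is_inv_tr[OF hset_uinv(1)[OF assms(1)]] by (simp add: is_inv_def)
    finally show ?thesis using assms(2) that w by (simp add: mem_dom)
  qed
  moreover have "tr (uinv g) \<in> gl D" "g \<in> gl D"
    using assms hset_uinv hset_closed by (auto simp: hset_def)
  ultimately show ?thesis using assms(2) mu_gl by (simp add: w act_def mem_dom)
qed

sublocale group_action dom wgt act hset
proof
  have "dom \<subseteq> {v. mu v \<noteq> 0} \<times> {v. mu v \<noteq> 0}" by (auto simp: dom_def)
  then show "wt dom wgt"
    using finite_supp mu_nonneg finite_subset by (fastforce simp: wt_def wgt_def)
  show "act (g * h) w = act g (act h w)" if "g \<in> hset" "h \<in> hset" "w \<in> dom" for g h w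
    using that uinv_mult[of g D h] by (simp add: act_def hset_def mult.assoc)
  show "act 1 w = w" if "w \<in> dom" for w
    using uinv_eq[OF is_inv_1] by (simp add: act_def)
  show "wgt (act g w) = wgt w" if "g \<in> hset" "w \<in> dom" for g w
    using that hset_uinv hset_closed mu_gl by (simp add: wgt_def act_def hset_def)
  show "\<exists>h\<in>hset. g * h = 1 \<and> h * g = 1" if "g \<in> hset" for g
    using hset_uinv[OF that] by (auto simp: is_inv_def)
qed (use hset_closed act_dom in auto)

lemma rset_mult_0: "X \<in> rset x y \<Longrightarrow> Y \<in> rset x' y' \<Longrightarrow> y \<inter> x' = {} \<Longrightarrow> X * Y = 0"
  unfolding rset_def by (auto intro: mult_orth)

lemma rset_add: "X \<in> rset x y \<Longrightarrow> Y \<in> rset x y \<Longrightarrow> X + Y \<in> rset x y"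
  unfolding rset_def by (auto simp: comm_closed distrib_left distrib_right)

lemma rset_mult:
  assumes "X \<in> rset x y" "Y \<in> rset y' z" shows "X * Y \<in> rset x z"
  using assms mult_eq_assoc[of "dg x" X X Y] unfolding rset_def by (auto simp: comm_closed mult.assoc)

lemma rset_0: "0 \<in> rset x y"
  unfolding rset_def by (auto simp: comm_closed)

lemma rset_finite: assumes "x \<subseteq> {..<D}" "y \<subseteq> {..<D}" shows "finite (rset x y)"
proof (rule finite_subset[OF _ finite_corner])
  show "rset x y \<subseteq> corner D D"
    using assms unfolding rset_def dg_mult_fix mult_dg_fix by (fastforce simp: corner_iff)
qed

lemma one_add_rset_inv: "X \<in> rset x y \<Longrightarrow> x \<inter> y = {} \<Longrightarrow> is_inv (1 + X) (1 + X)"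
  using rset_mult_0[of X x y X x y] by (auto simp: is_inv_def distrib_left distrib_right Int_commute)

lemma nset_hset:
  assumes "x \<subseteq> {..<D}" "y \<subseteq> {..<D}" "x \<inter> y = {}" shows "nset x y \<subseteq> hset"
proof
  fix g assume "g \<in> nset x y"
  then obtain X where X: "X \<in> rset x y" "g = 1 + X" by (auto simp: nset_def)
  have "X * dg {D..} = 0"
    by (rule mult_orth[of X y "{D..}"]) (use X assms in \<open>auto simp: rset_def\<close>)
  moreover have "dg {D..} * X = 0"
    by (rule mult_orth[of _ "{D..}" x]) (use X assms in \<open>auto simp: rset_def\<close>)
  ultimately show "g \<in> hset"
    using X one_add_rset_inv[OF X(1) assms(3)]
    by (auto simp: hset_def gl_def distrib_left distrib_right comm_closed rset_def)
qed

lemma sg_nset: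
  assumes "x \<subseteq> {..<D}" "y \<subseteq> {..<D}" "x \<inter> y = {}" shows "sg (nset x y)"
  unfolding sg_def
proof (intro conjI ballI)
  show "nset x y \<subseteq> hset" using assms by (rule nset_hset)
  show "1 \<in> nset x y" unfolding nset_def by (rule image_eqI[of _ _ 0]) (simp_all add: rset_0)
next
  fix g h assume "g \<in> nset x y" "h \<in> nset x y"
  then obtain X Y where X: "X \<in> rset x y" "g = 1 + X" "Y \<in> rset x y" "h = 1 + Y"
    by (auto simp: nset_def)
  have "g * h = 1 + (X + Y)"
    using rset_mult_0[OF X(1,3)] assms(3) X by (simp add: distrib_left distrib_right Int_commute add_ac)
  then show "g * h \<in> nset x y" using rset_add X by (auto simp: nset_def)
next
  fix g assume g: "g \<in> nset x y"
  then obtain X where X: "X \<in> rset x y" "g = 1 + X" by (auto simp: nset_def)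
  show "\<exists>h\<in>nset x y. g * h = 1 \<and> h * g = 1"
    using one_add_rset_inv[OF X(1) assms(3)] X g by (auto simp: is_inv_def)
qed

lemma av_diff: "av N (\<lambda>w. F w - G w) w = av N F w - av N G w"
  by (simp add: av_def sum_subtractf diff_divide_distrib)

lemma card_nset: "card (nset x y) = card (rset x y)"
  unfolding nset_def by (rule card_image) (auto simp: inj_on_def)

lemma sum_nset: "(\<Sum>g\<in>nset x y. f g) = (\<Sum>X\<in>rset x y. f (1 + X))"
  unfolding nset_def by (subst sum.reindex) (auto simp: inj_on_def)

text \<open>Conjugating \<open>1 + T\<close> by \<open>nset y z\<close> produces all of \<open>nset x z\<close>, so the translates of a function
  fixed by \<open>nset y z\<close> with vanishing \<open>nset x z\<close>-average are exactly orthogonal.\<close>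

lemma heisenberg_mixing:
  assumes sub: "x \<subseteq> {..<D}" "y \<subseteq> {..<D}" "z \<subseteq> {..<D}"
    and disj: "x \<inter> y = {}" "y \<inter> z = {}" "x \<inter> z = {}"
    and sy: "s * dg y = dg x * s" and ty: "\<And>i. i < M \<Longrightarrow> tau i * dg x = dg x * tau i"
      "\<And>i. i < M \<Longrightarrow> tau i * dg y = dg y * tau i"
    and F: "fixed (nset x y) F" and G: "fixed (nset y z) G"
  shows "\<bar>ip F G - ip F (av (nset x z) G)\<bar> \<le> 1 / sqrt (real M) * nm F * nm G"
proof -
  define G' where "G' = (\<lambda>w. G w - av (nset x z) G w)"
  \<comment> \<open>Since \<open>s\<close> exchanges \<open>y\<close> with \<open>x\<close>, these
    elements lie in \<open>nset x y\<close>. The quotient of two of them is 1 + (tau i + tau j) s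
    P_y, whose block from \<open>y\<close> to \<open>x\<close> is invertible by
    \<open>tau_inv\<close>.\<close>
  define n where "n i = 1 + tau i * s * dg y" for i
  note sgxz = sg_nset[OF sub(1,3) disj(3)] and sgyz = sg_nset[OF sub(2,3) disj(2)]
    and sgxy = sg_nset[OF sub(1,2) disj(1)]
  have sx: "s * dg x = dg y * s"
    using sy s_s by (metis mult.assoc mult_1_left mult_1_right)
  have T_rset: "T * s * dg y \<in> rset x y" if "T \<in> comm" "T * dg x = dg x * T" for T
  proof -
    have "dg x * (T * s * dg y) = T * (dg x * s) * dg y" using that(2) by (simp add: mult.assoc flip: mult.assoc)
    also have "\<dots> = T * s * dg y" by (simp add: mult.assoc flip: sy)
    finally show ?thesis using that comm_closed comm_tau_s by (simp add: rset_def mult.assoc)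
  qed
  have n_in: "n i \<in> nset x y" if "i < M" for i
    unfolding n_def nset_def using T_rset[OF comm_tau_s(1)[OF that] ty(1)[OF that]] by blast
  have fix_yz: "fixed (nset y z) (av (nset x z) G)"
  proof (rule fixed_av_normal[OF sgxz sgD(1)[OF sgyz] _ G])
    fix g k assume "g \<in> nset x z" and k: "k \<in> nset y z"
    then obtain X Y where X: "X \<in> rset x z" "g = 1 + X" "Y \<in> rset y z" "k = 1 + Y"
      by (auto simp: nset_def)
    have "X * Y = 0" "Y * X = 0" using X disj by (auto intro!: rset_mult_0)
    then have "g * k = k * g" using X by (simp add: distrib_left distrib_right add_ac)
    then show "\<exists>k'\<in>nset y z. g * k = k' * g" using k by blast
  qed
  have G'_fix: "fixed (nset y z) G'" unfolding G'_def by (intro fixed_diff G fix_yz)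
  have avG': "av (nset x z) G' w = 0" if "w \<in> dom" for w
    using av_fixed[OF sgxz fixed_av[OF sgxz] that] by (simp add: G'_def av_diff)
  have orth: "ip (\<lambda>w. G' (act (n i) w)) (\<lambda>w. G' (act (n j) w)) = 0"
    if ij: "i < M" "j < M" "i \<noteq> j" for i j
  proof -
    define \<Delta> where "\<Delta> = tau i + tau j"
    obtain \<Delta>' where \<Delta>': "is_inv \<Delta> \<Delta>'" using tau_inv[OF ij] by (auto simp: \<Delta>_def)
    define T where "T = \<Delta> * s * dg y"
    \<comment> \<open>The inverse of \<open>T\<close> as a map between the blocks; with it,
      multiplication by \<open>T\<close> is a bijection from \<open>rset y z\<close> to
      \<open>rset x z\<close>.\<close>
    define T' where "T' = s * \<Delta>' * dg x"
    have \<Delta>_comm: "\<Delta> \<in> comm" "\<Delta>' \<in> comm"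
      using comm_closed comm_tau_s ij comm_is_inv[OF _ \<Delta>'] by (auto simp: \<Delta>_def)
    have \<Delta>x: "\<Delta> * dg x = dg x * \<Delta>" "\<Delta> * dg y = dg y * \<Delta>"
      using ty ij by (auto simp: \<Delta>_def distrib_left distrib_right)
    have \<Delta>'x: "\<Delta>' * dg x = dg x * \<Delta>'" "\<Delta>' * dg y = dg y * \<Delta>'" "\<Delta>' * s = s * \<Delta>'"
      using is_inv_commute[OF \<Delta>'] \<Delta>x tau_s ij by (auto simp: \<Delta>_def distrib_left distrib_right)
    have T: "T \<in> rset x y" unfolding T_def by (rule T_rset[OF \<Delta>_comm(1) \<Delta>x(1)])
    have T': "T' \<in> rset y x"
    proof -
      have "dg y * T' = s * (dg x * \<Delta>') * dg x"
        using sx[symmetric, THEN mult_eq_assoc] by (simp add: T'_def mult.assoc)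
      also have "\<dots> = T'" by (simp add: \<Delta>'x(1)[symmetric] T'_def mult.assoc)
      finally show ?thesis
        using \<Delta>_comm comm_tau_s comm_closed by (simp add: rset_def T'_def mult.assoc)
    qed
    note rules = \<Delta>x(1)[symmetric, THEN mult_eq_assoc] \<Delta>'x(1)[symmetric, THEN mult_eq_assoc]
      sy[symmetric, THEN mult_eq_assoc] sx[symmetric, THEN mult_eq_assoc] s_s[THEN mult_eq_assoc]
    have \<Delta>\<Delta>: "\<Delta> * (\<Delta>' * Y) = Y" "\<Delta>' * (\<Delta> * Y) = Y" for Y
      using \<Delta>' by (auto simp: is_inv_def mult_eq_assoc)
    have TT: "T' * (T * Y) = Y" if "Y \<in> rset y z" for Y
      using that by (simp add: T_def T'_def mult.assoc rset_def rules \<Delta>\<Delta>)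
    have TT': "T * (T' * X) = X" if "X \<in> rset x z" for X
      using that by (simp add: T_def T'_def mult.assoc rset_def rules \<Delta>\<Delta>)
    have bij: "bij_betw (\<lambda>Y. T * Y) (rset y z) (rset x z)"
      by (rule bij_betw_byWitness[where f' = "\<lambda>X. T' * X"])
        (use TT TT' rset_mult[OF T] rset_mult[OF T'] in auto)
    define k where "k = 1 + T"
    have k: "k \<in> nset x y" using T by (auto simp: k_def nset_def)
    have kU: "k \<in> hset" using k sgD(6)[OF sgxy] by blast
    have nU: "n i \<in> hset" "n j \<in> hset" using n_in ij sgD(6)[OF sgxy] by auto
    have kn: "k * n j = n i"
    proof -
      have R: "tau j * s * dg y \<in> rset x y" using T_rset comm_tau_s(1) ty(1) ij by blast
      have "T * (tau j * s * dg y) = 0" using rset_mult_0[OF T R] disj by (simp add: Int_commute)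
      then show ?thesis by (simp add: k_def n_def distrib_left distrib_right T_def \<Delta>_def add_ac)
    qed
    have "ip (\<lambda>w. G' (act (n i) w)) (\<lambda>w. G' (act (n j) w)) =
        ip (\<lambda>w. G' (act k (act (n j) w))) (\<lambda>w. G' (act (n j) w))"
      by (rule wip_cong) (use kU nU in \<open>auto simp: kn simp flip: act_mult\<close>)
    also have "\<dots> = ip (\<lambda>w. G' (act k w)) G'" by (rule ip_act[OF nU(2)])
    finally have 1: "ip (\<lambda>w. G' (act (n i) w)) (\<lambda>w. G' (act (n j) w)) = ip (\<lambda>w. G' (act k w)) G'" .
    \<comment> \<open>The commutator of \<open>k\<close> and \<open>1 + Y\<close> is
      \<open>1 + T * Y\<close>. The factor \<open>1 + Y\<close> itself is absorbed by the invariance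
      of \<open>G'\<close> on both sides of the inner product. Summing over all \<open>Y\<close>
      then gives an \<open>nset x z\<close>-average of \<open>G'\<close>, which is 0.\<close>
    have 2: "ip (\<lambda>w. G' (act k w)) G' = ip (\<lambda>w. G' (act (1 + T * Y) (act k w))) G'"
      if Y: "Y \<in> rset y z" for Y
    proof -
      let ?h = "1 + Y" and ?j = "1 + T * Y"
      have TY: "T * Y \<in> rset x z" using bij Y by (auto simp: bij_betw_def)
      have h: "?h \<in> nset y z" "?j \<in> nset x z" using Y TY by (auto simp: nset_def)
      have U: "?h \<in> hset" "?j \<in> hset" using h sgD(6)[OF sgyz] sgD(6)[OF sgxz] by auto
      have 0: "Y * (T * Y) = 0" "Y * T = 0" "T * Y * T = 0"
        using rset_mult_0[OF Y TY] rset_mult_0[OF Y T] rset_mult_0[OF TY T] disj by auto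
      have e: "k * ?h = ?h * (?j * k)"
        unfolding k_def using 0 by (simp add: distrib_left distrib_right add_ac mult.assoc)
      have "ip (\<lambda>w. G' (act k w)) G' = ip (\<lambda>w. G' (act k (act ?h w))) (\<lambda>w. G' (act ?h w))"
        by (rule ip_act[OF U(1), symmetric])
      also have "\<dots> = ip (\<lambda>w. G' (act ?j (act k w))) G'"
      proof (rule wip_cong)
        fix w assume w: "w \<in> dom"
        have "act k (act ?h w) = act ?h (act ?j (act k w))"
          using U kU w e act_mult[OF U(1) mult_U[OF U(2) kU] w] act_mult[OF U(2) kU w] act_mult[OF kU U(1) w]
          by simp
        then show "G' (act k (act ?h w)) = G' (act ?j (act k w))"
          using G'_fix h U kU w by (simp add: fixed_def act_W)
        show "G' (act ?h w) = G' w" using G'_fix h w by (simp add: fixed_def)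
      qed simp
      finally show ?thesis .
    qed
    have "real (card (rset y z)) * ip (\<lambda>w. G' (act k w)) G' =
        (\<Sum>Y\<in>rset y z. ip (\<lambda>w. G' (act k w)) G')"
      by simp
    also have "\<dots> = (\<Sum>Y\<in>rset y z. ip (\<lambda>w. G' (act (1 + T * Y) (act k w))) G')"
      by (rule sum.cong[OF refl 2])
    also have "\<dots> = ip (\<lambda>w. \<Sum>Y\<in>rset y z. G' (act (1 + T * Y) (act k w))) G'"
      by (rule wip_sum_left[symmetric])
    also have "\<dots> = ip (\<lambda>w. 0) G'"
    proof (rule wip_cong)
      fix w assume w: "w \<in> dom"
      have "(\<Sum>Y\<in>rset y z. G' (act (1 + T * Y) (act k w))) = (\<Sum>X\<in>rset x z. G' (act (1 + X) (act k w)))"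
        by (rule sum.reindex_bij_betw[OF bij])
      also have "\<dots> = (\<Sum>g\<in>nset x z. G' (act g (act k w)))" by (simp add: sum_nset)
      also have "\<dots> = 0" using avG'[OF act_W[OF kU w]] sgD(5)[OF sgxz] by (simp add: av_def)
      finally show "(\<Sum>Y\<in>rset y z. G' (act (1 + T * Y) (act k w))) = 0" .
    qed auto
    also have "\<dots> = 0" by (simp add: wip_def)
    finally have "ip (\<lambda>w. G' (act k w)) G' = 0"
      using sgD(5)[OF sgyz] by (simp add: card_nset)
    then show ?thesis using 1 by simp
  qed
  have "\<bar>ip F G'\<bar> \<le> sqrt (1 / real M + 0) * nm F * nm G'"
  proof (rule almost_orthogonal_translates[of M n])
    show "n i \<in> hset" if "i < M" for i using n_in[OF that] sgD(6)[OF sgxy] by blast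
    show "F (act (n i) w) = F w" if "i < M" "w \<in> dom" for i w
      using F n_in that by (auto simp: fixed_def)
  qed (use M_pos orth in auto)
  also have "\<dots> \<le> 1 / sqrt (real M) * nm F * nm G"
    unfolding G'_def using nm_diff_av[OF sgxz, of G] nm_nonneg[of F]
    by (simp add: real_sqrt_divide divide_right_mono mult_left_mono)
  finally show ?thesis by (simp add: G'_def wip_diff_right)
qed

end

section \<open>Unipotent and block-diagonal factorisations of the group of the fibre\<close>

context tensor_link
begin

lemma comm_entry: "X \<in> comm \<Longrightarrow> ent X i j \<noteq> 0 \<Longrightarrow> l < m \<Longrightarrow> i \<in> bset l \<longleftrightarrow> j \<in> bset l"
  unfolding comm_def by (metis (mono_tags, lifting) ent_dg_mult ent_mult_dg mem_Collect_eq)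

lemma comm_mun: "(\<And>l. l < m \<Longrightarrow> i \<in> bset l \<longleftrightarrow> j \<in> bset l) \<Longrightarrow> mun i j \<in> comm"
  unfolding comm_def by auto

lemma partition_one: "p \<inter> p' = {} \<Longrightarrow> p \<union> p' = {..<D} \<Longrightarrow> dg p + (dg p' + dg {D..}) = 1"
  using id_mat_Compl[of D] by (simp add: id_mat_def flip: dg_Un_disjoint add.assoc)

text \<open>Stable range: a correction \<open>X\<close> for which the kernel is smallest makes the diagonal block
  invertible, since a nonzero kernel could be reduced further by a matrix of rank one.\<close>

lemma stable_range:
  assumes pp': "p \<inter> p' = {}" "p \<union> p' = {..<D}" and g: "g \<in> hset"
  obtains X A' where "X \<in> rset p p'" "A' \<in> rset p p"
    "A' * (dg p * ((1 + X) * g) * dg p) = dg p" "dg p * ((1 + X) * g) * dg p * A' = dg p"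
proof -
  have sub: "p \<subseteq> {..<D}" "p' \<subseteq> {..<D}" using pp' by auto
  define T where "T X = dg p * ((1 + X) * g) * dg p" for X
  define K where "K X = {u \<in> rset p p. T X * u = 0}" for X
  have gc: "g \<in> comm" using g by (simp add: hset_def)
  have fin: "finite (rset p p)" "finite (rset p p')" using rset_finite sub by auto
  have T_rset: "T X \<in> rset p p" if "X \<in> rset p p'" for X
    using that gc unfolding T_def rset_def by (auto simp: comm_closed mult.assoc)
  have T_mult: "T X * u \<in> rset p p" if "X \<in> rset p p'" "u \<in> rset p p" for X u
    using rset_mult[OF T_rset[OF that(1)] that(2)] .
  have T_eq: "T X = dg p * g * dg p + X * g * dg p" if "X \<in> rset p p'" for X
    using that by (simp add: T_def distrib_left distrib_right rset_def flip: mult.assoc)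
  have "rset p p' \<noteq> {}" using rset_0 by auto
  then obtain X where X: "X \<in> rset p p'" and least: "\<And>Y. Y \<in> rset p p' \<Longrightarrow> card (K X) \<le> card (K Y)"
    using ex_min_if_finite[of "(\<lambda>X. card (K X)) ` rset p p'"] fin(2)
    by (smt (verit) finite_imageI imageE image_eqI image_is_empty linorder_not_le)
  have K0: "u = 0" if "u \<in> K X" for u
  proof (rule ccontr)
    assume "u \<noteq> 0"
    then obtain i0 j where ij0: "ent u i0 j = 1" by (rule bmat_nonzero_entry)
    have u: "u \<in> rset p p" "T X * u = 0" using that by (auto simp: K_def)
    have jp: "j \<in> p" using u(1) ij0 unfolding rset_def mult_dg_fix by (metis (mono_tags, lifting) mem_Collect_eq zero_neq_one)
    define u' where "u' = u * dg {j}"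
    \<comment> \<open>Matrices with a single column \<open>j\<close>, that is, vectors in the cell
      of \<open>j\<close>. On this finite set \<open>T X\<close> kills \<open>u'\<close>, so it is
      not injective, hence not surjective; a value \<open>y\<close> that is missed drives the
      correction.\<close>
    define V where "V = {t \<in> rset p p. t * dg {j} = t}"
    have u'0: "u' \<noteq> 0" using ij0 unfolding u'_def by (metis ent_mult_dg ent_0 insertI1 zero_neq_one)
    have "dg {j} \<in> rset p p" using jp by (simp add: rset_def comm_closed)
    from rset_mult[OF u(1) this] have u'V: "u' \<in> V" by (simp add: u'_def V_def mult.assoc)
    have Tu': "T X * u' = 0" using u(2) by (simp add: u'_def flip: mult.assoc)
    have V0: "0 \<in> V" by (simp add: V_def rset_0)
    have finV: "finite V" using fin by (auto simp: V_def)
    have TV: "(*) (T X) ` V \<subseteq> V" using T_mult[OF X] by (auto simp: V_def mult.assoc)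
    have "\<not> inj_on ((*) (T X)) V"
      using u'V V0 Tu' u'0 by (auto simp: inj_on_def) (metis mult_zero_right)
    then have "\<not> V \<subseteq> (*) (T X) ` V" using finite_surj_inj[OF finV] by blast
    then obtain y where y: "y \<in> V" "y \<notin> (*) (T X) ` V" by auto
    have y0: "y \<noteq> 0" using y V0 by (metis image_eqI mult_zero_right)
    define C where "C = dg p' * g * dg p"
    have C_comm: "C \<in> comm" using gc comm_closed by (simp add: C_def)
    have pu': "dg p * u' = u'" using u'V by (simp add: V_def rset_def)
    have Xp: "X * dg p' = X" using X by (simp add: rset_def)
    \<comment> \<open>A column killed by both the corrected upper block and the lower block
      \<open>C\<close> would be killed by the invertible matrix \<open>g\<close>.\<close>
    have Cu': "C * u' \<noteq> 0"
    proof
      assume 0: "C * u' = 0"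
      then have c: "dg p' * (g * u') = 0" by (simp add: C_def mult.assoc pu')
      have "X * (g * u') = X * (dg p' * (g * u'))" using Xp by (metis mult.assoc)
      then have "X * (g * u') = 0" using c by simp
      then have a: "dg p * (g * u') = 0"
        using Tu' T_eq[OF X] by (simp add: distrib_right mult.assoc pu')
      have "dg {D..} * g = dg {D..}" using g by (simp add: hset_def gl_def)
      then have "dg {D..} * (g * u') = dg {D..} * u'" by (rule mult_eq_assoc)
      also have "\<dots> = 0" using sub pu' by (intro mult_orth[of _ "{D..}" p]) auto
      finally have "(dg p + (dg p' + dg {D..})) * (g * u') = 0" using a c by (simp add: distrib_right)
      then have "g * u' = 0" by (simp add: partition_one[OF pp'])
      then have "uinv g * g * u' = 0" by (simp add: mult.assoc)
      then show False using hset_uinv(1)[OF g] u'0 by (simp add: is_inv_def)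
    qed
    then obtain i j' where ij': "ent (C * u') i j' = 1" by (rule bmat_nonzero_entry)
    have "C * u' * dg {j} = C * u'" using u'V by (simp add: V_def mult.assoc)
    then have "j' = j" using ij' unfolding mult_dg_fix by (metis singletonD zero_neq_one)
    then have ij: "ent (C * u') i j = 1" using ij' by simp
    have Cu'_comm: "C * u' \<in> comm" using C_comm u'V comm_closed by (simp add: V_def rset_def)
    have "dg p' * (C * u') = C * u'" by (simp add: C_def flip: mult.assoc)
    then have ip: "i \<in> p'" using ij unfolding dg_mult_fix by (metis zero_neq_one)
    \<comment> \<open>The rank-one change \<open>y * \<phi>\<close> of \<open>X\<close> sends
      \<open>u'\<close> to \<open>y\<close>, so \<open>u'\<close> leaves the kernel. No new kernel
      element arises, because \<open>y\<close> is outside the image of \<open>T X\<close>.\<close>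
    define \<phi> where "\<phi> = mun j i"
    have \<phi>_comm: "\<phi> \<in> comm"
      unfolding \<phi>_def using comm_entry[OF Cu'_comm, of i j] ij by (intro comm_mun) auto
    have \<phi>p: "\<phi> * dg p' = \<phi>" using ip by (simp add: \<phi>_def)
    have yC: "y \<in> comm" "dg p * y = y" "y * dg {j} = y" using y by (auto simp: V_def rset_def)
    have Z: "y * \<phi> \<in> rset p p'"
      using yC \<phi>_comm \<phi>p comm_closed by (simp add: rset_def mult.assoc mult_eq_assoc)
    have X': "X + y * \<phi> \<in> rset p p'" using X Z by (rule rset_add)
    have TX': "T (X + y * \<phi>) = T X + y * (\<phi> * C)"
    proof -
      have "\<phi> * C = \<phi> * g * dg p" using \<phi>p by (simp add: C_def flip: mult.assoc)
      then show ?thesis by (simp add: T_eq X X' distrib_right mult.assoc add.assoc)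
    qed
    have sub_K: "w \<in> K X" if "w \<in> K (X + y * \<phi>)" for w
    proof -
      have w: "w \<in> rset p p" "T X * w = y * (\<phi> * C * w)"
        using that by (auto simp: K_def TX' distrib_right mult.assoc)
      have "\<phi> * C * w = 0"
      proof (rule ccontr)
        assume "\<phi> * C * w \<noteq> 0"
        then obtain a b where ab: "ent (\<phi> * C * w) a b = 1" by (rule bmat_nonzero_entry)
        then have a: "a = j" by (auto simp: \<phi>_def mult.assoc split: if_splits)
        have cm: "\<phi> * C * w \<in> comm" using \<phi>_comm C_comm w comm_closed by (simp add: rset_def)
        have bj: "mun b j \<in> comm"
          using comm_entry[OF cm, of a b] ab a by (intro comm_mun) auto
        have "w * mun b j * dg p = w * mun b j" "w * mun b j * dg {j} = w * mun b j"
          using jp by (simp_all add: mult.assoc)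
        then have "w * mun b j \<in> V"
          using w(1) bj comm_closed mult_eq_assoc[of "dg p" w w "mun b j"] by (simp add: V_def rset_def)
        moreover have "T X * (w * mun b j) = y"
        proof -
          have "T X * (w * mun b j) = y * (\<phi> * C * w * mun b j)"
            using w(2) by (simp flip: mult.assoc)
          also have "\<phi> * C * w = mun j j * (\<phi> * C * w)" by (simp add: \<phi>_def flip: mult.assoc)
          also have "mun j j * (\<phi> * C * w) * mun b j = mun j j"
            using ab a by (intro mun_sandwich) simp
          finally show ?thesis using yC by (simp add: mun_diag)
        qed
        ultimately show False using y(2) by blast
      qed
      then show ?thesis using w by (simp add: K_def)
    qed
    have "u' \<in> K X" using u'V Tu' by (simp add: K_def V_def)
    moreover have "u' \<notin> K (X + y * \<phi>)"
    proof -
      have "\<phi> * C * u' = \<phi> * (C * u') * mun j j"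
        using u'V by (simp add: V_def mun_diag mult.assoc)
      also have "\<dots> = mun j j" unfolding \<phi>_def using ij by (rule mun_sandwich)
      finally have "T (X + y * \<phi>) * u' = y"
        using Tu' yC by (simp add: TX' distrib_right mult.assoc mun_diag)
      then show ?thesis using y0 by (simp add: K_def)
    qed
    ultimately have "K (X + y * \<phi>) \<subset> K X" using sub_K by blast
    then have "card (K (X + y * \<phi>)) < card (K X)" using fin(1) by (intro psubset_card_mono) (auto simp: K_def)
    then show False using least[OF X'] by simp
  qed
  have inj: "inj_on ((*) (T X)) (rset p p)"
  proof (rule inj_onI)
    fix u w assume uw: "u \<in> rset p p" "w \<in> rset p p" "T X * u = T X * w"
    then have "u + w \<in> K X" using rset_add by (simp add: K_def distrib_left)
    then show "u = w" using K0 by fastforce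
  qed
  have "(*) (T X) ` rset p p = rset p p"
    using T_mult[OF X] by (intro endo_inj_surj[OF fin(1) _ inj]) auto
  moreover have dp: "dg p \<in> rset p p" by (simp add: rset_def comm_closed)
  ultimately obtain A' where A': "A' \<in> rset p p" "T X * A' = dg p" by (metis imageE)
  have TX: "T X \<in> rset p p" by (rule T_rset[OF X])
  have "A' * T X + dg p \<in> rset p p"
    using rset_mult[OF A'(1) TX] dp by (rule rset_add)
  moreover have "T X * (A' * T X + dg p) = 0"
    using A'(2) TX by (simp add: distrib_left rset_def flip: mult.assoc)
  ultimately have "A' * T X + dg p \<in> K X" by (simp add: K_def)
  then have "A' * T X = dg p" using K0 by fastforce
  then show ?thesis using that[OF X A'(1)] A'(2) by (simp add: T_def)
qed

text \<open>Block elimination: after the correction by \<open>stable_range\<close> the diagonal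
  block on \<open>p\<close> is invertible, and clearing the two off-diagonal blocks leaves a factor
  that commutes with \<open>dg p\<close>. What counts later is that the number of unipotent factors
  is bounded independently of all sizes.\<close>

lemma bounded_generation:
  assumes pp': "p \<inter> p' = {}" "p \<union> p' = {..<D}" and g: "g \<in> hset"
  obtains n1 n2 l n3 where "n1 \<in> nset p p'" "n2 \<in> nset p' p" "l \<in> hset" "l * dg p = dg p * l"
    "n3 \<in> nset p p'" "g = n1 * (n2 * (l * n3))"
proof -
  have sub: "p \<subseteq> {..<D}" "p' \<subseteq> {..<D}" using pp' by auto
  have pp'': "p' \<inter> p = {}" using pp' by auto
  obtain X A' where X: "X \<in> rset p p'" and A': "A' \<in> rset p p"
    and inv: "A' * (dg p * ((1 + X) * g) * dg p) = dg p" "dg p * ((1 + X) * g) * dg p * A' = dg p"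
    using stable_range[OF pp' g] by blast
  have n1: "1 + X \<in> nset p p'" using X by (auto simp: nset_def)
  have n1H: "1 + X \<in> hset" using n1 nset_hset[OF sub pp'(1)] by blast
  define g1 where "g1 = (1 + X) * g"
  have g1: "g1 \<in> hset" using n1H g hset_closed by (simp add: g1_def)
  define C where "C = dg p' * g1 * dg p"
  \<comment> \<open>As \<open>A'\<close> inverts the block on \<open>p\<close>, adding
    \<open>Y\<close> times the rows in \<open>p\<close> cancels the block \<open>C\<close> below
    it.\<close>
  define Y where "Y = C * A'"
  have A'p: "A' * dg p = A'" "dg p * A' = A'" "A' \<in> comm" using A' by (auto simp: rset_def)
  have C: "C \<in> rset p' p" using g1 by (simp add: C_def rset_def comm_closed hset_def mult.assoc)
  have Y: "Y \<in> rset p' p" unfolding Y_def using C A' by (rule rset_mult)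
  have n2: "1 + Y \<in> nset p' p" using Y by (auto simp: nset_def)
  have n2H: "1 + Y \<in> hset" using n2 nset_hset[OF sub(2,1) pp''] by blast
  define g2 where "g2 = (1 + Y) * g1"
  have g2: "g2 \<in> hset" using n2H g1 hset_closed by (simp add: g2_def)
  have "Y * g1 * dg p = C * (A' * (dg p * g1 * dg p))"
    unfolding Y_def using A'p(1) by (metis mult.assoc)
  also have "A' * (dg p * g1 * dg p) = dg p" using inv(1) by (simp only: g1_def)
  also have "C * dg p = C" using C by (simp add: rset_def)
  finally have "g2 * dg p = g1 * dg p + C" by (simp add: g2_def distrib_right)
  moreover have "dg p' * C = C" "dg p' * (g1 * dg p) = C" using C by (simp_all add: rset_def C_def mult.assoc)
  ultimately have low0: "dg p' * (g2 * dg p) = 0" by (simp add: distrib_left)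
  have "dg p * Y = 0"
    using Y pp' by (intro mult_orth[of _ p p']) (auto simp: rset_def)
  then have top: "dg p * g2 = dg p * g1"
    by (simp add: g2_def distrib_left distrib_right flip: mult.assoc)
  define B where "B = dg p * g2 * dg p'"
  have B: "B \<in> rset p p'" using g2 by (simp add: B_def rset_def comm_closed hset_def mult.assoc)
  have AB: "A' * B \<in> rset p p'" using A' B by (rule rset_mult)
  define n3 where "n3 = 1 + A' * B"
  have n3: "n3 \<in> nset p p'" using AB by (auto simp: n3_def nset_def)
  have n3H: "n3 \<in> hset" using n3 nset_hset[OF sub pp'(1)] by blast
  define l where "l = g2 * n3"
  have l: "l \<in> hset" using g2 n3H hset_closed by (simp add: l_def)
  have out: "dg {D..} * g2 = dg {D..}" "g2 * dg {D..} = dg {D..}" using g2 by (auto simp: hset_def gl_def)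
  have "{D..} \<inter> p = {}" "p \<inter> {D..} = {}" using sub by auto
  then have oc: "dg {D..} * dg p = 0" "dg p * dg {D..} = 0" by simp_all
  have "B * dg p = 0" using pp'' by (simp add: B_def mult.assoc)
  then have "l * dg p = g2 * dg p" by (simp add: l_def n3_def distrib_left distrib_right mult.assoc)
  also have "\<dots> = (dg p + (dg p' + dg {D..})) * (g2 * dg p)" by (simp add: partition_one[OF pp'])
  also have "\<dots> = dg p * g2 * dg p"
    using low0 oc mult_eq_assoc[OF out(1), of "dg p"] by (simp add: distrib_right mult.assoc)
  finally have lp: "l * dg p = dg p * g2 * dg p" .
  have "dg p * g2 * (A' * B) = (dg p * g2 * dg p * A') * B"
    using A'p(2) by (metis mult.assoc)
  also have "dg p * g2 * dg p * A' = dg p" using inv(2) by (simp only: top g1_def)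
  also have "dg p * B = B" using B by (simp add: rset_def)
  finally have "dg p * l = dg p * g2 + B" by (simp add: l_def n3_def distrib_left flip: mult.assoc)
  also have "dg p * g2 = dg p * g2 * (dg p + (dg p' + dg {D..}))" by (simp add: partition_one[OF pp'])
  also have "\<dots> + B = dg p * g2 * dg p"
    using out oc by (simp add: distrib_left B_def mult.assoc add.assoc)
  finally have "l * dg p = dg p * l" using lp by simp
  moreover have "g = (1 + X) * ((1 + Y) * (l * n3))"
  proof -
    have "l * n3 = g2" using one_add_rset_inv[OF AB pp'(1)]
      by (simp add: l_def n3_def is_inv_def mult.assoc)
    moreover have "(1 + Y) * g2 = g1" using one_add_rset_inv[OF Y pp'']
      by (simp add: g2_def is_inv_def flip: mult.assoc)
    moreover have "(1 + X) * g1 = g" using one_add_rset_inv[OF X pp'(1)]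
      by (simp add: g1_def is_inv_def flip: mult.assoc)
    ultimately show ?thesis by simp
  qed
  ultimately show ?thesis using that n1 n2 n3 l by blast
qed

lemma nset_commute:
  assumes "y \<inter> x' = {}" "y' \<inter> x = {}" "g \<in> nset x y" "h \<in> nset x' y'"
  shows "g * h = h * g"
proof -
  obtain X Y where X: "X \<in> rset x y" "g = 1 + X" "Y \<in> rset x' y'" "h = 1 + Y"
    using assms by (auto simp: nset_def)
  have "X * Y = 0" "Y * X = 0" using X assms by (auto intro!: rset_mult_0)
  then show ?thesis using X by (simp add: distrib_left distrib_right add_ac)
qed

lemma fixed_av_nset:
  assumes "x \<subseteq> {..<D}" "y \<subseteq> {..<D}" "x \<inter> y = {}" "x' \<subseteq> {..<D}" "y' \<subseteq> {..<D}" "x' \<inter> y' = {}"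
    and "y \<inter> x' = {}" "y' \<inter> x = {}" "fixed (nset x' y') G"
  shows "fixed (nset x' y') (av (nset x y) G)"
proof (rule fixed_av_normal)
  show "sg (nset x y)" using assms by (intro sg_nset)
  show "nset x' y' \<subseteq> hset" using assms by (intro nset_hset)
  show "\<exists>n'\<in>nset x' y'. g * n = n' * g" if "g \<in> nset x y" "n \<in> nset x' y'" for g n
    using that nset_commute[OF assms(7,8) that] by auto
qed (use assms in auto)

lemma fixed_mult:
  assumes "g \<in> hset" "h \<in> hset" "\<And>w. w \<in> dom \<Longrightarrow> F (act g w) = F w" "\<And>w. w \<in> dom \<Longrightarrow> F (act h w) = F w" "w \<in> dom"
  shows "F (act (g * h) w) = F w"
  using assms by (simp add: act_mult act_W)

text \<open>An element of the large block splits into its four subblocks. Their pairwise products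
  vanish, so the unipotent matrix is the product of four unipotent matrices, one for each
  subblock.\<close>

lemma fixed_nset_Un:
  assumes "a \<subseteq> {..<D}" "b \<subseteq> {..<D}" "c \<subseteq> {..<D}" "d \<subseteq> {..<D}" "a \<inter> b = {}" "c \<inter> d = {}" "(a \<union> b) \<inter> (c \<union> d) = {}"
    and F: "fixed (nset a c) F" "fixed (nset a d) F" "fixed (nset b c) F" "fixed (nset b d) F"
  shows "fixed (nset (a \<union> b) (c \<union> d)) F"
  unfolding fixed_def
proof (intro ballI)
  fix g w assume g: "g \<in> nset (a \<union> b) (c \<union> d)" and w: "w \<in> dom"
  then obtain X where X: "X \<in> rset (a \<union> b) (c \<union> d)" "g = 1 + X" by (auto simp: nset_def)
  define f where "f x y = dg x * X * dg y" for x y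
  have f: "f x y \<in> rset x y" for x y
    using X by (auto simp: f_def rset_def comm_closed mult.assoc)
  have dis: "a \<inter> c = {}" "a \<inter> d = {}" "b \<inter> c = {}" "b \<inter> d = {}" "c \<inter> a = {}" "d \<inter> a = {}" "c \<inter> b = {}" "d \<inter> b = {}"
    using assms(7) by auto
  have X_eq: "X = f a c + (f a d + (f b c + f b d))"
  proof -
    have "X = dg (a \<union> b) * X * dg (c \<union> d)" using X by (simp add: rset_def)
    then show ?thesis
      by (simp add: f_def dg_Un_disjoint assms(5,6) distrib_left distrib_right add_ac)
  qed
  have z: "f x y * f x' y' = 0" if "y \<inter> x' = {}" for x y x' y'
    using rset_mult_0[OF f f that] .
  have "g = (1 + f a c) * ((1 + f a d) * ((1 + f b c) * (1 + f b d)))"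
    unfolding X(2) by (subst X_eq) (simp add: distrib_left distrib_right z dis add_ac mult.assoc)
  moreover have n: "1 + f x y \<in> nset x y" for x y using f by (auto simp: nset_def)
  have H: "1 + f a c \<in> hset" "1 + f a d \<in> hset" "1 + f b c \<in> hset" "1 + f b d \<in> hset"
    using n nset_hset[OF assms(1,3) dis(1)] nset_hset[OF assms(1,4) dis(2)]
      nset_hset[OF assms(2,3) dis(3)] nset_hset[OF assms(2,4) dis(4)] by blast+
  ultimately show "F (act g w) = F w"
    using F n H w hset_closed by (simp only:) (intro fixed_mult; auto simp: fixed_def)
qed

text \<open>Two uses of \<open>heisenberg_mixing\<close>, along \<open>a\<close>, \<open>b\<close>,
  \<open>d\<close> and along \<open>b\<close>, \<open>a\<close>, \<open>c\<close>, supply the two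
  missing invariances at a cost of 1/sqrt M each. The function \<open>G2\<close> is independent of
  \<open>F\<close>, as the duality argument of \<open>av_near_fixed\<close> requires.\<close>

lemma half_mixing:
  assumes sub: "a \<subseteq> {..<D}" "b \<subseteq> {..<D}" "c \<subseteq> {..<D}" "d \<subseteq> {..<D}"
    and disj: "a \<inter> b = {}" "c \<inter> d = {}" "(a \<union> b) \<inter> (c \<union> d) = {}"
    and s: "s * dg b = dg a * s" and t: "\<And>i. i < M \<Longrightarrow> tau i * dg a = dg a * tau i"
      "\<And>i. i < M \<Longrightarrow> tau i * dg b = dg b * tau i"
    and G: "fixed (nset a c) G" "fixed (nset b d) G"
  obtains G2 where "fixed (nset (a \<union> b) (c \<union> d)) G2"
    "\<And>F. fixed (nset a b) F \<Longrightarrow> fixed (nset b a) F \<Longrightarrow>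
       \<bar>ip F (\<lambda>w. G w - G2 w)\<bar> \<le> (2 / sqrt (real M) * nm G) * nm F"
proof -
  have dis: "a \<inter> c = {}" "a \<inter> d = {}" "b \<inter> c = {}" "b \<inter> d = {}" "c \<inter> a = {}" "d \<inter> a = {}" "c \<inter> b = {}" "d \<inter> b = {}"
    "b \<inter> a = {}" "d \<inter> c = {}"
    using disj by auto
  define G1 where "G1 = av (nset a d) G"
  define G2 where "G2 = av (nset b c) G1"
  have sgs: "sg (nset a d)" "sg (nset b c)" using sub dis by (auto intro!: sg_nset)
  have G1: "fixed (nset a c) G1" "fixed (nset b d) G1" "fixed (nset a d) G1"
    unfolding G1_def using sub dis disj G fixed_av[OF sgs(1)] by (auto intro!: fixed_av_nset)
  have G2: "fixed (nset a c) G2" "fixed (nset b d) G2" "fixed (nset a d) G2" "fixed (nset b c) G2"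
    unfolding G2_def using sub dis disj G1 fixed_av[OF sgs(2)] by (auto intro!: fixed_av_nset)
  have s': "s * dg a = dg b * s" using s s_s by (metis mult.assoc mult_1_left mult_1_right)
  have fx: "fixed (nset (a \<union> b) (c \<union> d)) G2" using sub disj G2 by (intro fixed_nset_Un)
  have "\<bar>ip F (\<lambda>w. G w - G2 w)\<bar> \<le> (2 / sqrt (real M) * nm G) * nm F"
    if F: "fixed (nset a b) F" "fixed (nset b a) F" for F
  proof -
    have "\<bar>ip F G - ip F G1\<bar> \<le> 1 / sqrt (real M) * nm F * nm G"
      unfolding G1_def using sub dis disj s t F G by (intro heisenberg_mixing) auto
    moreover have "\<bar>ip F G1 - ip F G2\<bar> \<le> 1 / sqrt (real M) * nm F * nm G1"
      unfolding G2_def using sub dis disj s' t F G1 by (intro heisenberg_mixing) auto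
    moreover have "1 / sqrt (real M) * nm F * nm G1 \<le> 1 / sqrt (real M) * nm F * nm G"
      unfolding G1_def using nm_av[OF sgs(1)] nm_nonneg by (intro mult_left_mono) auto
    ultimately have "\<bar>ip F G - ip F G2\<bar> \<le> 2 * (1 / sqrt (real M) * nm F * nm G)" by linarith
    then show ?thesis by (simp add: wip_diff_right mult_ac)
  qed
  then show ?thesis using that fx by blast
qed

end

text \<open>Turns commutation with projections into a statement about single nonzero entries, so
  that relations for sets defined by digits become propositional.\<close>

lemma dg_intertwine: "X * dg S = dg T * X \<longleftrightarrow> (\<forall>i j. ent X i j \<noteq> 0 \<longrightarrow> (j \<in> S \<longleftrightarrow> i \<in> T))"
proof
  assume *: "X * dg S = dg T * X"
  show "\<forall>i j. ent X i j \<noteq> 0 \<longrightarrow> (j \<in> S \<longleftrightarrow> i \<in> T)"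
  proof (intro allI impI)
    fix i j assume "ent X i j \<noteq> 0"
    moreover have "ent (X * dg S) i j = ent (dg T * X) i j" by (simp only: *)
    ultimately show "j \<in> S \<longleftrightarrow> i \<in> T" by (auto split: if_splits)
  qed
next
  assume "\<forall>i j. ent X i j \<noteq> 0 \<longrightarrow> (j \<in> S \<longleftrightarrow> i \<in> T)"
  then show "X * dg S = dg T * X" by (intro bmat_eqI) auto
qed

section \<open>Near independence of functions invariant under two block-diagonal subgroups\<close>

context tensor_link
begin

definition PS :: "nat set" where "PS = {..<D} \<inter> bset m"
definition QS :: "nat set" where "QS = {..<D} \<inter> bset (Suc m)"

text \<open>The subgroup that leaves the matrix tr v (dg x) \<xi> unchanged; it is used for the
  index sets \<open>PS\<close> and \<open>QS\<close> of the two matrices to be compared.\<close>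

definition lset :: "nat set \<Rightarrow> bmat set" where
  "lset x = {g \<in> hset. g * dg x = dg x * g}"

lemma sg_lset: "sg (lset x)"
  unfolding sg_def
proof (intro conjI ballI)
  fix g h assume gh: "g \<in> lset x" "h \<in> lset x"
  then have "g * (h * dg x) = dg x * (g * h)"
    using mult_eq_assoc[of g "dg x" "dg x * g" h] by (simp add: lset_def mult.assoc)
  then show "g * h \<in> lset x" using gh hset_closed by (simp add: lset_def mult.assoc)
next
  fix g assume "g \<in> lset x"
  then have "uinv g \<in> lset x" "is_inv g (uinv g)"
    using hset_uinv[of g] is_inv_commute[of g "uinv g" "dg x"] by (auto simp: lset_def)
  then show "\<exists>h\<in>lset x. g * h = 1 \<and> h * g = 1" by (auto simp: is_inv_def)
qed (auto simp: lset_def hset_closed)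

lemma tau_dg:
  assumes "i < M" "\<And>a b. (\<forall>l\<le>Suc m. a \<in> bset l \<longleftrightarrow> b \<in> bset l) \<Longrightarrow> (a < D \<longleftrightarrow> b < D) \<Longrightarrow> a \<in> S \<longleftrightarrow> b \<in> S"
  shows "tau i * dg S = dg S * tau i"
  unfolding dg_intertwine
proof (intro allI impI)
  fix a b assume "ent (tau i) a b \<noteq> 0"
  then have "\<forall>l\<le>Suc m. a \<in> bset l \<longleftrightarrow> b \<in> bset l" "a < D \<longleftrightarrow> b < D"
    using tau_bset[OF assms(1)] tau_D[OF assms(1)] unfolding dg_intertwine id_mat_def by auto
  then show "b \<in> S \<longleftrightarrow> a \<in> S" using assms(2)[of a b] by simp
qed

lemma s_dg:
  assumes "\<And>a b. (\<forall>l\<le>m. a \<in> bset l \<longleftrightarrow> b \<in> bset l) \<Longrightarrow> (a < D \<longleftrightarrow> b < D) \<Longrightarrow>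
     (a \<in> bset (Suc m) \<longleftrightarrow> b \<notin> bset (Suc m)) \<Longrightarrow> a \<in> S \<longleftrightarrow> b \<in> T"
  shows "s * dg S = dg T * s"
  unfolding dg_intertwine
proof (intro allI impI)
  fix b a assume "ent s b a \<noteq> 0"
  then have "\<forall>l\<le>m. a \<in> bset l \<longleftrightarrow> b \<in> bset l" "a < D \<longleftrightarrow> b < D" "a \<in> bset (Suc m) \<longleftrightarrow> b \<notin> bset (Suc m)"
    using s_bset s_D s_flip unfolding dg_intertwine id_mat_def by auto
  then show "a \<in> S \<longleftrightarrow> b \<in> T" using assms[of a b] by simp
qed

lemma nset_lset:
  assumes "x \<subseteq> {..<D}" "y \<subseteq> {..<D}" "x \<inter> y = {}" "x \<union> y \<subseteq> S \<or> (x \<union> y) \<inter> S = {}"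
  shows "nset x y \<subseteq> lset S"
proof
  fix g assume g: "g \<in> nset x y"
  then obtain X where X: "X \<in> rset x y" "g = 1 + X" by (auto simp: nset_def)
  then have "ent X i j \<noteq> 0 \<Longrightarrow> i \<in> x \<and> j \<in> y" for i j
    by (auto simp: rset_def dg_mult_fix mult_dg_fix)
  then have "X * dg S = dg S * X" unfolding dg_intertwine using assms(4) by blast
  then show "g \<in> lset S"
    using g X nset_hset[OF assms(1-3)] by (auto simp: lset_def distrib_left distrib_right)
qed

text \<open>By \<open>com\<close>, the group \<open>lset x\<close> normalises
  \<open>nset p p'\<close>, so averaging keeps the invariance of \<open>G2\<close>. Duality puts the
  averages of \<open>G\<close> and \<open>G2\<close> within \<open>e\<close> of each other, and a
  function that close to a fixed one is displaced by at most \<open>2 * e\<close>.\<close>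

lemma av_near_fixed:
  assumes sub: "p \<subseteq> {..<D}" "p' \<subseteq> {..<D}" "p \<inter> p' = {}"
    and com: "\<And>g. g \<in> lset x \<Longrightarrow> g * dg p = dg p * g \<and> g * dg p' = dg p' * g"
    and G2: "fixed (nset p p') G2" and e: "0 \<le> e"
    and dual: "\<And>F. fixed (lset x) F \<Longrightarrow> \<bar>ip F (\<lambda>w. G w - G2 w)\<bar> \<le> e * nm F"
    and n: "n \<in> nset p p'"
  shows "nm (\<lambda>w. av (lset x) G (act n w) - av (lset x) G w) \<le> 2 * e"
proof (rule nm_act_diff_near_fixed[where A = "av (lset x) G2"])
  show "n \<in> hset" using n nset_hset[OF sub] by blast
  have "nm (av (lset x) (\<lambda>w. G w - G2 w)) \<le> e"
    using sg_lset e dual by (rule nm_av_le_of_dual)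
  then show "nm (\<lambda>w. av (lset x) G w - av (lset x) G2 w) \<le> e" by (simp add: av_diff[abs_def])
  have "fixed (nset p p') (av (lset x) G2)"
  proof (rule fixed_av_normal[OF sg_lset nset_hset[OF sub] _ G2])
    fix g k assume g: "g \<in> lset x" and k: "k \<in> nset p p'"
    then obtain X where X: "X \<in> rset p p'" "k = 1 + X" by (auto simp: nset_def)
    have gH: "g \<in> hset" using g by (simp add: lset_def)
    have gc: "g \<in> comm" "uinv g \<in> comm" using hset_uinv(2)[OF gH] gH by (auto simp: hset_def)
    have inv: "is_inv g (uinv g)" by (rule hset_uinv(1)[OF gH])
    define X' where "X' = g * (X * uinv g)"
    have "dg p * X' = X'"
    proof -
      have "dg p * X' = (dg p * g) * (X * uinv g)" by (simp add: X'_def mult.assoc)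
      also have "dg p * g = g * dg p" using com[OF g] by simp
      also have "g * dg p * (X * uinv g) = g * ((dg p * X) * uinv g)" by (simp only: mult.assoc)
      finally show ?thesis using X(1) by (simp add: X'_def rset_def)
    qed
    moreover have "X' * dg p' = X'"
      using is_inv_commute[OF inv, of "dg p'"] com[OF g] mult_eq_assoc[of X "dg p'" X] X(1)
      by (simp add: X'_def rset_def mult.assoc)
    ultimately have "X' \<in> rset p p'" using gc X comm_closed by (simp add: X'_def rset_def)
    moreover have "g * k = (1 + X') * g"
      using inv by (simp add: X'_def X(2) distrib_left distrib_right is_inv_def mult.assoc)
    ultimately show "\<exists>k'\<in>nset p p'. g * k = k' * g" by (auto simp: nset_def)
  qed
  then show "av (lset x) G2 (act n w) = av (lset x) G2 w" if "w \<in> dom" for w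
    using n that by (simp add: fixed_def)
qed

text \<open>Replacing \<open>G\<close> by its \<open>lset PS\<close>-average \<open>G0\<close> does
  not change the inner product with \<open>F\<close>. That average is almost fixed by both unipotent
  block groups and exactly fixed by \<open>lset PS\<close>; by \<open>bounded_generation\<close> it
  is almost fixed by the whole group. The constant 12 is 3 * 2 * 2: three unipotent factors,
  displacement \<open>2 * e\<close> for each, and \<open>e\<close> equal to 2/sqrt M times the norm
  of \<open>G\<close>.\<close>

lemma mixing:
  assumes F: "fixed (lset PS) F" and G: "fixed (lset QS) G"
  shows "\<bar>ip F G - ip F (av hset G)\<bar> \<le> 12 / sqrt (real M) * nm F * nm G"
proof -
  \<comment> \<open>The four sets given by the digits \<open>m\<close> and \<open>Suc m\<close>.
    Flipping digit \<open>Suc m\<close> makes \<open>s\<close> exchange \<open>a\<close> with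
    \<open>b\<close> and \<open>c\<close> with \<open>d\<close>; \<open>F\<close> is invariant under
    the blocks inside \<open>a \<union> b\<close> and \<open>c \<union> d\<close>, and
    \<open>G\<close> under those inside \<open>a \<union> c\<close> and
    \<open>b \<union> d\<close>.\<close>
  define a where "a = PS \<inter> QS"
  define b where "b = PS - QS"
  define c where "c = QS - PS"
  define d where "d = {..<D} - PS - QS"
  note defs = a_def b_def c_def d_def PS_def QS_def
  have sub: "a \<subseteq> {..<D}" "b \<subseteq> {..<D}" "c \<subseteq> {..<D}" "d \<subseteq> {..<D}" by (auto simp: defs)
  have disj: "a \<inter> b = {}" "c \<inter> d = {}" "(a \<union> b) \<inter> (c \<union> d) = {}" "(c \<union> d) \<inter> (a \<union> b) = {}"
    "a \<inter> c = {}" "b \<inter> d = {}" "c \<inter> a = {}" "d \<inter> b = {}" "b \<inter> a = {}" "d \<inter> c = {}"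
    by (auto simp: defs)
  define p where "p = a \<union> b"
  define p' where "p' = c \<union> d"
  have p: "p = PS" "p' = {..<D} - PS" by (auto simp: p_def p'_def defs)
  have pp': "p \<inter> p' = {}" "p \<union> p' = {..<D}" "p \<subseteq> {..<D}" "p' \<subseteq> {..<D}" "p' \<inter> p = {}"
    by (auto simp: p PS_def)
  have s: "s * dg b = dg a * s" "s * dg d = dg c * s" by (rule s_dg; auto simp: defs)+
  have t: "tau i * dg a = dg a * tau i" "tau i * dg b = dg b * tau i"
    "tau i * dg c = dg c * tau i" "tau i * dg d = dg d * tau i" if "i < M" for i
    by (rule tau_dg[OF that]; auto simp: defs)+
  have G': "fixed (nset a c) G" "fixed (nset b d) G" "fixed (nset c a) G" "fixed (nset d b) G"
    by (rule fixed_subset[OF G nset_lset]; use sub disj in \<open>auto simp: defs\<close>)+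
  have F': "fixed (nset a b) H \<and> fixed (nset b a) H \<and> fixed (nset c d) H \<and> fixed (nset d c) H"
    if H: "fixed (lset PS) H" for H
    by (intro conjI; rule fixed_subset[OF H nset_lset]; use sub disj in \<open>auto simp: defs\<close>)
  define e where "e = 2 / sqrt (real M) * nm G"
  have e0: "0 \<le> e" using nm_nonneg[of G] by (simp add: e_def)
  obtain G2 where G2: "fixed (nset p p') G2"
    "\<And>H. fixed (nset a b) H \<Longrightarrow> fixed (nset b a) H \<Longrightarrow> \<bar>ip H (\<lambda>w. G w - G2 w)\<bar> \<le> e * nm H"
    using half_mixing[OF sub disj(1,2,3) s(1) t(1,2) G'(1,2)] unfolding p_def p'_def e_def by blast
  obtain G3 where G3: "fixed (nset p' p) G3"
    "\<And>H. fixed (nset c d) H \<Longrightarrow> fixed (nset d c) H \<Longrightarrow> \<bar>ip H (\<lambda>w. G w - G3 w)\<bar> \<le> e * nm H"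
    using half_mixing[OF sub(3,4,1,2) disj(2,1,4) s(2) t(3,4) G'(3,4)] unfolding p_def p'_def e_def by blast
  have com: "g * dg p = dg p * g" "g * dg p' = dg p' * g" if "g \<in> lset PS" for g
  proof -
    show 1: "g * dg p = dg p * g" using that p by (simp add: lset_def)
    have "g * id_mat D = id_mat D * g" using that gl_id_mat by (auto simp: lset_def hset_def)
    then show "g * dg p' = dg p' * g" using 1 unfolding dg_intertwine p id_mat_def by auto
  qed
  define G0 where "G0 = av (lset PS) G"
  have m1: "nm (\<lambda>w. G0 (act n w) - G0 w) \<le> 2 * e" if "n \<in> nset p p'" for n
    unfolding G0_def
    by (rule av_near_fixed[OF pp'(3,4,1) _ G2(1) e0 _ that]) (use com G2(2) F' in auto)
  have m2: "nm (\<lambda>w. G0 (act n w) - G0 w) \<le> 2 * e" if "n \<in> nset p' p" for n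
    unfolding G0_def
    by (rule av_near_fixed[OF pp'(4,3,5) _ G3(1) e0 _ that]) (use com G3(2) F' in auto)
  have m3: "nm (\<lambda>w. G0 (act l w) - G0 w) \<le> 0" if "l \<in> lset PS" for l
  proof -
    have "nm (\<lambda>w. G0 (act l w) - G0 w) = nm (\<lambda>w. 0)"
      using fixed_av[OF sg_lset, of PS G] that
      by (intro wnm_cong refl) (auto simp: G0_def fixed_def)
    then show ?thesis by (simp add: wnm_def wip_def)
  qed
  have m4: "nm (\<lambda>w. G0 (act g w) - G0 w) \<le> 6 * e" if g: "g \<in> hset" for g
  proof -
    obtain n1 n2 l n3 where n: "n1 \<in> nset p p'" "n2 \<in> nset p' p" "l \<in> hset" "l * dg p = dg p * l"
      "n3 \<in> nset p p'" "g = n1 * (n2 * (l * n3))"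
      using bounded_generation[OF pp'(1,2) g] by blast
    have H: "n1 \<in> hset" "n2 \<in> hset" "n3 \<in> hset"
      using n nset_hset[OF pp'(3,4,1)] nset_hset[OF pp'(4,3,5)] by auto
    have lL: "l \<in> lset PS" using n p by (simp add: lset_def)
    have "nm (\<lambda>w. G0 (act (l * n3) w) - G0 w) \<le> 0 + 2 * e"
      by (rule nm_act_mult_diff[OF n(3) H(3) m3[OF lL] m1[OF n(5)]])
    from nm_act_mult_diff[OF H(2) mult_U[OF n(3) H(3)] m2[OF n(2)] this]
    have "nm (\<lambda>w. G0 (act (n2 * (l * n3)) w) - G0 w) \<le> 2 * e + (0 + 2 * e)" .
    from nm_act_mult_diff[OF H(1) mult_U[OF H(2) mult_U[OF n(3) H(3)]] m1[OF n(1)] this]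
    show ?thesis by (simp add: n(6))
  qed
  have "nm (\<lambda>w. av hset G0 w - G0 w) \<le> 6 * e"
    using sg_U m4 by (rule nm_av_diff_le)
  then have "\<bar>ip F (\<lambda>w. av hset G0 w - G0 w)\<bar> \<le> nm F * (6 * e)"
    using cauchy_schwarz[of F "\<lambda>w. av hset G0 w - G0 w"] nm_nonneg[of F] mult_left_mono order_trans by blast
  moreover have "ip F G0 = ip F G" unfolding G0_def by (rule ip_av_fixed[OF sg_lset F])
  moreover have "ip F (av hset G0) = ip F (av hset G)"
  proof -
    have fx: "fixed (lset PS) (av hset F)"
      using fixed_av[OF sg_U] by (rule fixed_subset) (auto simp: lset_def)
    have "ip F (av hset G0) = ip (av hset F) G0" by (rule ip_av[OF sg_U, symmetric])
    also have "\<dots> = ip (av hset F) G" unfolding G0_def by (rule ip_av_fixed[OF sg_lset fx])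
    also have "\<dots> = ip F (av hset G)" by (rule ip_av[OF sg_U])
    finally show ?thesis .
  qed
  ultimately show ?thesis by (simp add: wip_diff_right e_def mult_ac abs_minus_commute)
qed

end

lemma mc_reindex:
  assumes "mc W m X Y \<delta>" "bij_betw \<phi> W' W" "\<And>w. w \<in> W' \<Longrightarrow> m (\<phi> w) = m' w"
  shows "mc W' m' (\<lambda>w. X (\<phi> w)) (\<lambda>w. Y (\<phi> w)) \<delta>"
proof -
  have S: "(\<Sum>w\<in>W'. m' w * h (\<phi> w)) = (\<Sum>w\<in>W. m w * h w)" for h
    by (subst sum.reindex_bij_betw[OF assms(2), symmetric]) (simp add: assms(3))
  have ip: "wip W' m' (\<lambda>w. h1 (\<phi> w)) (\<lambda>w. h2 (\<phi> w)) = wip W m h1 h2" for h1 h2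
    using S[of "\<lambda>w. h1 w * h2 w"] by (simp add: wip_def mult.assoc)
  have nm: "wnm W' m' (\<lambda>w. h (\<phi> w)) = wnm W m h" for h by (simp add: wnm_def ip)
  show ?thesis unfolding mc_def
  proof (intro allI impI)
    fix f g assume "(\<Sum>w\<in>W'. m' w * f (X (\<phi> w))) = 0" "(\<Sum>w\<in>W'. m' w * g (Y (\<phi> w))) = 0"
    then have "(\<Sum>w\<in>W. m w * f (X w)) = 0" "(\<Sum>w\<in>W. m w * g (Y w)) = 0"
      using S[of "\<lambda>w. f (X w)"] S[of "\<lambda>w. g (Y w)"] by auto
    from mcD[OF assms(1) this]
    show "\<bar>wip W' m' (\<lambda>w. f (X (\<phi> w))) (\<lambda>w. g (Y (\<phi> w)))\<bar>
       \<le> \<delta> * wnm W' m' (\<lambda>w. f (X (\<phi> w))) * wnm W' m' (\<lambda>w. g (Y (\<phi> w)))"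
      using ip[of "\<lambda>w. f (X w)" "\<lambda>w. g (Y w)"] nm[of "\<lambda>w. f (X w)"] nm[of "\<lambda>w. g (Y w)"] by simp
  qed
qed

text \<open>With the blocks \<open>Q\<close> and \<open>N\<close> identified through
  \<open>s\<close>, the matrix is ((1 + \<Delta>, \<Delta>), (1, 0)) plus the identity on
  \<open>Y\<close>. Its determinant is \<Delta> in characteristic 2, and the claimed inverse is ((0,
  1), (\<Delta>', 1 + \<Delta>')).\<close>

lemma block_unit:
  fixes Q N Y s \<Delta> \<Delta>' :: bmat
  assumes idem: "Q * Q = Q" "N * N = N" "Y * Y = Y" "Q * N = 0" "N * Q = 0" "Q * Y = 0" "Y * Q = 0"
      "N * Y = 0" "Y * N = 0" "Y + (Q + N) = 1"
    and s: "s * s = 1" "Q * s = s * N" "N * s = s * Q" "Y * s = s * Y"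
    and \<Delta>: "is_inv \<Delta> \<Delta>'" "Q * \<Delta> = \<Delta> * Q" "N * \<Delta> = \<Delta> * N" "Y * \<Delta> = \<Delta> * Y" "s * \<Delta> = \<Delta> * s"
  shows "is_inv (Y + (Q + (\<Delta> * Q + (\<Delta> * (s * N) + s * Q))))
    (Y + (s * N + (\<Delta>' * (s * Q) + (\<Delta>' * N + N))))"
proof -
  have \<Delta>': "Q * \<Delta>' = \<Delta>' * Q" "N * \<Delta>' = \<Delta>' * N" "Y * \<Delta>' = \<Delta>' * Y" "s * \<Delta>' = \<Delta>' * s"
    using is_inv_commute[OF \<Delta>(1), of Q] is_inv_commute[OF \<Delta>(1), of N] is_inv_commute[OF \<Delta>(1), of Y]
      is_inv_commute[OF \<Delta>(1), of s] \<Delta> by simp_all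
  have inv: "\<Delta> * \<Delta>' = 1" "\<Delta>' * \<Delta> = 1" using \<Delta>(1) by (auto simp: is_inv_def)
  note r = idem(1-9) s \<Delta>(2-5) \<Delta>' inv
  note r' = r[THEN mult_eq_assoc]
  have perm: "Y + (N + Q) = 1" "Q + (Y + N) = 1" "N + (Y + Q) = 1" "Q + (N + Y) = 1" "N + (Q + Y) = 1"
    using idem(10) by (simp_all add: add_ac)
  show ?thesis
    unfolding is_inv_def
    by (simp add: distrib_left distrib_right mult.assoc r r')
      (simp add: add_ac perm idem(10))
qed

section \<open>Rows outside the zero cell\<close>

context tensor_link
begin

text \<open>The zero cell: every fixed projection vanishes on these indices, so the fixed matrices
  carry no information about these rows.\<close>

definition ZS :: "nat set" where "ZS = {i. i < D \<and> (\<forall>l<m. i \<notin> bset l)}"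

definition h1set :: "bmat set" where
  "h1set = {h \<in> hset. h * dg ZS = dg ZS \<and> dg ZS * h = dg ZS}"

definition zmap :: "bmat \<times> bmat \<Rightarrow> bmat \<times> bmat" where
  "zmap w = (dg (- ZS) * fst w, dg (- ZS) * snd w)"

definition pairing :: "nat set \<Rightarrow> bmat \<times> bmat \<Rightarrow> bmat" where
  "pairing S w = tr (fst w) * dg S * snd w"

lemma h1set_uinv:
  assumes "h \<in> h1set" shows "uinv h \<in> h1set"
proof -
  have h: "h \<in> hset" using assms by (simp add: h1set_def)
  have i: "is_inv h (uinv h)" by (rule hset_uinv(1)[OF h])
  have Z: "h * dg ZS = dg ZS" "dg ZS * h = dg ZS" using assms by (simp_all add: h1set_def)
  have "uinv h * (h * dg ZS) = dg ZS" "(dg ZS * h) * uinv h = dg ZS"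
    using i mult_eq_assoc[of "uinv h" h 1] by (simp_all add: is_inv_def mult.assoc)
  then have "uinv h * dg ZS = dg ZS" "dg ZS * uinv h = dg ZS" unfolding Z .
  then show ?thesis using hset_uinv(2)[OF h] by (simp add: h1set_def)
qed

lemma sg_h1set: "sg h1set"
  unfolding sg_def
proof (intro conjI ballI)
  fix g h assume "g \<in> h1set" "h \<in> h1set"
  then show "g * h \<in> h1set"
    using hset_closed by (simp add: h1set_def mult.assoc) (metis mult.assoc)
next
  fix g assume "g \<in> h1set"
  then show "\<exists>h\<in>h1set. g * h = 1 \<and> h * g = 1"
    using h1set_uinv[of g] hset_uinv(1)[of g] by (auto simp: is_inv_def h1set_def)
qed (auto simp: h1set_def hset_closed)

lemma pairing_act:
  assumes "g \<in> hset" shows "pairing S (act g w) = tr (fst w) * (tr g * dg S * tr (uinv g)) * snd w"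
  by (simp add: pairing_def act_def mult.assoc)

lemma fixed_pairing: "fixed (lset S) (\<lambda>w. f (pairing S w))"
  unfolding fixed_def
proof (intro ballI)
  fix g w assume g: "g \<in> lset S"
  have gH: "g \<in> hset" using g by (simp add: lset_def)
  have "tr g * dg S = tr (dg S * g)" by simp
  also have "\<dots> = tr (g * dg S)" using g by (simp add: lset_def del: tr_mult)
  also have "\<dots> = dg S * tr g" by simp
  finally have "tr g * dg S * tr (uinv g) = dg S * (tr g * tr (uinv g))" by (simp add: mult.assoc)
  also have "tr g * tr (uinv g) = 1" using is_inv_tr[OF hset_uinv(1)[OF gH]] by (simp add: is_inv_def)
  finally show "f (pairing S (act g w)) = f (pairing S w)"
    unfolding pairing_act[OF gH] by (simp add: pairing_def)
qed

text \<open>Elements of \<open>h1set\<close> do not mix the zero cell with the other rows, so the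
  action descends to the values of \<open>zmap\<close>.\<close>

lemma h1set_zmap:
  assumes "h \<in> h1set" shows "zmap (act h w) = (dg (- ZS) * h * fst (zmap w), dg (- ZS) * tr (uinv h) * snd (zmap w))"
proof -
  have *: "dg (- ZS) * g = dg (- ZS) * g * dg (- ZS)" if "g * dg ZS = dg ZS" for g
  proof -
    have "dg (- ZS) * g * dg (- ZS) = dg (- ZS) * g + dg (- ZS) * (g * dg ZS)"
      by (simp add: dg_Compl distrib_left mult.assoc)
    then show ?thesis using that by simp
  qed
  have "tr (uinv h) * dg ZS = tr (dg ZS * uinv h)" by simp
  also have "\<dots> = dg ZS" using h1set_uinv[OF assms] by (simp add: h1set_def del: tr_mult)
  finally have 2: "tr (uinv h) * dg ZS = dg ZS" .
  have 1: "h * dg ZS = dg ZS" using assms by (simp add: h1set_def)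
  have "dg (- ZS) * (h * fst w) = dg (- ZS) * h * (dg (- ZS) * fst w)"
    using *[OF 1] by (metis mult.assoc)
  moreover have "dg (- ZS) * (tr (uinv h) * snd w) = dg (- ZS) * tr (uinv h) * (dg (- ZS) * snd w)"
    using *[OF 2] by (metis mult.assoc)
  ultimately show ?thesis by (simp add: zmap_def act_def)
qed

lemma ZS_sub: "ZS \<subseteq> {..<D}"
  by (auto simp: ZS_def)

lemma bset_ZS: "l < m \<Longrightarrow> dg (bset l) = dg (- ZS) * dg (bset l) * dg (- ZS)"
  by (simp, rule arg_cong[where f = dg]) (auto simp: ZS_def)

lemma zmap_dom:
  assumes "w \<in> dom" "mu v \<noteq> 0" "mu \<xi> \<noteq> 0" "zmap (v, \<xi>) = zmap w" shows "(v, \<xi>) \<in> dom"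
proof -
  have "tr v * dg (bset l) * \<xi> = tr (fst w) * dg (bset l) * snd w" if "l < m" for l
  proof -
    have *: "tr a * dg (bset l) * b = tr (dg (- ZS) * a) * dg (bset l) * (dg (- ZS) * b)" for a b
      by (subst bset_ZS[OF that]) (simp add: mult.assoc)
    show ?thesis using assms(4) unfolding *[of v \<xi>] *[of "fst w" "snd w"] by (simp add: zmap_def)
  qed
  then show ?thesis using assms by (cases w) (auto simp: mem_dom)
qed

text \<open>The fixed matrices determine the rows outside the zero cell up to \<open>h1set\<close>.\<close>

lemma transitive:
  assumes w: "(v, \<xi>) \<in> dom" and w': "(v', \<xi>') \<in> dom"
  obtains h where "h \<in> h1set" "zmap (act h (v, \<xi>)) = zmap (v', \<xi>')"
proof -
  define y where "y = dg ({..<D} - ZS)"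
  let ?P = "\<lambda>l. dg (bset l)"
  let ?I = "id_mat D"
  obtain \<theta> where \<theta>: "v * \<theta> = ?I" using supp_rinv[of v] w by (auto simp: mem_dom)
  obtain \<theta>' where \<theta>': "v' * \<theta>' = ?I" using supp_rinv[of v'] w' by (auto simp: mem_dom)
  obtain \<eta> where \<eta>: "\<xi> * \<eta> = ?I" using supp_rinv[of \<xi>] w by (auto simp: mem_dom)
  obtain \<eta>' where \<eta>': "\<xi>' * \<eta>' = ?I" using supp_rinv[of \<xi>'] w' by (auto simp: mem_dom)
  have I: "?I * v = v" "?I * v' = v'" "?I * \<xi> = \<xi>" "?I * \<xi>' = \<xi>'" using supp_row w w' by (auto simp: mem_dom)
  define P where "P l = ?I * dg (bset l)" for l
  have P: "P l = dg ({..<D} \<inter> bset l)" for l by (simp add: P_def id_mat_def)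
  have trP: "tr (P l) = P l" for l by (simp add: P)
  have PP: "P l * P l = P l" for l by (simp add: P)
  have PI: "P l * ?I = P l" for l by (auto simp: P id_mat_def intro!: arg_cong[where f = dg])
  have yP: "y * P l = P l" "P l * y = P l" if "l < m" for l
    using that by (auto simp: y_def P ZS_def intro!: arg_cong[where f = dg])
  have eq: "tr v * P l * \<xi> = tr v' * P l * \<xi>'" if "l < m" for l
  proof -
    have "tr a * P l * b = tr a * dg (bset l) * b" if "?I * a = a" for a b
    proof -
      have "tr a = tr (?I * a)" using that by simp
      then have "tr a = tr a * ?I" by (simp add: id_mat_def)
      then show ?thesis by (metis P_def mult.assoc)
    qed
    then show ?thesis using w w' that I by (simp add: mem_dom)
  qed
  have yext: "y * A = y * B" if "\<And>l. l < m \<Longrightarrow> P l * A = P l * B" for A B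
    unfolding y_def dg_mult_eq_iff
  proof (intro ballI allI)
    fix i j assume "i \<in> {..<D} - ZS"
    then obtain l where "l < m" "i \<in> {..<D} \<inter> bset l" by (auto simp: ZS_def)
    then show "ent A i j = ent B i j" using that[of l] unfolding P dg_mult_eq_iff by blast
  qed
  \<comment> \<open>Transposing the relation and multiplying with the right inverse of
    \<open>b'\<close> gives a witness that does not depend on \<open>l\<close>. That one matrix
    serves all projections is what makes a compression of the transition matrix commute with
    them.\<close>
  have key: "\<exists>\<kappa>. (\<forall>l<m. P l * (a' * \<theta>) = \<kappa> * P l \<and> P l * a' = \<kappa> * P l * a)"
    if "\<And>l. l < m \<Longrightarrow> tr a * P l * b = tr a' * P l * b'" "a * \<theta> = ?I" "b' * \<eta>' = ?I" for a a' b b' \<theta> \<eta>'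
  proof (intro exI allI impI)
    let ?\<kappa> = "tr (b * \<eta>')"
    fix l assume l: "l < m"
    have "tr (tr a * P l * b) = tr (tr a' * P l * b')" using that(1)[OF l] by simp
    then have "tr b * (P l * a) = tr b' * (P l * a')" by (simp add: trP mult.assoc)
    then have "tr \<eta>' * (tr b * (P l * a)) = tr \<eta>' * (tr b' * (P l * a'))" by simp
    then have "?\<kappa> * P l * a = tr (b' * \<eta>') * (P l * a')" by (simp add: mult.assoc)
    also have "\<dots> = P l * a'" unfolding that(3) by (simp add: id_mat_def P flip: mult.assoc)
    finally show "P l * (a' * \<theta>) = ?\<kappa> * P l \<and> P l * a' = ?\<kappa> * P l * a"
    proof (intro conjI)
      assume e: "?\<kappa> * P l * a = P l * a'"
      have "P l * (a' * \<theta>) = ?\<kappa> * P l * (a * \<theta>)" using e by (metis mult.assoc)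
      also have "\<dots> = ?\<kappa> * P l" unfolding that(2) by (simp add: PI mult.assoc)
      finally show "P l * (a' * \<theta>) = ?\<kappa> * P l" .
    qed simp
  qed
  \<comment> \<open>As \<theta> is a right inverse of \<open>v\<close>, this is the candidate for a
    matrix that carries the rows of \<open>v\<close> outside the zero cell to those of
    \<open>v'\<close>; \<open>B'\<close> goes back.\<close>
  define B where "B = v' * \<theta>"
  define B' where "B' = v * \<theta>'"
  obtain \<kappa> where \<kappa>: "\<And>l. l < m \<Longrightarrow> P l * B = \<kappa> * P l" "\<And>l. l < m \<Longrightarrow> P l * v' = \<kappa> * P l * v"
    using key[OF eq \<theta> \<eta>'] unfolding B_def by blast
  obtain \<kappa>' where \<kappa>': "\<And>l. l < m \<Longrightarrow> P l * B' = \<kappa>' * P l" "\<And>l. l < m \<Longrightarrow> P l * v = \<kappa>' * P l * v'"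
    using key[OF eq[symmetric] \<theta>' \<eta>] unfolding B'_def by blast
  have v'B: "y * v' = y * (B * v)"
    by (rule yext) (simp add: \<kappa> flip: mult.assoc)
  have vB': "y * v = y * (B' * v')"
    by (rule yext) (simp add: \<kappa>' flip: mult.assoc)
  have yB: "y * B = y * (B * y)" by (rule yext) (simp add: \<kappa> yP flip: mult.assoc, simp add: mult.assoc yP)
  have yB': "y * B' = y * (B' * y)" by (rule yext) (simp add: \<kappa>' yP flip: mult.assoc, simp add: mult.assoc yP)
  have comB: "y * (C * y) * P l = P l * (y * (C * y))"
    if "\<And>l. l < m \<Longrightarrow> P l * C = k * P l" "l < m" for C k l
  proof -
    have 1: "P l * C * P l = P l * C" using that by (simp add: mult.assoc PP)
    have "y * (C * P l) = y * (P l * C)"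
    proof (rule yext)
      fix l' assume l': "l' < m"
      have "P l' * (C * P l) = k * (P l' * P l)" using that(1)[OF l'] by (simp flip: mult.assoc)
      also have "P l' * P l = P l * P l'" by (simp add: P Int_ac)
      also have "k * (P l * P l') = P l * C * P l'" using that(1)[OF that(2)] by (simp flip: mult.assoc)
      finally have a: "P l' * (C * P l) = P l * C * P l'" .
      then have "P l' * (C * P l) = P l * (P l * C * P l')" using PP[of l] by (simp flip: mult.assoc)
      also have "\<dots> = P l * (P l' * (C * P l))" by (simp only: a)
      also have "\<dots> = P l' * (P l * C * P l)" by (simp add: P Int_ac flip: mult.assoc)
      finally show "P l' * (C * P l) = P l' * (P l * C)" by (simp only: 1)
    qed
    then have "y * (C * (y * P l)) = P l * C"
      using yP[OF that(2)] by (simp flip: mult.assoc)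
    moreover have "P l * (y * (C * y)) = P l * C * y" using yP[OF that(2)] by (simp flip: mult.assoc)
    moreover have "P l * C * y = P l * C" using that yP by (simp add: mult.assoc)
    ultimately show ?thesis by (simp add: mult.assoc)
  qed
  have yy: "y * y = y" by (simp add: y_def)
  have yI: "y * ?I = y" "?I * y = y" by (auto simp: y_def id_mat_def intro!: arg_cong[where f = dg])
  have BB: "y * (C * y) * (y * (C' * y)) = y"
    if "y * C' = y * (C' * y)" "y * C = y * (C * y)" "y * a = y * (C * a')" "C' = a' * t" "a * t = ?I" for C C' a a' t
  proof -
    have "y * (C * y) * (y * (C' * y)) = y * (C * y) * (y * C')" by (simp only: that(1)[symmetric])
    also have "\<dots> = y * (C * y) * C'" by (simp add: mult.assoc) (simp add: yy flip: mult.assoc)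
    also have "\<dots> = y * C * C'" by (simp only: that(2)[symmetric])
    also have "\<dots> = y * (C * a') * t" by (simp add: that(4) mult.assoc)
    also have "\<dots> = y * (a * t)" by (simp only: that(3)[symmetric] mult.assoc)
    finally show ?thesis by (simp only: that(5) yI)
  qed
  \<comment> \<open>The compression of \<open>B\<close> to the rows outside the zero cell, extended
    by the identity: in characteristic 2 the complementary projection is
    \<open>1 + y\<close>.\<close>
  define h where "h = y * (B * y) + (1 + y)"
  define h' where "h' = y * (B' * y) + (1 + y)"
  have y1: "y * (1 + y) = 0" "(1 + y) * y = 0" "(1 + y) * (1 + y) = 1 + y"
    by (simp_all add: distrib_left distrib_right yy)
  have hh: "(y * (C * y) + (1 + y)) * (y * (C' * y) + (1 + y)) = y * (C * y) * (y * (C' * y)) + (1 + y)" for C C'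
  proof -
    have "(1 + y) * (y * (C' * y)) = 0" "y * (C * y) * (1 + y) = 0"
      using y1 by (simp_all add: mult.assoc) (simp_all flip: mult.assoc)
    moreover have "(a + e) * (b + e) = a * b + e" if "a * e = 0" "e * b = 0" "e * e = e" for a b e :: bmat
      by (simp add: distrib_left distrib_right that)
    ultimately show ?thesis using y1(3) by blast
  qed
  have inv: "is_inv h h'"
    unfolding is_inv_def h_def h'_def hh
    using BB[OF yB' yB v'B B'_def \<theta>'] BB[OF yB yB' vB' B_def \<theta>] by simp
  have cmh: "y * (C * y) + (1 + y) \<in> comm" if "\<And>l. l < m \<Longrightarrow> P l * C = k * P l" for C k
    unfolding comm_def
  proof (intro CollectI allI impI)
    fix l assume l: "l < m"
    have "y * dg (bset l) = P l" "dg (bset l) * y = P l"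
      using l by (auto simp: y_def P ZS_def intro!: arg_cong[where f = dg])
    then have "y * (C * y) * dg (bset l) = y * (C * y) * P l" "dg (bset l) * (y * (C * y)) = P l * (y * (C * y))"
      using yP[OF l] by (simp_all add: mult.assoc) (simp_all add: yy flip: mult.assoc)
    then show "(y * (C * y) + (1 + y)) * dg (bset l) = dg (bset l) * (y * (C * y) + (1 + y))"
      using comB[OF that l] \<open>y * dg (bset l) = P l\<close> \<open>dg (bset l) * y = P l\<close>
      by (simp add: distrib_left distrib_right)
  qed
  have yZ: "y * dg ZS = 0" "dg ZS * y = 0" "y * dg {D..} = 0" "dg {D..} * y = 0"
    by (simp_all add: y_def, simp_all add: Diff_Int_distrib2 Int_Diff)
      (use dg_empty in \<open>force intro: arg_cong[where f = dg, of _ "{}", simplified]\<close>)+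
  have hZ: "h * dg ZS = dg ZS" "dg ZS * h = dg ZS" "h * dg {D..} = dg {D..}" "dg {D..} * h = dg {D..}"
    using yZ by (simp_all add: h_def distrib_left distrib_right mult.assoc) (simp_all flip: mult.assoc)
  have hH: "h \<in> hset"
    unfolding hset_def gl_def using inv hZ cmh[OF \<kappa>(1)] by (auto simp: h_def)
  have h1: "h \<in> h1set" using hH hZ by (simp add: h1set_def)
  have uh: "uinv h = h'" by (rule uinv_eq[OF inv])
  have yh: "y * h = y * (B * y)" "y * tr h' = y * (tr B' * y)"
  proof -
    show "y * h = y * (B * y)" using y1 yy by (simp add: h_def distrib_left flip: mult.assoc)
    have "tr y = y" by (simp add: y_def)
    then have "tr h' = y * (tr B' * y) + (1 + y)" by (simp add: h'_def mult.assoc)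
    then show "y * tr h' = y * (tr B' * y)" using y1 yy by (simp add: distrib_left flip: mult.assoc)
  qed
  have V: "y * (h * v) = y * v'"
    using yh(1) yB v'B by (metis mult.assoc)
  have X: "y * (tr h' * \<xi>) = y * \<xi>'"
  proof -
    have "y * (y * (tr B' * y) * \<xi>) = y * \<xi>'"
    proof (rule yext)
      fix l assume l: "l < m"
      have "tr \<theta>' * (tr v' * P l * \<xi>') = tr \<theta>' * (tr v * P l * \<xi>)" using eq[OF l] by simp
      then have "tr (v' * \<theta>') * (P l * \<xi>') = tr B' * (P l * \<xi>)" by (simp add: B'_def mult.assoc)
      then have e: "P l * \<xi>' = tr B' * (P l * \<xi>)"
        unfolding \<theta>' by (simp add: id_mat_def P flip: mult.assoc)
      have "tr (y * (B' * y) * P l) = tr (P l * (y * (B' * y)))" using comB[OF \<kappa>'(1) l] by simp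
      then have c: "P l * (y * (tr B' * y)) = y * (tr B' * y) * P l"
        by (simp add: trP y_def mult.assoc)
      have "P l * (y * (tr B' * y) * \<xi>) = P l * (P l * (y * (tr B' * y))) * \<xi>"
        using PP[of l] by (simp flip: mult.assoc)
      also have "\<dots> = P l * (y * (tr B' * y) * P l) * \<xi>" by (simp only: c)
      also have "\<dots> = P l * (tr B' * (P l * \<xi>))"
        using yP[OF l] by (simp add: mult.assoc) (simp flip: mult.assoc)
      also have "\<dots> = P l * \<xi>'" by (simp only: e[symmetric]) (simp add: PP flip: mult.assoc)
      finally show "P l * (y * (tr B' * y) * \<xi>) = P l * \<xi>'" .
    qed
    then show ?thesis using yh(2) yy by (metis mult.assoc)
  qed
  have D: "dg (- ZS) * x = y * x" if "?I * x = x" for x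
  proof -
    have "dg (- ZS) * ?I = y" by (auto simp: y_def id_mat_def intro!: arg_cong[where f = dg])
    then show ?thesis using that by (metis mult.assoc)
  qed
  have "act h (v, \<xi>) \<in> dom" using act_dom[OF hH w] .
  then have "?I * (h * v) = h * v" "?I * (tr h' * \<xi>) = tr h' * \<xi>"
    using supp_row by (auto simp: act_def uh mem_dom)
  then have "zmap (act h (v, \<xi>)) = zmap (v', \<xi>')"
    using D I V X by (simp add: zmap_def act_def uh)
  then show ?thesis using that h1 by blast
qed

end

section \<open>Correlation of the two next matrices on a fibre\<close>

context tensor_link
begin

text \<open>Because \<open>h\<close> is the identity on the zero cell, the transformed projection
  \<open>K\<close> is \<open>dg (ZS \<inter> QS)\<close> there and has no blocks between the zero
  cell and its complement. Hence the rows of the zero cell enter only through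
  \<open>ZS \<inter> QS\<close>, and the rest is seen by \<open>zmap\<close>.\<close>

lemma fibre_depends:
  assumes "w \<in> dom" "w' \<in> dom" "zmap w = zmap w'"
    "dg (ZS \<inter> QS) * fst w = dg (ZS \<inter> QS) * fst w'" "dg (ZS \<inter> QS) * snd w = dg (ZS \<inter> QS) * snd w'"
  shows "av h1set (\<lambda>w. f (pairing QS w)) w = av h1set (\<lambda>w. f (pairing QS w)) w'"
proof -
  have "pairing QS (act h w) = pairing QS (act h w')" if h: "h \<in> h1set" for h
  proof -
    define K where "K = tr h * dg QS * tr (uinv h)"
    have Zh: "h * dg ZS = dg ZS" "dg ZS * h = dg ZS" "uinv h * dg ZS = dg ZS" "dg ZS * uinv h = dg ZS"
      using h h1set_uinv[OF h] by (auto simp: h1set_def)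
    have Zt: "tr h * dg ZS = dg ZS" "dg ZS * tr h = dg ZS" "tr (uinv h) * dg ZS = dg ZS" "dg ZS * tr (uinv h) = dg ZS"
      using arg_cong[where f = tr, OF Zh(2)] arg_cong[where f = tr, OF Zh(1)]
        arg_cong[where f = tr, OF Zh(4)] arg_cong[where f = tr, OF Zh(3)] by simp_all
    have "K * dg ZS = tr h * (dg QS * dg ZS)" by (simp add: K_def mult.assoc Zt)
    also have "dg QS * dg ZS = dg ZS * dg QS" by (simp add: Int_commute)
    also have "tr h * (dg ZS * dg QS) = dg ZS * dg QS" using Zt(1) by (rule mult_eq_assoc)
    finally have KZ: "K * dg ZS = dg (ZS \<inter> QS)" by simp
    have "dg ZS * K = dg ZS * dg QS * tr (uinv h)" using mult_eq_assoc[OF Zt(2)] by (simp add: K_def mult.assoc)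
    also have "dg ZS * dg QS = dg QS * dg ZS" by (simp add: Int_commute)
    also have "dg QS * dg ZS * tr (uinv h) = dg QS * dg ZS" by (simp only: mult.assoc Zt)
    finally have ZK: "dg ZS * K = dg (ZS \<inter> QS)" by (simp add: Int_commute)
    have z1: "dg ZS + dg (- ZS) = 1" by (simp add: dg_Compl)
    have "K = (dg ZS + dg (- ZS)) * K * (dg ZS + dg (- ZS))" by (simp add: z1)
    also have "\<dots> = dg ZS * K * dg ZS + dg ZS * K * dg (- ZS) + (dg (- ZS) * (K * dg ZS) + dg (- ZS) * K * dg (- ZS))"
      by (simp add: distrib_left distrib_right add_ac mult.assoc)
    also have "dg ZS * K * dg ZS = dg (ZS \<inter> QS)"
      unfolding ZK by (simp, rule arg_cong[where f = dg]) auto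
    also have "dg ZS * K * dg (- ZS) = 0"
    proof -
      have "ZS \<inter> QS \<inter> - ZS = {}" by auto
      then show ?thesis unfolding ZK by simp
    qed
    also have "dg (- ZS) * (K * dg ZS) = 0"
    proof -
      have "- ZS \<inter> (ZS \<inter> QS) = {}" by auto
      then show ?thesis unfolding KZ by simp
    qed
    finally have K: "K = dg (ZS \<inter> QS) + dg (- ZS) * K * dg (- ZS)" by simp
    have *: "tr a * K * b = tr (dg (ZS \<inter> QS) * a) * (dg (ZS \<inter> QS) * b) + tr (dg (- ZS) * a) * K * (dg (- ZS) * b)" for a b
    proof -
      have "tr a * K * b = tr a * dg (ZS \<inter> QS) * b + tr a * (dg (- ZS) * K * dg (- ZS)) * b"
        by (subst K) (simp add: distrib_left distrib_right)
      then show ?thesis by (simp add: mult.assoc)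
    qed
    have hH: "h \<in> hset" using h by (simp add: h1set_def)
    show ?thesis
      unfolding pairing_act[OF hH] K_def[symmetric] *[of "fst w" "snd w"] *[of "fst w'" "snd w'"]
      using assms by (simp add: zmap_def)
  qed
  then show ?thesis by (simp add: av_def)
qed

text \<open>Membership in \<open>dom\<close> is decided outside the zero cell, so once those rows
  are fixed the two frames vary independently.\<close>

lemma fibre_prod:
  assumes "w \<in> dom"
  shows "{x \<in> dom. zmap x = zmap w} =
    {v. mu v \<noteq> 0 \<and> dg (- ZS) * v = fst (zmap w)} \<times> {v. mu v \<noteq> 0 \<and> dg (- ZS) * v = snd (zmap w)}"
  using zmap_dom[OF assms] by (auto simp: zmap_def mem_dom)

text \<open>The matrix \<open>u\<close> of \<open>block_unit\<close> has the rows \<open>Q\<close>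
  of the translation \<open>k\<close> as its rows \<open>Q\<close>, and its rows \<open>N\<close>
  are a copy of the identity on \<open>Q\<close>. The weight is invariant under \<open>u\<close> and
  \<open>u\<close> preserves the fibre, so the correlation between old and translated rows equals
  that between the blocks \<open>Q\<close> and \<open>N\<close> of a single frame.\<close>

lemma mc_translated:
  assumes blk: "mc {v. mu v \<noteq> 0 \<and> dg (- ZS) * v = \<zeta>} mu (\<lambda>v. dg (ZS \<inter> QS) * v) (\<lambda>v. dg (ZS - QS) * v) \<eta>"
    and inv: "is_inv \<Delta> \<Delta>'" and \<Delta>s: "\<Delta> * s = s * \<Delta>"
    and \<Delta>dg: "\<And>S. (\<And>a b. (\<forall>l\<le>Suc m. a \<in> bset l \<longleftrightarrow> b \<in> bset l) \<Longrightarrow> (a < D \<longleftrightarrow> b < D) \<Longrightarrow> a \<in> S \<longleftrightarrow> b \<in> S) \<Longrightarrow>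
       \<Delta> * dg S = dg S * \<Delta>"
  shows "mc {v. mu v \<noteq> 0 \<and> dg (- ZS) * v = \<zeta>} mu
    (\<lambda>v. dg (ZS \<inter> QS) * ((1 + \<Delta> * ((1 + s) * dg ZS)) * v)) (\<lambda>v. dg (ZS \<inter> QS) * v) \<eta>"
proof -
  let ?A = "{v. mu v \<noteq> 0 \<and> dg (- ZS) * v = \<zeta>}"
  define Q where "Q = dg (ZS \<inter> QS)"
  define N where "N = dg (ZS - QS)"
  define Y where "Y = dg (- ZS)"
  have sets: "(ZS \<inter> QS) \<inter> (ZS - QS) = {}" "(ZS - QS) \<inter> (ZS \<inter> QS) = {}" "(ZS \<inter> QS) \<inter> - ZS = {}"
    "- ZS \<inter> (ZS \<inter> QS) = {}" "(ZS - QS) \<inter> - ZS = {}" "- ZS \<inter> (ZS - QS) = {}" by auto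
  have zsum: "dg ZS = Q + N" unfolding Q_def N_def
    by (subst dg_Un_disjoint[symmetric]) (auto intro!: arg_cong[where f = dg])
  have idem: "Q * Q = Q" "N * N = N" "Y * Y = Y" "Q * N = 0" "N * Q = 0" "Q * Y = 0" "Y * Q = 0"
      "N * Y = 0" "Y * N = 0" by (simp_all add: Q_def N_def Y_def sets)
  have one: "Y + (Q + N) = 1" by (simp add: Y_def dg_Compl zsum[symmetric] add.assoc)
  have sQ: "s * Q = N * s" "s * N = Q * s" "s * Y = Y * s"
    unfolding Q_def N_def Y_def by (rule s_dg; auto simp: QS_def ZS_def)+
  have \<Delta>Q: "\<Delta> * Q = Q * \<Delta>" "\<Delta> * N = N * \<Delta>" "\<Delta> * Y = Y * \<Delta>" "\<Delta> * dg {D..} = dg {D..} * \<Delta>"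
    unfolding Q_def N_def Y_def by (rule \<Delta>dg; auto simp: QS_def ZS_def)+
  define u where "u = Y + (Q + (\<Delta> * Q + (\<Delta> * (s * N) + s * Q)))"
  define u' where "u' = Y + (s * N + (\<Delta>' * (s * Q) + (\<Delta>' * N + N)))"
  have uinv: "is_inv u u'" unfolding u_def u'_def
    by (rule block_unit[OF idem one s_s _ _ _ inv]) (simp_all add: sQ \<Delta>Q \<Delta>s)
  define k where "k = 1 + \<Delta> * ((1 + s) * dg ZS)"
  have ks: "(1 + s) * dg ZS = Q + (N + (s * Q + s * N))"
    by (simp add: zsum distrib_left distrib_right add_ac)
  note R = \<Delta>Q(1-3)[symmetric] sQ[symmetric] idem
  note R' = R R[THEN mult_eq_assoc]
  have "Q * u = Q + (\<Delta> * Q + \<Delta> * (s * N))"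
    by (simp add: u_def distrib_left mult.assoc R')
  moreover have "Q * k = Q + (\<Delta> * Q + \<Delta> * (s * N))"
    by (simp add: k_def ks distrib_left mult.assoc R')
  ultimately have Qk: "Q * u = Q * k" by simp
  have Nu: "N * u = s * Q"
    by (simp add: u_def distrib_left mult.assoc R')
  have Yu: "Y * u = Y"
    by (simp add: u_def distrib_left mult.assoc R')
  have dis: "{D..} \<inter> (ZS \<inter> QS) = {}" "{D..} \<inter> (ZS - QS) = {}" "(ZS \<inter> QS) \<inter> {D..} = {}" "(ZS - QS) \<inter> {D..} = {}"
    "{D..} \<inter> - ZS = {D..}" "- ZS \<inter> {D..} = {D..}" using ZS_sub by auto
  have O: "dg {D..} * Q = 0" "dg {D..} * N = 0" "Q * dg {D..} = 0" "N * dg {D..} = 0"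
    "dg {D..} * Y = dg {D..}" "Y * dg {D..} = dg {D..}" by (simp_all add: Q_def N_def Y_def dis)
  have sO: "s * dg {D..} = dg {D..} * s" by (rule s_dg) auto
  have ugl: "u \<in> gl D"
  proof -
    have "u * dg {D..} = dg {D..}" using O by (simp add: u_def distrib_right mult.assoc)
    moreover have "dg {D..} * u = dg {D..}"
      using O mult_eq_assoc[OF \<Delta>Q(4)[symmetric]] mult_eq_assoc[OF sO[symmetric]]
      by (simp add: u_def distrib_left mult.assoc)
    ultimately show ?thesis using uinv by (auto simp: gl_def)
  qed
  have u'gl: "u' \<in> gl D" using gl_is_inv_mem[OF ugl uinv] .
  have Yu': "Y * u' = Y"
    using Yu uinv unfolding is_inv_def by (metis mult.assoc mult_1_right)
  have bij: "bij_betw (\<lambda>v. u * v) ?A ?A"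
  proof (rule bij_betw_byWitness[where f' = "\<lambda>v. u' * v"])
    show "\<forall>a\<in>?A. u' * (u * a) = a" "\<forall>a\<in>?A. u * (u' * a) = a"
      using uinv by (auto simp: is_inv_def mult_eq_assoc)
    show "(*) u ` ?A \<subseteq> ?A" "(*) u' ` ?A \<subseteq> ?A"
      using mu_gl[OF ugl] mu_gl[OF u'gl] mult_eq_assoc[OF Yu] mult_eq_assoc[OF Yu'] by (auto simp: Y_def)
  qed
  have "mc ?A mu (\<lambda>v. Q * (u * v)) (\<lambda>v. N * (u * v)) \<eta>"
    using mc_reindex[OF blk bij] mu_gl[OF ugl] by (simp add: Q_def N_def)
  then have "mc ?A mu (\<lambda>v. Q * (k * v)) (\<lambda>v. Q * v) \<eta>"
  proof (rule mc_comp[where \<phi> = "\<lambda>x. x" and \<psi> = "\<lambda>x. s * x"])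
    show "Q * (k * v) = Q * (u * v)" for v using Qk by (metis mult.assoc)
    show "Q * v = s * (N * (u * v))" for v
      using mult_eq_assoc[OF Nu] mult_eq_assoc[OF s_s] by (simp add: mult.assoc)
  qed
  then show ?thesis by (simp add: Q_def k_def)
qed

text \<open>The first term is the price of replacing one function by its average over the group of
  the fibre. The second bounds what the averages can still share: \<open>G0\<close> has mean 0 on
  every fibre of \<open>zmap\<close>, and the correlation of the old frames makes its translates
  almost orthogonal.\<close>

theorem tensor_mc:
  assumes blk: "\<And>\<zeta>. mc {v. mu v \<noteq> 0 \<and> dg (- ZS) * v = \<zeta>} mu (\<lambda>v. dg (ZS \<inter> QS) * v) (\<lambda>v. dg (ZS - QS) * v) \<eta>"
    and \<eta>: "0 \<le> \<eta>"
  shows "mc dom wgt (pairing PS) (pairing QS) (12 / sqrt (real M) + sqrt (1 / real M + 2 * \<eta>))"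
  unfolding mc_def
proof (intro allI impI)
  fix f g :: "bmat \<Rightarrow> real"
  let ?F = "\<lambda>w. f (pairing PS w)" and ?G = "\<lambda>w. g (pairing QS w)"
  assume "(\<Sum>w\<in>dom. wgt w * f (pairing PS w)) = 0" and g0: "(\<Sum>w\<in>dom. wgt w * g (pairing QS w)) = 0"
  define G0 where "G0 = av h1set ?G"
  have mean0: "(\<Sum>w\<in>dom. wgt w * G0 w) = 0"
    using ip_av_fixed[OF sg_h1set, of "\<lambda>_. 1" ?G] g0 by (simp add: G0_def wip_def fixed_def)
  have G0_fix: "fixed h1set G0" unfolding G0_def by (rule fixed_av[OF sg_h1set])
  define fib where "fib w = {x \<in> dom. zmap x = zmap w}" for w
  \<comment> \<open>By \<open>transitive\<close> the fibres of \<open>zmap\<close> are permuted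
    transitively by maps under which \<open>G0\<close> is invariant, so all of them carry the same
    weighted sum, which must then be 0.\<close>
  have fibre_sum: "(\<Sum>x\<in>fib w. wgt x * G0 x) = (\<Sum>x\<in>fib w'. wgt x * G0 x)" if ww: "w \<in> dom" "w' \<in> dom" for w w'
  proof -
    obtain h where h: "h \<in> h1set" "zmap (act h w) = zmap w'"
      using transitive[of "fst w" "snd w" "fst w'" "snd w'"] ww by (metis prod.collapse)
    have hH: "h \<in> hset" using h by (simp add: h1set_def)
    have uH: "uinv h \<in> hset" by (rule hset_uinv(2)[OF hH])
    have inv: "uinv h * h = 1" "h * uinv h = 1" using hset_uinv(1)[OF hH] by (auto simp: is_inv_def)
    have "zmap (act (uinv h) w') = zmap (act (uinv h) (act h w))"
      by (simp only: h1set_zmap[OF h1set_uinv[OF h(1)]] h(2))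
    then have zback: "zmap (act (uinv h) w') = zmap w"
      using act_mult[OF uH hH ww(1)] inv act_one[OF ww(1)] by simp
    have bij: "bij_betw (act h) (fib w) (fib w')"
    proof (rule bij_betw_byWitness[where f' = "act (uinv h)"])
      show "\<forall>x\<in>fib w. act (uinv h) (act h x) = x" "\<forall>x\<in>fib w'. act h (act (uinv h) x) = x"
        using act_mult[OF uH hH] act_mult[OF hH uH] inv act_one by (auto simp: fib_def)
      show "act h ` fib w \<subseteq> fib w'"
        using act_dom[OF hH] h(2) by (auto simp: fib_def h1set_zmap[OF h(1)])
      show "act (uinv h) ` fib w' \<subseteq> fib w"
        using act_dom[OF uH] zback by (auto simp: fib_def h1set_zmap[OF h1set_uinv[OF h(1)]])
    qed
    have "(\<Sum>x\<in>fib w'. wgt x * G0 x) = (\<Sum>x\<in>fib w. wgt (act h x) * G0 (act h x))"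
      by (rule sum.reindex_bij_betw[OF bij, symmetric])
    also have "\<dots> = (\<Sum>x\<in>fib w. wgt x * G0 x)"
      using m_act[OF hH] G0_fix h(1) by (intro sum.cong refl) (auto simp: fib_def fixed_def)
    finally show ?thesis by simp
  qed
  have fib0: "(\<Sum>x\<in>fib w. wgt x * G0 x) = 0" if w: "w \<in> dom" for w
  proof -
    have "0 = (\<Sum>z\<in>zmap ` dom. \<Sum>x\<in>{x\<in>dom. zmap x = z}. wgt x * G0 x)"
      using mean0 sum_fibres[OF wtD(1)[OF wt_W], of "\<lambda>w. wgt w * G0 w" zmap] by simp
    also have "\<dots> = (\<Sum>z\<in>zmap ` dom. \<Sum>x\<in>fib w. wgt x * G0 x)"
    proof (rule sum.cong[OF refl])
      fix z assume "z \<in> zmap ` dom"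
      then obtain w' where w': "w' \<in> dom" "z = zmap w'" by blast
      show "(\<Sum>x\<in>{x\<in>dom. zmap x = z}. wgt x * G0 x) = (\<Sum>x\<in>fib w. wgt x * G0 x)"
        using fibre_sum[OF w'(1) w] unfolding fib_def w'(2) .
    qed
    also have "\<dots> = real (card (zmap ` dom)) * (\<Sum>x\<in>fib w. wgt x * G0 x)" by simp
    finally show ?thesis using w wtD(1)[OF wt_W] by auto
  qed
  \<comment> \<open>In characteristic 2 the square of \<open>1 + s\<close> is 0, so these elements
    are commuting involutions; the transpose of a product of two of them has the same form, so both
    frames are moved in the same way.\<close>
  define n where "n i = 1 + tau i * ((1 + s) * dg ZS)" for i
  have tZ: "tau i * dg ZS = dg ZS * tau i" if "i < M" for i by (rule tau_dg[OF that]) (auto simp: ZS_def)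
  have sZ: "s * dg ZS = dg ZS * s" by (rule s_dg) (auto simp: ZS_def)
  have J: "(1 + s) * dg ZS * T * ((1 + s) * dg ZS) = 0" if "T * s = s * T" "T * dg ZS = dg ZS * T" for T
  proof -
    have "(1 + s) * dg ZS = dg ZS * (1 + s)" using sZ by (simp add: distrib_left distrib_right)
    then have "(1 + s) * dg ZS * T * ((1 + s) * dg ZS) = dg ZS * ((1 + s) * T * (1 + s)) * dg ZS"
      by (metis mult.assoc)
    also have "(1 + s) * T * (1 + s) = T + (T * s + (s * T + s * T * s))"
      by (simp add: distrib_left distrib_right add_ac)
    also have "s * T * s = T" using that(1) s_s by (metis mult.assoc mult_1_right)
    finally show ?thesis using that(1) by simp
  qed
  have nn: "n i * n j = 1 + (tau i + tau j) * ((1 + s) * dg ZS)" if "i < M" "j < M" for i j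
  proof -
    have "tau i * ((1 + s) * dg ZS) * (tau j * ((1 + s) * dg ZS)) = tau i * ((1 + s) * dg ZS * tau j * ((1 + s) * dg ZS))"
      by (simp only: mult.assoc)
    also have "\<dots> = 0" using J[of "tau j"] tau_s tZ that by simp
    finally show ?thesis by (simp add: n_def distrib_left distrib_right add_ac)
  qed
  have n_invol: "is_inv (n i) (n i)" if "i < M" for i using nn[OF that that] by (simp add: is_inv_def)
  have n_H: "n i \<in> hset" if "i < M" for i
  proof -
    have tO: "tau i * dg {D..} = dg {D..} * tau i" by (rule tau_dg[OF that]) auto
    have sO: "s * dg {D..} = dg {D..} * s" by (rule s_dg) auto
    have "ZS \<inter> {D..} = {}" "{D..} \<inter> ZS = {}" using ZS_sub by auto
    then have Z: "dg ZS * dg {D..} = 0" "dg {D..} * dg ZS = 0" by simp_all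
    have "n i * dg {D..} = dg {D..}" using Z by (simp add: n_def distrib_right mult.assoc)
    moreover have "dg {D..} * n i = dg {D..}"
      using Z mult_eq_assoc[OF tO[symmetric]] mult_eq_assoc[OF sO[symmetric]]
      by (simp add: n_def distrib_left distrib_right mult.assoc)
    moreover have "n i \<in> comm" using comm_closed comm_tau_s that by (simp add: n_def)
    ultimately show ?thesis using n_invol[OF that] by (auto simp: hset_def gl_def)
  qed
  have orth: "\<bar>ip (\<lambda>w. G0 (act (n i) w)) (\<lambda>w. G0 (act (n j) w))\<bar> \<le> 2 * \<eta> * (nm G0)\<^sup>2"
    if ij: "i < M" "j < M" "i \<noteq> j" for i j
  proof -
    define \<Delta> where "\<Delta> = tau i + tau j"
    obtain \<Delta>' where \<Delta>': "is_inv \<Delta> \<Delta>'" using tau_inv[OF ij] by (auto simp: \<Delta>_def)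
    define k where "k = 1 + \<Delta> * ((1 + s) * dg ZS)"
    have k: "k = n i * n j" by (simp add: k_def \<Delta>_def nn ij)
    have kH: "k \<in> hset" unfolding k using n_H ij hset_closed by simp
    have kn: "k * n j = n i" using n_invol[OF ij(2)] by (simp add: k is_inv_def mult.assoc)
    have \<Delta>dg: "\<Delta> * dg S = dg S * \<Delta>"
      if "\<And>a b. (\<forall>l\<le>Suc m. a \<in> bset l \<longleftrightarrow> b \<in> bset l) \<Longrightarrow> (a < D \<longleftrightarrow> b < D) \<Longrightarrow> a \<in> S \<longleftrightarrow> b \<in> S" for S
      using tau_dg[OF ij(1) that] tau_dg[OF ij(2) that] by (simp add: \<Delta>_def distrib_left distrib_right)
    have \<Delta>s: "\<Delta> * s = s * \<Delta>" using tau_s ij by (simp add: \<Delta>_def distrib_left distrib_right)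
    have k_invol: "is_inv k k"
    proof -
      have "\<Delta> * ((1 + s) * dg ZS) * (\<Delta> * ((1 + s) * dg ZS)) = \<Delta> * ((1 + s) * dg ZS * \<Delta> * ((1 + s) * dg ZS))"
        by (simp only: mult.assoc)
      also have "\<dots> = 0" using J[OF \<Delta>s \<Delta>dg] by (simp add: ZS_def)
      finally show ?thesis by (simp add: k_def is_inv_def distrib_left distrib_right add_ac)
    qed
    have uk: "uinv k = k" by (rule uinv_eq[OF k_invol])
    have tr\<Delta>dg: "tr \<Delta> * dg S = dg S * tr \<Delta>" if "\<Delta> * dg S = dg S * \<Delta>" for S
      using arg_cong[where f = tr, OF that] by simp
    have tr\<Delta>s: "tr \<Delta> * s = s * tr \<Delta>" using arg_cong[where f = tr, OF \<Delta>s] by (simp add: tr_s)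
    have trk: "tr k = 1 + tr \<Delta> * ((1 + s) * dg ZS)"
    proof -
      have Zt: "tr \<Delta> * dg ZS = dg ZS * tr \<Delta>" by (rule tr\<Delta>dg[OF \<Delta>dg]) (simp add: ZS_def)
      have "tr k = 1 + dg ZS * (1 + s) * tr \<Delta>" by (simp add: k_def tr_s)
      also have "dg ZS * (1 + s) * tr \<Delta> = tr \<Delta> * ((1 + s) * dg ZS)"
        using sZ Zt tr\<Delta>s by (simp add: distrib_left distrib_right) (metis mult.assoc)
      finally show ?thesis .
    qed
    have "ip (\<lambda>w. G0 (act (n i) w)) (\<lambda>w. G0 (act (n j) w)) =
        ip (\<lambda>w. G0 (act k (act (n j) w))) (\<lambda>w. G0 (act (n j) w))"
      by (rule wip_cong) (use kH n_H ij in \<open>auto simp: kn simp flip: act_mult\<close>)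
    also have "\<dots> = ip (\<lambda>w. G0 (act k w)) G0" by (rule ip_act[OF n_H[OF ij(2)]])
    finally have 1: "ip (\<lambda>w. G0 (act (n i) w)) (\<lambda>w. G0 (act (n j) w)) = ip (\<lambda>w. G0 (act k w)) G0" .
    have fibre: "\<bar>wip (fib w) wgt (\<lambda>w. G0 (act k w)) G0\<bar> \<le> 2 * \<eta> * wip (fib w) wgt G0 G0" if w: "w \<in> dom" for w
    proof -
      define Q where "Q = dg (ZS \<inter> QS)"
      let ?A = "{v. mu v \<noteq> 0 \<and> dg (- ZS) * v = fst (zmap w)}" and ?B = "{v. mu v \<noteq> 0 \<and> dg (- ZS) * v = snd (zmap w)}"
      have fp: "fib w = ?A \<times> ?B" unfolding fib_def by (rule fibre_prod[OF w])
      have wtA: "wt ?A mu" "wt ?B mu" using finite_supp mu_nonneg by (auto simp: wt_def)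
      have mcA: "mc ?A mu (\<lambda>v. Q * (k * v)) (\<lambda>v. Q * v) \<eta>"
        unfolding Q_def k_def by (rule mc_translated[OF blk \<Delta>' \<Delta>s \<Delta>dg])
      have mcB: "mc ?B mu (\<lambda>v. Q * (tr k * v)) (\<lambda>v. Q * v) \<eta>"
        unfolding Q_def trk by (rule mc_translated[OF blk is_inv_tr[OF \<Delta>'] tr\<Delta>s tr\<Delta>dg[OF \<Delta>dg]])
      \<comment> \<open>The two frames are independent on the fibre and contribute
        \<open>\<eta>\<close> each; this is the factor 2 in the final bound.\<close>
      have mcP: "mc (fib w) wgt (\<lambda>w. (Q * (k * fst w), Q * (tr k * snd w))) (\<lambda>w. (Q * fst w, Q * snd w)) (\<eta> + \<eta>)"
        unfolding fp using mc_prod[OF wtA \<eta> \<eta> mcA mcB] unfolding wgt_def .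
      \<comment> \<open>\<open>G0\<close> written as a function of the rows in
        \<open>ZS \<inter> QS\<close>; by \<open>fibre_depends\<close> the representative chosen by
        \<open>SOME\<close> does not matter.\<close>
      define \<gamma> where "\<gamma> xy = G0 (SOME x. x \<in> fib w \<and> (Q * fst x, Q * snd x) = xy)" for xy
      have \<gamma>: "G0 x = \<gamma> (Q * fst x, Q * snd x)" if x: "x \<in> fib w" for x
      proof -
        define x' where "x' = (SOME x'. x' \<in> fib w \<and> (Q * fst x', Q * snd x') = (Q * fst x, Q * snd x))"
        have "x' \<in> fib w \<and> (Q * fst x', Q * snd x') = (Q * fst x, Q * snd x)"
          unfolding x'_def by (rule someI[of _ x]) (use x in simp)
        then have "G0 x = G0 x'"
          unfolding G0_def using x by (intro fibre_depends) (auto simp: fib_def Q_def)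
        then show ?thesis by (simp add: \<gamma>_def x'_def)
      qed
      have Zk: "dg (- ZS) * k = dg (- ZS)" "dg (- ZS) * tr k = dg (- ZS)"
      proof -
        have "dg (- ZS) * (T * ((1 + s) * dg ZS)) = 0" if "T * dg ZS = dg ZS * T" for T
        proof -
          have "T * ((1 + s) * dg ZS) = dg ZS * (T * (1 + s))"
            using sZ that by (simp add: distrib_left distrib_right) (metis mult.assoc)
          then show ?thesis by simp
        qed
        note z0 = this
        have \<Delta>Z: "\<Delta> * dg ZS = dg ZS * \<Delta>" by (rule \<Delta>dg) (simp add: ZS_def)
        show "dg (- ZS) * k = dg (- ZS)" unfolding k_def by (simp add: distrib_left z0[OF \<Delta>Z])
        show "dg (- ZS) * tr k = dg (- ZS)"
          unfolding trk by (simp add: distrib_left z0[OF tr\<Delta>dg[OF \<Delta>Z]])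
      qed
      have act_k: "act k x = (k * fst x, tr k * snd x)" for x by (simp add: act_def uk)
      have kfib: "act k x \<in> fib w" if "x \<in> fib w" for x
        using that act_dom[OF kH] mult_eq_assoc[OF Zk(1)] mult_eq_assoc[OF Zk(2)]
        by (auto simp: fib_def zmap_def act_k)
      have kk: "act k (act k x) = x" if "x \<in> fib w" for x
        using that act_mult[OF kH kH, of x] k_invol act_one[of x] by (auto simp: fib_def is_inv_def)
      have bij: "bij_betw (act k) (fib w) (fib w)"
        by (rule bij_betw_byWitness[where f' = "act k"]) (use kfib kk in auto)
      have wk: "wgt (act k x) = wgt x" if "x \<in> fib w" for x using that m_act[OF kH] by (simp add: fib_def)
      have Sk: "(\<Sum>x\<in>fib w. wgt x * h (act k x)) = (\<Sum>x\<in>fib w. wgt x * h x)" for h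
        by (subst sum.reindex_bij_betw[OF bij, symmetric]) (simp add: wk)
      have "\<bar>wip (fib w) wgt (\<lambda>x. \<gamma> (Q * (k * fst x), Q * (tr k * snd x))) (\<lambda>x. \<gamma> (Q * fst x, Q * snd x))\<bar> \<le>
         (\<eta> + \<eta>) * wnm (fib w) wgt (\<lambda>x. \<gamma> (Q * (k * fst x), Q * (tr k * snd x))) * wnm (fib w) wgt (\<lambda>x. \<gamma> (Q * fst x, Q * snd x))"
      proof (rule mcD[OF mcP])
        have "(\<Sum>x\<in>fib w. wgt x * \<gamma> (Q * (k * fst x), Q * (tr k * snd x))) = (\<Sum>x\<in>fib w. wgt x * G0 (act k x))"
          using \<gamma>[OF kfib] by (intro sum.cong refl) (simp add: act_k)
        also have "\<dots> = 0" using Sk[of G0] fib0[OF w] by simp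
        finally show "(\<Sum>x\<in>fib w. wgt x * \<gamma> (Q * (k * fst x), Q * (tr k * snd x))) = 0" .
        show "(\<Sum>x\<in>fib w. wgt x * \<gamma> (Q * fst x, Q * snd x)) = 0"
          using fib0[OF w] \<gamma> by (simp cong: sum.cong)
      qed
      moreover have "wip (fib w) wgt (\<lambda>x. \<gamma> (Q * (k * fst x), Q * (tr k * snd x))) (\<lambda>x. \<gamma> (Q * fst x, Q * snd x))
         = wip (fib w) wgt (\<lambda>x. G0 (act k x)) G0"
        by (rule wip_cong) (simp_all add: \<gamma> \<gamma>[OF kfib], simp add: act_k)
      moreover have "wnm (fib w) wgt (\<lambda>x. \<gamma> (Q * (k * fst x), Q * (tr k * snd x))) = wnm (fib w) wgt (\<lambda>x. G0 (act k x))"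
        by (rule wnm_cong) (simp_all add: \<gamma>[OF kfib], simp add: act_k)
      moreover have "wnm (fib w) wgt (\<lambda>x. \<gamma> (Q * fst x, Q * snd x)) = wnm (fib w) wgt G0"
        by (rule wnm_cong) (simp_all add: \<gamma>)
      moreover have "wnm (fib w) wgt (\<lambda>x. G0 (act k x)) = wnm (fib w) wgt G0"
        using Sk[of "\<lambda>x. G0 x * G0 x"] by (simp add: wnm_def wip_def mult.assoc)
      moreover have "wnm (fib w) wgt G0 * wnm (fib w) wgt G0 = wip (fib w) wgt G0 G0"
        using wnm_sq[of "fib w" wgt G0] wt_subset[OF wt_W, of "fib w"] by (simp add: power2_eq_square fib_def)
      ultimately show ?thesis by (simp add: mult.assoc)
    qed
    have "\<bar>ip (\<lambda>w. G0 (act k w)) G0\<bar> \<le> (\<Sum>z\<in>zmap ` dom. \<bar>wip {x\<in>dom. zmap x = z} wgt (\<lambda>w. G0 (act k w)) G0\<bar>)"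
      by (subst wip_fibres[OF wtD(1)[OF wt_W], of _ _ _ zmap]) (rule sum_abs)
    also have "\<dots> \<le> (\<Sum>z\<in>zmap ` dom. 2 * \<eta> * wip {x\<in>dom. zmap x = z} wgt G0 G0)"
      using fibre by (intro sum_mono) (auto simp: fib_def)
    also have "\<dots> = 2 * \<eta> * ip G0 G0"
      by (simp add: sum_distrib_left[symmetric] wip_fibres[OF wtD(1)[OF wt_W], of wgt G0 G0 zmap])
    finally show ?thesis using 1 by (simp add: nm_sq)
  qed
  have F: "fixed (lset PS) ?F" and G: "fixed (lset QS) ?G" by (rule fixed_pairing)+
  have a: "\<bar>ip ?F ?G - ip ?F (av hset ?G)\<bar> \<le> 12 / sqrt (real M) * nm ?F * nm ?G"
    by (rule mixing[OF F G])
  \<comment> \<open>Shifting the average to \<open>F\<close> produces a function fixed by the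
    subgroup \<open>h1set\<close>, against which \<open>G\<close> may be replaced by
    \<open>G0\<close>.\<close>
  have fx: "fixed h1set (av hset ?F)"
    using fixed_av[OF sg_U] by (rule fixed_subset) (auto simp: h1set_def)
  have "ip ?F (av hset ?G) = ip (av hset ?F) ?G" by (rule ip_av[OF sg_U, symmetric])
  also have "\<dots> = ip (av hset ?F) G0" unfolding G0_def by (rule ip_av_fixed[OF sg_h1set fx, symmetric])
  finally have b: "ip ?F (av hset ?G) = ip (av hset ?F) G0" .
  have "\<bar>ip (av hset ?F) G0\<bar> \<le> sqrt (1 / real M + 2 * \<eta>) * nm (av hset ?F) * nm G0"
    by (rule almost_orthogonal_translates[of M n])
      (use n_H orth M_pos \<eta> fixed_av[OF sg_U] in \<open>auto simp: fixed_def\<close>)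
  also have "\<dots> \<le> sqrt (1 / real M + 2 * \<eta>) * nm ?F * nm ?G"
    unfolding mult.assoc using nm_av[OF sg_U, of ?F] nm_av[OF sg_h1set, of ?G] nm_nonneg \<eta>
    by (intro mult_left_mono mult_mono) (auto simp: G0_def)
  finally show "\<bar>ip ?F ?G\<bar> \<le> (12 / sqrt (real M) + sqrt (1 / real M + 2 * \<eta>)) * nm ?F * nm ?G"
    using a b by (simp add: distrib_right)
qed

end

section \<open>Matrices with invertible differences\<close>

lemma geometric_sum_bmat: "(1 + x) * (\<Sum>k<n. x ^ k) = 1 + (x :: bmat) ^ n"
  by (induction n) (simp_all add: distrib_left distrib_right add_ac)

lemma of_nat_odd_bmat: "odd n \<Longrightarrow> of_nat n = (1 :: bmat)"
proof -
  have "of_nat (2 * k) = (0 :: bmat)" for k by (simp add: mult_2)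
  then show ?thesis if "odd n" using that by (auto elim!: oddE simp del: of_nat_mult)
qed

text \<open>The difference 1 - \<zeta> of roots of unity divides p, and p = 1 in characteristic 2.
  So differences of powers are units, in any matrix satisfying the cyclotomic equation.\<close>

lemma cyclotomic_differences:
  fixes c :: bmat
  assumes p: "prime p" "odd p" and 0: "(\<Sum>k<p. c ^ k) = 0" and ij: "i < p" "j < p" "i \<noteq> j"
  shows "\<exists>h. is_inv (c ^ i + c ^ j) h"
proof -
  have cp: "c ^ p = 1" using geometric_sum_bmat[of c p] 0 by simp
  have geo: "(\<Sum>l<n. (c ^ a) ^ l) * c ^ b = c ^ b * (\<Sum>l<n. (c ^ a) ^ l)" for n a b
    by (simp add: sum_distrib_left sum_distrib_right power_add[symmetric] power_mult[symmetric] add.commute)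
  define S where "S k = (\<Sum>l<k. c ^ l)" for k
  have Sc: "S k * c = c * S k" for k by (simp add: S_def sum_distrib_left sum_distrib_right power_commutes)
  define T where "T = (\<Sum>k<p. S k)"
  have Tc: "T * c = c * T" by (simp add: T_def sum_distrib_left sum_distrib_right Sc)
  \<comment> \<open>Geometric sums telescope; the powers of \<open>c\<close> add up to 0 and there
    remain p ones, which is 1 as p is odd.\<close>
  have "(1 + c) * T = (\<Sum>k<p. 1 + c ^ k)"
    unfolding T_def sum_distrib_left
    by (rule sum.cong[OF refl]) (simp only: S_def geometric_sum_bmat)
  also have "\<dots> = of_nat p" by (simp add: sum.distrib 0)
  finally have T1: "(1 + c) * T = 1" using of_nat_odd_bmat[OF p(2)] by simp
  have cT: "c * T = T * c" by (simp add: Tc)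
  have inv1: "\<exists>h. is_inv (1 + c ^ k) h" if k: "0 < k" "k < p" for k
  proof -
    have "coprime k p" using p(1) k by (metis coprime_commute nat_dvd_not_less prime_imp_coprime)
    then obtain k' where k': "[k * k' = 1] (mod p)" by (metis One_nat_def cong_solve_coprime_nat)
    then have "(k * k') mod p = 1" using prime_gt_1_nat[OF p(1)] by (simp add: cong_def)
    then obtain q where q: "k * k' = p * q + 1" by (metis mult_div_mod_eq)
    \<comment> \<open>With \<open>k'\<close> inverse to \<open>k\<close> modulo \<open>p\<close>,
      \<open>c\<close> is a power of \<open>c ^ k\<close>, so \<open>1 + c ^ k\<close> divides the
      unit \<open>1 + c\<close>.\<close>
    have ckk: "(c ^ k) ^ k' = c"
      by (simp add: power_mult[symmetric] q power_add power_mult cp)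
    define R where "R = (\<Sum>l<k'. (c ^ k) ^ l)"
    have R: "(1 + c ^ k) * R = 1 + c" unfolding R_def geometric_sum_bmat ckk ..
    have Rc: "R * c ^ k = c ^ k * R" unfolding R_def by (rule geo)
    have Tck: "c ^ k * T = T * c ^ k"
    proof (induction k)
      case (Suc k)
      have "c ^ Suc k * T = c * (c ^ k * T)" by (simp add: mult.assoc)
      also have "\<dots> = c * T * c ^ k" by (simp only: Suc mult.assoc)
      also have "\<dots> = T * c ^ Suc k" by (simp add: cT mult.assoc)
      finally show ?case .
    qed simp
    have "(1 + c ^ k) * (R * T) = 1" using R T1 by (simp flip: mult.assoc)
    moreover have "(R * T) * (1 + c ^ k) = (1 + c ^ k) * (R * T)"
    proof -
      have "R * T * c ^ k = R * c ^ k * T" by (simp only: Tck mult.assoc)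
      also have "\<dots> = c ^ k * (R * T)" by (simp only: Rc mult.assoc)
      finally show ?thesis by (simp add: distrib_left distrib_right)
    qed
    ultimately show ?thesis unfolding is_inv_def by auto
  qed
  have main: "\<exists>h. is_inv (c ^ a + c ^ b) h" if "a < b" "b < p" for a b
  proof -
    have "0 < b - a" "b - a < p" using that by auto
    from inv1[OF this] obtain h where h: "is_inv (1 + c ^ (b - a)) h" by blast
    have "a + (p - a) = p" "p - a + a = p" using that by auto
    then have "is_inv (c ^ a) (c ^ (p - a))" using cp unfolding is_inv_def by (metis power_add)
    from is_inv_mult[OF this h] have "\<exists>h. is_inv (c ^ a * (1 + c ^ (b - a))) h" by blast
    moreover have "c ^ a * (1 + c ^ (b - a)) = c ^ a + c ^ b"
    proof -
      have "c ^ a * c ^ (b - a) = c ^ b" using that by (metis le_add_diff_inverse less_imp_le power_add)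
      then show ?thesis by (simp add: distrib_left)
    qed
    ultimately show ?thesis by simp
  qed
  then show ?thesis using ij by (metis add.commute linorder_neqE_nat)
qed

text \<open>The companion matrix of 1 + x + ... + x^r, acting on \<open>i div 2 ^ d\<close> in
  blocks of length \<open>r\<close> and preserving the low \<open>d\<close> digits; the last column
  of a block consists of ones. Repeating the block over all indices makes the cyclotomic equation
  hold in the whole ring and not just in a corner.\<close>

definition comp_mat :: "nat \<Rightarrow> nat \<Rightarrow> bmat" where
  "comp_mat d r = Abs_bmat (\<lambda>i j. if i mod 2 ^ d = j mod 2 ^ d \<and> i div 2 ^ d div r = j div 2 ^ d div r \<and>
      (j div 2 ^ d mod r < r - 1 \<longrightarrow> i div 2 ^ d mod r = Suc (j div 2 ^ d mod r)) then 1 else 0)"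

context
  fixes d r :: nat
  assumes r: "0 < r"
begin

lemma ent_comp_mat: "ent (comp_mat d r) i j = (if i mod 2 ^ d = j mod 2 ^ d \<and> i div 2 ^ d div r = j div 2 ^ d div r \<and>
      (j div 2 ^ d mod r < r - 1 \<longrightarrow> i div 2 ^ d mod r = Suc (j div 2 ^ d mod r)) then 1 else 0)"
proof -
  have "finite {i. i div 2 ^ d div r = k}" for k
  proof (rule finite_subset)
    show "{i. i div 2 ^ d div r = k} \<subseteq> {..<2 ^ d * r * Suc k}"
    proof safe
      fix i
      have "i < 2 ^ d * r + i div (2 ^ d * r) * (2 ^ d * r)"
        using r by (intro dividend_less_div_times) simp
      then show "i < 2 ^ d * r * Suc (i div 2 ^ d div r)"
        unfolding div_mult2_eq mult_Suc_right by (simp only: mult.commute)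
    qed
  qed simp
  note fin = this
  show ?thesis unfolding comp_mat_def
  proof (subst ent_Abs)
    show "finite {j. (if i mod 2 ^ d = j mod 2 ^ d \<and> i div 2 ^ d div r = j div 2 ^ d div r \<and>
      (j div 2 ^ d mod r < r - 1 \<longrightarrow> i div 2 ^ d mod r = Suc (j div 2 ^ d mod r)) then 1 else 0) \<noteq> (0::bit)}" for i
      by (rule finite_subset[OF _ fin[of "i div 2 ^ d div r"]], rule subsetI) (simp split: if_splits)
    show "finite {i. (if i mod 2 ^ d = j mod 2 ^ d \<and> i div 2 ^ d div r = j div 2 ^ d div r \<and>
      (j div 2 ^ d mod r < r - 1 \<longrightarrow> i div 2 ^ d mod r = Suc (j div 2 ^ d mod r)) then 1 else 0) \<noteq> (0::bit)}" for j
      by (rule finite_subset[OF _ fin[of "j div 2 ^ d div r"]], rule subsetI) (simp split: if_splits)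
  qed simp
qed

text \<open>The powers run from the first basis vector of a block through the whole block, and the
  \<open>r\<close>-th power reaches the column of ones, that is, the sum of the block.\<close>

lemma comp_mat_orbit:
  assumes j0: "j0 div 2 ^ d mod r = 0"
  shows "k < r \<Longrightarrow> comp_mat d r ^ k * mun j0 l = mun (j0 + k * 2 ^ d) l"
    and "comp_mat d r ^ r * mun j0 l = (\<Sum>t<r. mun (j0 + t * 2 ^ d) l)"
proof -
  define J where "J t = j0 + t * 2 ^ d" for t
  define b where "b = j0 div 2 ^ d div r"
  have J0: "J 0 = j0" by (simp add: J_def)
  have Jm: "J t mod 2 ^ d = j0 mod 2 ^ d" for t by (simp add: J_def)
  have q: "j0 div 2 ^ d = r * b" using j0 unfolding b_def by (metis mult_div_mod_eq add_0_right)
  have Jd: "J t div 2 ^ d = r * b + t" for t by (simp add: J_def q)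
  have Jr: "J t div 2 ^ d mod r = t" "J t div 2 ^ d div r = b" if "t < r" for t
    using that unfolding Jd by simp_all
  have uniq: "i = J t" if "i mod 2 ^ d = j0 mod 2 ^ d" "i div 2 ^ d div r = b" "i div 2 ^ d mod r = t" for i t
  proof -
    have "i div 2 ^ d = r * (i div 2 ^ d div r) + i div 2 ^ d mod r" by (rule mult_div_mod_eq[symmetric])
    then have e: "i div 2 ^ d = r * b + t" unfolding that(2,3) .
    have "i = 2 ^ d * (i div 2 ^ d) + i mod 2 ^ d" by (rule mult_div_mod_eq[symmetric])
    then have "i = 2 ^ d * (r * b + t) + j0 mod 2 ^ d" unfolding e that(1) .
    moreover have "j0 = 2 ^ d * (j0 div 2 ^ d) + j0 mod 2 ^ d" by (rule mult_div_mod_eq[symmetric])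
    then have "j0 = 2 ^ d * (r * b) + j0 mod 2 ^ d" unfolding q .
    ultimately show ?thesis unfolding J_def by (simp add: algebra_simps)
  qed
  have ent_J: "ent (comp_mat d r) i (J t) = (if i mod 2 ^ d = j0 mod 2 ^ d \<and> i div 2 ^ d div r = b \<and>
      (t < r - 1 \<longrightarrow> i div 2 ^ d mod r = Suc t) then 1 else 0)" if "t < r" for i t
    unfolding ent_comp_mat by (simp only: Jm Jr[OF that])
  have ck: "comp_mat d r * mun (J t) l = mun (J (Suc t)) l" if "Suc t < r" for t
  proof (rule bmat_eqI)
    fix i j
    have "(i mod 2 ^ d = j0 mod 2 ^ d \<and> i div 2 ^ d div r = b \<and> i div 2 ^ d mod r = Suc t) \<longleftrightarrow> i = J (Suc t)"
      using uniq[of i "Suc t"] Jm[of "Suc t"] Jr[OF that] by blast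
    moreover have "t < r" "t < r - 1" using that by auto
    ultimately have "ent (comp_mat d r) i (J t) = (if i = J (Suc t) then 1 else 0)"
      using ent_J[of t i] by simp
    then show "ent (comp_mat d r * mun (J t) l) i j = ent (mun (J (Suc t)) l) i j"
      by (cases "i = J (Suc t)") (auto simp: ent_mun)
  qed
  have 1: "comp_mat d r ^ k * mun j0 l = mun (J k) l" if "k < r" for k
    using that
  proof (induction k)
    case (Suc k)
    have "comp_mat d r ^ Suc k * mun j0 l = comp_mat d r * (comp_mat d r ^ k * mun j0 l)" by (simp add: mult.assoc)
    also have "\<dots> = comp_mat d r * mun (J k) l" using Suc by simp
    also have "\<dots> = mun (J (Suc k)) l" by (rule ck[OF Suc.prems])
    finally show ?case .
  qed (simp add: J0)
  then show "comp_mat d r ^ k * mun j0 l = mun (j0 + k * 2 ^ d) l" if "k < r" for k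
    using that by (simp add: J_def)
  obtain r' where r': "r = Suc r'" using r by (cases r) auto
  have "comp_mat d r ^ r * mun j0 l = comp_mat d r * (comp_mat d r ^ r' * mun j0 l)"
    unfolding r' by (simp add: mult.assoc)
  also have "\<dots> = comp_mat d r * mun (J r') l" using 1[of r'] by (simp add: r')
  also have "\<dots> = (\<Sum>t<r. mun (J t) l)"
  proof (rule bmat_eqI)
    fix i j
    have ex: "(i mod 2 ^ d = j0 mod 2 ^ d \<and> i div 2 ^ d div r = b) \<longleftrightarrow> (\<exists>t<r. i = J t)"
    proof
      assume "i mod 2 ^ d = j0 mod 2 ^ d \<and> i div 2 ^ d div r = b"
      then have "i = J (i div 2 ^ d mod r)" using uniq by blast
      moreover have "i div 2 ^ d mod r < r" using r by simp
      ultimately show "\<exists>t<r. i = J t" by blast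
    next
      assume "\<exists>t<r. i = J t"
      then show "i mod 2 ^ d = j0 mod 2 ^ d \<and> i div 2 ^ d div r = b" using Jm Jr by blast
    qed
    have "r' < r" "\<not> r' < r - 1" by (simp_all add: r')
    then have "ent (comp_mat d r) i (J r') = (if \<exists>t<r. i = J t then 1 else 0)"
      using ent_J[of r' i] ex by simp
    also have "\<dots> = (\<Sum>t<r. if i = J t then 1 else 0)"
    proof (cases "\<exists>t<r. i = J t")
      case True
      then obtain t where t: "t < r" "i = J t" by blast
      have "(\<Sum>s<r. if i = J s then 1 else (0::bit)) = (\<Sum>s<r. if s = t then 1 else 0)"
        using t Jr(1) by (intro sum.cong refl) (metis lessThan_iff)
      then show ?thesis using t True by simp
    next
      case False
      then have "(\<Sum>t<r. if i = J t then 1 else (0::bit)) = 0" by (intro sum.neutral) auto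
      then show ?thesis using False by simp
    qed
    finally show "ent (comp_mat d r * mun (J r') l) i j = ent (\<Sum>t<r. mun (J t) l) i j"
      by (cases "j = l") (simp_all add: ent_mun ent_sum)
  qed
  finally show "comp_mat d r ^ r * mun j0 l = (\<Sum>t<r. mun (j0 + t * 2 ^ d) l)" by (simp add: J_def)
qed

text \<open>On the first vector of a block, the \<open>r\<close>-th power cancels the sum of the
  lower powers. The remaining vectors of the block are images of the first under powers of the
  matrix, which commute with the polynomial.\<close>

lemma comp_mat_cyclotomic: "(\<Sum>k<Suc r. comp_mat d r ^ k) = 0"
proof -
  let ?c = "comp_mat d r" and ?\<Phi> = "\<Sum>k<Suc r. comp_mat d r ^ k"
  have com: "?\<Phi> * ?c ^ t = ?c ^ t * ?\<Phi>" for t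
    by (simp add: sum_distrib_left sum_distrib_right add.commute del: sum.lessThan_Suc flip: power_add)
  have base: "?\<Phi> * mun j0 l = 0" if "j0 div 2 ^ d mod r = 0" for j0 l
  proof -
    have "?\<Phi> * mun j0 l = (\<Sum>k<r. ?c ^ k * mun j0 l) + ?c ^ r * mun j0 l"
      by (simp add: sum_distrib_right distrib_right)
    also have "\<dots> = (\<Sum>k<r. mun (j0 + k * 2 ^ d) l) + (\<Sum>t<r. mun (j0 + t * 2 ^ d) l)"
      unfolding comp_mat_orbit(2)[OF that] by (intro arg_cong2[where f = "(+)"] sum.cong refl comp_mat_orbit(1)[OF that]) auto
    finally show ?thesis by simp
  qed
  have "?\<Phi> * mun j j = 0" for j
  proof -
    define t where "t = j div 2 ^ d mod r"
    define j0 where "j0 = j - t * 2 ^ d"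
    have tr: "t < r" using r by (simp add: t_def)
    have "t \<le> j div 2 ^ d" by (simp add: t_def)
    then have "t * 2 ^ d \<le> j" by (metis div_times_less_eq_dividend le_trans mult_le_mono1)
    then have j: "j = j0 + t * 2 ^ d" by (simp add: j0_def)
    then have "j div 2 ^ d = j0 div 2 ^ d + t" by simp
    then have "j0 div 2 ^ d = j div 2 ^ d - j div 2 ^ d mod r" by (simp add: t_def)
    then have "j0 div 2 ^ d mod r = 0" by (simp add: minus_mod_eq_mult_div)
    note b = comp_mat_orbit(1)[OF this tr, of j] base[OF this, of j]
    have "?\<Phi> * mun j j = ?\<Phi> * (?c ^ t * mun j0 j)" using b(1) j by simp
    also have "\<dots> = ?c ^ t * (?\<Phi> * mun j0 j)" by (simp only: com flip: mult.assoc)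
    finally show ?thesis using b(2) by simp
  qed
  then have "ent ?\<Phi> i j = 0" for i j
    using ent_mult_mun[of ?\<Phi> j j i j] by (metis ent_0)
  then show ?thesis by (simp only: bmat_eq_0_iff) simp
qed

end

section \<open>Frame systems\<close>

text \<open>Finite sums of elements of \<open>S\<close>, built one summand at a time, so that a
  derivation is a walk in the Cayley graph.\<close>

inductive_set gen :: "'a :: ab_group_add set \<Rightarrow> 'a set" for S where
  gen_0: "0 \<in> gen S"
| gen_add: "x \<in> gen S \<Longrightarrow> s \<in> S \<Longrightarrow> x + s \<in> gen S"

lemma gen_sum: "y \<in> gen S \<Longrightarrow> x \<in> gen S \<Longrightarrow> x + y \<in> gen S"
proof (induction rule: gen.induct)
  case (gen_add z s)
  then have "(x + z) + s \<in> gen S" by (intro gen.gen_add[of "x + z"]) auto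
  then show ?case by (simp add: add.assoc)
qed simp

lemma gen_base: "s \<in> S \<Longrightarrow> s \<in> gen S"
  using gen_add[OF gen_0, of s S] by simp

lemma gen_finite_sum: "(\<And>i. i \<in> I \<Longrightarrow> f i \<in> gen S) \<Longrightarrow> sum f I \<in> gen S"
  by (induction I rule: infinite_finite_induct) (auto intro: gen_0 gen_sum)

lemma gen_image:
  assumes "x \<in> gen S" "\<And>s. s \<in> S \<Longrightarrow> h s \<in> gen T" "h 0 = 0" "\<And>x y. h (x + y) = h x + h y"
  shows "h x \<in> gen T"
  using assms(1) by (induction rule: gen.induct) (auto simp: assms intro: gen_0 gen_sum)

text \<open>A weight on frames (\<open>D\<close> independent row vectors in \<open>\<bbbF>\<^sub>2\<^sup>n\<close>), invariant under change of basis,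
  such that any two further vectors are almost uncorrelated once some of the vectors are fixed.\<close>

definition FS :: "nat \<Rightarrow> nat \<Rightarrow> real \<Rightarrow> (bmat \<Rightarrow> real) \<Rightarrow> bool" where
  "FS n D \<delta> mu \<longleftrightarrow>
     finite {v. mu v \<noteq> 0} \<and> (\<forall>v. 0 \<le> mu v) \<and> (\<exists>v. mu v \<noteq> 0) \<and>
     (\<forall>v. mu v \<noteq> 0 \<longrightarrow> v \<in> corner D n \<and> (\<exists>\<theta>. v * \<theta> = id_mat D)) \<and>
     (\<forall>g\<in>gl D. \<forall>v. mu (g * v) = mu v) \<and>
     (\<forall>j u. Suc j < D \<longrightarrow> mc {v. mu v \<noteq> 0 \<and> id_mat j * v = u} mu (\<lambda>v. dg {j} * v) (\<lambda>v. dg {Suc j} * v) \<delta>) \<and>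
     corner 1 n \<subseteq> gen ((\<lambda>v. dg {0} * v) ` {v. mu v \<noteq> 0})"

lemma exists_permutation:
  assumes K: "K \<subseteq> {..<D}" "i < D" "k < D" "i \<notin> K" "k \<notin> K" "i \<noteq> k"
  obtains \<pi> where "bij \<pi>" "\<And>x. D \<le> x \<Longrightarrow> \<pi> x = x" "\<pi> -` K = {..<card K}" "\<pi> (card K) = i" "\<pi> (Suc (card K)) = k"
proof -
  define j where "j = card K"
  have finK: "finite K" using K finite_subset by blast
  have "card (insert i (insert k K)) \<le> card {..<D}" by (rule card_mono) (use K in auto)
  then have jD: "Suc (Suc j) \<le> D" using K finK by (simp add: j_def)
  obtain e where e: "bij_betw e {..<j} K"
    using finite_same_card_bij[of "{..<j}" K] finK by (auto simp: j_def)
  let ?R = "{..<D} - insert i (insert k K)"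
  have "card ?R = D - Suc (Suc j)"
    using K finK by (subst card_Diff_subset) (auto simp: j_def)
  then obtain r where r: "bij_betw r {Suc (Suc j)..<D} ?R"
    using finite_same_card_bij[of "{Suc (Suc j)..<D}" ?R] by auto
  define \<pi> where "\<pi> x = (if x < j then e x else if x = j then i else if x = Suc j then k
      else if x < D then r x else x)" for x
  have b1: "bij_betw \<pi> {..<j} K" using e by (rule bij_betw_cong[THEN iffD1, rotated]) (auto simp: \<pi>_def)
  have b2: "bij_betw \<pi> {j} {i}" "bij_betw \<pi> {Suc j} {k}" by (simp_all add: \<pi>_def bij_betw_def)
  have b3: "bij_betw \<pi> {Suc (Suc j)..<D} ?R"
    using r by (rule bij_betw_cong[THEN iffD1, rotated]) (auto simp: \<pi>_def)
  have b4: "bij_betw \<pi> {D..} {D..}"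
    using bij_betw_id[of "{D..}"] by (rule bij_betw_cong[THEN iffD1, rotated]) (use jD in \<open>auto simp: \<pi>_def\<close>)
  have "bij_betw \<pi> ({..<j} \<union> {j} \<union> {Suc j} \<union> {Suc (Suc j)..<D} \<union> {D..}) (K \<union> {i} \<union> {k} \<union> ?R \<union> {D..})"
    by (intro bij_betw_combine b1 b2 b3 b4) (use K in auto)
  moreover have "{..<j} \<union> {j} \<union> {Suc j} \<union> {Suc (Suc j)..<D} \<union> {D..} = UNIV" using jD by auto
  moreover have "K \<union> {i} \<union> {k} \<union> ?R \<union> {D..} = UNIV" using K by auto
  ultimately have bij: "bij \<pi>" by simp
  have img: "\<pi> ` {..<j} = K" using b1 by (auto simp: bij_betw_def)
  have "\<pi> -` K = {..<j}"
    unfolding img[symmetric] using bij by (simp add: bij_is_inj inj_vimage_image_eq)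
  moreover have "\<pi> x = x" if "D \<le> x" for x using that jD by (simp add: \<pi>_def)
  ultimately show ?thesis using that[OF bij] by (simp add: \<pi>_def j_def)
qed

context
  fixes n D :: nat and \<delta> :: real and mu :: "bmat \<Rightarrow> real"
  assumes FS: "FS n D \<delta> mu" and \<delta>: "0 \<le> \<delta>"
begin

lemma FS_wt: "wt {v. mu v \<noteq> 0 \<and> P v} mu"
  using FS by (auto simp: FS_def wt_def)

text \<open>Permutation matrices belong to \<open>gl D\<close>, so invariance moves the standard
  position of the definition to arbitrary sets of fixed rows.\<close>

lemma FS_mc:
  assumes K: "K \<subseteq> {..<D}" "i < D" "k < D" "i \<notin> K" "k \<notin> K" "i \<noteq> k"
  shows "mc {v. mu v \<noteq> 0 \<and> dg K * v = u} mu (\<lambda>v. dg {i} * v) (\<lambda>v. dg {k} * v) \<delta>"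
proof -
  obtain \<pi> where \<pi>: "bij \<pi>" "\<And>x. D \<le> x \<Longrightarrow> \<pi> x = x" "\<pi> -` K = {..<card K}" "\<pi> (card K) = i" "\<pi> (Suc (card K)) = k"
    using exists_permutation[OF K] by blast
  let ?p = "pmat \<pi>" and ?j = "card K"
  have inv: "?p * tr ?p = 1" "tr ?p * ?p = 1" using pmat_inv[OF \<pi>(1)] by auto
  have gl: "?p \<in> gl D" using gl_pmat[OF \<pi>(1,2)] by simp
  have gl': "tr ?p \<in> gl D" by (rule gl_tr[OF gl])
  have mup: "mu (?p * v) = mu v" "mu (tr ?p * v) = mu v" for v using FS gl gl' by (auto simp: FS_def)
  have vim: "\<pi> -` {i} = {?j}" "\<pi> -` {k} = {Suc ?j}"
    using \<pi> by (auto simp: bij_is_inj inj_eq)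
  have comK: "?p * dg K = id_mat ?j * ?p" using pmat_dg[OF \<pi>(1), of K] \<pi>(3) by (simp add: id_mat_def)
  have com: "?p * dg {i} = dg {?j} * ?p" "?p * dg {k} = dg {Suc ?j} * ?p"
    using pmat_dg[OF \<pi>(1), of "{i}"] pmat_dg[OF \<pi>(1), of "{k}"] vim by auto
  have "card (insert i (insert k K)) \<le> card {..<D}" by (rule card_mono) (use K in auto)
  then have jD: "Suc ?j < D" using K finite_subset[of K "{..<D}"] by simp
  have iff: "id_mat ?j * (?p * v) = ?p * u \<longleftrightarrow> dg K * v = u" for v
  proof -
    have "id_mat ?j * (?p * v) = ?p * (dg K * v)" using mult_eq_assoc[OF comK[symmetric]] by (simp add: mult.assoc)
    moreover have "?p * a = ?p * b \<longleftrightarrow> a = b" for a b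
      using mult_eq_assoc[OF inv(2)] by (metis mult_1_left)
    ultimately show ?thesis by simp
  qed
  have bij: "bij_betw (\<lambda>v. ?p * v) {v. mu v \<noteq> 0 \<and> dg K * v = u} {v. mu v \<noteq> 0 \<and> id_mat ?j * v = ?p * u}"
  proof (rule bij_betw_byWitness[where f' = "\<lambda>v. tr ?p * v"])
    have r: "?p * (tr ?p * x) = x" "tr ?p * (?p * x) = x" for x
      using mult_eq_assoc[OF inv(1), of x] mult_eq_assoc[OF inv(2), of x] by auto
    show "\<forall>a\<in>{v. mu v \<noteq> 0 \<and> dg K * v = u}. tr ?p * (?p * a) = a"
      "\<forall>a\<in>{v. mu v \<noteq> 0 \<and> id_mat ?j * v = ?p * u}. ?p * (tr ?p * a) = a" using r by auto
    show "(*) ?p ` {v. mu v \<noteq> 0 \<and> dg K * v = u} \<subseteq> {v. mu v \<noteq> 0 \<and> id_mat ?j * v = ?p * u}"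
      using mup iff by auto
    show "(*) (tr ?p) ` {v. mu v \<noteq> 0 \<and> id_mat ?j * v = ?p * u} \<subseteq> {v. mu v \<noteq> 0 \<and> dg K * v = u}"
      using mup iff r by (auto simp flip: iff)
  qed
  have "mc {v. mu v \<noteq> 0 \<and> id_mat ?j * v = ?p * u} mu (\<lambda>v. dg {?j} * v) (\<lambda>v. dg {Suc ?j} * v) \<delta>"
    using FS jD by (simp add: FS_def)
  from mc_reindex[OF this bij] mup
  have "mc {v. mu v \<noteq> 0 \<and> dg K * v = u} mu (\<lambda>v. dg {?j} * (?p * v)) (\<lambda>v. dg {Suc ?j} * (?p * v)) \<delta>" by simp
  then show ?thesis
  proof (rule mc_comp[where \<phi> = "\<lambda>x. tr ?p * x" and \<psi> = "\<lambda>x. tr ?p * x"])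
    have r: "tr ?p * (?p * x) = x" for x using mult_eq_assoc[OF inv(2), of x] by simp
    show "dg {i} * v = tr ?p * (dg {?j} * (?p * v))" for v
      using mult_eq_assoc[OF com(1)[symmetric], of v] r by (simp add: mult.assoc)
    show "dg {k} * v = tr ?p * (dg {Suc ?j} * (?p * v))" for v
      using mult_eq_assoc[OF com(2)[symmetric], of v] r by (simp add: mult.assoc)
  qed
qed

lemma condition_insert:
  assumes "b \<notin> K"
  shows "{w \<in> {v. mu v \<noteq> 0 \<and> dg K * v = u}. dg {b} * w = y} = {} \<or>
    (\<exists>u'. {w \<in> {v. mu v \<noteq> 0 \<and> dg K * v = u}. dg {b} * w = y} = {v. mu v \<noteq> 0 \<and> dg (insert b K) * v = u'})"
proof (cases "{w \<in> {v. mu v \<noteq> 0 \<and> dg K * v = u}. dg {b} * w = y} = {}")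
  case False
  then obtain w where w: "dg K * w = u" "dg {b} * w = y" by auto
  have "dg K * v = dg K * w \<and> dg {b} * v = dg {b} * w \<longleftrightarrow> dg (insert b K) * v = dg (insert b K) * w" for v
    unfolding dg_mult_eq_iff by auto
  then have "{w \<in> {v. mu v \<noteq> 0 \<and> dg K * v = u}. dg {b} * w = y} = {v. mu v \<noteq> 0 \<and> dg (insert b K) * v = dg (insert b K) * w}"
    using w by auto
  then show ?thesis by blast
qed simp

text \<open>The chain rule, adding one row of \<open>B\<close> at a time to the rows conditioned on;
  each step costs \<delta>.\<close>

lemma FS_mc_row:
  assumes "finite B" "B \<subseteq> {..<D}" "K \<subseteq> {..<D}" "i < D" "i \<notin> K" "i \<notin> B" "B \<inter> K = {}"
  shows "mc {v. mu v \<noteq> 0 \<and> dg K * v = u} mu (\<lambda>v. dg {i} * v) (\<lambda>v. dg B * v) (real (card B) * \<delta>)"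
  using assms
proof (induction B arbitrary: K u rule: finite_induct)
  case empty
  then show ?case using mc_const by simp
next
  case (insert b B)
  have "mc {v. mu v \<noteq> 0 \<and> dg K * v = u} mu (\<lambda>v. dg {i} * v) (\<lambda>v. (dg {b} * v, dg B * v)) (\<delta> + real (card B) * \<delta>)"
  proof (rule mc_chain)
    show "mc {v. mu v \<noteq> 0 \<and> dg K * v = u} mu (\<lambda>v. dg {i} * v) (\<lambda>v. dg {b} * v) \<delta>"
      using insert by (intro FS_mc) auto
    fix y
    have "b \<notin> K" using insert by auto
    from condition_insert[OF this, of u y]
    show "mc {w \<in> {v. mu v \<noteq> 0 \<and> dg K * v = u}. dg {b} * w = y} mu (\<lambda>v. dg {i} * v) (\<lambda>v. dg B * v) (real (card B) * \<delta>)"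
    proof
      assume "\<exists>u'. {w \<in> {v. mu v \<noteq> 0 \<and> dg K * v = u}. dg {b} * w = y} = {v. mu v \<noteq> 0 \<and> dg (insert b K) * v = u'}"
      then obtain u' where "{w \<in> {v. mu v \<noteq> 0 \<and> dg K * v = u}. dg {b} * w = y} = {v. mu v \<noteq> 0 \<and> dg (insert b K) * v = u'}"
        by blast
      then show ?thesis using insert.IH[of "insert b K" u'] insert by auto
    qed (simp only: mc_empty)
  qed (use \<delta> FS_wt in auto)
  then have "mc {v. mu v \<noteq> 0 \<and> dg K * v = u} mu (\<lambda>v. dg {i} * v) (\<lambda>v. dg (insert b B) * v) (\<delta> + real (card B) * \<delta>)"
    by (rule mc_comp[where \<phi> = "\<lambda>x. x" and \<psi> = "\<lambda>x. fst x + snd x"])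
      (use insert dg_Un_disjoint[of "{b}" B] in \<open>auto simp: distrib_right\<close>)
  then show ?case using insert by (simp add: algebra_simps)
qed

text \<open>The chain rule once more, now over the rows of \<open>A\<close>; this is where the
  product of the two block sizes comes from.\<close>

lemma FS_mc_block:
  assumes "finite A" "A \<subseteq> {..<D}" "B \<subseteq> {..<D}" "K \<subseteq> {..<D}" "A \<inter> B = {}" "A \<inter> K = {}" "B \<inter> K = {}"
  shows "mc {v. mu v \<noteq> 0 \<and> dg K * v = u} mu (\<lambda>v. dg A * v) (\<lambda>v. dg B * v) (real (card A) * real (card B) * \<delta>)"
  using assms
proof (induction A arbitrary: K u rule: finite_induct)
  case empty
  then show ?case using mc_sym[OF mc_const] by simp
next
  case (insert a A)
  have finB: "finite B" using insert.prems(2) finite_subset[of B "{..<D}"] by auto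
  have "mc {v. mu v \<noteq> 0 \<and> dg K * v = u} mu (\<lambda>v. dg B * v) (\<lambda>v. (dg {a} * v, dg A * v))
     (real (card B) * \<delta> + real (card A) * real (card B) * \<delta>)"
  proof (rule mc_chain)
    show "mc {v. mu v \<noteq> 0 \<and> dg K * v = u} mu (\<lambda>v. dg B * v) (\<lambda>v. dg {a} * v) (real (card B) * \<delta>)"
      by (rule mc_sym, rule FS_mc_row) (use insert finB in auto)
    fix y
    have "a \<notin> K" using insert by auto
    from condition_insert[OF this, of u y]
    show "mc {w \<in> {v. mu v \<noteq> 0 \<and> dg K * v = u}. dg {a} * w = y} mu (\<lambda>v. dg B * v) (\<lambda>v. dg A * v)
      (real (card A) * real (card B) * \<delta>)"
    proof
      assume "\<exists>u'. {w \<in> {v. mu v \<noteq> 0 \<and> dg K * v = u}. dg {a} * w = y} = {v. mu v \<noteq> 0 \<and> dg (insert a K) * v = u'}"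
      then obtain u' where "{w \<in> {v. mu v \<noteq> 0 \<and> dg K * v = u}. dg {a} * w = y} = {v. mu v \<noteq> 0 \<and> dg (insert a K) * v = u'}"
        by blast
      then show ?thesis using mc_sym[OF insert.IH[of "insert a K" u']] insert by auto
    qed (simp only: mc_empty)
  qed (use \<delta> FS_wt in auto)
  then have "mc {v. mu v \<noteq> 0 \<and> dg K * v = u} mu (\<lambda>v. dg B * v) (\<lambda>v. dg (insert a A) * v)
     (real (card B) * \<delta> + real (card A) * real (card B) * \<delta>)"
    by (rule mc_comp[where \<phi> = "\<lambda>x. x" and \<psi> = "\<lambda>x. fst x + snd x"])
      (use insert dg_Un_disjoint[of "{a}" A] in \<open>auto simp: distrib_right\<close>)
  from mc_sym[OF this]
  have "mc {v. mu v \<noteq> 0 \<and> dg K * v = u} mu (\<lambda>v. dg (insert a A) * v) (\<lambda>v. dg B * v)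
     (real (card B) * \<delta> + real (card A) * real (card B) * \<delta>)" .
  moreover have "real (card B) * \<delta> + real (card A) * real (card B) * \<delta> = real (card (insert a A)) * real (card B) * \<delta>"
    using insert(1,2) by (simp add: algebra_simps)
  ultimately show ?case by (simp only:)
qed

end

section \<open>The tensor step\<close>

text \<open>Functions that factor through \<open>\<phi>\<close> have the same weighted sums under
  \<open>m\<close> and under its image \<open>nu\<close>, so a bound proved upstairs descends.
  Positivity of \<open>m\<close> excludes cancellation in the support of \<open>nu\<close>.\<close>

lemma mc_push:
  assumes fin: "finite S" and m: "\<And>x. x \<in> S \<Longrightarrow> 0 < m x"
    and nu: "\<And>w. nu w = (\<Sum>x\<in>{x\<in>S. \<phi> x = w}. m x)"
    and mc: "mc {x\<in>S. P (\<phi> x)} m (\<lambda>x. X (\<phi> x)) (\<lambda>x. Y (\<phi> x)) \<delta>"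
  shows "mc {w. nu w \<noteq> 0 \<and> P w} nu X Y \<delta>"
proof -
  let ?S = "{x\<in>S. P (\<phi> x)}" and ?T = "{w. nu w \<noteq> 0 \<and> P w}"
  have pos: "nu w \<noteq> 0 \<longleftrightarrow> (\<exists>x\<in>S. \<phi> x = w)" for w
  proof -
    have "nu w = 0 \<longleftrightarrow> (\<forall>x\<in>{x\<in>S. \<phi> x = w}. m x = 0)"
      unfolding nu using fin m by (intro sum_nonneg_eq_0_iff) (auto intro: less_imp_le)
    then show ?thesis using m by force
  qed
  have T: "?T = \<phi> ` ?S" using pos by auto
  have S: "(\<Sum>x\<in>?S. m x * h (\<phi> x)) = (\<Sum>w\<in>?T. nu w * h w)" for h
  proof -
    have "(\<Sum>x\<in>?S. m x * h (\<phi> x)) = (\<Sum>w\<in>\<phi> ` ?S. \<Sum>x\<in>{x\<in>?S. \<phi> x = w}. m x * h (\<phi> x))"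
      using fin by (intro sum.image_gen) auto
    also have "\<dots> = (\<Sum>w\<in>?T. nu w * h w)"
      unfolding T[symmetric]
    proof (rule sum.cong[OF refl])
      fix w assume w: "w \<in> ?T"
      then have "{x\<in>?S. \<phi> x = w} = {x\<in>S. \<phi> x = w}" by auto
      then show "(\<Sum>x\<in>{x\<in>?S. \<phi> x = w}. m x * h (\<phi> x)) = nu w * h w"
        unfolding nu by (simp add: sum_distrib_right)
    qed
    finally show ?thesis .
  qed
  have ip: "wip ?S m (\<lambda>x. f (\<phi> x)) (\<lambda>x. g (\<phi> x)) = wip ?T nu f g" for f g
    using S[of "\<lambda>w. f w * g w"] by (simp add: wip_def mult.assoc)
  have nm: "wnm ?S m (\<lambda>x. f (\<phi> x)) = wnm ?T nu f" for f by (simp add: wnm_def ip)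
  show ?thesis unfolding mc_def
  proof (intro allI impI)
    fix f g assume "(\<Sum>w\<in>?T. nu w * f (X w)) = 0" "(\<Sum>w\<in>?T. nu w * g (Y w)) = 0"
    then have "(\<Sum>x\<in>?S. m x * f (X (\<phi> x))) = 0" "(\<Sum>x\<in>?S. m x * g (Y (\<phi> x))) = 0"
      using S[of "\<lambda>w. f (X w)"] S[of "\<lambda>w. g (Y w)"] by auto
    from mcD[OF mc this] show "\<bar>wip ?T nu (\<lambda>w. f (X w)) (\<lambda>w. g (Y w))\<bar> \<le>
       \<delta> * wnm ?T nu (\<lambda>w. f (X w)) * wnm ?T nu (\<lambda>w. g (Y w))"
      using ip[of "\<lambda>w. f (X w)" "\<lambda>w. g (Y w)"] nm[of "\<lambda>w. f (X w)"] nm[of "\<lambda>w. g (Y w)"] by simp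
  qed
qed

lemma ent_Abs_corner:
  "ent (Abs_bmat (\<lambda>i j. if i < a \<and> j < b then f i j else 0)) i j = (if i < a \<and> j < b then f i j else 0)"
proof (subst ent_Abs)
  show "finite {j. (if i < a \<and> j < b then f i j else 0) \<noteq> 0}" for i
    by (rule finite_subset[of _ "{..<b}"]) (auto split: if_splits)
  show "finite {i. (if i < a \<and> j < b then f i j else 0) \<noteq> 0}" for j
    by (rule finite_subset[of _ "{..<a}"]) (auto split: if_splits)
qed simp

text \<open>Row-major vectorisation of an \<open>n\<close> by \<open>n\<close> matrix, placed in row
  0.\<close>

definition flat :: "nat \<Rightarrow> bmat \<Rightarrow> bmat" where
  "flat n A = Abs_bmat (\<lambda>i j. if i < 1 \<and> j < n * n then ent A (j div n) (j mod n) else 0)"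

lemma ent_flat: "ent (flat n A) i j = (if i < 1 \<and> j < n * n then ent A (j div n) (j mod n) else 0)"
  unfolding flat_def by (rule ent_Abs_corner)

lemma flat_add: "flat n (A + B) = flat n A + flat n B"
  by (rule bmat_eqI) (simp add: ent_flat ent_simps)

lemma flat_0: "flat n 0 = 0"
  by (rule bmat_eqI) (simp add: ent_flat ent_simps)

lemma flat_inj:
  assumes "A \<in> corner n n" "B \<in> corner n n" "flat n A = flat n B" shows "A = B"
proof (rule bmat_eqI)
  fix a b
  show "ent A a b = ent B a b"
  proof (cases "a < n \<and> b < n")
    case True
    have "a * n + b < Suc a * n" using True by simp
    also have "\<dots> \<le> n * n" using True by (intro mult_le_mono1) simp
    finally have "a * n + b < n * n" .
    moreover have "(a * n + b) div n = a" "(a * n + b) mod n = b" using True by simp_all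
    moreover have "ent (flat n A) 0 (a * n + b) = ent (flat n B) 0 (a * n + b)" using assms by simp
    ultimately show ?thesis by (simp add: ent_flat)
  next
    case False
    then show ?thesis using assms(1,2) unfolding corner_iff by metis
  qed
qed

lemma sum_pairs: "(\<Sum>j<n * n. f (j div n) (j mod n)) = (\<Sum>a<n. \<Sum>b<(n::nat). (f a b :: bit))"
proof -
  have "(\<Sum>a<n. \<Sum>b<n. f a b) = (\<Sum>(a, b)\<in>{..<n} \<times> {..<n}. f a b)" by (rule sum.cartesian_product)
  also have "\<dots> = (\<Sum>j<n * n. f (j div n) (j mod n))"
  proof (rule sum.reindex_bij_witness[where i = "\<lambda>j. (j div n, j mod n)" and j = "\<lambda>(a, b). a * n + b"])
    fix x assume "x \<in> {..<n} \<times> {..<n}"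
    then obtain a b where x: "x = (a, b)" "a < n" "b < n" by auto
    have "a * n + b < Suc a * n" using x by simp
    also have "\<dots> \<le> n * n" using x by (intro mult_le_mono1) simp
    finally show "(case x of (a, b) \<Rightarrow> a * n + b) \<in> {..<n * n}" using x by simp
  next
    fix j assume "j \<in> {..<n * n}"
    then show "(j div n, j mod n) \<in> {..<n} \<times> {..<n}"
      by (cases "n = 0") (auto simp: less_mult_imp_div_less)
  qed auto
  finally show ?thesis by simp
qed

definition tmat :: "nat \<Rightarrow> nat \<Rightarrow> bmat \<times> bmat \<Rightarrow> bmat" where
  "tmat n d w = (\<Sum>k<d. mun k 0 * flat n (tr (fst w) * dg (bset k) * snd w))"

lemma ent_tmat:
  "ent (tmat n d w) k j = (if k < d \<and> j < n * n then ent (tr (fst w) * dg (bset k) * snd w) (j div n) (j mod n) else 0)"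
proof -
  have "ent (tmat n d w) k j = (\<Sum>l<d. if k = l then ent (flat n (tr (fst w) * dg (bset l) * snd w)) 0 j else 0)"
    unfolding tmat_def by (simp add: ent_sum)
  then show ?thesis by (simp add: ent_flat)
qed

lemma row_tmat: "k < d \<Longrightarrow> dg {k} * tmat n d w = mun k 0 * flat n (tr (fst w) * dg (bset k) * snd w)"
  by (rule bmat_eqI) (auto simp: ent_tmat ent_flat)

lemma corner_sandwich: "v \<in> corner D n \<Longrightarrow> \<xi> \<in> corner D n \<Longrightarrow> tr v * A * \<xi> \<in> corner n n"
proof -
  assume v: "v \<in> corner D n" and \<xi>: "\<xi> \<in> corner D n"
  have "tr v = tr (v * id_mat n)" using v by (simp add: corner_def del: tr_mult)
  also have "\<dots> = id_mat n * tr v" by (simp add: id_mat_def)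
  finally have "id_mat n * (tr v * A * \<xi>) = tr v * A * \<xi>" by (metis mult.assoc)
  moreover have "tr v * A * \<xi> * id_mat n = tr v * A * \<xi>" using \<xi> by (simp add: corner_def mult.assoc)
  ultimately show ?thesis by (simp add: corner_def)
qed

definition bitcol :: "nat \<Rightarrow> nat \<Rightarrow> bmat" where
  "bitcol d i = Abs_bmat (\<lambda>k l. if k < d \<and> l < 1 then of_bool (bit i k) else 0)"

lemma ent_bitcol: "ent (bitcol d i) k l = (if k < d \<and> l < 1 then of_bool (bit i k) else 0)"
  unfolding bitcol_def by (rule ent_Abs_corner)

definition bitnum :: "nat \<Rightarrow> bmat \<Rightarrow> nat" where
  "bitnum d x = horner_sum of_bool 2 (map (\<lambda>k. ent x k 0 \<noteq> 0) [0..<d])"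

lemma bit_bitnum: "bit (bitnum d x) k \<longleftrightarrow> k < d \<and> ent x k 0 \<noteq> 0"
  by (auto simp: bitnum_def bit_horner_sum_bit_iff)

lemma bitnum_less: "bitnum d x < 2 ^ d"
proof -
  have "take_bit d (bitnum d x) = bitnum d x"
    by (rule bit_eqI) (auto simp: bit_take_bit_iff bit_bitnum)
  then show ?thesis by (simp add: take_bit_nat_eq_self_iff)
qed

lemma bit_low: "k < d \<Longrightarrow> bit (a + 2 ^ d * b) k \<longleftrightarrow> bit (a :: nat) k"
proof -
  assume "k < d"
  have "take_bit d (a + 2 ^ d * b) = take_bit d a" by (simp add: take_bit_eq_mod)
  then show ?thesis using \<open>k < d\<close> by (metis bit_take_bit_iff)
qed

text \<open>Applies \<open>g\<close> to the low \<open>d\<close> digits, read as a vector over F_2,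
  and keeps the higher part of the index. This permutation of old indices realises a change of basis
  among the new vectors.\<close>

definition bitperm :: "nat \<Rightarrow> nat \<Rightarrow> bmat \<Rightarrow> nat \<Rightarrow> nat" where
  "bitperm d D g i = (if i < D then bitnum d (g * bitcol d i) + 2 ^ d * (i div 2 ^ d) else i)"

lemma bitcol_bitperm:
  assumes "g \<in> gl d" "i < D" shows "bitcol d (bitperm d D g i) = g * bitcol d i"
proof (rule bmat_eqI)
  fix k l
  have c: "g * bitcol d i \<in> corner d 1"
  proof -
    have "id_mat d * bitcol d i = bitcol d i" "bitcol d i * id_mat 1 = bitcol d i"
      unfolding id_mat_def dg_mult_fix mult_dg_fix by (auto simp: ent_bitcol split: if_splits)
    then have "id_mat d * (g * bitcol d i) = g * bitcol d i"
      using mult_eq_assoc[OF gl_id_mat[OF assms(1), symmetric], of "bitcol d i"] by (simp add: mult.assoc)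
    then show ?thesis using \<open>bitcol d i * id_mat 1 = bitcol d i\<close> by (simp add: corner_def mult.assoc)
  qed
  show "ent (bitcol d (bitperm d D g i)) k l = ent (g * bitcol d i) k l"
  proof (cases "k < d \<and> l < 1")
    case True
    then have "bit (bitperm d D g i) k \<longleftrightarrow> ent (g * bitcol d i) k l \<noteq> 0"
      using assms by (simp add: bitperm_def bit_low bit_bitnum)
    then show ?thesis using True by (simp add: ent_bitcol) (metis bit_1_iff)
  next
    case False
    then have "ent (g * bitcol d i) k l = 0" using c unfolding corner_iff by metis
    then show ?thesis using False by (auto simp: ent_bitcol)
  qed
qed

lemma bitperm_div: "i < D \<Longrightarrow> bitperm d D g i div 2 ^ d = i div 2 ^ d"
  using bitnum_less[of d] by (simp add: bitperm_def)

lemma nat_eq_bits: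
  assumes "bitcol d i = bitcol d j" "i div 2 ^ d = j div 2 ^ d" shows "i = j"
proof -
  have "bit i k \<longleftrightarrow> bit j k" if "k < d" for k
    using arg_cong[where f = "\<lambda>A. ent A k 0", OF assms(1)] that by (auto simp: ent_bitcol)
  then have "take_bit d i = take_bit d j" by (intro bit_eqI) (auto simp: bit_take_bit_iff)
  then have "i mod 2 ^ d = j mod 2 ^ d" by (simp add: take_bit_eq_mod)
  then show ?thesis using assms(2) by (metis div_mult_mod_eq)
qed

text \<open>As \<open>D\<close> is a multiple of \<open>2 ^ d\<close>, changing low digits never
  leaves \<open>{..<D}\<close>, so the rule below \<open>D\<close> fits the identity above
  it.\<close>

lemma bitperm_inverse:
  assumes "g \<in> gl d" "h \<in> gl d" "h * g = 1" "D = 2 ^ d * r" shows "bitperm d D h (bitperm d D g i) = i"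
proof (cases "i < D")
  case True
  have lt: "bitperm d D g i < D"
  proof -
    have "bitperm d D g i div 2 ^ d < r"
      unfolding bitperm_div[OF True] using True assms(4) by (simp add: less_mult_imp_div_less mult.commute)
    then show ?thesis unfolding assms(4) by (metis div_less_iff_less_mult mult.commute pos2 zero_less_power)
  qed
  show ?thesis
  proof (rule nat_eq_bits[of d])
    show "bitcol d (bitperm d D h (bitperm d D g i)) = bitcol d i"
      using bitcol_bitperm[OF assms(2) lt] bitcol_bitperm[OF assms(1) True] mult_eq_assoc[OF assms(3)] by simp
    show "bitperm d D h (bitperm d D g i) div 2 ^ d = i div 2 ^ d"
      using bitperm_div[OF lt] bitperm_div[OF True] by simp
  qed
qed (simp add: bitperm_def)

lemma flip_bits:
  assumes "k < d"
  shows "flip_bit k (i::nat) div 2 ^ d = i div 2 ^ d" "bit (flip_bit k i) l \<longleftrightarrow> (if l = k then \<not> bit i l else bit i l)"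
    "flip_bit k (flip_bit k i) = i"
proof -
  show b: "bit (flip_bit k i) l \<longleftrightarrow> (if l = k then \<not> bit i l else bit i l)" for i :: nat and l
    by (auto simp: bit_flip_bit_iff)
  have "drop_bit d (flip_bit k i) = drop_bit d i"
    by (rule bit_eqI) (use assms in \<open>auto simp: bit_drop_bit_eq b\<close>)
  then show "flip_bit k i div 2 ^ d = i div 2 ^ d" by (simp add: drop_bit_eq_div)
  show "flip_bit k (flip_bit k i) = i" by (rule bit_eqI) (auto simp: b)
qed

lemma mod_eq_bits: "(i::nat) mod 2 ^ d = j mod 2 ^ d \<longleftrightarrow> (\<forall>k<d. bit i k \<longleftrightarrow> bit j k)"
proof -
  have "take_bit d i = take_bit d j \<longleftrightarrow> (\<forall>k<d. bit i k \<longleftrightarrow> bit j k)"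
    by (auto simp: bit_eq_iff bit_take_bit_iff)
  then show ?thesis by (simp add: take_bit_eq_mod)
qed

lemma dg_preserves: "(\<And>i j. ent X i j \<noteq> 0 \<Longrightarrow> i \<in> S \<longleftrightarrow> j \<in> S) \<Longrightarrow> X * dg S = dg S * X"
  unfolding dg_intertwine by blast

lemma comp_mat_entry:
  assumes "0 < r" "ent (comp_mat d r) i j \<noteq> 0"
  shows "i mod 2 ^ d = j mod 2 ^ d" "i div 2 ^ d div r = j div 2 ^ d div r"
  using assms(2) by (auto simp: ent_comp_mat[OF assms(1)] split: if_splits)

lemma less_block: "0 < r \<Longrightarrow> i < 2 ^ d * r \<longleftrightarrow> i div 2 ^ d div r = (0::nat)"
  by (simp add: div_eq_0_iff flip: div_mult2_eq)

text \<open>The companion matrix only tests whether the low digits agree and otherwise looks at the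
  higher part. Flipping a low digit on both sides preserves both.\<close>

lemma comp_mat_flip:
  assumes r: "0 < r" and k: "k < d"
  shows "comp_mat d r * pmat (flip_bit k) = pmat (flip_bit k) * comp_mat d r"
    and "tr (pmat (flip_bit k)) = pmat (flip_bit k)" "bij (flip_bit k :: nat \<Rightarrow> nat)"
proof -
  let ?f = "flip_bit k :: nat \<Rightarrow> nat" and ?s = "pmat (flip_bit k)" and ?c = "comp_mat d r"
  have inv: "?f (?f i) = i" for i using flip_bits(3)[OF k] .
  then show bij: "bij ?f" by (metis bij_betw_def inj_on_inverseI surjI)
  show sym: "tr ?s = ?s"
    by (rule bmat_eqI) (use inv in \<open>auto simp: ent_pmat[OF bij]\<close>)
  show "?c * ?s = ?s * ?c"
  proof (rule bmat_eqI)
    fix i j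
    have "ent (?c * ?s) i j = ent (tr (?c * ?s)) j i" by (simp only: ent_tr)
    also have "\<dots> = ent (?s * tr ?c) j i" by (simp add: sym)
    also have "\<dots> = ent ?c i (?f j)" by (simp add: ent_pmat_mult[OF bij])
    finally have 1: "ent (?c * ?s) i j = ent ?c i (?f j)" .
    have 2: "ent (?s * ?c) i j = ent ?c (?f i) j" by (simp add: ent_pmat_mult[OF bij])
    have "i mod 2 ^ d = ?f j mod 2 ^ d \<longleftrightarrow> ?f i mod 2 ^ d = j mod 2 ^ d"
      unfolding mod_eq_bits flip_bits(2)[OF k] by (rule all_cong) auto
    then show "ent (?c * ?s) i j = ent (?s * ?c) i j"
      unfolding 1 2 ent_comp_mat[OF r] by (simp add: flip_bits(1)[OF k])
  qed
qed

section \<open>The tensor of two frames as a new frame system\<close>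

context
  fixes n d r D :: nat and \<delta> :: real and mu :: "bmat \<Rightarrow> real"
  assumes FS: "FS n D \<delta> mu" and \<delta>: "0 \<le> \<delta>" and D: "D = 2 ^ d * r" and p: "prime (Suc r)" "odd (Suc r)" and d: "1 \<le> d"
begin

definition tS :: "(bmat \<times> bmat) set" where "tS = {v. mu v \<noteq> 0} \<times> {v. mu v \<noteq> 0}"

definition tm :: "bmat \<times> bmat \<Rightarrow> real" where "tm x = mu (fst x) * mu (snd x)"

definition tnu :: "bmat \<Rightarrow> real" where "tnu w = (\<Sum>x\<in>{x\<in>tS. tmat n d x = w}. tm x)"

lemma r_pos: "0 < r" using p by (metis gr0I One_nat_def not_prime_1)

lemma tS_finite: "finite tS" using FS by (simp add: tS_def FS_def)

lemma tm_pos: "x \<in> tS \<Longrightarrow> 0 < tm x"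
  using FS by (auto simp: tS_def tm_def FS_def less_le)

lemma tnu_supp: "tnu w \<noteq> 0 \<longleftrightarrow> (\<exists>x\<in>tS. tmat n d x = w)"
proof -
  have "tnu w = 0 \<longleftrightarrow> (\<forall>x\<in>{x\<in>tS. tmat n d x = w}. tm x = 0)"
    unfolding tnu_def using tS_finite tm_pos by (intro sum_nonneg_eq_0_iff) (auto intro: less_imp_le)
  then show ?thesis using tm_pos by force
qed

lemma tS_D:
  assumes "x \<in> tS"
  shows "mu (fst x) \<noteq> 0" "mu (snd x) \<noteq> 0" "fst x \<in> corner D n" "snd x \<in> corner D n"
    "id_mat D * fst x = fst x" "id_mat D * snd x = snd x"
  using assms FS by (auto simp: tS_def FS_def corner_def)

lemma tpair_corner: "x \<in> tS \<Longrightarrow> tr (fst x) * A * snd x \<in> corner n n"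
  using tS_D corner_sandwich by blast

text \<open>Passing to pairs of frames by \<open>mc_push\<close>, fixing the first \<open>m\<close>
  rows of the tensor means fixing \<open>m\<close> matrices, which is the situation of
  \<open>tensor_link\<close> with powers of the companion matrix and the flip of digit
  \<open>Suc m\<close>. There are \<open>Suc r\<close> powers, the prime of the cyclotomic
  equation.\<close>

lemma tensor_step_mc:
  assumes m: "Suc m < d"
  shows "mc {w. tnu w \<noteq> 0 \<and> id_mat m * w = u} tnu (\<lambda>w. dg {m} * w) (\<lambda>w. dg {Suc m} * w)
    (12 / sqrt (real (Suc r)) + sqrt (1 / real (Suc r) + 2 * (real D * real D * \<delta>)))"
proof (rule mc_push[OF tS_finite tm_pos tnu_def])
  show "mc {x \<in> tS. id_mat m * tmat n d x = u} tm (\<lambda>x. dg {m} * tmat n d x) (\<lambda>x. dg {Suc m} * tmat n d x)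
     (12 / sqrt (real (Suc r)) + sqrt (1 / real (Suc r) + 2 * (real D * real D * \<delta>)))" (is "mc ?W _ _ _ ?\<delta>'")
  proof (cases "?W = {}")
    case False
    then obtain x0 where x0: "x0 \<in> tS" "id_mat m * tmat n d x0 = u" by auto
    \<comment> \<open>The fibre is nonempty here, and any of its elements supplies the prescribed
      matrices, since \<open>flat\<close> is injective on them.\<close>
    define cst where "cst l = tr (fst x0) * dg (bset l) * snd x0" for l
    define tau where "tau i = comp_mat d r ^ i" for i
    define s where "s = pmat (flip_bit (Suc m) :: nat \<Rightarrow> nat)"
    note flip = comp_mat_flip[OF r_pos m]
    have bit_mod: "bit i l \<longleftrightarrow> bit j l" if "ent (comp_mat d r) i j \<noteq> 0" "l < d" for i j l
      using comp_mat_entry(1)[OF r_pos that(1)] that(2) unfolding mod_eq_bits by blast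
    have cD: "comp_mat d r * id_mat D = id_mat D * comp_mat d r"
      unfolding id_mat_def D
      by (rule dg_preserves) (simp add: less_block[OF r_pos] comp_mat_entry(2)[OF r_pos])
    have cb: "comp_mat d r * dg (bset l) = dg (bset l) * comp_mat d r" if "l < d" for l
      by (rule dg_preserves) (use bit_mod that in \<open>auto simp: bset_def\<close>)
    have s_ent: "ent s i j \<noteq> 0 \<Longrightarrow> j = flip_bit (Suc m) i" for i j
      by (auto simp: s_def ent_pmat[OF flip(3)] split: if_splits)
    interpret tensor_link D m "Suc r" mu cst tau s
    proof
      show "finite {v. mu v \<noteq> 0}" "\<And>v. 0 \<le> mu v" "\<And>v. mu v \<noteq> 0 \<Longrightarrow> id_mat D * v = v"
        "\<And>v. mu v \<noteq> 0 \<Longrightarrow> \<exists>\<theta>. v * \<theta> = id_mat D" "\<And>g v. g \<in> gl D \<Longrightarrow> mu (g * v) = mu v"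
        using FS by (auto simp: FS_def corner_def)
      show "tau i * id_mat D = id_mat D * tau i" for i
        unfolding tau_def using cD by (rule power_commuting_commutes)
      show "tau i * dg (bset l) = dg (bset l) * tau i" if "l \<le> Suc m" for i l
        unfolding tau_def by (rule power_commuting_commutes[OF cb]) (use that m in simp)
      show "tau i * s = s * tau i" for i
        unfolding tau_def s_def using flip(1) by (rule power_commuting_commutes)
      show "tau i * tau j = tau j * tau i" for i j
        by (simp add: tau_def add.commute flip: power_add)
      show "\<exists>h. is_inv (tau i + tau j) h" if "i < Suc r" "j < Suc r" "i \<noteq> j" for i j
        unfolding tau_def by (rule cyclotomic_differences[OF p comp_mat_cyclotomic[OF r_pos] that])
      show "s * s = 1" using pmat_inv(1)[OF flip(3)] by (simp add: s_def flip(2))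
      show "tr s = s" by (simp add: s_def flip(2))
      show "s * id_mat D = id_mat D * s"
        unfolding id_mat_def D
        by (rule dg_preserves) (auto simp: less_block[OF r_pos] flip_bits(1)[OF m] dest!: s_ent)
      show "s * dg (bset l) = dg (bset l) * s" if "l \<le> m" for l
        by (rule dg_preserves) (use that in \<open>auto simp: bset_def flip_bits(2)[OF m] dest!: s_ent\<close>)
      show "s * dg (bset (Suc m)) = dg (- bset (Suc m)) * s"
        unfolding dg_intertwine by (auto simp: bset_def flip_bits(2)[OF m] dest!: s_ent)
    qed (use r_pos in auto)
    have W: "?W = dom"
    proof -
      have "id_mat m * tmat n d x = u \<longleftrightarrow> (\<forall>l<m. tr (fst x) * dg (bset l) * snd x = cst l)" if x: "x \<in> tS" for x
      proof
        assume a: "id_mat m * tmat n d x = u"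
        show "\<forall>l<m. tr (fst x) * dg (bset l) * snd x = cst l"
        proof (intro allI impI)
          fix l assume l: "l < m"
          have "dg {l} * (id_mat m * tmat n d x) = dg {l} * (id_mat m * tmat n d x0)" using a x0 by simp
          moreover have "{l} \<inter> {..<m} = {l}" using l by auto
          ultimately have "dg {l} * tmat n d x = dg {l} * tmat n d x0" by (simp add: id_mat_def)
          then have "mun 0 l * (mun l 0 * flat n (tr (fst x) * dg (bset l) * snd x)) = mun 0 l * (mun l 0 * flat n (cst l))"
            using l m by (simp add: row_tmat cst_def)
          then have "mun 0 0 * flat n (tr (fst x) * dg (bset l) * snd x) = mun 0 0 * flat n (cst l)"
            by (simp flip: mult.assoc)
          moreover have "mun 0 0 * flat n A = flat n A" for A by (rule bmat_eqI) (auto simp: ent_flat)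
          ultimately show "tr (fst x) * dg (bset l) * snd x = cst l"
            using flat_inj[OF tpair_corner[OF x] tpair_corner[OF x0(1)]] by (simp add: cst_def)
        qed
      next
        assume "\<forall>l<m. tr (fst x) * dg (bset l) * snd x = cst l"
        then have "id_mat m * tmat n d x = id_mat m * tmat n d x0"
          by (intro bmat_eqI) (simp add: id_mat_def ent_tmat cst_def)
        then show "id_mat m * tmat n d x = u" using x0 by simp
      qed
      then have "x \<in> ?W \<longleftrightarrow> x \<in> tS \<and> (\<forall>l<m. tr (fst x) * dg (bset l) * snd x = cst l)" for x by blast
      moreover have "x \<in> tS \<and> (\<forall>l<m. tr (fst x) * dg (bset l) * snd x = cst l) \<longleftrightarrow> x \<in> dom" for x
        by (cases x) (auto simp: mem_dom tS_def)
      ultimately show ?thesis by blast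
    qed
    \<comment> \<open>The input of \<open>tensor_mc\<close> on the zero cell comes from the old
      frame system, with all rows outside the zero cell fixed; both block sizes are estimated by
      \<open>D\<close>.\<close>
    have blk: "mc {v. mu v \<noteq> 0 \<and> dg (- ZS) * v = \<zeta>} mu (\<lambda>v. dg (ZS \<inter> QS) * v) (\<lambda>v. dg (ZS - QS) * v) (real D * real D * \<delta>)" for \<zeta>
    proof -
      let ?K = "{..<D} - ZS" and ?A = "ZS \<inter> QS" and ?B = "ZS - QS"
      have sub: "ZS \<subseteq> {..<D}" by (rule ZS_sub)
      have "dg (- ZS) * v = dg ?K * v" if "mu v \<noteq> 0" for v
      proof -
        have "dg (- ZS) * v = dg (- ZS) * (id_mat D * v)" using that FS by (auto simp: FS_def corner_def)
        also have "\<dots> = dg (- ZS \<inter> {..<D}) * v" by (simp add: id_mat_def)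
        also have "- ZS \<inter> {..<D} = ?K" by auto
        finally show ?thesis .
      qed
      then have a: "{v. mu v \<noteq> 0 \<and> dg (- ZS) * v = \<zeta>} = {v. mu v \<noteq> 0 \<and> dg ?K * v = \<zeta>}" by auto
      have b: "mc {v. mu v \<noteq> 0 \<and> dg ?K * v = \<zeta>} mu (\<lambda>v. dg ?A * v) (\<lambda>v. dg ?B * v) (real (card ?A) * real (card ?B) * \<delta>)"
        by (rule FS_mc_block[OF FS \<delta>]) (use sub finite_subset[OF sub] in auto)
      have c: "real (card ?A) * real (card ?B) * \<delta> \<le> real D * real D * \<delta>"
      proof -
        have "card ?A \<le> card {..<D}" "card ?B \<le> card {..<D}" by (rule card_mono; use sub in auto)+
        then show ?thesis using \<delta> by (intro mult_right_mono mult_mono) auto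
      qed
      show ?thesis unfolding a by (rule mc_mono[OF b c FS_wt[OF FS \<delta>]])
    qed
    have "mc dom wgt (pairing PS) (pairing QS) ?\<delta>'"
      using tensor_mc[OF blk] \<delta> by simp
    moreover have "wgt = tm" by (rule ext) (simp add: wgt_def tm_def)
    ultimately have "mc ?W tm (pairing PS) (pairing QS) ?\<delta>'" by (simp only: W)
    then show ?thesis
    proof (rule mc_comp[where \<phi> = "\<lambda>X. mun m 0 * flat n X" and \<psi> = "\<lambda>X. mun (Suc m) 0 * flat n X"])
      fix x assume "x \<in> ?W"
      then have x: "x \<in> tS" by simp
      have e: "dg ({..<D} \<inter> S) * snd x = dg S * snd x" for S
      proof -
        have "dg S * snd x = dg S * (id_mat D * snd x)" using tS_D(6)[OF x] by simp
        then show ?thesis by (simp add: id_mat_def Int_commute)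
      qed
      show "dg {m} * tmat n d x = mun m 0 * flat n (pairing PS x)"
        using m e by (simp add: row_tmat pairing_def PS_def mult.assoc)
      show "dg {Suc m} * tmat n d x = mun (Suc m) 0 * flat n (pairing QS x)"
        using m e by (simp add: row_tmat pairing_def QS_def mult.assoc)
    qed
  next
    case True
    then show ?thesis by (simp only: mc_empty)
  qed
qed

text \<open>A change of basis of the new vectors is undone by permuting the rows of both old frames,
  under which the old weight is invariant.\<close>

lemma tensor_step_gl:
  assumes g: "g \<in> gl d" shows "tnu (g * w) = tnu w"
proof -
  define \<pi> where "\<pi> = bitperm d D g"
  have ginv: "is_inv g (uinv g)" "uinv g \<in> gl d" using gl_is_inv[OF g] gl_uinv[OF g] by auto
  have bij: "bij \<pi>"
    by (rule o_bij[of "bitperm d D (uinv g)"])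
      (use bitperm_inverse[OF ginv(2) g _ D] bitperm_inverse[OF g ginv(2) _ D] ginv in
        \<open>auto simp: \<pi>_def fun_eq_iff is_inv_def\<close>)
  have fix_ge: "\<pi> i = i" if "D \<le> i" for i using that by (simp add: \<pi>_def bitperm_def)
  define Q where "Q = tr (pmat \<pi>)"
  have Qgl: "Q \<in> gl D" "tr Q \<in> gl D" unfolding Q_def using gl_tr[OF gl_pmat[OF bij fix_ge]] gl_pmat[OF bij fix_ge] by simp_all
  have QQ: "tr Q * Q = 1" "Q * tr Q = 1" using pmat_inv[OF bij] by (auto simp: Q_def)
  define \<Phi> where "\<Phi> x = (Q * fst x, Q * snd x)" for x :: "bmat \<times> bmat"
  have muQ: "mu (Q * v) = mu v" "mu (tr Q * v) = mu v" for v using FS Qgl by (auto simp: FS_def)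
  have bij\<Phi>: "bij_betw \<Phi> tS tS"
    by (rule bij_betw_byWitness[where f' = "\<lambda>x. (tr Q * fst x, tr Q * snd x)"])
      (auto simp: \<Phi>_def tS_def muQ mult_eq_assoc[OF QQ(1)] mult_eq_assoc[OF QQ(2)])
  have tm\<Phi>: "tm (\<Phi> x) = tm x" for x by (simp add: tm_def \<Phi>_def muQ)
  have t\<Phi>: "tmat n d (\<Phi> x) = g * tmat n d x" if x: "x \<in> tS" for x
  proof (rule bmat_eqI)
    fix k j
    show "ent (tmat n d (\<Phi> x)) k j = ent (g * tmat n d x) k j"
    proof (cases "k < d")
      case False
      have "id_mat d * tmat n d x = tmat n d x"
        unfolding id_mat_def dg_mult_fix by (auto simp: ent_tmat split: if_splits)
      then have "id_mat d * (g * tmat n d x) = g * tmat n d x"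
        using mult_eq_assoc[OF gl_id_mat[OF g, symmetric], of "tmat n d x"] by (simp add: mult.assoc)
      then have "ent (g * tmat n d x) k j = 0" using False unfolding id_mat_def dg_mult_fix by blast
      then show ?thesis using False by (simp add: ent_tmat)
    next
      case True
      define L where "L = {l. l < d \<and> ent g k l \<noteq> 0}"
      \<comment> \<open>Digit \<open>k\<close> of the permuted index is the F_2-sum of the digits in
        \<open>L\<close> of the old one. Digits are the diagonal entries of the projections, so the
        projections obey the same linear relation modulo 2.\<close>
      have key: "dg (\<pi> -` bset k) * id_mat D = (\<Sum>l\<in>L. dg (bset l) * id_mat D)"
      proof (rule bmat_eqI)
        fix a b
        show "ent (dg (\<pi> -` bset k) * id_mat D) a b = ent (\<Sum>l\<in>L. dg (bset l) * id_mat D) a b"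
        proof (cases "a = b \<and> a < D")
          case ab: True
          have "ent (g * bitcol d a) k 0 = (\<Sum>l<d. ent g k l * ent (bitcol d a) l 0)"
            by (rule ent_mult) (auto simp: ent_bitcol split: if_splits)
          also have "\<dots> = (\<Sum>l<d. if ent g k l \<noteq> 0 then of_bool (bit a l) else 0)"
            by (intro sum.cong refl) (auto simp: ent_bitcol bit_1_iff[symmetric])
          also have "\<dots> = (\<Sum>l\<in>L. of_bool (bit a l))"
            unfolding L_def by (subst sum.inter_filter[symmetric]) (auto intro!: sum.cong)
          finally have "ent (bitcol d (\<pi> a)) k 0 = (\<Sum>l\<in>L. of_bool (bit a l))"
            using bitcol_bitperm[OF g, of a D] ab by (simp add: \<pi>_def)
          then have "of_bool (bit (\<pi> a) k) = (\<Sum>l\<in>L. of_bool (bit a l) :: bit)" using True by (simp add: ent_bitcol)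
          moreover have "ent (dg (\<pi> -` bset k) * id_mat D) a b = of_bool (bit (\<pi> a) k)"
            using ab by (simp add: id_mat_def ent_dg bset_def)
          moreover have "ent (dg (bset l) * id_mat D) a b = of_bool (bit a l)" for l
            using ab by (simp add: id_mat_def ent_dg bset_def)
          ultimately show ?thesis by (simp add: ent_sum)
        next
          case False
          then show ?thesis by (auto simp: ent_sum id_mat_def ent_dg intro!: sum.neutral sum.neutral[symmetric])
        qed
      qed
      have "tr (Q * fst x) * dg (bset k) * (Q * snd x) = tr (fst x) * (pmat \<pi> * dg (bset k) * tr (pmat \<pi>)) * snd x"
        by (simp add: Q_def mult.assoc)
      also have "pmat \<pi> * dg (bset k) * tr (pmat \<pi>) = dg (\<pi> -` bset k)"
        unfolding pmat_dg[OF bij] by (simp add: mult.assoc pmat_inv[OF bij])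
      also have "tr (fst x) * dg (\<pi> -` bset k) * snd x = tr (fst x) * (dg (\<pi> -` bset k) * id_mat D) * snd x"
        using tS_D(6)[OF x] by (simp add: mult.assoc)
      also have "\<dots> = (\<Sum>l\<in>L. tr (fst x) * dg (bset l) * snd x)"
        unfolding key using tS_D(6)[OF x] by (simp add: sum_distrib_left sum_distrib_right mult.assoc)
      finally have eq: "tr (fst (\<Phi> x)) * dg (bset k) * snd (\<Phi> x) = (\<Sum>l\<in>L. tr (fst x) * dg (bset l) * snd x)"
        by (simp add: \<Phi>_def)
      have "ent (g * tmat n d x) k j = (\<Sum>l<d. ent g k l * ent (tmat n d x) l j)"
        by (rule ent_mult) (auto simp: ent_tmat split: if_splits)
      also have "\<dots> = (\<Sum>l<d. if ent g k l \<noteq> 0 then ent (tmat n d x) l j else 0)"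
        by (intro sum.cong refl) (metis bit_1_iff mult_1_left mult_zero_left)
      also have "\<dots> = (\<Sum>l\<in>L. ent (tmat n d x) l j)"
        unfolding L_def by (subst sum.inter_filter[symmetric]) (auto intro!: sum.cong)
      finally have "ent (g * tmat n d x) k j = (\<Sum>l\<in>L. ent (tmat n d x) l j)" .
      moreover have "(\<Sum>l\<in>L. ent (tmat n d x) l j) =
          (if j < n * n then (\<Sum>l\<in>L. ent (tr (fst x) * dg (bset l) * snd x) (j div n) (j mod n)) else 0)"
        by (auto simp: ent_tmat L_def intro!: sum.cong sum.neutral)
      moreover have "ent (tmat n d (\<Phi> x)) k j = (if j < n * n then ent (\<Sum>l\<in>L. tr (fst x) * dg (bset l) * snd x) (j div n) (j mod n) else 0)"
        unfolding ent_tmat eq using True by simp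
      ultimately show ?thesis by (simp add: ent_sum)
    qed
  qed
  have can: "g * a = g * b \<longleftrightarrow> a = b" for a b
    using ginv(1) unfolding is_inv_def by (metis mult.assoc mult_1_left)
  have bij': "bij_betw \<Phi> {x\<in>tS. tmat n d x = w} {x\<in>tS. tmat n d x = g * w}"
  proof -
    have img: "\<Phi> ` tS = tS" "inj_on \<Phi> tS" using bij\<Phi> by (auto simp: bij_betw_def)
    have "\<Phi> ` {x\<in>tS. tmat n d x = w} = {x\<in>tS. tmat n d x = g * w}"
    proof (rule equalityI; rule subsetI)
      fix y assume "y \<in> \<Phi> ` {x\<in>tS. tmat n d x = w}"
      then obtain x where x: "x \<in> tS" "tmat n d x = w" "y = \<Phi> x" by blast
      then have "y \<in> tS" using img by blast
      then show "y \<in> {x\<in>tS. tmat n d x = g * w}" using t\<Phi>[OF x(1)] x by simp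
    next
      fix y assume y: "y \<in> {x\<in>tS. tmat n d x = g * w}"
      then have "y \<in> \<Phi> ` tS" using img(1) by simp
      then obtain x where x: "x \<in> tS" "y = \<Phi> x" by blast
      then have "tmat n d x = w" using t\<Phi>[OF x(1)] y can by simp
      then show "y \<in> \<Phi> ` {x\<in>tS. tmat n d x = w}" using x by blast
    qed
    then show ?thesis using img(2) by (auto simp: bij_betw_def intro: inj_on_subset)
  qed
  show ?thesis unfolding tnu_def
    using sum.reindex_bij_betw[OF bij', of tm] by (simp add: tm\<Phi>)
qed

text \<open>Contracting with right inverses of both frames recovers the projections themselves. The
  index \<open>2 ^ k\<close> has digit \<open>k\<close> as its only nonzero digit, so the diagonal
  entries at these indices form a dual system to the rows.\<close>

lemma tensor_step_rinv:
  assumes x: "x \<in> tS" shows "\<exists>\<theta>. tmat n d x * \<theta> = id_mat d"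
proof -
  have rinv: "\<exists>\<theta>. v * \<theta> = id_mat D" if "mu v \<noteq> 0" for v using FS that by (simp add: FS_def)
  obtain \<theta> \<eta> where th: "fst x * \<theta> = id_mat D" "snd x * \<eta> = id_mat D"
    using rinv[OF tS_D(1)[OF x]] rinv[OF tS_D(2)[OF x]] by blast
  define \<Theta> where "\<Theta> = Abs_bmat (\<lambda>j k. if j < n * n \<and> k < d then ent \<theta> (j div n) (2 ^ k) * ent \<eta> (j mod n) (2 ^ k) else 0)"
  have \<Theta>: "ent \<Theta> j k = (if j < n * n \<and> k < d then ent \<theta> (j div n) (2 ^ k) * ent \<eta> (j mod n) (2 ^ k) else 0)" for j k
    unfolding \<Theta>_def by (rule ent_Abs_corner)
  have "tmat n d x * \<Theta> = id_mat d"
  proof (rule bmat_eqI)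
    fix l k
    show "ent (tmat n d x * \<Theta>) l k = ent (id_mat d) l k"
    proof (cases "l < d \<and> k < d")
      case True
      define X where "X = tr (fst x) * dg (bset l) * snd x"
      have Xc: "X \<in> corner n n" unfolding X_def by (rule tpair_corner[OF x])
      have "ent (tmat n d x * \<Theta>) l k = (\<Sum>j<n * n. ent (tmat n d x) l j * ent \<Theta> j k)"
        by (rule ent_mult) (auto simp: \<Theta> split: if_splits)
      also have "\<dots> = (\<Sum>j<n * n. ent X (j div n) (j mod n) * (ent \<theta> (j div n) (2 ^ k) * ent \<eta> (j mod n) (2 ^ k)))"
        using True by (intro sum.cong refl) (simp add: ent_tmat \<Theta> X_def)
      also have "\<dots> = (\<Sum>a<n. \<Sum>b<n. ent X a b * (ent \<theta> a (2 ^ k) * ent \<eta> b (2 ^ k)))"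
        by (rule sum_pairs)
      also have "\<dots> = (\<Sum>a<n. ent (tr \<theta>) (2 ^ k) a * (\<Sum>b<n. ent X a b * ent \<eta> b (2 ^ k)))"
        by (simp add: sum_distrib_left mult_ac)
      also have "\<dots> = (\<Sum>a<n. ent (tr \<theta>) (2 ^ k) a * ent (X * \<eta>) a (2 ^ k))"
        using Xc by (intro sum.cong refl arg_cong2[where f = "(*)"] ent_mult[symmetric]) (auto simp: corner_iff)
      also have "\<dots> = ent (tr \<theta> * (X * \<eta>)) (2 ^ k) (2 ^ k)"
      proof (rule ent_mult[symmetric])
        have "id_mat n * (X * \<eta>) = X * \<eta>" using Xc by (simp add: corner_def mult_eq_assoc)
        then show "a \<in> {..<n}" if "ent (X * \<eta>) a (2 ^ k) \<noteq> 0" for a using that unfolding id_mat_def dg_mult_fix by blast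
      qed simp
      also have "tr \<theta> * (X * \<eta>) = tr (fst x * \<theta>) * dg (bset l) * (snd x * \<eta>)" by (simp add: X_def mult.assoc)
      also have "\<dots> = id_mat D * dg (bset l) * id_mat D" unfolding th by (simp add: id_mat_def)
      also have "ent \<dots> (2 ^ k) (2 ^ k) = ent (id_mat d) l k"
      proof -
        have "(2::nat) ^ k < 2 ^ d" using True by simp
        then have "2 ^ k < D" using r_pos unfolding D by (metis less_le_trans mult.right_neutral mult_le_mono2 One_nat_def Suc_leI)
        moreover have "bit ((2::nat) ^ k) l \<longleftrightarrow> k = l" by (auto simp: bit_exp_iff)
        ultimately show ?thesis using True by (simp add: id_mat_def ent_dg bset_def)
      qed
      finally show ?thesis .
    next
      case False
      have "id_mat d * tmat n d x = tmat n d x" "\<Theta> * id_mat d = \<Theta>"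
        unfolding id_mat_def dg_mult_fix mult_dg_fix by (auto simp: ent_tmat \<Theta> split: if_splits)
      then have "tmat n d x * \<Theta> \<in> corner d d" by (simp add: corner_def mult_eq_assoc mult.assoc)
      then have "ent (tmat n d x * \<Theta>) l k = 0" using False unfolding corner_iff by metis
      then show ?thesis using False by (auto simp: id_mat_def ent_dg)
    qed
  qed
  then show ?thesis by blast
qed

text \<open>Adding row 0 of the second frame to its row 1 changes the first matrix by the pure
  tensor of row 1 of the first frame and row 0 of the second. Such tensors are thus generated, and
  bilinearity extends this to the tensors of all generated vectors.\<close>

lemma tensor_step_gen: "corner 1 (n * n) \<subseteq> gen ((\<lambda>w. dg {0} * w) ` {w. tnu w \<noteq> 0})"
proof -
  let ?S = "(\<lambda>w. dg {0} * w) ` {w. tnu w \<noteq> 0}"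
  have mflat: "mun 0 0 * flat n A = flat n A" for A by (rule bmat_eqI) (auto simp: ent_flat)
  have row0: "flat n (tr (fst x) * dg (bset 0) * snd x) \<in> ?S" if x: "x \<in> tS" for x
  proof (rule image_eqI)
    show "flat n (tr (fst x) * dg (bset 0) * snd x) = dg {0} * tmat n d x"
      using row_tmat[of 0 d n x] d mflat by simp
    show "tmat n d x \<in> {w. tnu w \<noteq> 0}" using x tnu_supp by blast
  qed
  have D2: "2 \<le> D"
  proof -
    have "(2::nat) ^ 1 \<le> 2 ^ d" using d by (intro power_increasing) auto
    then show ?thesis using r_pos unfolding D by (metis One_nat_def Suc_leI le_trans mult.right_neutral mult_le_mono power_one_right)
  qed
  have gs: "1 + mun (Suc 0) 0 \<in> gl D"
  proof -
    have "is_inv (1 + mun (Suc 0) 0) (1 + mun (Suc 0) 0)" by (simp add: is_inv_def distrib_left distrib_right)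
    then show ?thesis using D2 by (auto simp: gl_def distrib_left distrib_right)
  qed
  have two: "flat n (tr v * mun (Suc 0) 0 * \<xi>) \<in> gen ?S" if v: "mu v \<noteq> 0" "mu \<xi> \<noteq> 0" for v \<xi>
  proof -
    have "(v, \<xi>) \<in> tS" "(v, (1 + mun (Suc 0) 0) * \<xi>) \<in> tS" using v FS gs by (auto simp: tS_def FS_def)
    from gen_base[OF row0[OF this(1)]] gen_base[OF row0[OF this(2)]]
    have "flat n (tr v * dg (bset 0) * \<xi>) + flat n (tr v * dg (bset 0) * ((1 + mun (Suc 0) 0) * \<xi>)) \<in> gen ?S"
      by (auto intro: gen_sum)
    moreover have b: "dg (bset 0) * mun (Suc 0) 0 = mun (Suc 0) 0" by (simp add: bset_def bit_0)
    have "tr v * dg (bset 0) * \<xi> + tr v * dg (bset 0) * ((1 + mun (Suc 0) 0) * \<xi>) = tr v * mun (Suc 0) 0 * \<xi>"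
      by (simp add: distrib_left distrib_right mult.assoc mult_eq_assoc[OF b])
    ultimately show ?thesis by (simp flip: flat_add)
  qed
  \<comment> \<open>Exchanging rows 0 and 1 of the first frame lets its row 0, about which the old
    generation clause speaks, take part in the tensor.\<close>
  define \<sigma> where "\<sigma> = Transposition.transpose (0::nat) 1"
  have bs: "bij \<sigma>" by (simp add: \<sigma>_def)
  have sg: "pmat \<sigma> \<in> gl D" by (rule gl_pmat[OF bs]) (use D2 in \<open>auto simp: \<sigma>_def Transposition.transpose_def\<close>)
  let ?R = "(\<lambda>v. dg {0} * v) ` {v. mu v \<noteq> 0}"
  have rr: "flat n (tr x * y) \<in> gen ?S" if "x \<in> ?R" "y \<in> ?R" for x y
  proof -
    obtain v \<xi> where v: "x = dg {0} * v" "mu v \<noteq> 0" "y = dg {0} * \<xi>" "mu \<xi> \<noteq> 0" using \<open>x \<in> ?R\<close> \<open>y \<in> ?R\<close> by auto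
    have 1: "mun 0 (Suc 0) * (pmat \<sigma> * v) = dg {0} * v"
      by (rule bmat_eqI) (simp add: ent_pmat_mult[OF bs], simp add: \<sigma>_def)
    have "tr (pmat \<sigma> * v) * mun (Suc 0) 0 * \<xi> = tr (mun 0 (Suc 0) * (pmat \<sigma> * v)) * (mun 0 0 * \<xi>)"
      by (simp add: mult.assoc flip: mult.assoc[of "mun (Suc 0) 0"])
    also have "\<dots> = tr x * y" unfolding 1 v mun_diag ..
    finally show ?thesis using two[of "pmat \<sigma> * v" \<xi>] v FS sg by (auto simp: FS_def)
  qed
  have full: "corner 1 n \<subseteq> gen ?R" using FS by (simp add: FS_def)
  have r1: "flat n (tr x * y) \<in> gen ?S" if "x \<in> ?R" "y \<in> gen ?R" for x y
    using that(2) by (rule gen_image[where h = "\<lambda>y. flat n (tr x * y)"])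
      (use rr that(1) in \<open>auto simp: flat_0 flat_add distrib_left\<close>)
  have r2: "flat n (tr x * y) \<in> gen ?S" if "x \<in> gen ?R" "y \<in> gen ?R" for x y
    using that(1) by (rule gen_image[where h = "\<lambda>x. flat n (tr x * y)"])
      (use r1 that(2) in \<open>auto simp: flat_0 flat_add distrib_right\<close>)
  show ?thesis
  proof
    fix z assume z: "z \<in> corner 1 (n * n)"
    define J where "J = {j. j < n * n \<and> ent z 0 j \<noteq> 0}"
    have finJ: "finite J" by (simp add: J_def)
    define e where "e j = flat n (tr (mun 0 (j div n)) * mun 0 (j mod n))" for j
    have ee: "e j \<in> gen ?S" if "j \<in> J" for j
    proof -
      have "j < n * n" using that by (simp add: J_def)
      then have "j div n < n" "j mod n < n" by (cases "n = 0", auto simp: less_mult_imp_div_less)+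
      then have "mun 0 (j div n) \<in> corner 1 n" "mun 0 (j mod n) \<in> corner 1 n" by (auto simp: corner_iff ent_mun split: if_splits)
      then show ?thesis unfolding e_def using r2 full by blast
    qed
    have ent_e: "ent (e j) i k = (if i < 1 \<and> k = j then 1 else 0)" if "j \<in> J" for i j k
    proof -
      have jn: "j < n * n" using that by (simp add: J_def)
      have "k div n = j div n \<and> k mod n = j mod n \<longleftrightarrow> k = j" by (metis div_mult_mod_eq)
      then show ?thesis using jn by (auto simp: e_def ent_flat ent_mun)
    qed
    have "z = sum e J"
    proof (rule bmat_eqI)
      fix i k
      have "ent (sum e J) i k = (\<Sum>j\<in>J. if i < 1 \<and> k = j then 1 else 0)"
        unfolding ent_sum by (intro sum.cong refl ent_e)
      also have "\<dots> = (if i < 1 \<and> k \<in> J then 1 else 0)"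
        using finJ by (cases "i < 1") (simp_all add: sum.delta')
      also have "\<dots> = ent z i k"
      proof (cases "ent z i k = 0")
        case False
        then have "i < 1" "k < n * n" using z unfolding corner_iff by blast+
        then show ?thesis using False by (auto simp: J_def bit_1_iff)
      next
        case True
        then show ?thesis by (cases "i = 0") (auto simp: J_def)
      qed
      finally show "ent z i k = ent (sum e J) i k" by simp
    qed
    then show "z \<in> gen ?S" using gen_finite_sum[of J e, OF ee] by simp
  qed
qed

theorem FS_tensor:
  "\<exists>nu. FS (n * n) d (12 / sqrt (real (Suc r)) + sqrt (1 / real (Suc r) + 2 * (real D * real D * \<delta>))) nu \<and>
     card {w. nu w \<noteq> 0} \<le> (card {v. mu v \<noteq> 0})\<^sup>2"
proof (intro exI conjI)
  have supp: "{w. tnu w \<noteq> 0} = tmat n d ` tS" using tnu_supp by auto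
  have "card {w. tnu w \<noteq> 0} \<le> card tS" unfolding supp by (rule card_image_le[OF tS_finite])
  then show "card {w. tnu w \<noteq> 0} \<le> (card {v. mu v \<noteq> 0})\<^sup>2"
    by (simp add: tS_def card_cartesian_product power2_eq_square)
  have "tnu w \<ge> 0" for w unfolding tnu_def by (rule sum_nonneg) (use tm_pos in \<open>auto intro: less_imp_le\<close>)
  moreover have "\<exists>w. tnu w \<noteq> 0"
  proof -
    obtain v where "mu v \<noteq> 0" using FS by (auto simp: FS_def)
    then have "(v, v) \<in> tS" by (simp add: tS_def)
    then show ?thesis using tnu_supp by blast
  qed
  moreover have "w \<in> corner d (n * n)" if "tnu w \<noteq> 0" for w
    using that by (auto simp: tnu_supp corner_iff ent_tmat split: if_splits)
  moreover have "\<exists>\<theta>. w * \<theta> = id_mat d" if "tnu w \<noteq> 0" for w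
    using that tensor_step_rinv by (auto simp: tnu_supp)
  moreover have "finite {w. tnu w \<noteq> 0}" unfolding supp using tS_finite by simp
  ultimately show "FS (n * n) d (12 / sqrt (real (Suc r)) + sqrt (1 / real (Suc r) + 2 * (real D * real D * \<delta>))) tnu"
    unfolding FS_def using tensor_step_gl tensor_step_mc tensor_step_gen by blast
qed

end

section \<open>The frame system of all independent tuples\<close>

definition indep :: "nat \<Rightarrow> nat \<Rightarrow> bmat set" where
  "indep k n = {t \<in> corner k n. \<exists>\<theta>. t * \<theta> = id_mat k}"

definition rowspan :: "nat \<Rightarrow> bmat \<Rightarrow> bmat set" where
  "rowspan k t = (\<lambda>c. c * t) ` corner 1 k"

lemma card_rowspan:
  assumes "t \<in> indep k n" shows "card (rowspan k t) = 2 ^ k"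
proof -
  obtain \<theta> where \<theta>: "t * \<theta> = id_mat k" using assms by (auto simp: indep_def)
  have "inj_on (\<lambda>c. c * t) (corner 1 k)"
  proof (rule inj_onI)
    fix c c' assume c: "c \<in> corner 1 k" "c' \<in> corner 1 k" "c * t = c' * t"
    then have "c * (t * \<theta>) = c' * (t * \<theta>)" by (simp flip: mult.assoc)
    then show "c = c'" using c by (simp add: \<theta> corner_def)
  qed
  then show ?thesis unfolding rowspan_def by (simp add: card_image card_corner)
qed

lemma corner_mult: "A \<in> corner a b \<Longrightarrow> B \<in> corner b' c \<Longrightarrow> A * B \<in> corner a c"
  using mult_eq_assoc[of "id_mat a" A A B] by (simp add: corner_def mult.assoc)

lemma rowspan_sub: "t \<in> corner k n \<Longrightarrow> rowspan k t \<subseteq> corner 1 n"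
  unfolding rowspan_def by (auto intro: corner_mult)

lemma indep_extend:
  assumes t: "t \<in> indep k n" and x: "x \<in> corner 1 n"
  shows "t + mun k 0 * x \<in> indep (Suc k) n \<longleftrightarrow> x \<notin> rowspan k t"
proof -
  obtain \<theta> where \<theta>: "t * \<theta> = id_mat k" using t by (auto simp: indep_def)
  have tc: "id_mat k * t = t" "t * id_mat n = t" using t by (auto simp: indep_def corner_def)
  have xc: "mun 0 0 * x = x" "x * id_mat n = x"
  proof -
    have "id_mat 1 = mun 0 0" by (rule bmat_eqI) (auto simp: id_mat_def ent_dg ent_mun)
    then show "mun 0 0 * x = x" "x * id_mat n = x" using x by (auto simp: corner_def)
  qed
  have idS: "id_mat (Suc k) = id_mat k + mun k k"
    by (rule bmat_eqI) (auto simp: id_mat_def ent_dg ent_mun ent_simps)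
  have kk: "id_mat k * mun k j = 0" "mun i k * id_mat k = 0" for i j by (simp_all add: id_mat_def)
  let ?t = "t + mun k 0 * x"
  have tk: "mun i k * t = 0" for i using kk(2)[of i] tc(1) by (metis mult.assoc mult_zero_left)
  show ?thesis
  proof
    assume "?t \<in> indep (Suc k) n"
    then obtain \<theta>' where \<theta>': "?t * \<theta>' = id_mat (Suc k)" by (auto simp: indep_def)
    show "x \<notin> rowspan k t"
    proof
      assume "x \<in> rowspan k t"
      then obtain c where c: "x = c * t" "c \<in> corner 1 k" by (auto simp: rowspan_def)
      have ck: "c * id_mat k = c" using c by (simp add: corner_def)
      have cm: "c * mun k 0 = 0" using kk(1)[of 0] ck by (metis mult.assoc mult_zero_right)
      have "(mun 0 k + c) * ?t = 0"
        using xc(1) tk c(1) mult_eq_assoc[OF cm, of x] by (simp add: distrib_left distrib_right flip: mult.assoc)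
      then have "(mun 0 k + c) * (?t * \<theta>') = 0" by (simp flip: mult.assoc)
      moreover have "c * mun k k = 0" using kk(1)[of k] ck by (metis mult.assoc mult_zero_right)
      ultimately have "c + mun 0 k = 0" unfolding \<theta>' idS
        by (simp add: distrib_left distrib_right kk ck del: bmat_add_eq_0_iff)
      then have "c = mun 0 k" by simp
      then have "mun 0 k = 0" using ck kk(2)[of 0] by simp
      then have "ent (mun 0 k) 0 k = 0" by (simp add: ent_0)
      then show False by (simp add: ent_mun)
    qed
  next
    assume nx: "x \<notin> rowspan k t"
    have "x * \<theta> * id_mat k \<in> corner 1 k"
    proof -
      have "id_mat 1 * x = x" using x by (simp add: corner_def)
      then have "id_mat 1 * (x * (\<theta> * id_mat k)) = x * (\<theta> * id_mat k)" by (rule mult_eq_assoc)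
      then show ?thesis by (simp add: corner_def mult.assoc) (simp add: id_mat_def)
    qed
    then have "x * \<theta> * id_mat k * t \<in> rowspan k t" by (auto simp: rowspan_def)
    then have "x \<noteq> x * \<theta> * t" using nx tc(1) by (metis mult.assoc)
    then have "x + x * \<theta> * t \<noteq> 0" by simp
    then obtain i m where im: "ent (x + x * \<theta> * t) i m = 1" by (rule bmat_nonzero_entry)
    have r0: "mun 0 0 * (x + x * \<theta> * t) = x + x * \<theta> * t"
      using xc(1) mult_eq_assoc[OF xc(1)] by (simp add: distrib_left mult.assoc)
    have "i = 0"
    proof (rule ccontr)
      assume "i \<noteq> 0"
      then have "ent (mun 0 0 * (x + x * \<theta> * t)) i m = 0" by simp
      then show False using im r0 by simp
    qed
    then have rm: "(x + x * \<theta> * t) * mun m k = mun 0 k"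
      using mun_sandwich[of "x + x * \<theta> * t" 0 m 0 k] im r0 by simp
    \<comment> \<open>A column that \<open>t\<close> kills and on which \<open>x\<close> takes the
      value 1; it exists because \<open>x\<close> is not in the row span. It corrects a right
      inverse of \<open>t\<close> to one of the extended matrix.\<close>
    define \<phi> where "\<phi> = mun m k + \<theta> * (t * mun m k)"
    have t\<phi>: "t * \<phi> = 0"
      using mult_eq_assoc[OF \<theta>] mult_eq_assoc[OF tc(1)] by (simp add: \<phi>_def distrib_left)
    have x\<phi>: "x * \<phi> = mun 0 k" using rm by (simp add: \<phi>_def distrib_left distrib_right mult.assoc)
    define \<theta>' where "\<theta>' = \<theta> * id_mat k + (\<phi> + \<phi> * (mun k 0 * (x * (\<theta> * id_mat k))))"
    have t\<theta>: "t * \<theta>' = id_mat k"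
      using mult_eq_assoc[OF t\<phi>] mult_eq_assoc[OF \<theta>]
      by (simp add: \<theta>'_def distrib_left t\<phi>) (simp add: id_mat_def)
    have x\<theta>: "x * \<theta>' = mun 0 k"
    proof -
      have "x * \<theta>' = x * (\<theta> * id_mat k) + (mun 0 k + mun 0 k * (mun k 0 * (x * (\<theta> * id_mat k))))"
        using mult_eq_assoc[OF x\<phi>] by (simp add: \<theta>'_def distrib_left x\<phi>)
      also have "mun 0 k * (mun k 0 * (x * (\<theta> * id_mat k))) = x * (\<theta> * id_mat k)"
        using mult_eq_assoc[OF xc(1)] by (simp flip: mult.assoc)
      finally show ?thesis by (simp add: add.commute)
    qed
    have "?t * \<theta>' = id_mat (Suc k)"
      by (simp add: distrib_right t\<theta> mult.assoc x\<theta> idS)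
    moreover have "?t \<in> corner (Suc k) n"
    proof -
      have "id_mat (Suc k) * id_mat k = id_mat k" by (auto simp: id_mat_def intro!: arg_cong[where f = dg])
      then have 1: "id_mat (Suc k) * t = t" using tc(1) by (metis mult.assoc)
      have "id_mat (Suc k) * mun k 0 = mun k 0" by (simp add: id_mat_def)
      then have 2: "id_mat (Suc k) * (mun k 0 * x) = mun k 0 * x" by (rule mult_eq_assoc)
      have 3: "t * id_mat n = t" "x * id_mat n = x" using t x by (auto simp: indep_def corner_def)
      show ?thesis by (simp add: corner_def distrib_left distrib_right 1 2 3 mult.assoc)
    qed
    ultimately show "?t \<in> indep (Suc k) n" by (auto simp: indep_def)
  qed
qed

lemma indep_restrict:
  assumes "v \<in> indep D n" "k \<le> D" shows "id_mat k * v \<in> indep k n"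
proof -
  obtain \<theta> where \<theta>: "v * \<theta> = id_mat D" using assms by (auto simp: indep_def)
  have "id_mat k * v * (\<theta> * id_mat k) = id_mat k * (id_mat D * id_mat k)"
    using mult_eq_assoc[OF \<theta>] by (simp add: mult.assoc)
  also have "\<dots> = id_mat k" using assms(2) by (auto simp: id_mat_def intro!: arg_cong[where f = dg])
  finally show ?thesis using assms by (auto simp: indep_def corner_def id_mat_def mult.assoc)
qed

lemma card_extend:
  assumes "t \<in> indep k n"
  shows "card {x \<in> corner 1 n. x \<notin> rowspan k t} = 2 ^ n - 2 ^ k"
proof -
  have tc: "t \<in> corner k n" using assms by (simp add: indep_def)
  have "{x \<in> corner 1 n. x \<notin> rowspan k t} = corner 1 n - rowspan k t" by auto
  then show ?thesis using card_rowspan[OF assms] rowspan_sub[OF tc] finite_corner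
    by (simp add: card_Diff_subset card_corner finite_subset)
qed

text \<open>Splits the sum by the next row; by \<open>indep_extend\<close> that row is any vector
  outside the span of the previous ones.\<close>

lemma sum_completions:
  assumes "k < D" "t \<in> indep k n"
  shows "(\<Sum>v\<in>{v \<in> indep D n. id_mat k * v = t}. h v) =
    (\<Sum>x\<in>{x \<in> corner 1 n. x \<notin> rowspan k t}. \<Sum>v\<in>{v \<in> indep D n. id_mat (Suc k) * v = t + mun k 0 * x}. (h v :: real))"
proof -
  let ?W = "{v \<in> indep D n. id_mat k * v = t}"
  let ?X = "{x \<in> corner 1 n. x \<notin> rowspan k t}"
  have fin: "finite ?W" by (rule finite_subset[OF _ finite_corner[of D n]]) (auto simp: indep_def)
  have idS: "id_mat (Suc k) = id_mat k + mun k k"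
    by (rule bmat_eqI) (auto simp: id_mat_def ent_dg ent_mun ent_simps)
  have tc: "id_mat k * t = t" using assms by (auto simp: indep_def corner_def)
  have tk: "mun i k * t = 0" for i
  proof -
    have "mun i k * id_mat k = 0" by (simp add: id_mat_def)
    then show ?thesis using tc by (metis mult.assoc mult_zero_left)
  qed
  have mem: "mun 0 k * v \<in> ?X" if v: "v \<in> ?W" for v
  proof -
    have "id_mat (Suc k) * v \<in> indep (Suc k) n" using indep_restrict[of v D n "Suc k"] v assms by simp
    moreover have "id_mat (Suc k) * v = t + mun k 0 * (mun 0 k * v)"
      using v by (simp add: idS distrib_right flip: mult.assoc)
    moreover have x: "mun 0 k * v \<in> corner 1 n" using v by (auto simp: indep_def corner_iff split: if_splits)
    ultimately show ?thesis using indep_extend[OF assms(2) x] by simp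
  qed
  have "(\<Sum>v\<in>?W. h v) = (\<Sum>x\<in>?X. \<Sum>v\<in>{v\<in>?W. mun 0 k * v = x}. h v)"
  proof (rule sum.group[symmetric, OF fin])
    show "finite ?X" by (rule finite_subset[OF _ finite_corner[of 1 n]]) auto
    show "(\<lambda>v. mun 0 k * v) ` ?W \<subseteq> ?X" using mem by blast
  qed
  also have "\<dots> = (\<Sum>x\<in>?X. \<Sum>v\<in>{v \<in> indep D n. id_mat (Suc k) * v = t + mun k 0 * x}. h v)"
  proof (rule sum.cong[OF refl], rule sum.cong[OF _ refl])
    fix x assume x: "x \<in> ?X"
    have xc: "mun 0 0 * x = x"
    proof -
      have "id_mat 1 = mun 0 0" by (rule bmat_eqI) (auto simp: id_mat_def ent_dg ent_mun)
      then show ?thesis using x by (auto simp: corner_def)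
    qed
    have "id_mat k * v = t \<and> mun 0 k * v = x \<longleftrightarrow> id_mat (Suc k) * v = t + mun k 0 * x" for v
    proof
      assume "id_mat k * v = t \<and> mun 0 k * v = x"
      then show "id_mat (Suc k) * v = t + mun k 0 * x" by (auto simp: idS distrib_right simp flip: mult.assoc)
    next
      assume e: "id_mat (Suc k) * v = t + mun k 0 * x"
      have "id_mat k * (id_mat (Suc k) * v) = id_mat k * (t + mun k 0 * x)" using e by simp
      moreover have "id_mat k * id_mat (Suc k) = id_mat k" by (auto simp: id_mat_def intro!: arg_cong[where f = dg])
      moreover have "id_mat k * mun k 0 = 0" by (simp add: id_mat_def)
      ultimately have 1: "id_mat k * v = t" using tc mult_eq_assoc[of "id_mat k" "id_mat (Suc k)" "id_mat k" v]
          mult_eq_assoc[of "id_mat k" "mun k 0" 0 x] by (simp add: distrib_left)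
      have "mun 0 k * (id_mat (Suc k) * v) = mun 0 k * (t + mun k 0 * x)" using e by simp
      moreover have "mun 0 k * id_mat (Suc k) = mun 0 k" by (simp add: id_mat_def)
      ultimately have "mun 0 k * v = x" using tk xc by (simp add: distrib_left mult_eq_assoc[of "mun 0 k"])
      then show "id_mat k * v = t \<and> mun 0 k * v = x" using 1 by simp
    qed
    then show "{v\<in>?W. mun 0 k * v = x} = {v \<in> indep D n. id_mat (Suc k) * v = t + mun k 0 * x}" by auto
  qed
  finally show ?thesis .
qed

lemma card_completions:
  assumes "k \<le> D" "t \<in> indep k n"
  shows "(\<Sum>v\<in>{v \<in> indep D n. id_mat k * v = t}. 1 :: real) = (\<Prod>i\<in>{k..<D}. real (2 ^ n - 2 ^ i))"
  using assms
proof (induction "D - k" arbitrary: k t)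
  case 0
  then have k: "k = D" by simp
  have "{v \<in> indep D n. id_mat k * v = t} = {t}" using 0 k by (auto simp: indep_def corner_def)
  then show ?case by (simp add: k)
next
  case (Suc l)
  then have kD: "k < D" by simp
  have "(\<Sum>v\<in>{v \<in> indep D n. id_mat k * v = t}. 1 :: real) =
    (\<Sum>x\<in>{x \<in> corner 1 n. x \<notin> rowspan k t}. \<Sum>v\<in>{v \<in> indep D n. id_mat (Suc k) * v = t + mun k 0 * x}. 1)"
    by (rule sum_completions[OF kD Suc.prems(2)])
  also have "\<dots> = (\<Sum>x\<in>{x \<in> corner 1 n. x \<notin> rowspan k t}. (\<Prod>i\<in>{Suc k..<D}. real (2 ^ n - 2 ^ i)))"
    using Suc kD indep_extend[OF Suc.prems(2)] by (intro sum.cong refl Suc(1)) auto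
  also have "\<dots> = real (2 ^ n - 2 ^ k) * (\<Prod>i\<in>{Suc k..<D}. real (2 ^ n - 2 ^ i))"
    by (simp only: sum_constant card_extend[OF Suc.prems(2)])
  also have "\<dots> = (\<Prod>i\<in>{k..<D}. real (2 ^ n - 2 ^ i))"
    using kD by (simp add: prod.atLeast_Suc_lessThan)
  finally show ?case .
qed

lemma rowspan_closed: "a \<in> rowspan k t \<Longrightarrow> b \<in> rowspan k t \<Longrightarrow> a + b \<in> rowspan k t"
proof -
  assume "a \<in> rowspan k t" "b \<in> rowspan k t"
  then obtain c c' where c: "a = c * t" "b = c' * t" "c \<in> corner 1 k" "c' \<in> corner 1 k" by (auto simp: rowspan_def)
  then have "a + b = (c + c') * t" "c + c' \<in> corner 1 k" by (auto simp: distrib_left distrib_right corner_def)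
  then show ?thesis by (auto simp: rowspan_def)
qed

lemma rowspan_extend:
  assumes "t \<in> corner k n" "x \<in> corner 1 n"
  shows "y \<in> rowspan (Suc k) (t + mun k 0 * x) \<longleftrightarrow> y \<in> rowspan k t \<or> x + y \<in> rowspan k t"
proof -
  have tc: "id_mat k * t = t" using assms by (simp add: corner_def)
  have i1: "id_mat (Suc 0) = mun 0 0" by (rule bmat_eqI) (auto simp: id_mat_def ent_dg ent_mun)
  have xc: "mun 0 0 * x = x" using assms by (simp add: corner_def i1)
  have idS: "id_mat (Suc k) = id_mat k + mun k k"
    by (rule bmat_eqI) (auto simp: id_mat_def ent_dg ent_mun ent_simps)
  have tk: "mun i k * t = 0" for i
  proof -
    have "mun i k * id_mat k = 0" by (simp add: id_mat_def)
    then show ?thesis using tc by (metis mult.assoc mult_zero_left)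
  qed
  have small: "c * (t + mun k 0 * x) = c * t" "c \<in> corner 1 (Suc k)" if "c \<in> corner 1 k" for c
  proof -
    have "c * mun k 0 = 0"
      by (rule bmat_eqI) (use that in \<open>auto simp: corner_iff ent_simps\<close>)
    then show "c * (t + mun k 0 * x) = c * t" by (simp add: distrib_left mult_eq_assoc[of c "mun k 0" 0])
    show "c \<in> corner 1 (Suc k)" using that by (auto simp: corner_iff intro: less_SucI)
  qed
  have big: "(c + mun 0 k) * (t + mun k 0 * x) = c * t + x" "c + mun 0 k \<in> corner 1 (Suc k)" if "c \<in> corner 1 k" for c
  proof -
    have "mun 0 k * (t + mun k 0 * x) = x" using tk xc by (simp add: distrib_left flip: mult.assoc)
    then show "(c + mun 0 k) * (t + mun k 0 * x) = c * t + x" using small(1)[OF that] by (simp add: distrib_right)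
    have "mun 0 k \<in> corner 1 (Suc k)" by (auto simp: corner_iff ent_mun split: if_splits)
    then show "c + mun 0 k \<in> corner 1 (Suc k)" using small(2)[OF that] by (auto simp: corner_def distrib_left distrib_right)
  qed
  show ?thesis
  proof
    assume "y \<in> rowspan (Suc k) (t + mun k 0 * x)"
    then obtain c where c: "y = c * (t + mun k 0 * x)" "c \<in> corner 1 (Suc k)" by (auto simp: rowspan_def)
    define c' where "c' = c * id_mat k"
    have "id_mat 1 * (c * id_mat k) = c * id_mat k" using c(2) by (intro mult_eq_assoc) (simp add: corner_def)
    then have c': "c' \<in> corner 1 k" by (simp add: c'_def corner_def mult.assoc) (simp add: id_mat_def)
    have "c = c * id_mat (Suc k)" using c(2) by (simp add: corner_def)
    then have cc: "c = c' + c * mun k k" by (simp add: idS distrib_left c'_def)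
    show "y \<in> rowspan k t \<or> x + y \<in> rowspan k t"
    proof (cases "ent c 0 k = 0")
      case True
      have "c * mun k k = 0"
      proof (rule bmat_eqI)
        fix i j
        show "ent (c * mun k k) i j = ent 0 i j"
        proof (cases "i = 0")
          case False
          then have "ent c i k = 0" using c(2) unfolding corner_iff by auto
          then show ?thesis by (simp add: ent_simps)
        qed (simp add: True ent_simps)
      qed
      then have "y = c' * t" using c(1) cc small(1)[OF c'] by simp
      then show ?thesis using c' by (auto simp: rowspan_def)
    next
      case False
      have "c * mun k k = mun 0 k"
      proof (rule bmat_eqI)
        fix i j
        show "ent (c * mun k k) i j = ent (mun 0 k) i j"
        proof (cases "i = 0")
          case i: False
          then have "ent c i k = 0" using c(2) unfolding corner_iff by auto
          then show ?thesis using i by (simp add: ent_mun)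
        qed (use False in \<open>simp add: ent_mun bit_1_iff\<close>)
      qed
      then have "y = c' * t + x" using c(1) cc big(1)[OF c'] by simp
      then have "x + y = c' * t" by (simp add: add.commute)
      then show ?thesis using c' by (auto simp: rowspan_def)
    qed
  next
    assume "y \<in> rowspan k t \<or> x + y \<in> rowspan k t"
    then show "y \<in> rowspan (Suc k) (t + mun k 0 * x)"
    proof
      assume "y \<in> rowspan k t"
      then obtain c where c: "y = c * t" "c \<in> corner 1 k" by (auto simp: rowspan_def)
      then show ?thesis using small[OF c(2)] unfolding rowspan_def by (metis image_eqI)
    next
      assume "x + y \<in> rowspan k t"
      then obtain c where c: "x + y = c * t" "c \<in> corner 1 k" by (auto simp: rowspan_def)
      then have "y = c * t + x" by (metis add.commute bmat_add_self_left)
      then show ?thesis using big[OF c(2)] unfolding rowspan_def by (metis image_eqI)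
    qed
  qed
qed

section \<open>Two further rows of a uniform independent tuple\<close>

context
  fixes j n D :: nat and u :: bmat
  assumes jD: "Suc j < D" and Dn: "D < n" and u: "u \<in> indep j n"
begin

abbreviation "bR \<equiv> rowspan j u"
abbreviation "bA \<equiv> corner 1 n - rowspan j u"

text \<open>The number of ways to complete \<open>j + 2\<close> independent rows to \<open>D\<close>
  independent rows; it is the same for every choice of those rows.\<close>

definition bc :: real where "bc = (\<Prod>i\<in>{Suc (Suc j)..<D}. real (2 ^ n - 2 ^ i))"

lemma bc_pos: "0 < bc"
proof -
  have "0 < real (2 ^ n - 2 ^ i)" if "i < D" for i
    using that Dn by (simp add: power_strict_increasing)
  then show ?thesis unfolding bc_def by (intro prod_pos) auto
qed

lemma corner_add: "a \<in> corner k l \<Longrightarrow> b \<in> corner k l \<Longrightarrow> a + b \<in> corner k l"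
  by (auto simp: corner_def distrib_left distrib_right)

lemma bR_sub: "bR \<subseteq> corner 1 n" using rowspan_sub u by (auto simp: indep_def)

text \<open>By \<open>rowspan_extend\<close>, two vectors outside the span of \<open>u\<close> can
  follow \<open>u\<close> together exactly if their sum is outside the span as well.\<close>

lemma base_pair_sum:
  "(\<Sum>v\<in>{v \<in> indep D n. id_mat j * v = u}. h (mun 0 j * v) (mun 0 (Suc j) * v)) =
    bc * (\<Sum>x\<in>bA. \<Sum>y\<in>bA. if x + y \<notin> bR then h x y else 0)"
proof -
  have i1: "id_mat (Suc 0) = mun 0 0" by (rule bmat_eqI) (auto simp: id_mat_def ent_dg ent_mun)
  have A: "{x \<in> corner 1 n. x \<notin> rowspan j u} = bA" by auto
  have "(\<Sum>v\<in>{v \<in> indep D n. id_mat j * v = u}. h (mun 0 j * v) (mun 0 (Suc j) * v)) =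
     (\<Sum>x\<in>bA. \<Sum>v\<in>{v \<in> indep D n. id_mat (Suc j) * v = u + mun j 0 * x}. h (mun 0 j * v) (mun 0 (Suc j) * v))"
    using sum_completions[of j D u n "\<lambda>v. h (mun 0 j * v) (mun 0 (Suc j) * v)"] jD u unfolding A by simp
  also have "\<dots> = (\<Sum>x\<in>bA. bc * (\<Sum>y\<in>bA. if x + y \<notin> bR then h x y else 0))"
  proof (rule sum.cong[OF refl])
    fix x assume x: "x \<in> bA"
    define t where "t = u + mun j 0 * x"
    have t: "t \<in> indep (Suc j) n" using indep_extend[OF u] x by (simp add: t_def)
    have uc: "u \<in> corner j n" using u by (simp add: indep_def)
    have xx: "mun 0 0 * x = x" using x by (simp add: corner_def i1)
    have muj: "mun 0 j * u = 0"
    proof -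
      have "mun 0 j * id_mat j = 0" by (simp add: id_mat_def)
      then show ?thesis using uc unfolding corner_def by (metis (mono_tags, lifting) mem_Collect_eq mult.assoc mult_zero_left)
    qed
    have "(\<Sum>v\<in>{v \<in> indep D n. id_mat (Suc j) * v = t}. h (mun 0 j * v) (mun 0 (Suc j) * v)) =
       (\<Sum>y\<in>{y \<in> corner 1 n. y \<notin> rowspan (Suc j) t}.
          \<Sum>v\<in>{v \<in> indep D n. id_mat (Suc (Suc j)) * v = t + mun (Suc j) 0 * y}. h (mun 0 j * v) (mun 0 (Suc j) * v))"
      using jD t by (rule sum_completions)
    also have "\<dots> = (\<Sum>y\<in>{y \<in> corner 1 n. y \<notin> rowspan (Suc j) t}. bc * h x y)"
    proof (rule sum.cong[OF refl])
      fix y assume y: "y \<in> {y \<in> corner 1 n. y \<notin> rowspan (Suc j) t}"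
      have yy: "mun 0 0 * y = y" using y by (simp add: corner_def i1)
      have ty: "t + mun (Suc j) 0 * y \<in> indep (Suc (Suc j)) n" using indep_extend[OF t] y by simp
      have rows: "mun 0 j * v = x \<and> mun 0 (Suc j) * v = y" if v: "id_mat (Suc (Suc j)) * v = t + mun (Suc j) 0 * y" for v
      proof -
        have "mun 0 j * (id_mat (Suc (Suc j)) * v) = mun 0 j * (t + mun (Suc j) 0 * y)"
          "mun 0 (Suc j) * (id_mat (Suc (Suc j)) * v) = mun 0 (Suc j) * (t + mun (Suc j) 0 * y)" using v by simp_all
        moreover have "mun 0 j * id_mat (Suc (Suc j)) = mun 0 j" "mun 0 (Suc j) * id_mat (Suc (Suc j)) = mun 0 (Suc j)"
          by (simp_all add: id_mat_def)
        moreover have "mun 0 j * (t + mun (Suc j) 0 * y) = x"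
          using muj xx by (simp add: t_def distrib_left flip: mult.assoc)
        moreover have "mun 0 (Suc j) * (t + mun (Suc j) 0 * y) = y"
        proof -
          have "mun 0 (Suc j) * id_mat (Suc j) = 0" by (simp add: id_mat_def)
          moreover have "id_mat (Suc j) * t = t" using t by (simp add: indep_def corner_def)
          ultimately have "mun 0 (Suc j) * t = 0" by (metis mult.assoc mult_zero_left)
          then show ?thesis using yy by (simp add: distrib_left flip: mult.assoc)
        qed
        ultimately show ?thesis by (metis mult.assoc)
      qed
      have "(\<Sum>v\<in>{v \<in> indep D n. id_mat (Suc (Suc j)) * v = t + mun (Suc j) 0 * y}. h (mun 0 j * v) (mun 0 (Suc j) * v)) =
         (\<Sum>v\<in>{v \<in> indep D n. id_mat (Suc (Suc j)) * v = t + mun (Suc j) 0 * y}. 1 * h x y)"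
        using rows by (intro sum.cong refl) auto
      also have "\<dots> = bc * h x y"
        unfolding sum_distrib_right[symmetric] bc_def
        using card_completions[of "Suc (Suc j)" D "t + mun (Suc j) 0 * y" n] jD ty by simp
      finally show "(\<Sum>v\<in>{v \<in> indep D n. id_mat (Suc (Suc j)) * v = t + mun (Suc j) 0 * y}. h (mun 0 j * v) (mun 0 (Suc j) * v)) = bc * h x y" .
    qed
    also have "{y \<in> corner 1 n. y \<notin> rowspan (Suc j) t} = {y\<in>bA. x + y \<notin> bR}"
      using rowspan_extend[OF uc, of x] x unfolding t_def by auto
    also have "(\<Sum>y\<in>{y\<in>bA. x + y \<notin> bR}. bc * h x y) = bc * (\<Sum>y\<in>bA. if x + y \<notin> bR then h x y else 0)"
      unfolding sum_distrib_left[symmetric] by (subst sum.inter_filter) auto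
    finally show "(\<Sum>v\<in>{v \<in> indep D n. id_mat (Suc j) * v = u + mun j 0 * x}. h (mun 0 j * v) (mun 0 (Suc j) * v)) =
        bc * (\<Sum>y\<in>bA. if x + y \<notin> bR then h x y else 0)" unfolding t_def .
  qed
  finally show ?thesis by (simp add: sum_distrib_left)
qed

text \<open>The partners excluded for \<open>x\<close> form the coset of \<open>bR\<close> through
  \<open>x\<close>, which lies entirely in \<open>bA\<close>.\<close>

lemma coset_sum:
  assumes x: "x \<in> bA"
  shows "(\<Sum>y\<in>bA. if x + y \<notin> bR then g y else 0) = (\<Sum>y\<in>bA. g y) - (\<Sum>s\<in>bR. (g (x + s) :: real))"
proof -
  have shift: "x + s \<in> bA" if "s \<in> bR" for s
  proof -
    have "x + s \<notin> bR"
    proof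
      assume "x + s \<in> bR"
      from rowspan_closed[OF this that] show False using x by (simp add: add.assoc)
    qed
    then show ?thesis using x that bR_sub corner_add by blast
  qed
  have "(\<Sum>y\<in>bA. g y) = (\<Sum>y\<in>bA. if x + y \<notin> bR then g y else 0) + (\<Sum>y\<in>bA. if x + y \<in> bR then g y else 0)"
    unfolding sum.distrib[symmetric] by (intro sum.cong refl) auto
  also have "(\<Sum>y\<in>bA. if x + y \<in> bR then g y else 0) = (\<Sum>y\<in>{y\<in>bA. x + y \<in> bR}. g y)"
    by (subst sum.inter_filter) auto
  also have "\<dots> = (\<Sum>s\<in>bR. g (x + s))"
    by (rule sum.reindex_bij_witness[where i = "\<lambda>s. x + s" and j = "\<lambda>y. x + y"]) (use shift in auto)
  finally show ?thesis by simp
qed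

lemma card_bA: "real (card bA) - real (card bR) = 2 ^ n - 2 ^ Suc j"
proof -
  have "card bA = 2 ^ n - 2 ^ j" using card_extend[OF u] by (simp add: set_diff_eq)
  moreover have "(2::nat) ^ j \<le> 2 ^ n" using jD Dn by (intro power_increasing) auto
  ultimately show ?thesis using card_rowspan[OF u] by (simp add: of_nat_diff)
qed

text \<open>The pair of rows is uniform except for the excluded cosets. For centred functions the
  uniform part contributes nothing, and the excluded part is a sum of 2^j shifted inner products,
  each bounded by Cauchy-Schwarz. Relative to the number 2^n - 2^(j+1) of partners of a row this is
  at most \<delta>.\<close>

lemma base_mc:
  assumes \<delta>: "2 ^ D \<le> \<delta> * (2 ^ n - 2 ^ D)"
  shows "mc {v \<in> indep D n. id_mat j * v = u} (\<lambda>_. 1) (\<lambda>v. mun 0 j * v) (\<lambda>v. mun 0 (Suc j) * v) \<delta>"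
    (is "mc ?W _ ?X ?Y _")
  unfolding mc_def
proof (intro allI impI)
  fix f g :: "bmat \<Rightarrow> real"
  define B :: real where "B = 2 ^ n - 2 ^ Suc j"
  have B: "0 < B" "2 ^ j \<le> \<delta> * B" "2 ^ n - 2 ^ D \<le> B" "0 \<le> \<delta>"
  proof -
    have "(2::real) ^ Suc j < 2 ^ n" "(2::real) ^ Suc j \<le> 2 ^ D" "(2::real) ^ D < 2 ^ n" "(2::real) ^ j \<le> 2 ^ D"
      using jD Dn by (auto intro: power_strict_increasing power_increasing simp del: power_Suc)
    then show "0 < B" and le: "2 ^ n - 2 ^ D \<le> B" by (auto simp: B_def)
    have "0 < \<delta> * (2 ^ n - 2 ^ D)" using \<delta> by (smt (verit) zero_less_power)
    then show "0 \<le> \<delta>" using \<open>(2::real) ^ D < 2 ^ n\<close> by (simp add: zero_less_mult_iff)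
    then have "\<delta> * (2 ^ n - 2 ^ D) \<le> \<delta> * B" using le by (rule mult_left_mono[rotated])
    then show "2 ^ j \<le> \<delta> * B" using \<delta> \<open>(2::real) ^ j \<le> 2 ^ D\<close> by linarith
  qed
  have finA: "finite bA" by simp
  have one: "(\<Sum>v\<in>?W. h (?X v)) = bc * B * (\<Sum>x\<in>bA. h x)" for h
  proof -
    have "(\<Sum>y\<in>bA. if x + y \<notin> bR then h x else 0) = B * h x" if "x \<in> bA" for x
      using coset_sum[OF that, of "\<lambda>_. h x"] card_bA by (simp add: B_def left_diff_distrib[symmetric])
    then show ?thesis using base_pair_sum[of "\<lambda>x y. h x"] by (simp add: sum_distrib_left mult.assoc)
  qed
  have two: "(\<Sum>v\<in>?W. h (?Y v)) = bc * B * (\<Sum>x\<in>bA. h x)" for h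
  proof -
    have "(\<Sum>x\<in>bA. if x + y \<notin> bR then h y else 0) = B * h y" if "y \<in> bA" for y
      using coset_sum[OF that, of "\<lambda>_. h y"] card_bA by (simp add: B_def left_diff_distrib[symmetric] add.commute)
    then show ?thesis using base_pair_sum[of "\<lambda>x y. h y"]
      by (subst (asm) sum.swap) (simp add: sum_distrib_left mult.assoc)
  qed
  assume "(\<Sum>v\<in>?W. 1 * f (?X v)) = 0" "(\<Sum>v\<in>?W. 1 * g (?Y v)) = 0"
  then have f0: "(\<Sum>x\<in>bA. f x) = 0" and g0: "(\<Sum>x\<in>bA. g x) = 0"
    using one[of f] two[of g] bc_pos B(1) by simp_all
  define nf where "nf = sqrt (\<Sum>x\<in>bA. (f x)\<^sup>2)"
  define ng where "ng = sqrt (\<Sum>x\<in>bA. (g x)\<^sup>2)"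
  have n1: "wnm ?W (\<lambda>_. 1) (\<lambda>v. f (?X v)) = sqrt (bc * B) * nf"
    using one[of "\<lambda>x. (f x)\<^sup>2"] by (simp add: wnm_def wip_def nf_def real_sqrt_mult power2_eq_square)
  have n2: "wnm ?W (\<lambda>_. 1) (\<lambda>v. g (?Y v)) = sqrt (bc * B) * ng"
    using two[of "\<lambda>x. (g x)\<^sup>2"] by (simp add: wnm_def wip_def ng_def real_sqrt_mult power2_eq_square)
  have "wip ?W (\<lambda>_. 1) (\<lambda>v. f (?X v)) (\<lambda>v. g (?Y v)) = bc * (\<Sum>x\<in>bA. \<Sum>y\<in>bA. if x + y \<notin> bR then f x * g y else 0)"
    unfolding wip_def using base_pair_sum[of "\<lambda>x y. f x * g y"] by simp
  also have "(\<Sum>x\<in>bA. \<Sum>y\<in>bA. if x + y \<notin> bR then f x * g y else 0) = (\<Sum>x\<in>bA. - (\<Sum>s\<in>bR. f x * g (x + s)))"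
  proof (rule sum.cong[OF refl])
    fix x assume x: "x \<in> bA"
    have "(\<Sum>y\<in>bA. if x + y \<notin> bR then f x * g y else 0) = f x * (\<Sum>y\<in>bA. if x + y \<notin> bR then g y else 0)"
      unfolding sum_distrib_left by (intro sum.cong refl) auto
    also have "\<dots> = f x * (0 - (\<Sum>s\<in>bR. g (x + s)))" unfolding coset_sum[OF x] g0 ..
    finally show "(\<Sum>y\<in>bA. if x + y \<notin> bR then f x * g y else 0) = - (\<Sum>s\<in>bR. f x * g (x + s))"
      by (simp add: sum_distrib_left)
  qed
  also have "\<dots> = - (\<Sum>s\<in>bR. \<Sum>x\<in>bA. f x * g (x + s))" unfolding sum_negf by (subst sum.swap) simp
  finally have ip: "\<bar>wip ?W (\<lambda>_. 1) (\<lambda>v. f (?X v)) (\<lambda>v. g (?Y v))\<bar> = bc * \<bar>\<Sum>s\<in>bR. \<Sum>x\<in>bA. f x * g (x + s)\<bar>"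
    using bc_pos by (simp add: abs_mult)
  have inner: "\<bar>\<Sum>x\<in>bA. f x * g (x + s)\<bar> \<le> nf * ng" if s: "s \<in> bR" for s
  proof -
    have bij: "bij_betw (\<lambda>x. x + s) bA bA"
    proof (rule bij_betw_byWitness[where f' = "\<lambda>x. x + s"])
      have "x + s \<in> bA" if "x \<in> bA" for x
      proof -
        have "x + s \<notin> bR"
        proof
          assume "x + s \<in> bR"
          from rowspan_closed[OF this s] show False using that by (simp add: add.assoc)
        qed
        then show ?thesis using that s bR_sub corner_add by blast
      qed
      then show "(\<lambda>x. x + s) ` bA \<subseteq> bA" "(\<lambda>x. x + s) ` bA \<subseteq> bA" by auto
    qed (auto simp: add.assoc)
    have "(\<Sum>x\<in>bA. f x * g (x + s))\<^sup>2 \<le> (\<Sum>x\<in>bA. (f x)\<^sup>2) * (\<Sum>x\<in>bA. (g (x + s))\<^sup>2)"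
      by (rule Cauchy_Schwarz_ineq_sum)
    also have "(\<Sum>x\<in>bA. (g (x + s))\<^sup>2) = (\<Sum>x\<in>bA. (g x)\<^sup>2)"
      by (rule sum.reindex_bij_betw[OF bij, of "\<lambda>x. (g x)\<^sup>2"])
    also have "(\<Sum>x\<in>bA. (f x)\<^sup>2) * (\<Sum>x\<in>bA. (g x)\<^sup>2) = (nf * ng)\<^sup>2"
      by (simp add: nf_def ng_def power_mult_distrib sum_nonneg)
    finally show ?thesis by (simp add: abs_le_square_iff[symmetric] nf_def ng_def sum_nonneg abs_mult)
  qed
  have "\<bar>\<Sum>s\<in>bR. \<Sum>x\<in>bA. f x * g (x + s)\<bar> \<le> (\<Sum>s\<in>bR. \<bar>\<Sum>x\<in>bA. f x * g (x + s)\<bar>)"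
    by (rule sum_abs)
  also have "\<dots> \<le> (\<Sum>s\<in>bR. nf * ng)" by (rule sum_mono[OF inner])
  also have "\<dots> = 2 ^ j * (nf * ng)" using card_rowspan[OF u] by simp
  also have "\<dots> \<le> \<delta> * B * (nf * ng)"
    by (rule mult_right_mono[OF B(2)]) (simp add: nf_def ng_def sum_nonneg)
  finally have "bc * \<bar>\<Sum>s\<in>bR. \<Sum>x\<in>bA. f x * g (x + s)\<bar> \<le> bc * (\<delta> * B * (nf * ng))"
    using bc_pos by (intro mult_left_mono) auto
  also have "\<dots> = \<delta> * (sqrt (bc * B) * nf) * (sqrt (bc * B) * ng)"
  proof -
    have "sqrt (bc * B) * sqrt (bc * B) = bc * B" using bc_pos B(1) by simp
    then have "\<delta> * (sqrt (bc * B) * nf) * (sqrt (bc * B) * ng) = \<delta> * (bc * B) * (nf * ng)"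
      by (metis (no_types, lifting) mult.assoc mult.left_commute)
    moreover have "bc * (\<delta> * B * (nf * ng)) = \<delta> * (bc * B) * (nf * ng)" by (simp only: mult_ac)
    ultimately show ?thesis by (simp only:)
  qed
  finally show "\<bar>wip ?W (\<lambda>_. 1) (\<lambda>v. f (?X v)) (\<lambda>v. g (?Y v))\<bar> \<le>
     \<delta> * wnm ?W (\<lambda>_. 1) (\<lambda>v. f (?X v)) * wnm ?W (\<lambda>_. 1) (\<lambda>v. g (?Y v))"
    unfolding ip n1 n2 .
qed

end

theorem FS_base:
  assumes Dn: "D < n" and \<delta>: "2 ^ D \<le> \<delta> * (2 ^ n - 2 ^ D)" and D: "1 \<le> D"
  shows "\<exists>mu. FS n D \<delta> mu \<and> card {v. mu v \<noteq> 0} \<le> 2 ^ (D * n)"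
proof (intro exI conjI)
  define mu :: "bmat \<Rightarrow> real" where "mu v = (if v \<in> indep D n then 1 else 0)" for v
  have supp: "{v. mu v \<noteq> 0 \<and> P v} = {v \<in> indep D n. P v}" for P by (auto simp: mu_def)
  have supp': "{v. mu v \<noteq> 0} = indep D n" by (auto simp: mu_def)
  have sub: "indep D n \<subseteq> corner D n" by (auto simp: indep_def)
  show "card {v. mu v \<noteq> 0} \<le> 2 ^ (D * n)"
    unfolding supp' card_corner[symmetric] by (rule card_mono[OF finite_corner sub])
  have perm: "id_mat D * pmat \<pi> \<in> indep D n" if \<pi>: "bij \<pi>" "\<And>i. i < n \<Longrightarrow> \<pi> i < n" for \<pi>
  proof -
    have "id_mat D * pmat \<pi> * (tr (pmat \<pi>) * id_mat D) = id_mat D"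
      using mult_eq_assoc[OF pmat_inv(1)[OF \<pi>(1)]] by (simp add: mult.assoc id_mat_def)
    moreover have "id_mat D * pmat \<pi> \<in> corner D n"
      using \<pi>(2) Dn by (auto simp: corner_iff id_mat_def ent_pmat[OF \<pi>(1)] split: if_splits)
    ultimately show ?thesis by (auto simp: indep_def)
  qed
  have "id_mat D * pmat id \<in> indep D n" by (rule perm) auto
  then have ne: "\<exists>v. mu v \<noteq> 0" unfolding mu_def by (metis zero_neq_one)
  have glD: "g * v \<in> indep D n" if g: "g \<in> gl D" and v: "v \<in> indep D n" for g v
  proof -
    obtain \<theta> where \<theta>: "v * \<theta> = id_mat D" using v by (auto simp: indep_def)
    have gi: "g * uinv g = 1" using gl_is_inv[OF g] by (simp add: is_inv_def)
    have "g * v * (\<theta> * uinv g) = g * (v * \<theta>) * uinv g" by (simp only: mult.assoc)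
    also have "\<dots> = id_mat D" unfolding \<theta> gl_id_mat[OF g] by (simp add: mult.assoc gi)
    finally have "\<exists>\<theta>. g * v * \<theta> = id_mat D" by blast
    moreover have "g * v \<in> corner D n"
      using v mult_eq_assoc[OF gl_id_mat[OF g, symmetric], of v] by (simp add: indep_def corner_def mult.assoc)
    ultimately show ?thesis by (simp add: indep_def)
  qed
  have inv: "mu (g * v) = mu v" if g: "g \<in> gl D" for g v
  proof -
    have "v \<in> indep D n" if "g * v \<in> indep D n"
      using glD[OF gl_uinv[OF g] that] gl_is_inv[OF g] mult_eq_assoc[of "uinv g" g 1 v] by (simp add: is_inv_def)
    then show ?thesis using glD[OF g] by (auto simp: mu_def)
  qed
  have mcb: "mc {v. mu v \<noteq> 0 \<and> id_mat j * v = u} mu (\<lambda>v. dg {j} * v) (\<lambda>v. dg {Suc j} * v) \<delta>" if j: "Suc j < D" for j u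
  proof (cases "{v \<in> indep D n. id_mat j * v = u} = {}")
    case True
    then show ?thesis unfolding supp by (simp only: mc_empty)
  next
    case False
    then obtain v where "v \<in> indep D n" "id_mat j * v = u" by auto
    then have u: "u \<in> indep j n" using indep_restrict[of v D n j] j by simp
    have "mc {v \<in> indep D n. id_mat j * v = u} mu (\<lambda>v. mun 0 j * v) (\<lambda>v. mun 0 (Suc j) * v) \<delta>"
      using base_mc[OF j Dn u \<delta>] by (subst mc_cong[where m' = "\<lambda>_. 1"]) (auto simp: mu_def)
    then show ?thesis unfolding supp
      by (rule mc_comp[where \<phi> = "\<lambda>x. mun j 0 * x" and \<psi> = "\<lambda>x. mun (Suc j) 0 * x"])
        (simp_all add: mun_diag flip: mult.assoc)
  qed
  have gen: "corner 1 n \<subseteq> gen ((\<lambda>v. dg {0} * v) ` {v. mu v \<noteq> 0})"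
  proof
    fix z assume z: "z \<in> corner 1 n"
    define J where "J = {j. j < n \<and> ent z 0 j \<noteq> 0}"
    have finJ: "finite J" by (simp add: J_def)
    have m: "mun 0 j \<in> gen ((\<lambda>v. dg {0} * v) ` {v. mu v \<noteq> 0})" if "j \<in> J" for j
    proof (rule gen_base, rule image_eqI)
      let ?\<pi> = "Transposition.transpose 0 j"
      have jn: "j < n" using that by (simp add: J_def)
      have b: "bij ?\<pi>" by simp
      show "id_mat D * pmat ?\<pi> \<in> {v. mu v \<noteq> 0}" unfolding supp'
        by (rule perm) (use jn in \<open>auto simp: Transposition.transpose_def\<close>)
      show "mun 0 j = dg {0} * (id_mat D * pmat ?\<pi>)"
        by (rule bmat_eqI) (use D in \<open>auto simp: id_mat_def ent_mun ent_pmat[OF b]\<close>)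
    qed
    have "z = (\<Sum>j\<in>J. mun 0 j)"
    proof (rule bmat_eqI)
      fix i k
      have "ent (\<Sum>j\<in>J. mun 0 j) i k = (\<Sum>j\<in>J. if i = 0 \<and> k = j then 1 else 0)"
        unfolding ent_sum by (intro sum.cong refl) (simp add: ent_mun)
      also have "\<dots> = (if i = 0 \<and> k \<in> J then 1 else 0)"
        using finJ by (cases "i = 0") simp_all
      also have "\<dots> = ent z i k"
      proof (cases "ent z i k = 0")
        case False
        then have "i < 1" "k < n" using z unfolding corner_iff by blast+
        then show ?thesis using False by (auto simp: J_def bit_1_iff)
      next
        case True
        then show ?thesis by (cases "i = 0") (auto simp: J_def)
      qed
      finally show "ent z i k = ent (\<Sum>j\<in>J. mun 0 j) i k" by simp
    qed
    then show "z \<in> gen ((\<lambda>v. dg {0} * v) ` {v. mu v \<noteq> 0})"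
      using gen_finite_sum[of J "mun 0", OF m] by simp
  qed
  show "FS n D \<delta> mu"
    unfolding FS_def using ne inv mcb gen finite_subset[OF sub finite_corner]
    by (auto simp: supp' mu_def indep_def)
qed

lemma FS_mono:
  assumes F: "FS n D \<delta> mu" and le: "\<delta> \<le> \<delta>'" shows "FS n D \<delta>' mu"
proof -
  have "mc {v. mu v \<noteq> 0 \<and> id_mat j * v = u} mu (\<lambda>v. dg {j} * v) (\<lambda>v. dg {Suc j} * v) \<delta>'" if "Suc j < D" for j u
  proof (rule mc_mono[OF _ le])
    show "mc {v. mu v \<noteq> 0 \<and> id_mat j * v = u} mu (\<lambda>v. dg {j} * v) (\<lambda>v. dg {Suc j} * v) \<delta>"
      using F that unfolding FS_def by blast
    show "wt {v. mu v \<noteq> 0 \<and> id_mat j * v = u} mu" using F by (auto simp: FS_def wt_def)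
  qed
  then show ?thesis using F unfolding FS_def by blast
qed

text \<open>Each tensor step squares the dimension but only doubles the constant in the exponent of
  the support size. The induction is over all \<open>D\<close> and \<delta>, since a step consumes
  many more vectors and a much smaller correlation than it returns.\<close>

theorem FS_family:
  assumes "1 \<le> D" "0 < \<delta>"
  shows "\<exists>C n0. \<forall>n\<ge>n0. \<exists>mu. FS (n ^ (2 ^ t)) D \<delta> mu \<and> card {v. mu v \<noteq> 0} \<le> 2 ^ (C * n)"
  using assms
proof (induction t arbitrary: D \<delta>)
  case 0
  \<comment> \<open>This threshold is the condition 2^D <= \<delta> (2^n - 2^D) of
    \<open>FS_base\<close>, solved for 2^n.\<close>
  obtain N where N: "2 ^ D * (1 + 1 / \<delta>) < 2 ^ N" using real_arch_pow[of 2 "2 ^ D * (1 + 1 / \<delta>)"] by auto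
  have "\<exists>mu. FS (n ^ (2 ^ 0)) D \<delta> mu \<and> card {v. mu v \<noteq> 0} \<le> 2 ^ (D * n)" if n: "n \<ge> max N (Suc D)" for n
  proof -
    have "(2::real) ^ N \<le> 2 ^ n" using n by (intro power_increasing) auto
    then have "2 ^ D * (1 + 1 / \<delta>) \<le> 2 ^ n" using N by linarith
    then have "\<delta> * (2 ^ D * (1 + 1 / \<delta>)) \<le> \<delta> * 2 ^ n" using 0 by (intro mult_left_mono) auto
    moreover have "\<delta> * (2 ^ D * (1 + 1 / \<delta>)) = \<delta> * 2 ^ D + 2 ^ D" using 0 by (simp add: field_simps)
    ultimately have "2 ^ D \<le> \<delta> * (2 ^ n - 2 ^ D)" by (simp add: right_diff_distrib)
    then show ?thesis using FS_base[of D n \<delta>] n 0 by simp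
  qed
  then show ?case by blast
next
  case (Suc t)
  \<comment> \<open>The new correlation will be at most 14/sqrt p: 12/sqrt p from the mixing term
    and at most 2/sqrt p from the square root.\<close>
  obtain p :: nat where p: "prime p" "max 2 (nat \<lceil>(14 / \<delta>)\<^sup>2\<rceil>) < p" using bigger_prime by blast
  have p2: "2 < p" "(14 / \<delta>)\<^sup>2 \<le> real p" using p(2) by (auto simp: nat_ceiling_le_eq less_imp_le) linarith
  obtain r where r: "p = Suc r" using p2 by (cases p) auto
  have odd: "odd p" using p(1) p2 prime_odd_nat by blast
  define E where "E = 2 ^ D * r"
  have E1: "1 \<le> E" using p2 r by (simp add: E_def)
  \<comment> \<open>Chosen so that twice the squared number of old vectors times it is exactly 1/p,
    matching the other summand under the root.\<close>
  define \<delta>0 where "\<delta>0 = 1 / (2 * real p * (real E * real E))"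
  have \<delta>0: "0 < \<delta>0" using E1 p2 by (simp add: \<delta>0_def)
  obtain C n0 where C: "\<And>n. n \<ge> n0 \<Longrightarrow> \<exists>mu. FS (n ^ (2 ^ t)) E \<delta>0 mu \<and> card {v. mu v \<noteq> 0} \<le> 2 ^ (C * n)"
    using Suc.IH[OF E1 \<delta>0] by blast
  have bound: "12 / sqrt (real p) + sqrt (1 / real p + 2 * (real E * real E * \<delta>0)) \<le> \<delta>"
  proof -
    have e: "2 * (real E * real E * \<delta>0) = 1 / real p" using E1 p2 by (simp add: \<delta>0_def field_simps)
    have "sqrt (1 / real p + 1 / real p) \<le> sqrt (4 / real p)"
      using p2 by (intro real_sqrt_le_mono) (simp add: field_simps)
    also have "\<dots> = 2 / sqrt (real p)" by (simp add: real_sqrt_divide)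
    finally have "12 / sqrt (real p) + sqrt (1 / real p + 2 * (real E * real E * \<delta>0)) \<le> 14 / sqrt (real p)"
      unfolding e by simp
    also have "\<dots> \<le> \<delta>"
    proof -
      have "14 / \<delta> \<le> sqrt (real p)" using p2(2) Suc.prems(2) by (intro real_le_rsqrt) 
      then show ?thesis using Suc.prems(2) p2 by (simp add: field_simps)
    qed
    finally show ?thesis .
  qed
  have "\<exists>nu. FS (n ^ (2 ^ Suc t)) D \<delta> nu \<and> card {v. nu v \<noteq> 0} \<le> 2 ^ (2 * C * n)" if nn: "n \<ge> n0" for n
  proof -
    obtain mu where mu: "FS (n ^ (2 ^ t)) E \<delta>0 mu" "card {v. mu v \<noteq> 0} \<le> 2 ^ (C * n)" using C[OF nn] by blast
    obtain nu where nu: "FS (n ^ (2 ^ t) * n ^ (2 ^ t)) D (12 / sqrt (real (Suc r)) + sqrt (1 / real (Suc r) + 2 * (real E * real E * \<delta>0))) nu"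
      "card {w. nu w \<noteq> 0} \<le> (card {v. mu v \<noteq> 0})\<^sup>2"
      using FS_tensor[OF mu(1) less_imp_le[OF \<delta>0] E_def p(1)[unfolded r] odd[unfolded r] Suc.prems(1)] by (elim exE conjE)
    have "n ^ (2 ^ Suc t) = n ^ (2 ^ t) * n ^ (2 ^ t)" by (simp add: mult_2 flip: power_add)
    then have "FS (n ^ (2 ^ Suc t)) D \<delta> nu"
      using FS_mono[OF nu(1) bound[unfolded r]] by (simp only:)
    moreover have "card {w. nu w \<noteq> 0} \<le> 2 ^ (2 * C * n)"
    proof -
      have "(card {v. mu v \<noteq> 0})\<^sup>2 \<le> (2 ^ (C * n))\<^sup>2" using mu(2) by (rule power_mono) simp
      then show ?thesis using nu(2) by (simp add: power_mult[symmetric] mult_ac)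
    qed
    ultimately show ?thesis by blast
  qed
  then show ?case by blast
qed

section \<open>Spectra of reversible walks\<close>

lemma sum_Suc_shift: "(\<Sum>k = 0..<Suc l. f k) = f 0 + (\<Sum>k = 0..<l. f (Suc k))"
  by (simp add: sum.atLeast0_lessThan_Suc_shift del: sum.op_ivl_Suc)

text \<open>Conjugating by the basis \<open>(1, e\<^sub>1, \<dots>, e\<^sub>l)\<close> splits off the constant eigenvector.\<close>

lemma char_poly_stochastic:
  fixes A :: "real Matrix.mat"
  assumes A: "A \<in> carrier_mat (Suc l) (Suc l)" and row: "\<And>i. i < Suc l \<Longrightarrow> (\<Sum>j = 0..<Suc l. A $$ (i, j)) = 1"
  shows "char_poly A = [:-1, 1:] * char_poly (Matrix.mat l l (\<lambda>(i, j). A $$ (Suc i, Suc j) - A $$ (0, Suc j)))"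
proof -
  define B where "B = Matrix.mat l l (\<lambda>(i, j). A $$ (Suc i, Suc j) - A $$ (0, Suc j))"
  define R where "R = Matrix.mat 1 l (\<lambda>(i, j). A $$ (0, Suc j))"
  define F where "F = four_block_mat (1\<^sub>m 1) R (0\<^sub>m l 1) B"
  define S where "S = Matrix.mat (Suc l) (Suc l) (\<lambda>(i, j). if j = 0 \<or> i = j then 1 else (0::real))"
  define T where "T = Matrix.mat (Suc l) (Suc l) (\<lambda>(i, j). if i = j then 1 else if j = 0 then -1 else (0::real))"
  have F: "F $$ (i, j) = (if i = 0 then if j = 0 then 1 else A $$ (0, j) else if j = 0 then 0 else A $$ (i, j) - A $$ (0, j))"
    if "i < Suc l" "j < Suc l" for i j
    using that by (cases i; cases j) (auto simp: F_def R_def B_def)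
  have dF: "F \<in> carrier_mat (Suc l) (Suc l)" by (auto simp: F_def R_def B_def)
  have dS: "S \<in> carrier_mat (Suc l) (Suc l)" and dT: "T \<in> carrier_mat (Suc l) (Suc l)" by (auto simp: S_def T_def)
  have SX: "(S * X) $$ (i, j) = (if i = 0 then X $$ (0, j) else X $$ (0, j) + X $$ (i, j))"
    if X: "X \<in> carrier_mat (Suc l) (Suc l)" and ij: "i < Suc l" "j < Suc l" for X i j
  proof -
    have "(S * X) $$ (i, j) = (\<Sum>k = 0..<Suc l. S $$ (i, k) * X $$ (k, j))"
      using X ij dS by (simp add: scalar_prod_def)
    also have "\<dots> = X $$ (0, j) + (\<Sum>k = 0..<l. if i = Suc k then X $$ (i, j) else 0)"
      unfolding sum_Suc_shift using ij by (intro arg_cong2[where f = "(+)"] sum.cong) (auto simp: S_def)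
    also have "(\<Sum>k = 0..<l. if i = Suc k then X $$ (i, j) else 0) = (if i = 0 then 0 else X $$ (i, j))"
      using ij by (cases i) auto
    finally show ?thesis by simp
  qed
  have XS: "(X * S) $$ (i, j) = (if j = 0 then (\<Sum>k = 0..<Suc l. X $$ (i, k)) else X $$ (i, j))"
    if X: "X \<in> carrier_mat (Suc l) (Suc l)" and ij: "i < Suc l" "j < Suc l" for X i j
  proof -
    have "(X * S) $$ (i, j) = (\<Sum>k = 0..<Suc l. X $$ (i, k) * S $$ (k, j))"
      using X ij dS by (simp add: scalar_prod_def)
    also have "\<dots> = (\<Sum>k = 0..<Suc l. if j = 0 then X $$ (i, k) else if k = j then X $$ (i, k) else 0)"
      using ij by (intro sum.cong) (auto simp: S_def)
    also have "\<dots> = (if j = 0 then (\<Sum>k = 0..<Suc l. X $$ (i, k)) else X $$ (i, j))"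
      using ij by (simp del: sum.op_ivl_Suc)
    finally show ?thesis .
  qed
  have ST: "S * T = 1\<^sub>m (Suc l)"
  proof (rule eq_matI)
    fix i j assume "i < dim_row (1\<^sub>m (Suc l) :: real Matrix.mat)" "j < dim_col (1\<^sub>m (Suc l) :: real Matrix.mat)"
    then have ij: "i < Suc l" "j < Suc l" by auto
    show "(S * T) $$ (i, j) = 1\<^sub>m (Suc l) $$ (i, j)"
      unfolding SX[OF dT ij] using ij by (auto simp: T_def)
  qed (use dS dT in auto)
  have TS: "T * S = 1\<^sub>m (Suc l)"
  proof (rule eq_matI)
    fix i j assume "i < dim_row (1\<^sub>m (Suc l) :: real Matrix.mat)" "j < dim_col (1\<^sub>m (Suc l) :: real Matrix.mat)"
    then have ij: "i < Suc l" "j < Suc l" by auto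
    have "(\<Sum>k = 0..<Suc l. T $$ (i, k)) = (if i = 0 then 1 else 0)"
    proof (cases i)
      case 0
      have "(\<Sum>k = 0..<l. T $$ (i, Suc k)) = 0" using 0 by (intro sum.neutral) (auto simp: T_def)
      then show ?thesis unfolding sum_Suc_shift using 0 by (simp add: T_def)
    next
      case (Suc i')
      have "(\<Sum>k = 0..<l. T $$ (i, Suc k)) = (\<Sum>k = 0..<l. if k = i' then 1 else 0)"
        using Suc ij by (intro sum.cong) (auto simp: T_def)
      then show ?thesis unfolding sum_Suc_shift using Suc ij by (simp add: T_def)
    qed
    then show "(T * S) $$ (i, j) = 1\<^sub>m (Suc l) $$ (i, j)"
      unfolding XS[OF dT ij] using ij by (auto simp: T_def)
  qed (use dS dT in auto)
  have AS: "A * S = S * F"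
  proof (rule eq_matI)
    fix i j assume "i < dim_row (S * F)" "j < dim_col (S * F)"
    then have ij: "i < Suc l" "j < Suc l" using dS dF by auto
    show "(A * S) $$ (i, j) = (S * F) $$ (i, j)"
      unfolding XS[OF A ij] SX[OF dF ij] using ij row[of i] F[of 0 j] F[of i j] by (auto simp del: sum.op_ivl_Suc)
  qed (use A dS dF in auto)
  have "A = A * (S * T)" using A by (simp add: ST)
  also have "\<dots> = S * F * T" using A dS dT AS by (simp flip: assoc_mult_mat[of _ "Suc l" "Suc l" _ "Suc l" _ "Suc l"])
  finally have "similar_mat A F"
    using A dS dT dF ST TS by (intro similar_matI[of A F S T "Suc l"]) auto
  then have "char_poly A = char_poly F" by (rule char_poly_similar)
  also have "\<dots> = char_poly (1\<^sub>m 1 :: real Matrix.mat) * char_poly B"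
    unfolding F_def by (rule char_poly_four_block_zeros_col) (auto simp: R_def B_def)
  also have "char_poly (1\<^sub>m 1 :: real Matrix.mat) = [:-1, 1:]"
    by (simp add: char_poly_def char_poly_matrix_def det_single)
  finally show ?thesis by (simp add: B_def)
qed

text \<open>The factor \<open>q\<close> belongs to the walk on functions modulo constants. A root,
  complex a priori, has an eigenfunction up to a constant; after centring, stationarity removes the
  constant, and the Rayleigh quotient is real by symmetry and bounded by
  \<open>quad\<close>.\<close>

lemma reversible_spectrum:
  fixes e :: "nat \<Rightarrow> nat \<Rightarrow> real"
  assumes l: "1 \<le> l" and sym: "\<And>i j. e i j = e j i" and dpos: "\<And>i. i < Suc l \<Longrightarrow> 0 < dd i"
    and dd: "\<And>i. i < Suc l \<Longrightarrow> dd i = (\<Sum>j = 0..<Suc l. e i j)"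
    and quad: "\<And>x. (\<Sum>i = 0..<Suc l. dd i * x i) = 0 \<Longrightarrow>
       \<bar>\<Sum>i = 0..<Suc l. \<Sum>j = 0..<Suc l. e i j * x i * x j\<bar> \<le> \<delta> * (\<Sum>i = 0..<Suc l. dd i * (x i)\<^sup>2)"
  obtains q where "char_poly (Matrix.mat (Suc l) (Suc l) (\<lambda>(i, j). e i j / dd i)) = [:-1, 1:] * q" "q \<noteq> 0"
    "\<exists>k. poly q k = 0" "\<And>k. poly q k = 0 \<Longrightarrow> \<bar>k\<bar> \<le> \<delta>"
proof -
  note [simp del] = sum.op_ivl_Suc
  let ?I = "{0..<Suc l}"
  define P where "P i j = e i j / dd i" for i j
  define A where "A = Matrix.mat (Suc l) (Suc l) (\<lambda>(i, j). P i j)"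
  define B where "B = Matrix.mat l l (\<lambda>(i, j). A $$ (Suc i, Suc j) - A $$ (0, Suc j))"
  have Aij: "A $$ (i, j) = P i j" if "i < Suc l" "j < Suc l" for i j using that by (simp add: A_def)
  have dA: "A \<in> carrier_mat (Suc l) (Suc l)" and dB: "B \<in> carrier_mat l l" by (auto simp: A_def B_def)
  have Prow: "(\<Sum>j\<in>?I. P i j) = 1" if "i < Suc l" for i
    using dd[OF that] dpos[OF that] by (simp add: P_def sum_divide_distrib[symmetric])
  have dP: "dd i * P i j = e i j" if "i < Suc l" for i j using dpos[OF that] by (simp add: P_def)
  have row: "(\<Sum>j\<in>?I. A $$ (i, j)) = 1" if "i < Suc l" for i
  proof -
    have "(\<Sum>j\<in>?I. A $$ (i, j)) = (\<Sum>j\<in>?I. P i j)" using that by (intro sum.cong) (auto simp: Aij)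
    then show ?thesis using Prow[OF that] by simp
  qed
  have cp: "char_poly A = [:-1, 1:] * char_poly B"
    unfolding B_def by (rule char_poly_stochastic[OF dA row])
  have q0: "char_poly B \<noteq> 0" using degree_monic_char_poly[OF dB] l by auto
  have key: "\<exists>k'. k = complex_of_real k' \<and> \<bar>k'\<bar> \<le> \<delta>" if k: "poly (map_poly complex_of_real (char_poly B)) k = 0" for k
  proof -
    define Bc where "Bc = map_mat complex_of_real B"
    have dBc: "Bc \<in> carrier_mat l l" using dB by (simp add: Bc_def)
    have "eigenvalue Bc k"
      unfolding eigenvalue_root_char_poly[OF dBc] using k by (simp add: Bc_def of_real_hom.char_poly_hom[OF dB])
    then obtain u where u: "u \<in> carrier_vec l" "u \<noteq> 0\<^sub>v l" "Bc *\<^sub>v u = k \<cdot>\<^sub>v u"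
      unfolding eigenvalue_def eigenvector_def using dBc by auto
    \<comment> \<open>The eigenvector modulo constants is lifted by the representative that vanishes
      at vertex 0; the error of the lift is the constant \<open>c\<close>.\<close>
    define w where "w i = (if i = 0 then 0 else u $ (i - 1))" for i
    define c where "c = (\<Sum>j\<in>?I. complex_of_real (P 0 j) * w j)"
    have Pw: "(\<Sum>j\<in>?I. complex_of_real (P i j) * w j) = k * w i + c" if i: "i < Suc l" for i
    proof (cases i)
      case 0
      then show ?thesis by (simp add: c_def w_def)
    next
      case (Suc i')
      then have i': "i' < l" using i by simp
      have "(Bc *\<^sub>v u) $ i' = (\<Sum>j = 0..<l. Bc $$ (i', j) * u $ j)"
        using i' dBc u(1) by (simp add: scalar_prod_def)
      also have "\<dots> = (\<Sum>j = 0..<l. complex_of_real (P i (Suc j) - P 0 (Suc j)) * u $ j)"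
        using i' Suc dB by (intro sum.cong) (auto simp: Bc_def B_def Aij)
      finally have "k * w i = (\<Sum>j = 0..<l. complex_of_real (P i (Suc j) - P 0 (Suc j)) * u $ j)"
        using u i' Suc by (simp add: w_def)
      also have "\<dots> = (\<Sum>j = 0..<l. complex_of_real (P i (Suc j)) * w (Suc j)) - (\<Sum>j = 0..<l. complex_of_real (P 0 (Suc j)) * w (Suc j))"
        by (simp add: w_def algebra_simps sum_subtractf)
      also have "\<dots> = (\<Sum>j\<in>?I. complex_of_real (P i j) * w j) - c"
        unfolding c_def sum_Suc_shift by (simp add: w_def)
      finally show ?thesis by simp
    qed
    define Dt where "Dt = (\<Sum>i\<in>?I. dd i)"
    have Dt: "0 < Dt" unfolding Dt_def by (rule sum_pos) (auto simp: dpos)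
    define a where "a = (\<Sum>i\<in>?I. complex_of_real (dd i) * w i) / complex_of_real Dt"
    define f where "f i = w i - a" for i
    have f0: "(\<Sum>i\<in>?I. complex_of_real (dd i) * f i) = 0"
    proof -
      have "(\<Sum>i\<in>?I. complex_of_real (dd i) * f i) = (\<Sum>i\<in>?I. complex_of_real (dd i) * w i) - complex_of_real Dt * a"
        unfolding f_def right_diff_distrib sum_subtractf Dt_def of_real_sum sum_distrib_right ..
      then show ?thesis using Dt by (simp add: a_def)
    qed
    \<comment> \<open>The constant error after centring. Summing the eigenvalue equation against the
      stationary weight \<open>dd\<close> shows that it is 0.\<close>
    define c' where "c' = k * a + c - a"
    have Pf: "(\<Sum>j\<in>?I. complex_of_real (P i j) * f j) = k * f i + c'" if i: "i < Suc l" for i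
    proof -
      have "(\<Sum>j\<in>?I. complex_of_real (P i j) * f j) = (\<Sum>j\<in>?I. complex_of_real (P i j) * w j) - (\<Sum>j\<in>?I. complex_of_real (P i j)) * a"
        by (simp add: f_def right_diff_distrib sum_subtractf sum_distrib_right)
      moreover have "(\<Sum>j\<in>?I. complex_of_real (P i j)) = 1" using Prow[OF i] by (metis of_real_1 of_real_sum)
      moreover have "k * w i + c - 1 * a = k * f i + c'" by (simp add: f_def c'_def algebra_simps)
      ultimately show ?thesis unfolding Pw[OF i] by (simp only:)
    qed
    have ef: "(\<Sum>j\<in>?I. complex_of_real (e i j) * f j) = complex_of_real (dd i) * (k * f i + c')" if i: "i < Suc l" for i
    proof -
      have "(\<Sum>j\<in>?I. complex_of_real (e i j) * f j) = complex_of_real (dd i) * (\<Sum>j\<in>?I. complex_of_real (P i j) * f j)"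
        unfolding sum_distrib_left using dP[OF i] by (intro sum.cong refl) (simp add: mult.assoc[symmetric] flip: of_real_mult)
      then show ?thesis by (simp only: Pf[OF i])
    qed
    have "(\<Sum>i\<in>?I. complex_of_real (dd i) * (k * f i + c')) = (\<Sum>i\<in>?I. \<Sum>j\<in>?I. complex_of_real (e i j) * f j)"
      by (intro sum.cong refl) (simp add: ef)
    also have "\<dots> = (\<Sum>j\<in>?I. \<Sum>i\<in>?I. complex_of_real (e j i) * f j)"
      by (subst sum.swap) (simp add: sym)
    also have "\<dots> = (\<Sum>j\<in>?I. complex_of_real (dd j) * f j)"
      by (intro sum.cong refl) (simp add: dd sum_distrib_right)
    also have "\<dots> = 0" by (rule f0)
    finally have "k * (\<Sum>i\<in>?I. complex_of_real (dd i) * f i) + complex_of_real Dt * c' = 0"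
      by (simp add: distrib_left sum.distrib sum_distrib_left sum_distrib_right Dt_def mult_ac)
    then have c'0: "c' = 0" using f0 Dt by simp
    \<comment> \<open>The hypothesis \<open>quad\<close> is about real functions, so it is applied
      to real and imaginary part separately; by symmetry of \<open>e\<close> the Hermitian form is
      the sum of the two real forms.\<close>
    define x where "x i = Re (f i)" for i
    define y where "y i = Im (f i)" for i
    have fxy: "f i = Complex (x i) (y i)" for i by (simp add: x_def y_def)
    have x0: "(\<Sum>i\<in>?I. dd i * x i) = 0" using arg_cong[where f = Re, OF f0] by (simp add: x_def)
    have y0: "(\<Sum>i\<in>?I. dd i * y i) = 0" using arg_cong[where f = Im, OF f0] by (simp add: y_def)
    define N where "N = (\<Sum>i\<in>?I. dd i * ((x i)\<^sup>2 + (y i)\<^sup>2))"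
    have N: "0 < N"
    proof -
      have "\<exists>i<Suc l. f i \<noteq> 0"
      proof (rule ccontr)
        assume "\<not> ?thesis"
        then have z: "w i = a" if "i < Suc l" for i using that by (simp add: f_def)
        then have "a = 0" using z[of 0] by (simp add: w_def)
        then have "u $ i = 0" if "i < l" for i using z[of "Suc i"] that by (simp add: w_def)
        then have "u = 0\<^sub>v l" using u(1) by (intro eq_vecI) auto
        then show False using u(2) by simp
      qed
      then obtain i where i: "i \<in> ?I" "f i \<noteq> 0" by auto
      then have "0 < (x i)\<^sup>2 + (y i)\<^sup>2" by (simp add: x_def y_def sum_power2_gt_zero_iff complex_eq_iff)
      then have "0 < dd i * ((x i)\<^sup>2 + (y i)\<^sup>2)" using dpos i by simp
      moreover have "dd i * ((x i)\<^sup>2 + (y i)\<^sup>2) \<le> N"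
        unfolding N_def by (rule member_le_sum[OF i(1)]) (auto intro!: mult_nonneg_nonneg less_imp_le[OF dpos])
      ultimately show ?thesis by simp
    qed
    define S where "S h = (\<Sum>i\<in>?I. \<Sum>j\<in>?I. e i j * h i * h j)" for h :: "nat \<Rightarrow> real"
    have "(\<Sum>i\<in>?I. cnj (f i) * (\<Sum>j\<in>?I. complex_of_real (e i j) * f j)) = (\<Sum>i\<in>?I. k * complex_of_real (dd i * ((x i)\<^sup>2 + (y i)\<^sup>2)))"
    proof (intro sum.cong refl)
      fix i assume "i \<in> ?I"
      then have "(\<Sum>j\<in>?I. complex_of_real (e i j) * f j) = complex_of_real (dd i) * (k * f i)" using ef[of i] c'0 by (simp)
      moreover have "cnj (f i) * f i = complex_of_real ((x i)\<^sup>2 + (y i)\<^sup>2)"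
        by (simp add: fxy complex_eq_iff power2_eq_square)
      ultimately show "cnj (f i) * (\<Sum>j\<in>?I. complex_of_real (e i j) * f j) = k * complex_of_real (dd i * ((x i)\<^sup>2 + (y i)\<^sup>2))"
        by (simp add: mult_ac)
    qed
    also have "\<dots> = k * complex_of_real N" by (simp add: N_def sum_distrib_left)
    finally have 1: "k * complex_of_real N = (\<Sum>i\<in>?I. cnj (f i) * (\<Sum>j\<in>?I. complex_of_real (e i j) * f j))" by simp
    have 2: "(\<Sum>i\<in>?I. cnj (f i) * (\<Sum>j\<in>?I. complex_of_real (e i j) * f j)) = complex_of_real (S x + S y)"
    proof (rule complex_eqI)
      show "Re (\<Sum>i\<in>?I. cnj (f i) * (\<Sum>j\<in>?I. complex_of_real (e i j) * f j)) = Re (complex_of_real (S x + S y))"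
        by (simp add: S_def fxy sum_distrib_left algebra_simps sum.distrib)
      have "(\<Sum>i\<in>?I. \<Sum>j\<in>?I. e i j * (x i * y j)) = (\<Sum>i\<in>?I. \<Sum>j\<in>?I. e i j * (y i * x j))"
        by (subst sum.swap) (simp add: sym mult_ac)
      then show "Im (\<Sum>i\<in>?I. cnj (f i) * (\<Sum>j\<in>?I. complex_of_real (e i j) * f j)) = Im (complex_of_real (S x + S y))"
        by (simp add: fxy sum_distrib_left sum_subtractf algebra_simps)
    qed
    define k' where "k' = (S x + S y) / N"
    have "k = complex_of_real k'" using 1 2 N by (simp add: k'_def field_simps)
    moreover have "\<bar>k'\<bar> \<le> \<delta>"
    proof -
      have "\<bar>S x + S y\<bar> \<le> \<delta> * (\<Sum>i\<in>?I. dd i * (x i)\<^sup>2) + \<delta> * (\<Sum>i\<in>?I. dd i * (y i)\<^sup>2)"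
        using quad[OF x0] quad[OF y0] unfolding S_def by linarith
      also have "\<dots> = \<delta> * N" by (simp add: N_def distrib_left sum.distrib)
      finally show ?thesis using N by (simp add: k'_def field_simps)
    qed
    ultimately show ?thesis by blast
  qed
  have deg: "degree (char_poly B) = l" using degree_monic_char_poly[OF dB] by simp
  \<comment> \<open>A root of \<open>q\<close> must be exhibited so that the spectrum has a second
    entry; one exists over the complex numbers and is real by \<open>key\<close>.\<close>
  have "\<exists>z. poly (map_poly complex_of_real (char_poly B)) z = 0"
  proof (rule alg_closed_imp_poly_has_root)
    show "0 < degree (map_poly complex_of_real (char_poly B))" using deg l by simp
  qed
  then obtain z where z: "poly (map_poly complex_of_real (char_poly B)) z = 0" by blast
  then obtain k' where "z = complex_of_real k'" using key by blast
  then have "poly (char_poly B) k' = 0" using z by (metis of_real_eq_0_iff of_real_hom.poly_map_poly)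
  moreover have "\<bar>k\<bar> \<le> \<delta>" if "poly (char_poly B) k = 0" for k
  proof -
    have "poly (map_poly complex_of_real (char_poly B)) (complex_of_real k) = 0" using that by (simp add: of_real_hom.poly_map_poly)
    from key[OF this] show ?thesis by auto
  qed
  ultimately show ?thesis using that[of "char_poly B"] cp q0 unfolding A_def P_def by blast
qed

lemma edge_weight_sym: "edge_weight X u v = edge_weight X v u"
  by (simp add: edge_weight_def insert_commute)

text \<open>One copy of the eigenvalue 1 belongs to the constants, and all other eigenvalues are
  roots of \<open>q\<close>, bounded by \<delta>. A root of \<open>q\<close> exists, so the list
  entry with index 1 is a genuine one.\<close>

lemma second_abs_eigenvalue_le:
  fixes X :: "'a weighted_complex"
  assumes fin: "finite (vertices X)" and card: "2 \<le> card (vertices X)" and \<delta>: "0 \<le> \<delta>"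
    and dd: "\<And>u. u \<in> vertices X \<Longrightarrow> dd u = (\<Sum>v\<in>vertices X. edge_weight X u v)"
    and dpos: "\<And>u. u \<in> vertices X \<Longrightarrow> 0 < dd u"
    and quad: "\<And>f. (\<Sum>u\<in>vertices X. dd u * f u) = 0 \<Longrightarrow>
       \<bar>\<Sum>u\<in>vertices X. \<Sum>v\<in>vertices X. edge_weight X u v * f u * f v\<bar> \<le> \<delta> * (\<Sum>u\<in>vertices X. dd u * (f u)\<^sup>2)"
  shows "second_abs_eigenvalue X \<le> \<delta>"
proof -
  define vs where "vs = (SOME vs. distinct vs \<and> set vs = vertices X)"
  have vs: "distinct vs" "set vs = vertices X"
    using someI_ex[of "\<lambda>vs. distinct vs \<and> set vs = vertices X"] finite_distinct_list[OF fin]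
    unfolding vs_def by blast+
  define l where "l = length vs - 1"
  have len: "length vs = Suc l" and l: "1 \<le> l" using distinct_card[OF vs(1)] card vs(2) by (auto simp: l_def)
  have bij: "bij_betw ((!) vs) {0..<Suc l} (vertices X)" using bij_betw_nth[OF vs(1), of "{0..<Suc l}" "vertices X"] vs len
    by (simp add: atLeast0LessThan)
  have S: "(\<Sum>u\<in>vertices X. h u) = (\<Sum>i = 0..<Suc l. h (vs ! i))" for h :: "'a \<Rightarrow> real"
    using sum.reindex_bij_betw[OF bij, of h] by simp
  have V: "vs ! i \<in> vertices X" if "i < Suc l" for i using that vs len nth_mem by metis
  have quad': "\<bar>\<Sum>i = 0..<Suc l. \<Sum>j = 0..<Suc l. edge_weight X (vs ! i) (vs ! j) * x i * x j\<bar> \<le> \<delta> * (\<Sum>i = 0..<Suc l. dd (vs ! i) * (x i)\<^sup>2)"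
    if x: "(\<Sum>i = 0..<Suc l. dd (vs ! i) * x i) = 0" for x
  proof -
    define f where "f u = x (the_inv_into {0..<Suc l} ((!) vs) u)" for u
    have f: "f (vs ! i) = x i" if "i \<in> {0..<Suc l}" for i
      using the_inv_into_f_f[OF bij_betw_imp_inj_on[OF bij] that] by (simp add: f_def)
    have 1: "(\<Sum>u\<in>vertices X. dd u * f u) = (\<Sum>i = 0..<Suc l. dd (vs ! i) * x i)"
      unfolding S by (intro sum.cong refl) (simp only: f)
    have 2: "(\<Sum>u\<in>vertices X. dd u * (f u)\<^sup>2) = (\<Sum>i = 0..<Suc l. dd (vs ! i) * (x i)\<^sup>2)"
      unfolding S by (intro sum.cong refl) (simp only: f)
    have 3: "(\<Sum>u\<in>vertices X. \<Sum>v\<in>vertices X. edge_weight X u v * f u * f v)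
      = (\<Sum>i = 0..<Suc l. \<Sum>j = 0..<Suc l. edge_weight X (vs ! i) (vs ! j) * x i * x j)"
      unfolding S by (intro sum.cong refl) (simp only: f)
    show ?thesis using quad[of f] x unfolding 1 2 3 by simp
  qed
  obtain q where q: "char_poly (Matrix.mat (Suc l) (Suc l) (\<lambda>(i, j). edge_weight X (vs ! i) (vs ! j) / dd (vs ! i))) = [:-1, 1:] * q"
    "q \<noteq> 0" "\<exists>k. poly q k = 0" "\<And>k. poly q k = 0 \<Longrightarrow> \<bar>k\<bar> \<le> \<delta>"
    by (rule reversible_spectrum[OF l, of "\<lambda>i j. edge_weight X (vs ! i) (vs ! j)" "\<lambda>i. dd (vs ! i)" \<delta>])
      (use quad' V dpos dd in \<open>auto simp: S edge_weight_sym simp del: sum.op_ivl_Suc\<close>)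
  have "walk_matrix X = Matrix.mat (Suc l) (Suc l) (\<lambda>(i, j). edge_weight X (vs ! i) (vs ! j) / dd (vs ! i))"
    unfolding walk_matrix_def Let_def vs_def[symmetric] len
    by (rule cong_mat) (auto simp: walk_prob_def dd[OF V, symmetric])
  then have "walk_spectrum X = proots [:-1, 1:] + proots q"
    using q by (simp add: walk_spectrum_def proots_mult del: mult_pCons_left)
  also have "proots [:-1, 1 :: real:] = {#1#}" by simp
  finally have M: "image_mset abs (walk_spectrum X) = {#1#} + image_mset abs (proots q)" by simp
  obtain k where "poly q k = 0" using q(3) by blast
  then have k: "k \<in># proots q" using q(2) by simp
  define L where "L = rev (sorted_list_of_multiset (image_mset abs (walk_spectrum X)))"
  have mL: "mset L = {#1#} + image_mset abs (proots q)" using M by (simp add: L_def)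
  have "length L = Suc (size (proots q))" by (simp add: mL flip: size_mset)
  moreover have "0 < size (proots q)" using k by (auto simp: nonempty_has_size[symmetric])
  ultimately obtain b a zs where L: "L = b # a # zs" by (metis Suc_length_conv gr0_implies_Suc)
  have "sorted (rev L)" by (simp add: L_def)
  then have ab: "a \<le> b" by (simp add: L sorted_append)
  \<comment> \<open>The list is decreasing, so if the second entry exceeded \<delta>, then two
    entries would; only the split-off 1 can.\<close>
  have "a \<le> \<delta>"
  proof (rule ccontr)
    assume "\<not> a \<le> \<delta>"
    then have "2 \<le> size (filter_mset (\<lambda>x. \<delta> < x) (mset L))" using ab by (simp add: L)
    moreover have e: "filter_mset (\<lambda>x. \<delta> < x) (image_mset abs (proots q)) = {#}"
      using q(2,4) by (auto simp: not_less)
    then have "size (filter_mset (\<lambda>x. \<delta> < x) (mset L)) \<le> 1" unfolding mL filter_union_mset e by simp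
    ultimately show False by simp
  qed
  then show ?thesis by (simp add: second_abs_eigenvalue_def flip: L_def) (simp add: L)
qed

section \<open>Complexes from exchangeable tuples\<close>

lemma extend_to_permutation:
  fixes a :: "nat \<Rightarrow> nat"
  assumes a: "inj_on a {..<k}" "a ` {..<k} \<subseteq> {..d}"
  obtains \<sigma> where "\<sigma> permutes {..d}" "\<And>j. j < k \<Longrightarrow> \<sigma> j = a j"
proof -
  have k: "k \<le> Suc d" using card_inj_on_le[OF a] by simp
  have "card ({..d} - a ` {..<k}) = card {k..d}"
    using a k by (subst card_Diff_subset) (auto simp: card_image)
  then obtain b where b: "bij_betw b {k..d} ({..d} - a ` {..<k})"
    using finite_same_card_bij[of "{k..d}" "{..d} - a ` {..<k}"] by auto
  define \<sigma> where "\<sigma> j = (if j < k then a j else if j \<le> d then b j else j)" for j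
  have "bij_betw \<sigma> {..<k} (a ` {..<k})"
    using inj_on_imp_bij_betw[OF a(1)] by (rule bij_betw_cong[THEN iffD1, rotated]) (auto simp: \<sigma>_def)
  moreover have "bij_betw \<sigma> {k..d} ({..d} - a ` {..<k})"
    using b by (rule bij_betw_cong[THEN iffD1, rotated]) (auto simp: \<sigma>_def)
  ultimately have "bij_betw \<sigma> ({..<k} \<union> {k..d}) (a ` {..<k} \<union> ({..d} - a ` {..<k}))"
    by (rule bij_betw_combine) auto
  moreover have "{..<k} \<union> {k..d} = {..d}" using k by auto
  moreover have "a ` {..<k} \<union> ({..d} - a ` {..<k}) = {..d}" using a(2) by auto
  ultimately have "bij_betw \<sigma> {..d} {..d}" by simp
  then have "\<sigma> permutes {..d}" by (rule bij_imp_permutes) (use k in \<open>auto simp: \<sigma>_def\<close>)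
  then show ?thesis by (rule that) (simp add: \<sigma>_def)
qed

text \<open>\<open>Q\<close> is the distribution of a uniformly ordered top face.\<close>

locale exchangeable_tuples =
  fixes d :: nat and Q :: "(nat \<Rightarrow> 'a) pmf" and \<delta> :: real
  assumes fin: "finite (set_pmf Q)"
    and inj: "t \<in> set_pmf Q \<Longrightarrow> inj_on t {..d}"
    and exch: "\<sigma> permutes {..d} \<Longrightarrow> map_pmf (\<lambda>t. t \<circ> \<sigma>) Q = Q"
    and mix: "1 \<le> k \<Longrightarrow> k < d \<Longrightarrow>
      mc {t \<in> set_pmf Q. \<forall>j<k. t j = y j} (pmf Q) (\<lambda>t. t k) (\<lambda>t. t (Suc k)) \<delta>"
    and \<delta>: "0 \<le> \<delta>" "\<delta> < 1"
begin

definition cx :: "'a weighted_complex" where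
  "cx = \<lparr>faces = (\<Union>t\<in>set_pmf Q. Pow (t ` {..d})), top_distr = map_pmf (\<lambda>t. t ` {..d}) Q\<rparr>"

lemma faces_iff: "s \<in> faces cx \<longleftrightarrow> (\<exists>t\<in>set_pmf Q. s \<subseteq> t ` {..d})"
  by (auto simp: cx_def)

lemma card_top: "t \<in> set_pmf Q \<Longrightarrow> card (t ` {..d}) = Suc d"
  using inj by (simp add: card_image)

lemma cx_level: "level cx (int d) = (\<lambda>t. t ` {..d}) ` set_pmf Q"
proof (intro equalityI subsetI)
  fix s assume "s \<in> level cx (int d)"
  then obtain t where t: "t \<in> set_pmf Q" "s \<subseteq> t ` {..d}" "card s = Suc d"
    by (auto simp: level_def faces_iff)
  then have "s = t ` {..d}" using card_subset_eq[of "t ` {..d}" s] card_top by auto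
  then show "s \<in> (\<lambda>t. t ` {..d}) ` set_pmf Q" using t by auto
qed (auto simp: level_def faces_iff card_top)

lemma cx_pure: "pure_complex d cx"
  unfolding pure_complex_def cx_level using fin by (auto simp: cx_def)

lemma supp_comp: "\<sigma> permutes {..d} \<Longrightarrow> t \<in> set_pmf Q \<Longrightarrow> t \<circ> \<sigma> \<in> set_pmf Q"
  by (metis exch imageI set_map_pmf)

lemma sum_exch:
  assumes "\<sigma> permutes {..d}"
  shows "(\<Sum>t\<in>set_pmf Q. pmf Q t * F (t \<circ> \<sigma>)) = (\<Sum>t\<in>set_pmf Q. pmf Q t * (F t :: real))"
proof -
  have E: "measure_pmf.expectation Q G = (\<Sum>t\<in>set_pmf Q. pmf Q t * G t)" for G :: "(nat \<Rightarrow> 'a) \<Rightarrow> real"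
    by (subst integral_measure_pmf_real[OF fin]) (auto simp: mult.commute)
  have "measure_pmf.expectation (map_pmf (\<lambda>t. t \<circ> \<sigma>) Q) F = measure_pmf.expectation Q (\<lambda>t. F (t \<circ> \<sigma>))"
    by simp
  then show ?thesis unfolding exch[OF assms] E by simp
qed

lemma order_face:
  assumes t: "t \<in> set_pmf Q" and y: "inj_on y {..<k}" "y ` {..<k} \<subseteq> t ` {..d}"
  obtains \<sigma> where "\<sigma> permutes {..d}" "\<And>j. j < k \<Longrightarrow> t (\<sigma> j) = y j"
proof -
  define a where "a j = the_inv_into {..d} t (y j)" for j
  have a: "t (a j) = y j" "a j \<le> d" if "j < k" for j
  proof -
    have "y j \<in> t ` {..d}" using y that by auto
    then show "t (a j) = y j" "a j \<le> d"
      using f_the_inv_into_f[OF inj[OF t]] the_inv_into_into[OF inj[OF t], of _ "{..d}"] by (auto simp: a_def)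
  qed
  have "inj_on a {..<k}"
    by (rule inj_onI) (use a y(1) in \<open>metis inj_onD lessThan_iff\<close>)
  moreover have "a ` {..<k} \<subseteq> {..d}" using a by auto
  ultimately obtain \<sigma> where "\<sigma> permutes {..d}" "\<And>j. j < k \<Longrightarrow> \<sigma> j = a j" by (rule extend_to_permutation) blast
  then show ?thesis using that a by metis
qed

text \<open>The ordered counterpart of a link: top faces ordered so that they begin with the face
  enumerated by \<open>y\<close>.\<close>

definition ext :: "nat \<Rightarrow> (nat \<Rightarrow> 'a) \<Rightarrow> (nat \<Rightarrow> 'a) set" where
  "ext k y = {t \<in> set_pmf Q. \<forall>j<k. t j = y j}"

lemma link_vertices:
  assumes y: "inj_on y {..<k}" and k: "k \<le> d"
  shows "vertices (link cx (y ` {..<k})) = (\<lambda>t. t k) ` ext k y"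
proof (intro equalityI subsetI)
  fix u assume "u \<in> vertices (link cx (y ` {..<k}))"
  then obtain r where r: "r \<in> faces cx" "y ` {..<k} \<subseteq> r" "{u} = r - y ` {..<k}"
    by (auto simp: vertices_def level_def link_def)
  then obtain t where t: "t \<in> set_pmf Q" "r \<subseteq> t ` {..d}" by (auto simp: faces_iff)
  let ?y = "y(k := u)"
  have "inj_on ?y {..<Suc k}" using y r(3) by (fastforce simp: inj_on_def less_Suc_eq)
  moreover have "?y ` {..<Suc k} \<subseteq> t ` {..d}"
  proof -
    have "u \<in> r" using r(3) by blast
    then have "?y ` {..<Suc k} \<subseteq> r" using r(2) by (auto simp: less_Suc_eq image_subset_iff)
    then show ?thesis using t(2) by (rule subset_trans)
  qed
  ultimately obtain \<sigma> where \<sigma>: "\<sigma> permutes {..d}" "\<And>j. j < Suc k \<Longrightarrow> t (\<sigma> j) = ?y j"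
    by (rule order_face[OF t(1)]) blast
  have "t \<circ> \<sigma> \<in> ext k y" using supp_comp[OF \<sigma>(1) t(1)] \<sigma>(2) by (auto simp: ext_def)
  moreover have "(t \<circ> \<sigma>) k = u" using \<sigma>(2)[of k] by simp
  ultimately show "u \<in> (\<lambda>t. t k) ` ext k y" by blast
next
  fix u assume "u \<in> (\<lambda>t. t k) ` ext k y"
  then obtain t where t: "t \<in> set_pmf Q" "\<And>j. j < k \<Longrightarrow> t j = y j" "t k = u" by (auto simp: ext_def)
  have e: "t ` {..<k} = y ` {..<k}" by (intro image_cong) (auto simp: t)
  have nu: "u \<notin> y ` {..<k}"
  proof
    assume "u \<in> y ` {..<k}"
    then obtain j where "j < k" "t j = t k" using t by auto
    then show False using inj_onD[OF inj[OF t(1)], of j k] k by auto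
  qed
  have "insert u (t ` {..<k}) \<subseteq> t ` {..d}" using t(3) k by auto
  then have "insert u (y ` {..<k}) \<in> faces cx" unfolding faces_iff using t(1) e by auto
  moreover have "insert u (y ` {..<k}) - y ` {..<k} = {u}" using nu by auto
  ultimately have "{u} \<in> faces (link cx (y ` {..<k}))" unfolding link_def by (auto intro!: exI[of _ "insert u (y ` {..<k})"])
  then show "u \<in> vertices (link cx (y ` {..<k}))" by (simp add: vertices_def level_def)
qed

lemma link_edge:
  assumes t: "t \<in> ext k y" and k: "k < d"
  shows "{t k, t (Suc k)} \<in> level (link cx (y ` {..<k})) 1"
proof -
  have tj: "t \<in> set_pmf Q" "\<And>j. j < k \<Longrightarrow> t j = y j" using t by (auto simp: ext_def)
  have e: "t ` {..<k} = y ` {..<k}" by (intro image_cong) (auto simp: tj)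
  have ne: "t i \<noteq> t j" if "i \<le> d" "j \<le> d" "i \<noteq> j" for i j using inj[OF tj(1)] that by (auto simp: inj_on_def)
  have "t ` {..<Suc (Suc k)} \<in> faces cx" unfolding faces_iff using tj(1) k by (intro bexI[of _ t]) auto
  moreover have "t ` {..<Suc (Suc k)} - t ` {..<k} = {t k, t (Suc k)}"
  proof -
    have "inj_on t {..<Suc (Suc k)}" using inj[OF tj(1)] k by (auto elim!: inj_on_subset)
    then have "t ` {..<Suc (Suc k)} - t ` {..<k} = t ` ({..<Suc (Suc k)} - {..<k})"
      by (intro inj_on_image_set_diff[symmetric]) auto
    also have "{..<Suc (Suc k)} - {..<k} = {k, Suc k}" by auto
    finally show ?thesis by simp
  qed
  moreover have "t ` {..<k} \<subseteq> t ` {..<Suc (Suc k)}" by auto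
  ultimately have "{t k, t (Suc k)} \<in> faces (link cx (y ` {..<k}))" unfolding link_def e[symmetric] by simp metis
  moreover have "card {t k, t (Suc k)} = 2" using ne[of k "Suc k"] k by simp
  ultimately show ?thesis by (simp add: level_def)
qed

lemma ext_wt: "wt (ext k y) (pmf Q)"
  using fin by (auto simp: wt_def ext_def)

lemma ext_pos: "t \<in> ext k y \<Longrightarrow> 0 < pmf Q t"
  by (auto simp: ext_def pmf_positive)

text \<open>Exchanging the positions \<open>k\<close> and \<open>Suc k\<close> respects the
  condition on the first \<open>k\<close> entries, so both positions have the same conditional
  law.\<close>

lemma ext_swap:
  assumes k: "k < d"
  shows "(\<Sum>t\<in>ext k y. pmf Q t * g (t (Suc k))) = (\<Sum>t\<in>ext k y. pmf Q t * (g (t k) :: real))"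
proof -
  define F where "F t = (if \<forall>j<k. t j = y j then g (t k) else 0)" for t
  let ?\<sigma> = "Transposition.transpose k (Suc k)"
  have p: "?\<sigma> permutes {..d}" using k by (intro permutes_swap_id) auto
  have S: "(\<Sum>t\<in>ext k y. pmf Q t * h t) = (\<Sum>t\<in>set_pmf Q. pmf Q t * (if \<forall>j<k. t j = y j then h t else 0))" for h :: "_ \<Rightarrow> real"
    unfolding ext_def using fin by (subst sum.inter_filter) (auto intro!: sum.cong)
  have F: "F (t \<circ> ?\<sigma>) = (if \<forall>j<k. t j = y j then g (t (Suc k)) else 0)" for t
    by (auto simp: F_def Transposition.transpose_def)
  show ?thesis using sum_exch[OF p, of F] unfolding F S by (simp add: F_def)
qed

text \<open>The indicator of a component takes the same value at both ends of every edge, so its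
  centred version has correlation 1 with itself across an edge. As \<delta> is below 1, that version
  must vanish.\<close>

lemma link_connected:
  assumes y: "inj_on y {..<k}" and k: "1 \<le> k" "k < d"
  shows "connected_graph (link cx (y ` {..<k}))"
  unfolding connected_graph_def
proof (intro ballI)
  let ?L = "link cx (y ` {..<k})" and ?W = "ext k y"
  let ?E = "{(x, y). {x, y} \<in> level ?L 1}"
  fix u v assume "u \<in> vertices ?L" "v \<in> vertices ?L"
  then obtain t1 t2 where t1: "t1 \<in> ?W" "u = t1 k" and t2: "t2 \<in> ?W" "v = t2 k"
    unfolding link_vertices[OF y less_imp_le[OF k(2)]] by auto
  define I where "I x = (if (u, x) \<in> ?E\<^sup>* then 1 else 0 :: real)" for x
  have I: "I (t (Suc k)) = I (t k)" if "t \<in> ?W" for t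
  proof -
    have "(t k, t (Suc k)) \<in> ?E" "(t (Suc k), t k) \<in> ?E"
      using link_edge[OF that k(2)] by (auto simp: insert_commute)
    then have "(u, t (Suc k)) \<in> ?E\<^sup>* \<longleftrightarrow> (u, t k) \<in> ?E\<^sup>*" by (meson rtrancl.rtrancl_into_rtrancl)
    then show ?thesis by (simp add: I_def)
  qed
  have finW: "finite ?W" using ext_wt by (simp add: wt_def)
  define M where "M = (\<Sum>t\<in>?W. pmf Q t)"
  have M: "0 < M" unfolding M_def using finW t1(1) ext_pos by (intro sum_pos) auto
  define p where "p = (\<Sum>t\<in>?W. pmf Q t * I (t k)) / M"
  define f where "f x = I x - p" for x
  have f0: "(\<Sum>t\<in>?W. pmf Q t * f (t k)) = 0"
  proof -
    have "(\<Sum>t\<in>?W. pmf Q t * f (t k)) = (\<Sum>t\<in>?W. pmf Q t * I (t k)) - M * p"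
      unfolding f_def right_diff_distrib sum_subtractf M_def sum_distrib_right ..
    then show ?thesis using M by (simp add: p_def)
  qed
  have f1: "(\<Sum>t\<in>?W. pmf Q t * f (t (Suc k))) = 0" using f0 by (simp add: f_def I)
  define N where "N = (\<Sum>t\<in>?W. pmf Q t * (f (t k))\<^sup>2)"
  have N0: "0 \<le> N" unfolding N_def by (intro sum_nonneg) auto
  have "\<bar>wip ?W (pmf Q) (\<lambda>t. f (t k)) (\<lambda>t. f (t (Suc k)))\<bar>
      \<le> \<delta> * wnm ?W (pmf Q) (\<lambda>t. f (t k)) * wnm ?W (pmf Q) (\<lambda>t. f (t (Suc k)))"
    using mix[OF k, of y] f0 f1 unfolding ext_def by (rule mcD)
  moreover have "wip ?W (pmf Q) (\<lambda>t. f (t k)) (\<lambda>t. f (t (Suc k))) = N"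
    unfolding wip_def N_def by (intro sum.cong) (auto simp: f_def I power2_eq_square)
  moreover have "wnm ?W (pmf Q) (\<lambda>t. f (t k)) = sqrt N"
    unfolding wnm_def wip_def N_def by (simp add: power2_eq_square mult.assoc)
  moreover have "wnm ?W (pmf Q) (\<lambda>t. f (t (Suc k))) = sqrt N"
    unfolding wnm_def wip_def N_def by (intro arg_cong[where f = sqrt] sum.cong) (auto simp: f_def I power2_eq_square)
  ultimately have "N \<le> \<delta> * N" using N0 by (simp add: mult.assoc)
  then have "N = 0" using N0 \<delta>(2) by (metis antisym_conv2 less_le_not_le mult_less_cancel_right2 not_less)
  then have z: "f (t k) = 0" if "t \<in> ?W" for t
    unfolding N_def using that ext_pos[OF that] finW by (subst (asm) sum_nonneg_eq_0_iff) auto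
  have "I (t2 k) = I (t1 k)" using z[OF t1(1)] z[OF t2(1)] by (simp add: f_def)
  moreover have "I (t1 k) = 1" using t1(2) by (simp add: I_def)
  ultimately show "(u, v) \<in> ?E\<^sup>*" using t2(2) by (auto simp: I_def split: if_splits)
qed

end

lemma sum_doubleton:
  fixes H :: "'a \<Rightarrow> 'a \<Rightarrow> real"
  assumes "finite V" "a \<in> V" "b \<in> V" "a \<noteq> b"
  shows "(\<Sum>u\<in>V. \<Sum>v\<in>V. (if {a, b} = {u, v} then 1 else 0) * H u v) = H a b + H b a"
proof -
  have "(if {a, b} = {u, v} then 1 else 0) * H u v =
      (if u = a then if v = b then H a b else 0 else 0) + (if u = b then if v = a then H b a else 0 else 0)" for u v
    using assms(4) by (auto simp: doubleton_eq_iff)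
  then have "(\<Sum>u\<in>V. \<Sum>v\<in>V. (if {a, b} = {u, v} then 1 else 0) * H u v) =
     (\<Sum>u\<in>V. if u = a then (\<Sum>v\<in>V. if v = b then H a b else 0) else 0) + (\<Sum>u\<in>V. if u = b then (\<Sum>v\<in>V. if v = a then H b a else 0) else 0)"
    unfolding sum.distrib[symmetric] by (intro sum.cong refl) (auto simp: sum.distrib)
  then show ?thesis using assms by simp
qed

context exchangeable_tuples
begin

text \<open>Averaging over all reorderings: every top face containing the given face has equally
  many orderings that begin with \<open>y\<close>, namely as many as there are permutations fixing
  the first \<open>k\<close> positions.\<close>

lemma ordered_sum:
  assumes y: "inj_on y {..<k}" and k: "k \<le> d"
  shows "\<exists>R>0. \<forall>h. (\<Sum>t | t \<in> set_pmf Q \<and> y ` {..<k} \<subseteq> t ` {..d}. pmf Q t * h (t ` {..d})) =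
     R * (\<Sum>t\<in>ext k y. pmf Q t * (h (t ` {..d}) :: real))"
proof -
  define Pm where "Pm = {\<sigma>. \<sigma> permutes {..d}}"
  have finP: "finite Pm" unfolding Pm_def by (rule finite_permutations) simp
  have idP: "id \<in> Pm" by (simp add: Pm_def permutes_id)
  define N where "N = card {\<rho> \<in> Pm. \<forall>j<k. \<rho> j = j}"
  have N: "0 < N" unfolding N_def card_gt_0_iff using finP idP by auto
  have count: "card {\<sigma> \<in> Pm. \<forall>j<k. t (\<sigma> j) = y j} = (if y ` {..<k} \<subseteq> t ` {..d} then N else 0)" if t: "t \<in> set_pmf Q" for t
  proof (cases "y ` {..<k} \<subseteq> t ` {..d}")
    case True
    then obtain \<sigma>0 where \<sigma>0: "\<sigma>0 permutes {..d}" "\<And>j. j < k \<Longrightarrow> t (\<sigma>0 j) = y j" by (rule order_face[OF t y]) blast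
    have "{\<sigma> \<in> Pm. \<forall>j<k. t (\<sigma> j) = y j} = (\<lambda>\<rho>. \<sigma>0 \<circ> \<rho>) ` {\<rho> \<in> Pm. \<forall>j<k. \<rho> j = j}"
    proof (intro equalityI subsetI)
      fix \<sigma> assume "\<sigma> \<in> {\<sigma> \<in> Pm. \<forall>j<k. t (\<sigma> j) = y j}"
      then have \<sigma>: "\<sigma> permutes {..d}" "\<And>j. j < k \<Longrightarrow> t (\<sigma> j) = t (\<sigma>0 j)" by (auto simp: Pm_def \<sigma>0)
      have e: "\<sigma> j = \<sigma>0 j" if "j < k" for j
        using inj_onD[OF inj[OF t] \<sigma>(2)[OF that]] permutes_in_image[OF \<sigma>(1)] permutes_in_image[OF \<sigma>0(1)] that k by simp
      let ?\<rho> = "inv_into UNIV \<sigma>0 \<circ> \<sigma>"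
      have "?\<rho> permutes {..d}" by (rule permutes_compose[OF \<sigma>(1) permutes_inv[OF \<sigma>0(1)]])
      moreover have "?\<rho> j = j" if "j < k" for j using e[OF that] permutes_inverses(2)[OF \<sigma>0(1)] by simp
      moreover have "\<sigma> = \<sigma>0 \<circ> ?\<rho>" using permutes_inverses(1)[OF \<sigma>0(1)] by (auto simp: fun_eq_iff)
      ultimately show "\<sigma> \<in> (\<lambda>\<rho>. \<sigma>0 \<circ> \<rho>) ` {\<rho> \<in> Pm. \<forall>j<k. \<rho> j = j}" by (auto simp: Pm_def)
    qed (auto simp: Pm_def \<sigma>0 intro: permutes_compose)
    moreover have "inj_on (\<lambda>\<rho>. \<sigma>0 \<circ> \<rho>) {\<rho> \<in> Pm. \<forall>j<k. \<rho> j = j}"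
      using permutes_inj[OF \<sigma>0(1)] by (auto simp: inj_on_def fun_eq_iff)
    ultimately show ?thesis using True by (simp add: card_image N_def)
  next
    case False
    have "y ` {..<k} \<subseteq> t ` {..d}" if \<sigma>: "\<sigma> permutes {..d}" "\<forall>j<k. t (\<sigma> j) = y j" for \<sigma>
    proof
      fix z assume "z \<in> y ` {..<k}"
      then obtain j where j: "j < k" "z = y j" by auto
      then have "z = t (\<sigma> j)" using \<sigma>(2) by simp
      moreover have "\<sigma> j \<in> {..d}" unfolding permutes_in_image[OF \<sigma>(1)] using j k by simp
      ultimately show "z \<in> t ` {..d}" by blast
    qed
    then have "{\<sigma> \<in> Pm. \<forall>j<k. t (\<sigma> j) = y j} = {}" using False unfolding Pm_def by blast
    then show ?thesis using False by (simp only: card.empty if_False)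
  qed
  define R where "R = real (card Pm) / real N"
  have "0 < card Pm" unfolding card_gt_0_iff using idP finP by blast
  then have R: "0 < R" using N by (simp add: R_def)
  moreover have "(\<Sum>t | t \<in> set_pmf Q \<and> y ` {..<k} \<subseteq> t ` {..d}. pmf Q t * h (t ` {..d})) =
     R * (\<Sum>t\<in>ext k y. pmf Q t * (h (t ` {..d}) :: real))" (is "?l h = R * ?r h") for h
  proof -
    define F where "F t = (if \<forall>j<k. t j = y j then h (t ` {..d}) else 0)" for t
    have F: "F (t \<circ> \<sigma>) = (if \<forall>j<k. t (\<sigma> j) = y j then 1 else 0) * h (t ` {..d})" if "\<sigma> \<in> Pm" for t \<sigma>
    proof -
      have "\<sigma> ` {..d} = {..d}" using that permutes_image by (auto simp: Pm_def)
      then have "(t \<circ> \<sigma>) ` {..d} = t ` {..d}" by (metis image_comp)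
      then show ?thesis unfolding F_def o_apply[symmetric, of t \<sigma>] by auto
    qed
    have EF: "(\<Sum>t\<in>set_pmf Q. pmf Q t * F t) = ?r h"
      unfolding ext_def using fin by (subst sum.inter_filter) (auto intro!: sum.cong simp: F_def)
    have "real (card Pm) * ?r h = (\<Sum>\<sigma>\<in>Pm. \<Sum>t\<in>set_pmf Q. pmf Q t * F t)" by (simp add: EF)
    also have "\<dots> = (\<Sum>\<sigma>\<in>Pm. \<Sum>t\<in>set_pmf Q. pmf Q t * F (t \<circ> \<sigma>))"
      by (rule sum.cong[OF refl]) (simp add: Pm_def sum_exch)
    also have "\<dots> = (\<Sum>t\<in>set_pmf Q. \<Sum>\<sigma>\<in>Pm. pmf Q t * F (t \<circ> \<sigma>))" by (rule sum.swap)
    also have "\<dots> = (\<Sum>t\<in>set_pmf Q. if y ` {..<k} \<subseteq> t ` {..d} then real N * (pmf Q t * h (t ` {..d})) else 0)"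
    proof (rule sum.cong[OF refl])
      fix t assume t: "t \<in> set_pmf Q"
      have "(\<Sum>\<sigma>\<in>Pm. pmf Q t * F (t \<circ> \<sigma>)) = (\<Sum>\<sigma>\<in>Pm. if \<forall>j<k. t (\<sigma> j) = y j then 1 else 0) * (pmf Q t * h (t ` {..d}))"
        unfolding sum_distrib_right by (rule sum.cong[OF refl]) (simp add: F)
      also have "(\<Sum>\<sigma>\<in>Pm. if \<forall>j<k. t (\<sigma> j) = y j then 1 else 0) = real (card {\<sigma> \<in> Pm. \<forall>j<k. t (\<sigma> j) = y j})"
        using finP by (simp add: sum.inter_filter[symmetric])
      also have "\<dots> * (pmf Q t * h (t ` {..d})) = (if y ` {..<k} \<subseteq> t ` {..d} then real N * (pmf Q t * h (t ` {..d})) else 0)"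
        unfolding count[OF t] by simp
      finally show "(\<Sum>\<sigma>\<in>Pm. pmf Q t * F (t \<circ> \<sigma>)) = (if y ` {..<k} \<subseteq> t ` {..d} then real N * (pmf Q t * h (t ` {..d})) else 0)" .
    qed
    also have "\<dots> = real N * ?l h" unfolding sum_distrib_left using fin by (simp add: sum.inter_filter[symmetric])
    finally show ?thesis using N by (simp add: R_def field_simps)
  qed
  ultimately show ?thesis by blast
qed

text \<open>The constant collects the normalisation of the conditional distribution and the ordering
  factor of \<open>ordered_sum\<close>; it cancels in the random walk.\<close>

lemma link_edge_weight:
  assumes y: "inj_on y {..<k}" and dk: "d = Suc k" and ne: "ext k y \<noteq> {}"
  shows "\<exists>c>0. \<forall>u v. edge_weight (link cx (y ` {..<k})) u v =
    c * (\<Sum>t\<in>ext k y. pmf Q t * (if {t k, t d} = {u, v} then 1 else 0))"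
proof -
  let ?s = "y ` {..<k}" and ?T = "\<lambda>t. t ` {..d}"
  let ?A = "{t. ?s \<subseteq> ?T t}"
  have kd: "k \<le> d" using dk by simp
  obtain R where R: "0 < R" "\<And>h. (\<Sum>t | t \<in> set_pmf Q \<and> ?s \<subseteq> ?T t. pmf Q t * h (?T t)) =
     R * (\<Sum>t\<in>ext k y. pmf Q t * (h (?T t) :: real))"
    using ordered_sum[OF y kd] by (elim exE conjE) (rule that, auto)
  have sub: "?s \<subseteq> ?T t" if "t \<in> ext k y" for t
  proof -
    have "?s = t ` {..<k}" using that by (intro image_cong) (auto simp: ext_def)
    then show ?thesis using dk by auto
  qed
  obtain t0 where t0: "t0 \<in> ext k y" using ne by blast
  then have A: "t0 \<in> set_pmf Q" "t0 \<in> ?A" using sub by (auto simp: ext_def)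
  have cond: "cond_pmf (map_pmf ?T Q) {r. ?s \<subseteq> r} = map_pmf ?T (cond_pmf Q ?A)"
    using A by (subst cond_map_pmf) (auto simp: vimage_def)
  have top: "top_distr (link cx ?s) = map_pmf (\<lambda>t. ?T t - ?s) (cond_pmf Q ?A)"
    by (simp add: link_def cx_def cond map_pmf_comp)
  have setA: "set_pmf (cond_pmf Q ?A) = set_pmf Q \<inter> ?A" using A by (intro set_cond_pmf) auto
  \<comment> \<open>This link has dimension 1: its top faces are already edges, so choosing a random
    2-subset changes nothing.\<close>
  have "induced_distr (link cx ?s) 1 = bind_pmf (top_distr (link cx ?s)) return_pmf"
    unfolding induced_distr_def
  proof (rule bind_pmf_cong[OF refl])
    fix r assume "r \<in> set_pmf (top_distr (link cx ?s))"
    then obtain t where t: "t \<in> set_pmf Q" "?s \<subseteq> ?T t" "r = ?T t - ?s" unfolding top by (auto simp: setA)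
    then have "card r = 2" using card_top[OF t(1)] y dk by (simp add: card_Diff_subset card_image)
    moreover have "s' = r" if "s' \<subseteq> r" "card s' = 2" for s'
      by (rule card_subset_eq) (use that \<open>card r = 2\<close> t(3) in auto)
    ultimately have "{s. s \<subseteq> r \<and> int (card s) = 1 + 1} = {r}" by auto
    then show "pmf_of_set {s. s \<subseteq> r \<and> int (card s) = 1 + 1} = return_pmf r" by (simp add: pmf_of_set_singleton)
  qed
  then have ind: "induced_distr (link cx ?s) 1 = map_pmf (\<lambda>t. ?T t - ?s) (cond_pmf Q ?A)"
    by (simp add: bind_return_pmf' top)
  define Z where "Z = measure Q ?A"
  have Z: "0 < Z" unfolding Z_def using A by (intro measure_pmf_posI) auto
  have "edge_weight (link cx ?s) u v = R / Z * (\<Sum>t\<in>ext k y. pmf Q t * (if {t k, t d} = {u, v} then 1 else 0))" for u v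
  proof -
    let ?B = "(\<lambda>t. ?T t - ?s) -` {{u, v}}"
    have pc: "pmf (cond_pmf Q ?A) t = (if t \<in> ?A then pmf Q t / Z else 0)" for t
      unfolding Z_def using A by (intro pmf_cond) auto
    have fA: "finite (set_pmf (cond_pmf Q ?A))" unfolding setA using fin by simp
    have "edge_weight (link cx ?s) u v = measure (cond_pmf Q ?A) ?B"
      unfolding edge_weight_def ind by (simp add: pmf_map)
    also have "\<dots> = measure (cond_pmf Q ?A) (?B \<inter> set_pmf (cond_pmf Q ?A))" by (simp only: measure_Int_set_pmf)
    also have "\<dots> = (\<Sum>t\<in>?B \<inter> set_pmf (cond_pmf Q ?A). pmf (cond_pmf Q ?A) t)"
      using fA by (intro measure_measure_pmf_finite) auto
    also have "\<dots> = (\<Sum>t | t \<in> set_pmf Q \<and> ?s \<subseteq> ?T t. (pmf Q t * (if ?T t - ?s = {u, v} then 1 else 0)) / Z)"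
      unfolding setA using fin A by (intro sum.mono_neutral_cong_left) (auto simp: pc)
    also have "\<dots> = (\<Sum>t | t \<in> set_pmf Q \<and> ?s \<subseteq> ?T t. pmf Q t * (if ?T t - ?s = {u, v} then 1 else 0)) / Z"
      by (rule sum_divide_distrib[symmetric])
    also have "\<dots> = R / Z * (\<Sum>t\<in>ext k y. pmf Q t * (if ?T t - ?s = {u, v} then 1 else 0))"
      unfolding R(2)[of "\<lambda>r. if r - ?s = {u, v} then 1 else 0"] by simp
    also have "(\<Sum>t\<in>ext k y. pmf Q t * (if ?T t - ?s = {u, v} then 1 else 0)) =
        (\<Sum>t\<in>ext k y. pmf Q t * (if {t k, t d} = {u, v} then 1 else 0))"
    proof (rule sum.cong[OF refl])
      fix t assume t: "t \<in> ext k y"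
      have e: "?s = t ` {..<k}" using t by (intro image_cong) (auto simp: ext_def)
      have "inj_on t {..d}" using t inj by (simp add: ext_def)
      then have "?T t - t ` {..<k} = t ` ({..d} - {..<k})" using dk by (intro inj_on_image_set_diff[symmetric]) auto
      also have "{..d} - {..<k} = {k, d}" using dk by auto
      finally show "pmf Q t * (if ?T t - ?s = {u, v} then 1 else 0) = pmf Q t * (if {t k, t d} = {u, v} then 1 else 0)"
        unfolding e by simp
    qed
    finally show ?thesis .
  qed
  moreover have "0 < R / Z" using R(1) Z by simp
  ultimately show ?thesis by blast
qed

text \<open>Up to the constant of \<open>link_edge_weight\<close>, the quadratic form of the walk is
  twice the weighted inner product of f at positions \<open>k\<close> and \<open>d\<close>, and the
  vertex weights are twice the conditional law of position \<open>k\<close>. So the correlation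
  bound is the required bound on the form.\<close>

lemma link_spectral:
  assumes y: "inj_on y {..<k}" and dk: "d = Suc k" and k: "1 \<le> k" and ne: "ext k y \<noteq> {}"
  shows "second_abs_eigenvalue (link cx (y ` {..<k})) \<le> \<delta>"
proof -
  let ?L = "link cx (y ` {..<k})" and ?W = "ext k y"
  let ?V = "vertices ?L"
  obtain c where c: "0 < c" and ew: "\<And>u v. edge_weight ?L u v =
    c * (\<Sum>t\<in>?W. pmf Q t * (if {t k, t d} = {u, v} then 1 else 0))"
    using link_edge_weight[OF y dk ne] by blast
  have kd: "k < d" using dk by simp
  have V: "?V = (\<lambda>t. t k) ` ?W" using dk by (intro link_vertices[OF y]) simp
  have finW: "finite ?W" using ext_wt by (simp add: wt_def)
  then have finV: "finite ?V" by (simp add: V)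
  have tV: "t k \<in> ?V" "t d \<in> ?V" "t k \<noteq> t d" if "t \<in> ?W" for t
  proof -
    show "t k \<in> ?V" using that V by blast
    let ?\<sigma> = "Transposition.transpose k d"
    have p: "?\<sigma> permutes {..d}" using kd by (intro permutes_swap_id) auto
    have "t \<circ> ?\<sigma> \<in> ?W" using supp_comp[OF p] that dk by (auto simp: ext_def Transposition.transpose_def)
    then show "t d \<in> ?V" unfolding V by (intro image_eqI[of _ _ "t \<circ> ?\<sigma>"]) auto
    show "t k \<noteq> t d" using inj_onD[OF inj[of t], of k d] that dk by (auto simp: ext_def)
  qed
  have G: "(\<Sum>u\<in>?V. \<Sum>v\<in>?V. edge_weight ?L u v * H u v) = c * (\<Sum>t\<in>?W. pmf Q t * (H (t k) (t d) + H (t d) (t k)))" for H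
  proof -
    have "(\<Sum>u\<in>?V. \<Sum>v\<in>?V. edge_weight ?L u v * H u v) =
      (\<Sum>u\<in>?V. \<Sum>v\<in>?V. \<Sum>t\<in>?W. c * (pmf Q t * ((if {t k, t d} = {u, v} then 1 else 0) * H u v)))"
      unfolding ew sum_distrib_left sum_distrib_right by (simp only: mult.assoc)
    also have "\<dots> = (\<Sum>u\<in>?V. \<Sum>t\<in>?W. \<Sum>v\<in>?V. c * (pmf Q t * ((if {t k, t d} = {u, v} then 1 else 0) * H u v)))"
      by (rule sum.cong[OF refl]) (rule sum.swap)
    also have "\<dots> = (\<Sum>t\<in>?W. \<Sum>u\<in>?V. \<Sum>v\<in>?V. c * (pmf Q t * ((if {t k, t d} = {u, v} then 1 else 0) * H u v)))"
      by (rule sum.swap)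
    also have "\<dots> = (\<Sum>t\<in>?W. c * (pmf Q t * (\<Sum>u\<in>?V. \<Sum>v\<in>?V. (if {t k, t d} = {u, v} then 1 else 0) * H u v)))"
      by (simp only: sum_distrib_left)
    also have "\<dots> = (\<Sum>t\<in>?W. c * (pmf Q t * (H (t k) (t d) + H (t d) (t k))))"
      by (rule sum.cong[OF refl]) (simp only: sum_doubleton[OF finV tV])
    finally show ?thesis by (simp only: sum_distrib_left)
  qed
  define dd where "dd u = (\<Sum>v\<in>?V. edge_weight ?L u v)" for u
  have ddG: "(\<Sum>u\<in>?V. dd u * f u) = c * (2 * (\<Sum>t\<in>?W. pmf Q t * f (t k)))" for f
  proof -
    have "(\<Sum>u\<in>?V. dd u * f u) = c * (\<Sum>t\<in>?W. pmf Q t * (f (t k) + f (t d)))"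
      unfolding dd_def sum_distrib_right by (rule G)
    also have "(\<Sum>t\<in>?W. pmf Q t * (f (t k) + f (t d))) = 2 * (\<Sum>t\<in>?W. pmf Q t * f (t k))"
      using ext_swap[OF kd, of f y] by (simp add: distrib_left sum.distrib dk)
    finally show ?thesis .
  qed
  show ?thesis
  proof (rule second_abs_eigenvalue_le[OF finV _ \<delta>(1), of dd])
    obtain t where t: "t \<in> ?W" using ne by blast
    have "card {t k, t d} \<le> card ?V" using tV[OF t] finV by (intro card_mono) auto
    then show "2 \<le> card ?V" using tV[OF t] by simp
    show "dd u = (\<Sum>v\<in>?V. edge_weight ?L u v)" for u by (rule dd_def)
    show "0 < dd u" if u: "u \<in> ?V" for u
    proof -
      have "dd u = (\<Sum>x\<in>?V. dd x * (if x = u then 1 else 0))"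
        using sum.delta[OF finV, of u dd] u by (simp add: if_distrib cong: if_cong)
      also have "\<dots> = c * (2 * (\<Sum>t\<in>?W. pmf Q t * (if t k = u then 1 else 0)))" by (rule ddG)
      also have "\<dots> > 0"
      proof -
        obtain t where t: "t \<in> ?W" "t k = u" using u V by auto
        have "0 < (\<Sum>t\<in>?W. pmf Q t * (if t k = u then 1 else 0))"
          using t ext_pos[OF t(1)] by (intro sum_pos2[OF finW t(1)]) auto
        then show ?thesis using c by simp
      qed
      finally show ?thesis .
    qed
    fix f assume "(\<Sum>u\<in>?V. dd u * f u) = 0"
    then have f0: "(\<Sum>t\<in>?W. pmf Q t * f (t k)) = 0" using c unfolding ddG by simp
    then have f1: "(\<Sum>t\<in>?W. pmf Q t * f (t (Suc k))) = 0" using ext_swap[OF kd, of f y] by simp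
    define N where "N = (\<Sum>t\<in>?W. pmf Q t * (f (t k))\<^sup>2)"
    have N0: "0 \<le> N" unfolding N_def by (intro sum_nonneg) auto
    have "\<bar>wip ?W (pmf Q) (\<lambda>t. f (t k)) (\<lambda>t. f (t (Suc k)))\<bar>
      \<le> \<delta> * wnm ?W (pmf Q) (\<lambda>t. f (t k)) * wnm ?W (pmf Q) (\<lambda>t. f (t (Suc k)))"
      using mix[OF k kd, of y] f0 f1 unfolding ext_def by (rule mcD)
    also have "wnm ?W (pmf Q) (\<lambda>t. f (t k)) = sqrt N"
      unfolding wnm_def wip_def N_def by (simp add: power2_eq_square mult.assoc)
    also have "wnm ?W (pmf Q) (\<lambda>t. f (t (Suc k))) = sqrt N"
      using ext_swap[OF kd, of "\<lambda>x. (f x)\<^sup>2" y] unfolding wnm_def wip_def N_def by (simp add: power2_eq_square mult.assoc)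
    finally have w: "\<bar>wip ?W (pmf Q) (\<lambda>t. f (t k)) (\<lambda>t. f (t (Suc k)))\<bar> \<le> \<delta> * N" using N0 by (simp add: mult.assoc)
    have "(\<Sum>u\<in>?V. \<Sum>v\<in>?V. edge_weight ?L u v * f u * f v) = (\<Sum>u\<in>?V. \<Sum>v\<in>?V. edge_weight ?L u v * (f u * f v))"
      by (simp only: mult.assoc)
    also have "\<dots> = c * (\<Sum>t\<in>?W. pmf Q t * (f (t k) * f (t d) + f (t d) * f (t k)))" by (rule G)
    also have "(\<Sum>t\<in>?W. pmf Q t * (f (t k) * f (t d) + f (t d) * f (t k))) = 2 * wip ?W (pmf Q) (\<lambda>t. f (t k)) (\<lambda>t. f (t (Suc k)))"
      unfolding wip_def sum_distrib_left by (rule sum.cong[OF refl]) (simp add: dk)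
    finally have "\<bar>\<Sum>u\<in>?V. \<Sum>v\<in>?V. edge_weight ?L u v * f u * f v\<bar> = c * (2 * \<bar>wip ?W (pmf Q) (\<lambda>t. f (t k)) (\<lambda>t. f (t (Suc k)))\<bar>)"
      using c by (simp add: abs_mult)
    also have "\<dots> \<le> c * (2 * (\<delta> * N))" using c w by (intro mult_left_mono) auto
    also have "\<dots> = \<delta> * (\<Sum>u\<in>?V. dd u * (f u)\<^sup>2)" unfolding ddG N_def by simp
    finally show "\<bar>\<Sum>u\<in>?V. \<Sum>v\<in>?V. edge_weight ?L u v * f u * f v\<bar> \<le> \<delta> * (\<Sum>u\<in>?V. dd u * (f u)\<^sup>2)" .
  qed
qed

text \<open>The correlation hypothesis \<open>mix\<close> starts with one fixed vertex, so
  connectedness of the link of the empty face has to be supplied separately.\<close>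

theorem cx_local_expander:
  assumes d: "2 \<le> d" and conn: "connected_graph cx"
  shows "local_spectral_expander d \<delta> cx"
proof -
  have enum: "\<exists>y. s = y ` {..<card s} \<and> inj_on y {..<card s} \<and> ext (card s) y \<noteq> {}" if s: "s \<in> faces cx" for s
  proof -
    obtain t where t: "t \<in> set_pmf Q" "s \<subseteq> t ` {..d}" using s by (auto simp: faces_iff)
    then have "finite s" using finite_subset by blast
    then obtain y where y: "bij_betw y {..<card s} s" using ex_bij_betw_nat_finite[of s] by (auto simp: atLeast0LessThan)
    then have y': "inj_on y {..<card s}" "y ` {..<card s} = s" by (auto simp: bij_betw_def)
    have ysub: "y ` {..<card s} \<subseteq> t ` {..d}" using y'(2) t(2) by simp
    obtain \<sigma> where \<sigma>: "\<sigma> permutes {..d}" "\<And>j. j < card s \<Longrightarrow> t (\<sigma> j) = y j"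
      by (rule order_face[OF t(1) y'(1) ysub]) blast
    then have "t \<circ> \<sigma> \<in> ext (card s) y" using supp_comp[OF \<sigma>(1) t(1)] by (auto simp: ext_def)
    then have "ext (card s) y \<noteq> {}" by blast
    then show ?thesis using y' by (intro exI[of _ y]) simp
  qed
  have "connected_graph (link cx s)" if s: "s \<in> faces cx" "card s \<le> d - 1" for s
  proof (cases "s = {}")
    case True
    have "faces (link cx {}) = faces cx" by (auto simp: link_def)
    then show ?thesis using conn True by (simp add: connected_graph_def level_def vertices_def)
  next
    case False
    obtain y where y: "s = y ` {..<card s}" "inj_on y {..<card s}" using enum[OF s(1)] by blast
    have "1 \<le> card s" using False y by (metis One_nat_def Suc_leI card_gt_0_iff finite_imageI finite_lessThan)
    then have "connected_graph (link cx (y ` {..<card s}))" using s d by (intro link_connected[OF y(2)]) auto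
    then show ?thesis using y(1) by simp
  qed
  moreover have "second_abs_eigenvalue (link cx s) \<le> \<delta>" if s: "s \<in> faces cx" "card s = d - 1" for s
  proof -
    obtain y where y: "s = y ` {..<card s}" "inj_on y {..<card s}" "ext (card s) y \<noteq> {}" using enum[OF s(1)] by blast
    have "second_abs_eigenvalue (link cx (y ` {..<card s})) \<le> \<delta>"
      using s d y by (intro link_spectral) auto
    then show ?thesis using y(1) by simp
  qed
  ultimately show ?thesis unfolding local_spectral_expander_def level_def using d by auto
qed

end

section \<open>Cayley complexes from frame systems\<close>

lemma mc_scale:
  assumes "mc W m X Y \<delta>" "0 < c" shows "mc W (\<lambda>w. c * m w) X Y \<delta>"
  unfolding mc_def
proof (intro allI impI)
  fix f g assume 0: "(\<Sum>w\<in>W. c * m w * f (X w)) = 0" "(\<Sum>w\<in>W. c * m w * g (Y w)) = 0"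
  have w: "wip W (\<lambda>w. c * m w) F G = c * wip W m F G" for F G
    by (simp add: wip_def sum_distrib_left mult.assoc)
  have n: "wnm W (\<lambda>w. c * m w) F = sqrt c * wnm W m F" for F by (simp add: wnm_def w real_sqrt_mult)
  have s: "(\<Sum>w\<in>W. c * m w * h w) = c * (\<Sum>w\<in>W. m w * h w)" for h by (simp add: sum_distrib_left mult.assoc)
  have "\<bar>wip W m (\<lambda>w. f (X w)) (\<lambda>w. g (Y w))\<bar> \<le> \<delta> * wnm W m (\<lambda>w. f (X w)) * wnm W m (\<lambda>w. g (Y w))"
    using 0 assms(2) unfolding s by (intro mcD[OF assms(1)]) auto
  from sqrt_scale[OF less_imp_le[OF assms(2)] this]
  show "\<bar>wip W (\<lambda>w. c * m w) (\<lambda>w. f (X w)) (\<lambda>w. g (Y w))\<bar> \<le>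
      \<delta> * wnm W (\<lambda>w. c * m w) (\<lambda>w. f (X w)) * wnm W (\<lambda>w. c * m w) (\<lambda>w. g (Y w))"
    using assms(2) by (simp add: w n abs_mult)
qed

definition row_vec :: "nat \<Rightarrow> nat \<Rightarrow> bmat \<Rightarrow> bit Matrix.vec" where
  "row_vec n i v = Matrix.vec n (\<lambda>j. ent v i j)"

lemma row_vec_carrier [simp]: "row_vec n i v \<in> carrier_vec n"
  by (simp add: row_vec_def)

lemma row_vec_add: "row_vec n i (v + w) = row_vec n i v + row_vec n i w"
  by (rule eq_vecI) (simp_all add: row_vec_def ent_add)

lemma row_vec_dg: "row_vec n i (dg {i} * v) = row_vec n i v"
  by (rule eq_vecI) (simp_all add: row_vec_def)

lemma row_vec_eq_iff:
  assumes "v \<in> corner a n" "w \<in> corner b n"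
  shows "row_vec n i v = row_vec n k w \<longleftrightarrow> mun 0 i * v = mun 0 k * w"
proof
  assume e: "row_vec n i v = row_vec n k w"
  have "ent v i j = ent w k j" for j
  proof (cases "j < n")
    case True
    then show ?thesis using arg_cong[OF e, of "\<lambda>x. x $ j"] by (simp add: row_vec_def)
  next
    case False
    then have "ent v i j = 0" "ent w k j = 0" using assms unfolding corner_iff by blast+
    then show ?thesis by simp
  qed
  then show "mun 0 i * v = mun 0 k * w" by (intro bmat_eqI) simp
next
  assume e: "mun 0 i * v = mun 0 k * w"
  have "ent v i j = ent w k j" for j using arg_cong[OF e, of "\<lambda>x. ent x 0 j"] by simp
  then show "row_vec n i v = row_vec n k w" by (simp add: row_vec_def)
qed

definition vec_row :: "bit Matrix.vec \<Rightarrow> bmat" where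
  "vec_row x = (\<Sum>j | j < dim_vec x \<and> x $ j \<noteq> 0. mun 0 j)"

lemma ent_vec_row: "ent (vec_row x) i j = (if i = 0 \<and> j < dim_vec x then x $ j else 0)"
proof -
  have "ent (vec_row x) i j = (\<Sum>l | l < dim_vec x \<and> x $ l \<noteq> 0. if l = j then (if i = 0 then 1 else 0) else 0)"
    unfolding vec_row_def ent_sum by (rule sum.cong[OF refl]) (simp add: ent_mun)
  also have "\<dots> = (if j < dim_vec x \<and> x $ j \<noteq> 0 then (if i = 0 then 1 else 0) else 0)"
    by (subst sum.delta) auto
  finally have e: "ent (vec_row x) i j = (if j < dim_vec x \<and> x $ j \<noteq> 0 then if i = 0 then 1 else 0 else 0)" .
  show ?thesis
  proof (cases "x $ j = 0")
    case False
    then have "x $ j = 1" by (simp only: bit_1_iff not_False_eq_True)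
    then show ?thesis unfolding e by simp
  qed (simp add: e)
qed

lemma row_vec_vec_row: "x \<in> carrier_vec n \<Longrightarrow> row_vec n 0 (vec_row x) = x"
  by (rule eq_vecI) (auto simp: row_vec_def ent_vec_row)

lemma vec_row_corner: "x \<in> carrier_vec n \<Longrightarrow> vec_row x \<in> corner 1 n"
  by (auto simp: corner_iff ent_vec_row split: if_splits)

lemma finite_bit_vec: "finite (carrier_vec n :: bit Matrix.vec set)"
proof (rule finite_subset)
  show "carrier_vec n \<subseteq> row_vec n 0 ` corner 1 n"
  proof
    fix x :: "bit Matrix.vec" assume x: "x \<in> carrier_vec n"
    show "x \<in> row_vec n 0 ` corner 1 n"
      by (rule image_eqI[of x "row_vec n 0" "vec_row x"]) (simp_all add: row_vec_vec_row[OF x] vec_row_corner[OF x, simplified])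
  qed
qed simp

lemma bit_vec_add_self: "(x :: bit Matrix.vec) \<in> carrier_vec n \<Longrightarrow> x + x = 0\<^sub>v n"
  by (rule eq_vecI) auto

lemma bit_vec_cancel:
  assumes "(x :: bit Matrix.vec) \<in> carrier_vec n" "y \<in> carrier_vec n"
  shows "x + y + y = x" "x + (x + y) = y"
proof -
  show "x + y + y = x" using assms by (simp add: assoc_add_vec[OF assms(1,2,2)] bit_vec_add_self)
  show "x + (x + y) = y" unfolding assoc_add_vec[OF assms(1,1,2), symmetric] using assms by (simp add: bit_vec_add_self)
qed

lemma bit_vec_left_cancel:
  assumes "(x :: bit Matrix.vec) \<in> carrier_vec n" "y \<in> carrier_vec n" "z \<in> carrier_vec n"
  shows "x + y = x + z \<longleftrightarrow> y = z"
  by (metis assms bit_vec_cancel(2))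

text \<open>The filler value beyond \<open>d\<close> is constant, so tuples are determined by their
  vertices and composition with a permutation of \<open>{..d}\<close> yields again a tuple of this
  form.\<close>

definition tup :: "nat \<Rightarrow> nat \<Rightarrow> bit Matrix.vec \<times> bmat \<Rightarrow> nat \<Rightarrow> bit Matrix.vec" where
  "tup n d w j = (if j = 0 then fst w else if j \<le> d then fst w + row_vec n (j - 1) (snd w) else 0\<^sub>v n)"

lemma tup_simps [simp]:
  "tup n d w 0 = fst w" "i < d \<Longrightarrow> tup n d w (Suc i) = fst w + row_vec n i (snd w)"
  by (auto simp: tup_def)

lemma map_pmf_involution:
  assumes "\<And>w. w \<in> set_pmf P \<Longrightarrow> \<phi> w \<in> set_pmf P" "\<And>w. w \<in> set_pmf P \<Longrightarrow> \<phi> (\<phi> w) = w"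
    "\<And>w. w \<in> set_pmf P \<Longrightarrow> pmf P (\<phi> w) = pmf P w"
  shows "map_pmf \<phi> P = P"
proof (rule pmf_eqI)
  fix w
  have inj: "inj_on \<phi> (set_pmf P)" by (rule inj_on_inverseI[of _ \<phi>]) (rule assms(2))
  show "pmf (map_pmf \<phi> P) w = pmf P w"
  proof (cases "w \<in> set_pmf P")
    case True
    then show ?thesis using pmf_map_inj[OF inj assms(1)[OF True]] assms(2,3)[OF True] by simp
  next
    case False
    then have "w \<notin> set_pmf (map_pmf \<phi> P)" using assms(1) by auto
    then show ?thesis using False by (metis pmf_eq_0_set_pmf)
  qed
qed

locale frame_complex =
  fixes n d :: nat and \<delta> :: real and mu :: "bmat \<Rightarrow> real"
  assumes FS: "FS n d \<delta> mu" and \<delta>: "0 \<le> \<delta>" "\<delta> < 1" and d: "2 \<le> d"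
begin

definition "supp = {v. mu v \<noteq> 0}"
definition "frame_pmf = embed_pmf (\<lambda>v. mu v / sum mu supp)"
definition "flag_pmf = pair_pmf (pmf_of_set (carrier_vec n :: bit Matrix.vec set)) frame_pmf"
definition "tup_pmf = map_pmf (tup n d) flag_pmf"

lemma supp_finite: "finite supp" using FS by (simp add: supp_def FS_def)

lemma supp_D: "v \<in> supp \<Longrightarrow> v \<in> corner d n" "v \<in> supp \<Longrightarrow> \<exists>\<theta>. v * \<theta> = id_mat d"
  using FS by (simp_all add: supp_def FS_def)

lemma supp_gl: "g \<in> gl d \<Longrightarrow> v \<in> supp \<Longrightarrow> g * v \<in> supp" and mu_gl: "g \<in> gl d \<Longrightarrow> mu (g * v) = mu v"
  using FS by (simp_all add: supp_def FS_def)

lemma mass_pos: "0 < sum mu supp"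
proof -
  obtain v where v: "v \<in> supp" using FS by (auto simp: FS_def supp_def)
  have "0 < mu v" if "v \<in> supp" for v
  proof -
    have "0 \<le> mu v" using FS by (simp add: FS_def)
    moreover have "mu v \<noteq> 0" using that by (simp add: supp_def)
    ultimately show ?thesis by simp
  qed
  then show ?thesis using supp_finite v by (intro sum_pos) auto
qed

lemma pmf_frame: "pmf frame_pmf v = mu v / sum mu supp"
  unfolding frame_pmf_def
proof (rule pmf_embed_pmf)
  show nn: "0 \<le> mu v / sum mu supp" for v using FS mass_pos by (simp add: FS_def)
  have "(\<integral>\<^sup>+ v. ennreal (mu v / sum mu supp) \<partial>count_space UNIV) = (\<Sum>v\<in>supp. ennreal (mu v / sum mu supp))"
    by (rule nn_integral_count_space'[OF supp_finite]) (auto simp: supp_def)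
  also have "\<dots> = ennreal (\<Sum>v\<in>supp. mu v / sum mu supp)" using nn by (intro sum_ennreal) auto
  also have "(\<Sum>v\<in>supp. mu v / sum mu supp) = 1" using mass_pos by (simp flip: sum_divide_distrib)
  finally show "(\<integral>\<^sup>+ v. ennreal (mu v / sum mu supp) \<partial>count_space UNIV) = 1" by simp
qed

lemma set_frame: "set_pmf frame_pmf = supp"
  using mass_pos by (auto simp: set_pmf_eq pmf_frame supp_def)

lemma carrier_ne: "(carrier_vec n :: bit Matrix.vec set) \<noteq> {}" using zero_carrier_vec by blast

lemma set_flag: "set_pmf flag_pmf = carrier_vec n \<times> supp"
  by (simp add: flag_pmf_def set_frame set_pmf_of_set[OF carrier_ne finite_bit_vec])

lemma pmf_flag: "x \<in> carrier_vec n \<Longrightarrow> pmf flag_pmf (x, v) = mu v / sum mu supp / real (card (carrier_vec n :: bit Matrix.vec set))"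
  by (simp add: flag_pmf_def pmf_pair pmf_frame pmf_of_set[OF carrier_ne finite_bit_vec])

lemma row_nonzero:
  assumes v: "v \<in> supp" and i: "i < d" shows "row_vec n i v \<noteq> 0\<^sub>v n"
proof
  assume "row_vec n i v = 0\<^sub>v n"
  also have "0\<^sub>v n = row_vec n i 0" by (rule eq_vecI) (simp_all add: row_vec_def ent_0)
  finally have "mun 0 i * v = 0"
    using row_vec_eq_iff[of v d n 0 1 i i] supp_D(1)[OF v] by (simp add: corner_iff ent_0)
  moreover obtain \<theta> where "v * \<theta> = id_mat d" using supp_D(2)[OF v] by blast
  ultimately have "mun 0 i * id_mat d = 0" by (metis mult.assoc mult_zero_left)
  then have "ent (mun 0 i * id_mat d) 0 i = 0" by (simp only: ent_0)
  then show False using i by (simp add: id_mat_def ent_dg ent_mun)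
qed

lemma row_distinct:
  assumes v: "v \<in> supp" and i: "i < d" "k < d" "i \<noteq> k" shows "row_vec n i v \<noteq> row_vec n k v"
proof
  assume "row_vec n i v = row_vec n k v"
  then have "mun 0 i * v = mun 0 k * v" using row_vec_eq_iff supp_D(1)[OF v] by blast
  moreover obtain \<theta> where "v * \<theta> = id_mat d" using supp_D(2)[OF v] by blast
  ultimately have "mun 0 i * id_mat d = mun 0 k * id_mat d" by (metis mult.assoc)
  then have "ent (mun 0 i * id_mat d) 0 i = ent (mun 0 k * id_mat d) 0 i" by (simp only:)
  then show False using i by (simp add: id_mat_def ent_dg ent_mun)
qed

lemma tup_inj: "inj_on (tup n d) (carrier_vec n \<times> supp)"
proof (rule inj_onI)
  fix w w' assume w: "w \<in> carrier_vec n \<times> supp" "w' \<in> carrier_vec n \<times> supp" and e: "tup n d w = tup n d w'"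
  have x: "fst w = fst w'" using fun_cong[OF e, of 0] by simp
  have r: "row_vec n i (snd w) = row_vec n i (snd w')" if "i < d" for i
    using fun_cong[OF e, of "Suc i"] that w x bit_vec_left_cancel[of "fst w'" n] by auto
  have c: "snd w \<in> corner d n" "snd w' \<in> corner d n" using w supp_D(1) by auto
  have "ent (snd w) i j = ent (snd w') i j" for i j
  proof (cases "i < d")
    case True
    then have "mun 0 i * snd w = mun 0 i * snd w'" using r row_vec_eq_iff c by blast
    from arg_cong[OF this, of "\<lambda>x. ent x 0 j"] show ?thesis by simp
  next
    case False
    then have "ent (snd w) i j = 0" "ent (snd w') i j = 0" using c unfolding corner_iff by blast+
    then show ?thesis by simp
  qed
  then have "snd w = snd w'" by (rule bmat_eqI)
  then show "w = w'" using x by (simp add: prod_eq_iff)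
qed

lemma set_tup: "set_pmf tup_pmf = tup n d ` (carrier_vec n \<times> supp)"
  by (simp add: tup_pmf_def set_flag)

lemma pmf_tup:
  assumes "x \<in> carrier_vec n" "v \<in> supp"
  shows "pmf tup_pmf (tup n d (x, v)) = 1 / (sum mu supp * real (card (carrier_vec n :: bit Matrix.vec set))) * mu v"
proof -
  have "pmf tup_pmf (tup n d (x, v)) = pmf flag_pmf (x, v)"
    unfolding tup_pmf_def by (rule pmf_map_inj) (use assms in \<open>auto simp: set_flag tup_inj\<close>)
  then show ?thesis by (simp add: pmf_flag[OF assms(1)])
qed

lemma tup_carrier: "w \<in> carrier_vec n \<times> supp \<Longrightarrow> tup n d w j \<in> carrier_vec n"
  by (auto simp: tup_def)

lemma tup_inj_on:
  assumes w: "w \<in> carrier_vec n \<times> supp" shows "inj_on (tup n d w) {..d}"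
proof (rule inj_onI)
  have c: "fst w \<in> carrier_vec n" "snd w \<in> supp" using w by auto
  have z: "fst w + row_vec n i (snd w) \<noteq> fst w" if "i < d" for i
  proof
    assume "fst w + row_vec n i (snd w) = fst w"
    then have "fst w + row_vec n i (snd w) = fst w + 0\<^sub>v n" using c by simp
    then show False using bit_vec_left_cancel[OF c(1) row_vec_carrier zero_carrier_vec] row_nonzero[OF c(2) that] by blast
  qed
  have rd: "i = k" if "row_vec n i (snd w) = row_vec n k (snd w)" "i < d" "k < d" for i k
    using row_distinct[OF c(2)] that by blast
  fix a b assume "a \<in> {..d}" "b \<in> {..d}" "tup n d w a = tup n d w b"
  then show "a = b"
    using z z[symmetric] bit_vec_left_cancel[OF c(1) row_vec_carrier row_vec_carrier]
    by (cases a; cases b) (auto simp: Suc_le_eq intro: rd)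
qed

end

lemma gl_involution:
  assumes "g * g = 1" "\<And>i j. d \<le> i \<or> d \<le> j \<Longrightarrow> ent g i j = ent 1 i j" shows "g \<in> gl d"
proof -
  have "\<exists>h. is_inv g h" using assms(1) by (auto simp: is_inv_def)
  moreover have "g * dg {d..} = dg {d..}" by (rule bmat_eqI) (use assms(2) in \<open>auto simp: ent_dg ent_1\<close>)
  moreover have "dg {d..} * g = dg {d..}" by (rule bmat_eqI) (use assms(2) in \<open>auto simp: ent_dg ent_1\<close>)
  ultimately show ?thesis by (simp add: gl_def)
qed

text \<open>Re-basing a simplex \<open>x, x + v\<^sub>0, x + v\<^sub>1, \<dots>\<close> at \<open>x + v\<^sub>i\<close> adds the row \<open>i\<close> to the other rows.\<close>

definition rebase :: "nat \<Rightarrow> nat \<Rightarrow> bmat" where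
  "rebase d i = 1 + (\<Sum>l\<in>{..<d} - {i}. mun l i)"

lemma ent_rebase_mult: "ent (rebase d i * v) l j = ent v l j + (if l < d \<and> l \<noteq> i then ent v i j else 0)"
proof -
  have "ent ((\<Sum>l\<in>{..<d} - {i}. mun l i) * v) l j = (\<Sum>l'\<in>{..<d} - {i}. if l' = l then ent v i j else 0)"
    unfolding sum_distrib_right ent_sum by (rule sum.cong[OF refl]) auto
  also have "\<dots> = (if l < d \<and> l \<noteq> i then ent v i j else 0)" by (subst sum.delta) auto
  finally show ?thesis by (simp add: rebase_def distrib_right ent_add)
qed

lemma rebase_involution: "rebase d i * rebase d i = 1"
proof (rule bmat_eqI)
  fix l j
  have r: "ent (rebase d i) l j = ent 1 l j + (if l < d \<and> l \<noteq> i then ent 1 i j else 0)" for l j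
    using ent_rebase_mult[of d i 1 l j] by simp
  show "ent (rebase d i * rebase d i) l j = ent 1 l j"
    unfolding ent_rebase_mult r by (simp add: add.assoc)
qed

lemma rebase_gl: assumes "i < d" shows "rebase d i \<in> gl d"
proof (rule gl_involution[OF rebase_involution])
  fix l j assume "d \<le> l \<or> d \<le> j"
  then show "ent (rebase d i) l j = ent 1 l j"
    using ent_rebase_mult[of d i 1 l j] assms by (auto simp: ent_1)
qed

lemma row_vec_rebase:
  "row_vec n l (rebase d i * v) = (if l < d \<and> l \<noteq> i then row_vec n l v + row_vec n i v else row_vec n l v)"
proof (cases "l < d \<and> l \<noteq> i")
  case True
  show ?thesis unfolding if_P[OF True] by (rule eq_vecI) (use True in \<open>simp_all add: row_vec_def ent_rebase_mult\<close>)
next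
  case False
  show ?thesis unfolding if_not_P[OF False]
    by (rule eq_vecI) (simp_all add: row_vec_def ent_rebase_mult if_not_P[OF False])
qed

lemma row_vec_pmat: "bij \<pi> \<Longrightarrow> row_vec n l (pmat \<pi> * v) = row_vec n (\<pi> l) v"
  by (rule eq_vecI) (simp_all add: row_vec_def ent_pmat_mult)

context frame_complex
begin

text \<open>A reordering of the vertices is realised by an involution on pairs of base point and
  frame, which preserves the distribution because the frame weight is invariant under
  \<open>g\<close>.\<close>

lemma tup_exch_involution:
  assumes g: "g \<in> gl d" "g * g = 1"
    and \<psi>: "\<And>x v. x \<in> carrier_vec n \<Longrightarrow> \<psi> x v \<in> carrier_vec n" "\<And>x v. x \<in> carrier_vec n \<Longrightarrow> \<psi> (\<psi> x v) (g * v) = x"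
    and \<sigma>: "\<And>x v. x \<in> carrier_vec n \<Longrightarrow> v \<in> supp \<Longrightarrow> tup n d (\<psi> x v, g * v) = tup n d (x, v) \<circ> \<sigma>"
  shows "map_pmf (\<lambda>t. t \<circ> \<sigma>) tup_pmf = tup_pmf"
proof -
  define \<phi> where "\<phi> w = (\<psi> (fst w) (snd w), g * snd w)" for w
  have gg: "g * (g * v) = v" for v using mult_eq_assoc[OF g(2), of v] by simp
  have "map_pmf \<phi> flag_pmf = flag_pmf"
  proof (rule map_pmf_involution)
    fix w assume "w \<in> set_pmf flag_pmf"
    then have w: "fst w \<in> carrier_vec n" "snd w \<in> supp" by (auto simp: set_flag)
    then show "\<phi> w \<in> set_pmf flag_pmf" using \<psi>(1) supp_gl[OF g(1)] by (auto simp: set_flag \<phi>_def)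
    show "\<phi> (\<phi> w) = w" using w \<psi>(2) by (simp add: \<phi>_def gg)
    have "pmf flag_pmf (\<phi> w) = pmf flag_pmf (fst w, snd w)"
      unfolding \<phi>_def pmf_flag[OF \<psi>(1)[OF w(1)]] pmf_flag[OF w(1)] mu_gl[OF g(1)] ..
    then show "pmf flag_pmf (\<phi> w) = pmf flag_pmf w" by simp
  qed
  then have "tup_pmf = map_pmf (\<lambda>w. tup n d (\<phi> w)) flag_pmf"
    unfolding tup_pmf_def by (metis map_pmf_comp)
  also have "\<dots> = map_pmf (\<lambda>w. tup n d w \<circ> \<sigma>) flag_pmf"
  proof (rule map_pmf_cong[OF refl])
    fix w assume "w \<in> set_pmf flag_pmf"
    then have w: "fst w \<in> carrier_vec n" "snd w \<in> supp" by (auto simp: set_flag)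
    show "tup n d (\<phi> w) = tup n d w \<circ> \<sigma>" using \<sigma>[OF w] by (simp add: \<phi>_def)
  qed
  also have "\<dots> = map_pmf (\<lambda>t. t \<circ> \<sigma>) tup_pmf" by (simp add: tup_pmf_def map_pmf_comp)
  finally show ?thesis ..
qed

text \<open>Moving the base point to vertex \<open>Suc i\<close> replaces every other row by its sum
  with row \<open>i\<close>; in characteristic 2 the added row cancels and the other vertices stay
  in place.\<close>

lemma tup_exch_base:
  assumes i: "i < d" shows "map_pmf (\<lambda>t. t \<circ> Transposition.transpose 0 (Suc i)) tup_pmf = tup_pmf"
proof (rule tup_exch_involution[OF rebase_gl[OF i] rebase_involution, where \<psi> = "\<lambda>x v. x + row_vec n i v"])
  fix x :: "bit Matrix.vec" and v assume x: "x \<in> carrier_vec n"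
  show "x + row_vec n i v \<in> carrier_vec n" using x by simp
  show "x + row_vec n i v + row_vec n i (rebase d i * v) = x"
    using bit_vec_cancel(1)[OF x row_vec_carrier] by (simp add: row_vec_rebase)
  show "tup n d (x + row_vec n i v, rebase d i * v) = tup n d (x, v) \<circ> Transposition.transpose 0 (Suc i)"
  proof
    fix j
    have "j = 0 \<or> j = Suc i \<or> (\<exists>l. j = Suc l \<and> l \<noteq> i \<and> l < d) \<or> d < j" by (cases j) auto
    then consider "j = 0" | "j = Suc i" | l where "j = Suc l" "l \<noteq> i" "l < d" | "d < j" by blast
    then show "tup n d (x + row_vec n i v, rebase d i * v) j = (tup n d (x, v) \<circ> Transposition.transpose 0 (Suc i)) j"
    proof cases
      case 1
      then show ?thesis using i by simp
    next
      case 2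
      then show ?thesis using i bit_vec_cancel(1)[OF x row_vec_carrier] by (simp add: row_vec_rebase)
    next
      case 3
      let ?a = "row_vec n i v" and ?b = "row_vec n l v"
      have "x + ?a + (?b + ?a) = x + ?b + ?a + ?a"
        using x by (simp add: comm_add_vec[of ?b n ?a] assoc_add_vec[of _ n])
      also have "\<dots> = x + ?b" using x by (intro bit_vec_cancel(1)[of _ n]) auto
      finally show ?thesis using 3 by (simp add: row_vec_rebase)
    next
      case 4
      then show ?thesis using i by (simp add: tup_def Transposition.transpose_def)
    qed
  qed
qed

lemma tup_exch_rows:
  assumes ab: "a < d" "b < d" shows "map_pmf (\<lambda>t. t \<circ> Transposition.transpose (Suc a) (Suc b)) tup_pmf = tup_pmf"
proof -
  let ?\<pi> = "Transposition.transpose a b"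
  have b: "bij ?\<pi>" by simp
  have gl: "pmat ?\<pi> \<in> gl d" using ab by (intro gl_pmat) (auto simp: Transposition.transpose_def)
  have inv: "pmat ?\<pi> * pmat ?\<pi> = 1" unfolding pmat_comp[OF b b] by (simp add: comp_def)
  show ?thesis
  proof (rule tup_exch_involution[OF gl inv, where \<psi> = "\<lambda>x v. x"])
    fix x :: "bit Matrix.vec" and v
    show "tup n d (x, pmat ?\<pi> * v) = tup n d (x, v) \<circ> Transposition.transpose (Suc a) (Suc b)"
    proof
      fix j show "tup n d (x, pmat ?\<pi> * v) j = (tup n d (x, v) \<circ> Transposition.transpose (Suc a) (Suc b)) j"
        using ab by (cases j) (auto simp: tup_def row_vec_pmat[OF b] Transposition.transpose_def)
    qed
  qed auto
qed

text \<open>Transpositions suffice. Those that move position 0 come from a change of base point, all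
  others from permutations of the rows.\<close>

lemma tup_exch:
  assumes "\<sigma> permutes {..d}" shows "map_pmf (\<lambda>t. t \<circ> \<sigma>) tup_pmf = tup_pmf"
  using assms finite_atMost[of d]
proof (induction \<sigma> rule: permutes_induct)
  case (swap a b p)
  have base: "map_pmf (\<lambda>t. t \<circ> Transposition.transpose 0 b) tup_pmf = tup_pmf" if "0 < b" "b \<le> d" for b
    using tup_exch_base[of "b - 1"] that by simp
  have "map_pmf (\<lambda>t. t \<circ> Transposition.transpose a b) tup_pmf = tup_pmf"
  proof (cases "a = 0 \<or> b = 0")
    case True
    then show ?thesis using base[of a] base[of b] swap by (auto simp: transpose_commute)
  next
    case False
    then show ?thesis using tup_exch_rows[of "a - 1" "b - 1"] swap by simp
  qed
  then have "map_pmf (\<lambda>t. t \<circ> p) tup_pmf = map_pmf (\<lambda>t. t \<circ> p) (map_pmf (\<lambda>t. t \<circ> Transposition.transpose a b) tup_pmf)"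
    by simp
  also have "\<dots> = map_pmf (\<lambda>t. t \<circ> (Transposition.transpose a b \<circ> p)) tup_pmf" by (simp add: map_pmf_comp comp_assoc)
  finally show ?case unfolding swap.IH by (rule sym)
qed (simp_all add: map_pmf_ident)

text \<open>As at least one vertex is fixed, the base point is known. The other fixed vertices are
  equivalent to fixed rows, and the next two vertices are translates of the next two rows.\<close>

lemma tup_mix:
  assumes k: "1 \<le> k" "k < d"
  shows "mc {t \<in> set_pmf tup_pmf. \<forall>j<k. t j = y j} (pmf tup_pmf) (\<lambda>t. t k) (\<lambda>t. t (Suc k)) \<delta>"
proof (cases "{t \<in> set_pmf tup_pmf. \<forall>j<k. t j = y j} = {}")
  case True
  then show ?thesis by (simp only: mc_empty)
next
  case False
  let ?W' = "{t \<in> set_pmf tup_pmf. \<forall>j<k. t j = y j}"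
  \<comment> \<open>Vertex 0 is the base point, so vertex \<open>k\<close> carries row
    \<open>k - 1\<close>, and fixing \<open>k\<close> vertices fixes only \<open>j\<close>
    rows.\<close>
  obtain j where j: "k = Suc j" "Suc j < d" using k by (cases k) auto
  obtain x v0 where x: "x \<in> carrier_vec n" and v0: "v0 \<in> supp" and y: "\<And>l. l < k \<Longrightarrow> tup n d (x, v0) l = y l"
    using False by (auto simp: set_tup)
  let ?W = "{v. mu v \<noteq> 0 \<and> id_mat j * v = id_mat j * v0}"
  define \<psi> where "\<psi> v = tup n d (x, v)" for v
  have sW: "?W \<subseteq> supp" by (auto simp: supp_def)
  have rows: "id_mat j * v = id_mat j * v0 \<longleftrightarrow> (\<forall>l<j. row_vec n l v = row_vec n l v0)" if v: "v \<in> supp" for v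
  proof -
    have "row_vec n l v = row_vec n l v0 \<longleftrightarrow> (\<forall>i. ent v l i = ent v0 l i)" for l
      unfolding row_vec_eq_iff[OF supp_D(1)[OF v] supp_D(1)[OF v0]]
      by (auto intro: bmat_eqI dest: arg_cong[where f = "\<lambda>z i. ent z 0 i"] simp: fun_eq_iff)
    then show ?thesis unfolding id_mat_def dg_mult_eq_iff by auto
  qed
  have "bij_betw \<psi> ?W ?W'"
    unfolding bij_betw_def
  proof
    show "inj_on \<psi> ?W" using tup_inj sW x unfolding \<psi>_def inj_on_def by blast
    show "\<psi> ` ?W = ?W'"
    proof (intro equalityI subsetI)
      fix t assume "t \<in> \<psi> ` ?W"
      then obtain v where v: "v \<in> ?W" "t = tup n d (x, v)" by (auto simp: \<psi>_def)
      have vs: "v \<in> supp" using v sW by blast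
      have "t l = y l" if l: "l < k" for l
      proof (cases l)
        case 0
        then show ?thesis using y[OF l] v(2) by simp
      next
        case (Suc l')
        then have "row_vec n l' v = row_vec n l' v0" using rows[OF vs] v(1) l j by simp
        then show ?thesis using y[OF l] v(2) Suc l k by simp
      qed
      then show "t \<in> ?W'" using v(2) vs x by (auto simp: set_tup)
    next
      fix t assume t: "t \<in> ?W'"
      then obtain x' v where v: "t = tup n d (x', v)" "x' \<in> carrier_vec n" "v \<in> supp" by (auto simp: set_tup)
      have e: "tup n d (x', v) l = tup n d (x, v0) l" if "l < k" for l using t y that v(1) by simp
      have x': "x' = x" using e[of 0] j by simp
      have "row_vec n l v = row_vec n l v0" if "l < j" for l
        using e[of "Suc l"] that j x' x bit_vec_left_cancel[OF x row_vec_carrier row_vec_carrier] by simp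
      then have "v \<in> ?W" using rows[OF v(3)] v(3) by (simp add: supp_def)
      then show "t \<in> \<psi> ` ?W" using v(1) x' by (auto simp: \<psi>_def)
    qed
  qed
  note bij = this
  define \<phi> where "\<phi> = the_inv_into ?W \<psi>"
  have \<phi>: "\<phi> (\<psi> v) = v" if "v \<in> ?W" for v
    unfolding \<phi>_def by (rule the_inv_into_f_f[OF bij_betw_imp_inj_on[OF bij] that])
  have bij': "bij_betw \<phi> ?W' ?W" unfolding \<phi>_def by (rule bij_betw_the_inv_into[OF bij])
  have W': "\<exists>v\<in>?W. t = \<psi> v" if "t \<in> ?W'" for t using bij that unfolding bij_betw_def by blast
  define c where "c = 1 / (sum mu supp * real (card (carrier_vec n :: bit Matrix.vec set)))"
  have c: "0 < c" using mass_pos carrier_ne finite_bit_vec by (simp add: c_def card_gt_0_iff)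
  have "mc ?W mu (\<lambda>v. dg {j} * v) (\<lambda>v. dg {Suc j} * v) \<delta>" using FS j(2) unfolding FS_def by blast
  then have "mc ?W (\<lambda>v. c * mu v) (\<lambda>v. dg {j} * v) (\<lambda>v. dg {Suc j} * v) \<delta>" using c by (rule mc_scale)
  then have "mc ?W' (pmf tup_pmf) (\<lambda>t. dg {j} * \<phi> t) (\<lambda>t. dg {Suc j} * \<phi> t) \<delta>"
  proof (rule mc_reindex[OF _ bij'])
    fix t assume "t \<in> ?W'"
    then obtain v where v: "v \<in> ?W" "t = \<psi> v" using W' by blast
    then have "v \<in> supp" using sW by blast
    from pmf_tup[OF x this] show "c * mu (\<phi> t) = pmf tup_pmf t" unfolding v(2) \<phi>[OF v(1)] unfolding \<psi>_def c_def by (rule sym)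
  qed
  then show ?thesis
  proof (rule mc_comp[where \<phi> = "\<lambda>z. x + row_vec n j z" and \<psi> = "\<lambda>z. x + row_vec n (Suc j) z"])
    fix t assume "t \<in> ?W'"
    then obtain v where v: "v \<in> ?W" "t = \<psi> v" using W' by blast
    show "t k = x + row_vec n j (dg {j} * \<phi> t)" "t (Suc k) = x + row_vec n (Suc j) (dg {Suc j} * \<phi> t)"
      unfolding row_vec_dg v(2) \<phi>[OF v(1)] using j by (simp_all add: \<psi>_def)
  qed
qed

sublocale exchangeable_tuples d tup_pmf \<delta>
proof
  show "finite (set_pmf tup_pmf)" using finite_bit_vec supp_finite by (simp add: set_tup)
  show "inj_on t {..d}" if "t \<in> set_pmf tup_pmf" for t using that tup_inj_on by (auto simp: set_tup)
qed (use tup_exch tup_mix \<delta> in auto)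

end

lemma (in exchangeable_tuples) pair_face_tuple:
  assumes "{a, b} \<in> faces cx" "a \<noteq> b"
  obtains t where "t \<in> set_pmf Q" "t 0 = a" "t 1 = b"
proof -
  obtain t where t: "t \<in> set_pmf Q" "{a, b} \<subseteq> t ` {..d}" using assms(1) by (auto simp: faces_iff)
  define y where "y j = (if j = 0 then a else b)" for j :: nat
  have 2: "{..<2} = {0, Suc 0}" by auto
  have y: "inj_on y {..<2}" "y ` {..<2} \<subseteq> t ` {..d}" using assms(2) t(2) by (auto simp: y_def 2)
  obtain \<sigma> where \<sigma>: "\<sigma> permutes {..d}" "\<And>j. j < 2 \<Longrightarrow> t (\<sigma> j) = y j" by (rule order_face[OF t(1) y]) blast
  show ?thesis
    by (rule that[OF supp_comp[OF \<sigma>(1) t(1)]]) (use \<sigma>(2)[of 0] \<sigma>(2)[of 1] in \<open>auto simp: y_def\<close>)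
qed

context frame_complex
begin

text \<open>Row 0 suffices: invariance under change of basis makes every row, and every sum of two
  rows, run through the same set.\<close>

definition "gens = row_vec n 0 ` supp"

lemma supp_ne: "supp \<noteq> {}" using mass_pos by auto

lemma level_0: "level cx 0 = {{x} | x. x \<in> carrier_vec n}"
proof (intro equalityI subsetI)
  fix s assume s: "s \<in> level cx 0"
  then have "card s = 1" by (simp add: level_def)
  then obtain x where x: "s = {x}" by (rule card_1_singletonE)
  then have "x \<in> carrier_vec n" using s tup_carrier unfolding level_def faces_iff set_tup by blast
  then show "s \<in> {{x} | x. x \<in> carrier_vec n}" using x by blast
next
  fix s :: "bit Matrix.vec set" assume "s \<in> {{x} | x. x \<in> carrier_vec n}"
  then obtain x where x: "s = {x}" "x \<in> carrier_vec n" by blast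
  obtain v where v: "v \<in> supp" using supp_ne by blast
  have "x = tup n d (x, v) 0" by simp
  then have "{x} \<subseteq> tup n d (x, v) ` {..d}" by blast
  then have "{x} \<in> faces cx" unfolding faces_iff set_tup using x(2) v by blast
  then show "s \<in> level cx 0" using x(1) by (simp add: level_def)
qed

text \<open>By exchangeability every edge occurs in the first two positions of some ordered top
  face, where it joins the base point to its sum with row 0.\<close>

lemma level_1: "level cx 1 = {{x, x + s} | x s. x \<in> carrier_vec n \<and> s \<in> gens}"
proof (intro equalityI subsetI)
  fix e assume e: "e \<in> level cx 1"
  then have "card e = 2" by (simp add: level_def)
  then obtain a b where ab: "e = {a, b}" "a \<noteq> b" by (auto simp: card_2_iff)
  then obtain t where t: "t \<in> set_pmf tup_pmf" "t 0 = a" "t 1 = b" using e by (auto simp: level_def elim!: pair_face_tuple)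
  then obtain x v where v: "t = tup n d (x, v)" "x \<in> carrier_vec n" "v \<in> supp" by (auto simp: set_tup)
  have "a = x" "b = x + row_vec n 0 v" using t v(1) d by auto
  then show "e \<in> {{x, x + s} | x s. x \<in> carrier_vec n \<and> s \<in> gens}" using ab(1) v by (auto simp: gens_def)
next
  fix e assume "e \<in> {{x, x + s} | x s. x \<in> carrier_vec n \<and> s \<in> gens}"
  then obtain x v where v: "e = {x, x + row_vec n 0 v}" "x \<in> carrier_vec n" "v \<in> supp" by (auto simp: gens_def)
  let ?t = "tup n d (x, v)"
  have t: "?t \<in> set_pmf tup_pmf" using v by (auto simp: set_tup)
  have e: "e = {?t 0, ?t (Suc 0)}" using v(1) d by simp
  have "?t 0 \<noteq> ?t (Suc 0)" using inj_onD[OF inj[OF t], of 0 "Suc 0"] d by auto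
  then have "card e = 2" unfolding e by simp
  moreover have m: "?t i \<in> ?t ` {..d}" if "i \<le> d" for i using that by (intro imageI) simp
  have "Suc 0 \<le> d" using d by simp
  then have "e \<subseteq> ?t ` {..d}" unfolding e using m[OF le0] m[of "Suc 0"] by blast
  then have "e \<in> faces cx" unfolding faces_iff using t by blast
  ultimately show "e \<in> level cx 1" by (simp add: level_def)
qed

text \<open>The identity outside the carrier makes translation an injection of the whole vector
  type, hence injective on arbitrary sets of vectors.\<close>

definition shift :: "bit Matrix.vec \<Rightarrow> bit Matrix.vec \<Rightarrow> bit Matrix.vec" where
  "shift z x = (if x \<in> carrier_vec n then x + z else x)"

lemma shift_shift: "z \<in> carrier_vec n \<Longrightarrow> shift z (shift z x) = x"
  by (cases "x \<in> carrier_vec n") (simp_all add: shift_def bit_vec_cancel(1) del: assoc_add_vec)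

lemma shift_inj: "z \<in> carrier_vec n \<Longrightarrow> inj (shift z)"
  by (rule inj_on_inverseI) (rule shift_shift)

lemma shift_image_inj: "z \<in> carrier_vec n \<Longrightarrow> inj ((`) (shift z))"
  by (rule inj_on_image) (simp add: shift_inj)

lemma shift_top:
  assumes z: "z \<in> carrier_vec n" shows "map_pmf ((`) (shift z)) (top_distr cx) = top_distr cx"
proof -
  let ?U = "pmf_of_set (carrier_vec n :: bit Matrix.vec set)"
  have "bij_betw (shift z) (carrier_vec n) (carrier_vec n)"
    by (rule bij_betw_byWitness[where f' = "shift z"]) (use z in \<open>auto simp: shift_shift, auto simp: shift_def\<close>)
  then have U: "map_pmf (shift z) ?U = ?U" using carrier_ne finite_bit_vec by (intro map_pmf_of_set_bij_betw) auto
  have top: "top_distr cx = map_pmf (\<lambda>w. tup n d w ` {..d}) flag_pmf"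
    unfolding cx_def by (simp add: tup_pmf_def map_pmf_comp)
  have "map_pmf ((`) (shift z)) (top_distr cx) = map_pmf (\<lambda>w. shift z ` tup n d w ` {..d}) flag_pmf"
    unfolding top map_pmf_comp ..
  also have "\<dots> = map_pmf (\<lambda>w. tup n d (apfst (shift z) w) ` {..d}) flag_pmf"
  proof (rule map_pmf_cong[OF refl])
    fix w assume "w \<in> set_pmf flag_pmf"
    then have w: "fst w \<in> carrier_vec n" "w \<in> carrier_vec n \<times> supp" by (auto simp: set_flag)
    have "shift z (tup n d w j) = tup n d (apfst (shift z) w) j" if "j \<le> d" for j
    proof (cases j)
      case 0
      then show ?thesis by simp
    next
      case (Suc i)
      let ?r = "row_vec n i (snd w)"
      have "fst w + ?r + z = fst w + z + ?r"
        using w(1) z by (simp add: assoc_add_vec[of _ n] comm_add_vec[of ?r n z])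
      then show ?thesis using Suc that w(1) z by (simp add: shift_def)
    qed
    then show "shift z ` tup n d w ` {..d} = tup n d (apfst (shift z) w) ` {..d}"
      unfolding image_image by (intro image_cong) auto
  qed
  also have "\<dots> = map_pmf (\<lambda>w. tup n d w ` {..d}) (map_pmf (apfst (shift z)) flag_pmf)" by (simp add: map_pmf_comp)
  also have "map_pmf (apfst (shift z)) flag_pmf = flag_pmf"
    unfolding flag_pmf_def pair_map_pmf1[symmetric] U ..
  finally show ?thesis unfolding top .
qed

lemma shift_induced:
  assumes z: "z \<in> carrier_vec n" shows "map_pmf ((`) (shift z)) (induced_distr cx 1) = induced_distr cx 1"
proof -
  let ?P = "\<lambda>t. {s. s \<subseteq> t \<and> int (card s) = 1 + 1}"
  have inj: "inj (shift z)" by (rule shift_inj[OF z])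
  have "map_pmf ((`) (shift z)) (induced_distr cx 1) = bind_pmf (top_distr cx) (\<lambda>t. map_pmf ((`) (shift z)) (pmf_of_set (?P t)))"
    unfolding induced_distr_def map_bind_pmf ..
  also have "\<dots> = bind_pmf (top_distr cx) (\<lambda>t. pmf_of_set (?P (shift z ` t)))"
  proof (rule bind_pmf_cong[OF refl])
    fix t assume "t \<in> set_pmf (top_distr cx)"
    then obtain u where u: "u \<in> set_pmf tup_pmf" "t = u ` {..d}" by (auto simp: cx_def)
    then have ct: "card t = Suc d" "finite t" using card_top by auto
    have ne: "?P t \<noteq> {}" using obtain_subset_with_card_n[of 2 t] d ct(1) by auto
    have fin: "finite (?P t)" by (rule finite_subset[of _ "Pow t"]) (use ct(2) in auto)
    have "map_pmf ((`) (shift z)) (pmf_of_set (?P t)) = pmf_of_set ((`) (shift z) ` ?P t)"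
      by (rule map_pmf_of_set_inj[OF _ ne fin]) (rule inj_on_subset[OF shift_image_inj[OF z] subset_UNIV])
    also have "(`) (shift z) ` ?P t = ?P (shift z ` t)"
    proof (intro equalityI subsetI)
      fix s assume "s \<in> ?P (shift z ` t)"
      then obtain r where r: "r \<subseteq> t" "s = shift z ` r" "int (card s) = 1 + 1" by (auto simp: subset_image_iff)
      then have "r \<in> ?P t" using card_image[OF inj_on_subset[OF inj subset_UNIV]] by auto
      then show "s \<in> (`) (shift z) ` ?P t" using r(2) by blast
    qed (auto simp: card_image[OF inj_on_subset[OF inj subset_UNIV]])
    finally show "map_pmf ((`) (shift z)) (pmf_of_set (?P t)) = pmf_of_set (?P (shift z ` t))" .
  qed
  also have "\<dots> = bind_pmf (map_pmf ((`) (shift z)) (top_distr cx)) (\<lambda>t. pmf_of_set (?P t))" by (simp add: bind_map_pmf)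
  finally show ?thesis unfolding shift_top[OF z] induced_distr_def .
qed

text \<open>The base point is uniform, so the distribution is invariant under translation.
  Translating by \<open>x + y\<close> exchanges \<open>x\<close> with \<open>y\<close> in
  characteristic 2 and carries one edge with label \<open>s\<close> to the other.\<close>

lemma cx_cayley: "cayley_complex n gens cx"
proof -
  have ew: "edge_weight cx x (x + s) = edge_weight cx y (y + s)"
    if s: "s \<in> gens" and x: "x \<in> carrier_vec n" and y: "y \<in> carrier_vec n" for s x y
  proof -
    have sc: "s \<in> carrier_vec n" using s by (auto simp: gens_def)
    have z: "x + y \<in> carrier_vec n" using x y by simp
    have 1: "shift (x + y) x = y" using x y by (simp add: shift_def bit_vec_cancel(2))
    have "x + s + (x + y) = x + (x + (y + s))"
      using x y sc by (simp add: assoc_add_vec[of _ n] comm_add_vec[of s n "x + y"])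
    also have "\<dots> = y + s" using x y sc by (intro bit_vec_cancel(2)[of _ n]) auto
    finally have 2: "shift (x + y) (x + s) = y + s" using x sc by (simp add: shift_def del: assoc_add_vec)
    have "pmf (induced_distr cx 1) {x, x + s} = pmf (map_pmf ((`) (shift (x + y))) (induced_distr cx 1)) (shift (x + y) ` {x, x + s})"
      by (rule pmf_map_inj'[OF shift_image_inj[OF z], symmetric])
    also have "\<dots> = pmf (induced_distr cx 1) {y, y + s}" unfolding shift_induced[OF z] by (simp add: 1 2)
    finally show ?thesis by (simp add: edge_weight_def)
  qed
  show ?thesis unfolding cayley_complex_def
  proof (intro conjI ballI level_0 level_1)
    show "gens \<subseteq> carrier_vec n" by (auto simp: gens_def)
  qed (rule ew)
qed

text \<open>The generation clause of \<open>FS\<close> writes the difference of two vertices as a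
  sum of generators, and the successive summands are the steps of a path.\<close>

lemma cx_connected: "connected_graph cx"
  unfolding connected_graph_def
proof (intro ballI)
  let ?E = "{(x, y). {x, y} \<in> level cx 1}"
  have V: "vertices cx = carrier_vec n" unfolding vertices_def level_0 by auto
  have path: "(u, u + row_vec n 0 z) \<in> ?E\<^sup>*" if "z \<in> gen ((\<lambda>v. dg {0} * v) ` supp)" "u \<in> carrier_vec n" for z u
    using that
  proof (induction rule: gen.induct)
    case gen_0
    have "row_vec n 0 0 = 0\<^sub>v n" by (rule eq_vecI) (simp_all add: row_vec_def ent_0)
    then show ?case using gen_0 by simp
  next
    case (gen_add z s)
    obtain v where v: "v \<in> supp" "s = dg {0} * v" using gen_add by blast
    let ?w = "u + row_vec n 0 z"
    have "?w \<in> carrier_vec n" using gen_add.prems by simp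
    then have "{?w, ?w + row_vec n 0 v} \<in> level cx 1"
      unfolding level_1 by (intro CollectI exI conjI refl) (use v(1) in \<open>auto simp: gens_def\<close>)
    then have "(?w, ?w + row_vec n 0 v) \<in> ?E" by (simp only: mem_Collect_eq case_prod_conv)
    moreover have "?w + row_vec n 0 v = u + row_vec n 0 (z + s)"
      using gen_add.prems by (simp add: row_vec_add v(2) row_vec_dg assoc_add_vec[of _ n])
    ultimately show ?case using rtrancl.rtrancl_into_rtrancl[OF gen_add.IH[OF gen_add.prems]] by (simp only:)
  qed
  fix u v assume "u \<in> vertices cx" "v \<in> vertices cx"
  then have uv: "u \<in> carrier_vec n" "v \<in> carrier_vec n" unfolding V by auto
  have "vec_row (u + v) \<in> corner 1 n" using uv by (intro vec_row_corner) auto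
  then have "vec_row (u + v) \<in> gen ((\<lambda>v. dg {0} * v) ` supp)" using FS unfolding FS_def supp_def by blast
  from path[OF this uv(1)] show "(u, v) \<in> ?E\<^sup>*"
    using uv by (simp add: row_vec_vec_row bit_vec_cancel(2))
qed

theorem cayley_expander:
  "pure_complex d cx" "cayley_complex n gens cx" "local_spectral_expander d \<delta> cx" "card gens \<le> card {v. mu v \<noteq> 0}"
  using cx_pure cx_cayley cx_local_expander[OF d cx_connected] card_image_le[OF supp_finite, of "row_vec n 0"]
  by (auto simp: gens_def supp_def)

end

lemma linear_le_powr:
  assumes "1 < e"
  obtains N :: nat where "\<And>m::nat. N \<le> m \<Longrightarrow> real C * real m \<le> real m powr e"
proof -
  define B where "B = (real C + 1) powr (1 / (e - 1))"
  have "real C * real m \<le> real m powr e" if m: "nat \<lceil>B\<rceil> \<le> m" for m :: nat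
  proof (cases "m = 0")
    case False
    have B: "0 \<le> B" "B \<le> real m" using m by (auto simp: B_def nat_ceiling_le_eq)
    have "real C \<le> B powr (e - 1)" using assms by (simp add: B_def powr_powr)
    also have "\<dots> \<le> real m powr (e - 1)" using B assms by (intro powr_mono2) auto
    finally have "real C * real m \<le> real m powr (e - 1) * real m" by (rule mult_right_mono) simp
    also have "\<dots> = real m powr e" using False by (simp add: powr_diff)
    finally show ?thesis .
  qed (use assms in simp)
  then show ?thesis by (rule that)
qed

theorem theorem3p1:
  fixes lam eps :: real and d :: nat
  assumes "lam > 0" and "eps > 0" and "d \<ge> 2"
  shows "\<exists>(n :: nat \<Rightarrow> nat) (S :: nat \<Rightarrow> bit Matrix.vec set)
            (X :: nat \<Rightarrow> bit Matrix.vec weighted_complex).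
           strict_mono n \<and>
           (\<forall>k. pure_complex d (X k) \<and>
                cayley_complex (n k) (S k) (X k) \<and>
                local_spectral_expander d lam (X k) \<and>
                real (card (S k)) \<le> 2 powr (real (n k) powr eps))"
proof -
  \<comment> \<open>The cap 1/2 keeps \<delta> below 1, on which connectedness of the links depends,
    even if \<open>lam\<close> is large.\<close>
  define \<delta> where "\<delta> = min lam (1 / 2)"
  have \<delta>b: "0 < \<delta>" "0 \<le> \<delta>" "\<delta> < 1" "\<delta> \<le> lam" using assms(1) by (auto simp: \<delta>_def)
  \<comment> \<open>In dimension m^(2^t) the degree is at most 2^(C m). The bound allowed is
    2^(m^(2^t eps)), so the exponent 2^t eps has to exceed 1.\<close>
  obtain t where "1 / eps < 2 ^ t" using real_arch_pow[of 2 "1 / eps"] by auto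
  then have t: "1 < 2 ^ t * eps" using assms(2) by (simp add: field_simps)
  have "1 \<le> d" using assms(3) by simp
  from FS_family[OF this \<delta>b(1), of t] obtain C n0 where
    C: "\<And>m. n0 \<le> m \<Longrightarrow> \<exists>mu. FS (m ^ (2 ^ t)) d \<delta> mu \<and> card {v. mu v \<noteq> 0} \<le> 2 ^ (C * m)" by blast
  obtain N where N: "\<And>m. N \<le> m \<Longrightarrow> real C * real m \<le> real m powr (2 ^ t * eps)"
    by (rule linear_le_powr[OF t, of C]) blast
  \<comment> \<open>The offset passes both thresholds, and the successor keeps the base positive, as
    the conversion between \<open>^\<close> and \<open>powr\<close> demands.\<close>
  define b where "b k = Suc (n0 + N + k)" for k
  define n where "n k = b k ^ (2 ^ t)" for k
  have "strict_mono n" by (rule strict_monoI) (simp add: n_def b_def power_strict_mono)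
  moreover have "\<forall>k. \<exists>S X. pure_complex d X \<and> cayley_complex (n k) S X \<and> local_spectral_expander d lam X \<and>
      real (card S) \<le> 2 powr (real (n k) powr eps)"
  proof
    fix k
    obtain mu where mu: "FS (n k) d \<delta> mu" "card {v. mu v \<noteq> 0} \<le> 2 ^ (C * b k)"
      using C[of "b k"] by (auto simp: n_def b_def)
    interpret frame_complex "n k" d \<delta> mu
      by unfold_locales (use mu(1) \<delta>b assms(3) in auto)
    have "local_spectral_expander d lam cx"
      using cayley_expander(3) \<delta>b(4) unfolding local_spectral_expander_def by (meson order_trans)
    moreover have "real (card gens) \<le> 2 powr (real (n k) powr eps)"
    proof -
      have "card gens \<le> 2 ^ (C * b k)" using cayley_expander(4) mu(2) by (rule order_trans)
      then have "real (card gens) \<le> 2 ^ (C * b k)" by (metis of_nat_le_iff of_nat_numeral of_nat_power)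
      also have "\<dots> = 2 powr (real C * real (b k))" by (simp flip: powr_realpow)
      also have "\<dots> \<le> 2 powr (real (b k) powr (2 ^ t * eps))" by (intro powr_mono N) (simp_all add: b_def)
      also have "real (b k) powr (2 ^ t * eps) = real (n k) powr eps"
      proof -
        have "real (n k) = real (b k) powr (2 ^ t)" by (simp add: n_def b_def flip: powr_realpow)
        then show ?thesis by (simp add: powr_powr)
      qed
      finally show ?thesis .
    qed
    ultimately show "\<exists>S X. pure_complex d X \<and> cayley_complex (n k) S X \<and> local_spectral_expander d lam X \<and>
        real (card S) \<le> 2 powr (real (n k) powr eps)"
      using cayley_expander(1,2) by blast
  qed
  from choice[OF this] obtain S where "\<forall>k. \<exists>X. pure_complex d X \<and> cayley_complex (n k) (S k) X \<and>
      local_spectral_expander d lam X \<and> real (card (S k)) \<le> 2 powr (real (n k) powr eps)" ..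
  from choice[OF this] obtain X where "\<forall>k. pure_complex d (X k) \<and> cayley_complex (n k) (S k) (X k) \<and>
      local_spectral_expander d lam (X k) \<and> real (card (S k)) \<le> 2 powr (real (n k) powr eps)" ..
  ultimately show ?thesis by blast
qed

end
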